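(* Let $L$ be a quadratic $O_F$-lattice of rank $n$ and $\varepsilon\in\{\pm1\}$. Then for every integer $k\ge0$, $$\mathrm{Den}(H^\varepsilon_{n+2k},L)=\mathrm{Nor}^{\flat\varepsilon}(q^{-k},L)\cdot Q(q^{-k}),\qquad Q(X)=\sum_{L\subseteq L'\subseteq L'^\vee}(q^{1/2}X)^{2\ell(L'/L)}\,\mathfrak{m}^\flat\big(t(L'),\mathrm{sgn}_n(L'),\chi(L);\varepsilon X\big),$$ the sum over integral lattices $L'\subseteq L_F$ containing $L$, $\ell(L'/L)=\mathrm{length}_{O_F}(L'/L)$. In other words the local Siegel series $\mathrm{Den}^{\flat\varepsilon}(X,L)$ equals $Q(X)$.
   Context: $F$ is a non-archimedean local field of odd residue characteristic, ring of integers $O_F$, uniformizer $\varpi$, residue field $\kappa$ with $q$ elements. Lattices, $L^\vee$, integrality, type $t(L')$ (number of nonzero fundamental invariants of $L'^\vee/L'$), $H^\varepsilon_r$ (self-dual of rank $r$ with discriminant symbol $\varepsilon$), and $\mathrm{Den}(M,L)$ (limit of $\#\mathrm{Rep}_{M,L}(O_F/\varpi^N)$ normalized by $q^{N\cdot\dim}$) are as usual. $\chi(L)\in\{\pm1,0\}$ is the quadratic residue symbol of $\mathrm{disc}(L)=(-1)^{n(n-1)/2}\det(L)$ ($0$ iff odd valuation). For a quadratic space $U$ over $\kappa$, $U=U_0\perp(\text{radical})$, $\chi(U_0)=\pm1$ by discriminant ($\chi(0)=1$), $\mathrm{sgn}_r(U)=\chi(U_0)$ if $\dim U_0\equiv r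 \pmod 2$ else $0$; $\mathrm{sgn}_r(L')=\mathrm{sgn}_r(L'\otimes\kappa)$. Let $\mathrm{sgn}(H^\varepsilon_n)=\varepsilon$ if $n$ even, $0$ if $n$ odd. The normalizing polynomial is $\mathrm{Nor}^{\flat\varepsilon}(X,L)=(1-\mathrm{sgn}(H^\varepsilon_n)q^{-n/2}X)(1-\varepsilon\chi(L)X)^{-1}\prod_{0\le i<n/2}(1-q^{-2i}X^2)$ (a polynomial, since the $i=0$ factor is $1-X^2$). The local Siegel series $\mathrm{Den}^{\flat\varepsilon}(X,L)$ is the polynomial with $\mathrm{Den}^{\flat\varepsilon}(q^{-k},L)=\mathrm{Den}(H^\varepsilon_{n+2k},L)/\mathrm{Nor}^{\flat\varepsilon}(q^{-k},L)$ for $k\ge0$. Weight polynomials: $\mathfrak{m}^\flat(0,s,\chi;X)=1$, and for $t\ge1$, $\mathfrak{m}^\flat(t,s,\chi;X)=(1+s\,q^{t/2}X)(1-\chi X)\prod_{0<i<t/2}(1-q^{2i}X^2)$. *)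

theory Defs
  imports
    "Jordan_Normal_Form.Determinant"
    "HOL-Library.FuncSet"
    "HOL-Library.Function_Algebras"
begin

section \<open>Quotients of additive groups by subgroups\<close>

definition coset :: "'b::ab_group_add set \<Rightarrow> 'b \<Rightarrow> 'b set" where
  "coset S x = (\<lambda>s. x + s) ` S"

definition quot :: "'b::ab_group_add set \<Rightarrow> 'b set \<Rightarrow> 'b set set" where
  "quot A S = coset S ` A"


section \<open>Non-archimedean local fields\<close>

text \<open>
  The valuation is integer-valued on nonzero elements; its value at \<open>0\<close> is irrelevant.
  For a uniformizer \<open>\<varpi>\<close>, the set \<open>ideal_pow v N\<close> is the fractional ideal \<open>\<varpi>\<^sup>N O\<^sub>F\<close>; no particular
  uniformizer is needed below.
\<close>

definition ideal_pow :: "('a::field \<Rightarrow> int) \<Rightarrow> int \<Rightarrow> 'a set" where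
  "ideal_pow v N = {x. x = 0 \<or> N \<le> v x}"

abbreviation integer_ring :: "('a::field \<Rightarrow> int) \<Rightarrow> 'a set" where
  "integer_ring v \<equiv> ideal_pow v 0"

locale nonarch_local_field =
  fixes v :: "'a::field \<Rightarrow> int"
  assumes val_mult: "x \<noteq> 0 \<Longrightarrow> y \<noteq> 0 \<Longrightarrow> v (x * y) = v x + v y"
    and val_add: "x \<noteq> 0 \<Longrightarrow> y \<noteq> 0 \<Longrightarrow> x + y \<noteq> 0 \<Longrightarrow> min (v x) (v y) \<le> v (x + y)"
    and uniformizer_exists: "\<exists>w. w \<noteq> 0 \<and> v w = 1"
    and complete: "\<And>X :: nat \<Rightarrow> 'a.
      (\<forall>N. \<exists>K. \<forall>i\<ge>K. \<forall>j\<ge>K. X i - X j \<in> ideal_pow v N) \<Longrightarrow>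
      (\<exists>x. \<forall>N. \<exists>K. \<forall>i\<ge>K. X i - x \<in> ideal_pow v N)"
    and finite_residue_field: "finite (quot (ideal_pow v 0) (ideal_pow v 1))"

definition residue_card :: "('a::field \<Rightarrow> int) \<Rightarrow> nat" where
  "residue_card v = card (quot (integer_ring v) (ideal_pow v 1))"

definition residue_char :: "('a::field \<Rightarrow> int) \<Rightarrow> nat" where
  "residue_char v = (LEAST p. 0 < p \<and> of_nat p \<in> ideal_pow v 1)"

text \<open>
  The quadratic residue symbol of \<open>a \<noteq> 0\<close>. If \<open>v a = 2 * r\<close> and \<open>a = \<varpi>\<^sup>2\<^sup>r u\<close> with a unit \<open>u\<close>,
  then every \<open>c\<close> as below has the form \<open>\<varpi>\<^sup>r y\<close> with \<open>y\<close> a unit, and the condition says that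
  \<open>u \<equiv> y\<^sup>2\<close> modulo \<open>\<varpi>\<close>. On units this is the Legendre symbol of the residue class.
\<close>

definition quad_symbol :: "('a::field \<Rightarrow> int) \<Rightarrow> 'a \<Rightarrow> int" where
  "quad_symbol v a =
     (if odd (v a) then 0
      else if \<exists>c. a - c\<^sup>2 \<in> ideal_pow v (v a + 1) then 1
      else -1)"


section \<open>Quadratic spaces and lattices\<close>

text \<open>
  A space consists of a scalar multiplication and a symmetric bilinear form on a whole type.
  A lattice is a subset \<open>L\<close>; its rational span \<open>L\<^sub>F\<close> may be a proper subspace of the type,
  and nondegeneracy is required only on that span.
\<close>

record ('a, 'b) quad_space =
  scl :: "'a \<Rightarrow> 'b \<Rightarrow> 'b"
  frm :: "'b \<Rightarrow> 'b \<Rightarrow> 'a"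

definition quadratic_space :: "('a::field, 'b::ab_group_add) quad_space \<Rightarrow> bool" where
  "quadratic_space V \<longleftrightarrow>
     vector_space (scl V) \<and>
     (\<forall>x. Vector_Spaces.linear (scl V) (*) (frm V x)) \<and>
     (\<forall>x y. frm V x y = frm V y x)"

definition rational_span :: "('a::field, 'b::ab_group_add) quad_space \<Rightarrow> 'b set \<Rightarrow> 'b set" where
  "rational_span V L = Modules.module.span (scl V) L"

definition rank :: "('a::field, 'b::ab_group_add) quad_space \<Rightarrow> 'b set \<Rightarrow> nat" where
  "rank V L = Vector_Spaces.vector_space.dim (scl V) L"

definition lin_comb ::
  "('a::field, 'b::ab_group_add) quad_space \<Rightarrow> 'b list \<Rightarrow> (nat \<Rightarrow> 'a) \<Rightarrow> 'b" where
  "lin_comb V es c = (\<Sum>i<length es. scl V (c i) (es ! i))"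

definition lattice_basis ::
  "('a::field \<Rightarrow> int) \<Rightarrow> ('a, 'b::ab_group_add) quad_space \<Rightarrow> 'b set \<Rightarrow> 'b list \<Rightarrow> bool" where
  "lattice_basis v V L es \<longleftrightarrow>
     distinct es \<and> \<not> Modules.module.dependent (scl V) (set es) \<and>
     L = {lin_comb V es c | c. \<forall>i. c i \<in> integer_ring v}"

definition is_lattice ::
  "('a::field \<Rightarrow> int) \<Rightarrow> ('a, 'b::ab_group_add) quad_space \<Rightarrow> 'b set \<Rightarrow> bool" where
  "is_lattice v V L \<longleftrightarrow> (\<exists>es. lattice_basis v V L es)"

definition quadratic_lattice ::
  "('a::field \<Rightarrow> int) \<Rightarrow> ('a, 'b::ab_group_add) quad_space \<Rightarrow> 'b set \<Rightarrow> bool" where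
  "quadratic_lattice v V L \<longleftrightarrow>
     quadratic_space V \<and> is_lattice v V L \<and>
     (\<forall>x \<in> rational_span V L. (\<forall>y \<in> rational_span V L. frm V x y = 0) \<longrightarrow> x = 0)"

definition dual_lattice ::
  "('a::field \<Rightarrow> int) \<Rightarrow> ('a, 'b::ab_group_add) quad_space \<Rightarrow> 'b set \<Rightarrow> 'b set" where
  "dual_lattice v V L = {x \<in> rational_span V L. \<forall>y\<in>L. frm V x y \<in> integer_ring v}"

definition integral_overlattices ::
  "('a::field \<Rightarrow> int) \<Rightarrow> ('a, 'b::ab_group_add) quad_space \<Rightarrow> 'b set \<Rightarrow> 'b set set" where
  "integral_overlattices v V L =
     {L'. is_lattice v V L' \<and> L \<subseteq> L' \<and> L' \<subseteq> rational_span V L \<and> L' \<subseteq> dual_lattice v V L'}"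

definition disc_of_list :: "('a::field, 'b::ab_group_add) quad_space \<Rightarrow> 'b list \<Rightarrow> 'a" where
  "disc_of_list V es =
     (let n = length es in
      (-1) ^ (n * (n - 1) div 2) * det (mat n n (\<lambda>(i, j). frm V (es ! i) (es ! j))))"

text \<open>Another basis changes the discriminant by the square of a unit, so the symbol is unaffected.\<close>

definition lattice_chi ::
  "('a::field \<Rightarrow> int) \<Rightarrow> ('a, 'b::ab_group_add) quad_space \<Rightarrow> 'b set \<Rightarrow> int" where
  "lattice_chi v V L = quad_symbol v (disc_of_list V (SOME es. lattice_basis v V L es))"

text \<open>The property of being a lattice \<open>H\<^sup>\<epsilon>\<^sub>r\<close> (which is unique up to isometry).\<close>

definition is_H ::
  "('a::field \<Rightarrow> int) \<Rightarrow> int \<Rightarrow> nat \<Rightarrow> ('a, 'b::ab_group_add) quad_space \<Rightarrow> 'b set \<Rightarrow> bool" where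
  "is_H v \<epsilon> r W M \<longleftrightarrow>
     quadratic_lattice v W M \<and> rank W M = r \<and> dual_lattice v W M = M \<and> lattice_chi v W M = \<epsilon>"


section \<open>Length, type and residual sign\<close>

definition is_submodule ::
  "('a::field \<Rightarrow> int) \<Rightarrow> ('a, 'b::ab_group_add) quad_space \<Rightarrow> 'b set \<Rightarrow> bool" where
  "is_submodule v V S \<longleftrightarrow>
     0 \<in> S \<and> (\<forall>x\<in>S. \<forall>y\<in>S. x + y \<in> S) \<and> (\<forall>c\<in>integer_ring v. \<forall>x\<in>S. scl V c x \<in> S)"

text \<open>Submodules of \<open>A / S\<close> are identified with submodules between \<open>S\<close> and \<open>A\<close>.\<close>

definition quot_length ::
  "('a::field \<Rightarrow> int) \<Rightarrow> ('a, 'b::ab_group_add) quad_space \<Rightarrow> 'b set \<Rightarrow> 'b set \<Rightarrow> nat" where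
  "quot_length v V A S =
     (GREATEST l. \<exists>C :: nat \<Rightarrow> 'b set.
        (\<forall>i\<le>l. is_submodule v V (C i) \<and> S \<subseteq> C i \<and> C i \<subseteq> A) \<and> (\<forall>i<l. C i \<subset> C (Suc i)))"

text \<open>
  \<open>as\<close> lists the fundamental invariants of \<open>L\<^sup>\<or> / L\<close>: there is an \<open>O\<^sub>F\<close>-module isomorphism \<open>f\<close>
  from \<open>L\<^sup>\<or> / L\<close> onto the direct sum of the \<open>O\<^sub>F / \<varpi>\<^sup>a\<close>, for \<open>a\<close> in \<open>as\<close>. Since all values of \<open>f\<close>
  are cosets, \<open>s + t \<in> f [x + y] i\<close> for all \<open>s \<in> f [x] i\<close> and \<open>t \<in> f [y] i\<close> expresses additivity, and
  similarly for scalars.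
\<close>

definition fundamental_invariants ::
  "('a::field \<Rightarrow> int) \<Rightarrow> ('a, 'b::ab_group_add) quad_space \<Rightarrow> 'b set \<Rightarrow> nat list \<Rightarrow> bool" where
  "fundamental_invariants v V L as \<longleftrightarrow>
     sorted as \<and> length as = rank V L \<and>
     (\<exists>f. bij_betw f (quot (dual_lattice v V L) L)
            (\<Pi>\<^sub>E i\<in>{..<length as}. quot (integer_ring v) (ideal_pow v (int (as ! i)))) \<and>
          (\<forall>x\<in>dual_lattice v V L. \<forall>y\<in>dual_lattice v V L. \<forall>i<length as.
             \<forall>s\<in>f (coset L x) i. \<forall>t\<in>f (coset L y) i. s + t \<in> f (coset L (x + y)) i) \<and>
          (\<forall>c\<in>integer_ring v. \<forall>x\<in>dual_lattice v V L. \<forall>i<length as.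
             \<forall>s\<in>f (coset L x) i. c * s \<in> f (coset L (scl V c x)) i))"

definition lattice_type ::
  "('a::field \<Rightarrow> int) \<Rightarrow> ('a, 'b::ab_group_add) quad_space \<Rightarrow> 'b set \<Rightarrow> nat" where
  "lattice_type v V L =
     length (filter (\<lambda>a. a \<noteq> 0) (SOME as. fundamental_invariants v V L as))"

text \<open>
  The residual quadratic space \<open>U = L \<otimes> \<kappa> = L / \<varpi>L\<close> of an integral lattice is described by
  representatives in \<open>L\<close>. \<open>residual_radical\<close> is the preimage in \<open>L\<close> of the radical of \<open>U\<close>.
  In \<open>residual_core_basis\<close>, the last two conditions say that the images of \<open>us\<close> in \<open>U\<close> are a basis
  of a subspace \<open>U\<^sub>0\<close> with \<open>U\<^sub>0 + radical = U\<close> and \<open>U\<^sub>0 \<inter> radical = 0\<close>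
  (linear independence and trivial intersection together form the last condition).
\<close>

definition residual_radical ::
  "('a::field \<Rightarrow> int) \<Rightarrow> ('a, 'b::ab_group_add) quad_space \<Rightarrow> 'b set \<Rightarrow> 'b set" where
  "residual_radical v V L = {x\<in>L. \<forall>y\<in>L. frm V x y \<in> ideal_pow v 1}"

definition residual_core_basis ::
  "('a::field \<Rightarrow> int) \<Rightarrow> ('a, 'b::ab_group_add) quad_space \<Rightarrow> 'b set \<Rightarrow> 'b list \<Rightarrow> bool" where
  "residual_core_basis v V L us \<longleftrightarrow>
     set us \<subseteq> L \<and>
     (\<forall>x\<in>L. \<exists>c. (\<forall>i. c i \<in> integer_ring v) \<and> x - lin_comb V us c \<in> residual_radical v V L) \<and>
     (\<forall>c. (\<forall>i. c i \<in> integer_ring v) \<and> lin_comb V us c \<in> residual_radical v V L \<longrightarrow>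
        (\<forall>i<length us. c i \<in> ideal_pow v 1))"

text \<open>
  The form on \<open>U\<^sub>0\<close> is nondegenerate, so the discriminant of a lifted basis is a unit and its symbol
  is the quadratic residue symbol in \<open>\<kappa>\<close> of the discriminant of \<open>U\<^sub>0\<close> (it is \<open>1\<close> for \<open>U\<^sub>0 = 0\<close>).
\<close>

definition residual_sgn ::
  "('a::field \<Rightarrow> int) \<Rightarrow> ('a, 'b::ab_group_add) quad_space \<Rightarrow> nat \<Rightarrow> 'b set \<Rightarrow> int" where
  "residual_sgn v V r L =
     (let us = (SOME us. residual_core_basis v V L us) in
      if even (length us) = even r then quad_symbol v (disc_of_list V us) else 0)"


section \<open>Local densities\<close>

definition scaled_lattice ::
  "('a::field \<Rightarrow> int) \<Rightarrow> ('a, 'b::ab_group_add) quad_space \<Rightarrow> nat \<Rightarrow> 'b set \<Rightarrow> 'b set" where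
  "scaled_lattice v V N L = {scl V c x | c x. c \<in> ideal_pow v (int N) \<and> x \<in> L}"

text \<open>
  Homomorphisms of quadratic modules \<open>L / \<varpi>\<^sup>N L \<rightarrow> M / \<varpi>\<^sup>N M\<close> over \<open>O\<^sub>F / \<varpi>\<^sup>N\<close>, as maps between
  sets of cosets. Membership \<open>u + w \<in> f [x + y]\<close> for representatives expresses additivity.
  If \<open>M\<close> is integral and \<open>L\<close> is not, there are none.
\<close>

definition rep_set ::
  "('a::field \<Rightarrow> int) \<Rightarrow> ('a, 'c::ab_group_add) quad_space \<Rightarrow> 'c set \<Rightarrow>
   ('a, 'b::ab_group_add) quad_space \<Rightarrow> 'b set \<Rightarrow> nat \<Rightarrow> ('b set \<Rightarrow> 'c set) set" where
  "rep_set v W M V L N =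
     {f \<in> quot L (scaled_lattice v V N L) \<rightarrow>\<^sub>E quot M (scaled_lattice v W N M).
        (\<forall>x\<in>L. \<forall>y\<in>L.
           \<forall>u\<in>f (coset (scaled_lattice v V N L) x). \<forall>w\<in>f (coset (scaled_lattice v V N L) y).
             u + w \<in> f (coset (scaled_lattice v V N L) (x + y)) \<and>
             frm W u w - frm V x y \<in> ideal_pow v (int N)) \<and>
        (\<forall>c\<in>integer_ring v. \<forall>x\<in>L. \<forall>u\<in>f (coset (scaled_lattice v V N L) x).
             scl W c u \<in> f (coset (scaled_lattice v V N L) (scl V c x)))}"

text \<open>
  For \<open>n \<le> m\<close> the generic fibre of \<open>Rep\<^bsub>M,L\<^esub>\<close>, if nonempty, is homogeneous under \<open>O\<^sub>m\<close> with
  stabilizer \<open>O\<^bsub>m-n\<^esub>\<close>, so its dimension is \<open>m(m-1)/2 - (m-n)(m-n-1)/2 = mn - n(n+1)/2\<close>.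
\<close>

definition rep_dim :: "nat \<Rightarrow> nat \<Rightarrow> nat" where
  "rep_dim m n = m * n - n * (n + 1) div 2"

definition local_density ::
  "('a::field \<Rightarrow> int) \<Rightarrow> ('a, 'c::ab_group_add) quad_space \<Rightarrow> 'c set \<Rightarrow>
   ('a, 'b::ab_group_add) quad_space \<Rightarrow> 'b set \<Rightarrow> real" where
  "local_density v W M V L =
     lim (\<lambda>N. real (card (rep_set v W M V L N)) /
              real (residue_card v) ^ (N * rep_dim (rank W M) (rank V L)))"


section \<open>Polynomials\<close>

definition sgn_H :: "int \<Rightarrow> nat \<Rightarrow> int" where
  "sgn_H \<epsilon> n = (if even n then \<epsilon> else 0)"

text \<open>For positive rank the polynomial division is exact, because of the factor \<open>1 - X\<^sup>2\<close>.\<close>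

definition Nor_poly ::
  "('a::field \<Rightarrow> int) \<Rightarrow> ('a, 'b::ab_group_add) quad_space \<Rightarrow> 'b set \<Rightarrow> int \<Rightarrow> real poly" where
  "Nor_poly v V L \<epsilon> =
     (let n = rank V L; q = real (residue_card v) in
      ([:1, - (of_int (sgn_H \<epsilon> n) * q powr (- real n / 2)):] *
       (\<Prod>i\<in>{i::nat. real i < real n / 2}. [:1, 0, - (q powr (- 2 * real i)):]))
      div [:1, - of_int (\<epsilon> * lattice_chi v V L):])"

definition weight_poly :: "real \<Rightarrow> nat \<Rightarrow> int \<Rightarrow> int \<Rightarrow> real poly" where
  "weight_poly q t s \<chi> =
     (if t = 0 then 1
      else [:1, of_int s * q powr (real t / 2):] * [:1, - of_int \<chi>:] *
           (\<Prod>i\<in>{i::nat. 0 < i \<and> real i < real t / 2}. [:1, 0, - (q ^ (2 * i)):]))"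

definition lattice_sum_poly ::
  "('a::field \<Rightarrow> int) \<Rightarrow> ('a, 'b::ab_group_add) quad_space \<Rightarrow> 'b set \<Rightarrow> int \<Rightarrow> real poly" where
  "lattice_sum_poly v V L \<epsilon> =
     (let n = rank V L; q = real (residue_card v) in
      \<Sum>L'\<in>integral_overlattices v V L.
        [:0, q powr (1 / 2):] ^ (2 * quot_length v V L' L) *
        (weight_poly q (lattice_type v V L') (residual_sgn v V n L') (lattice_chi v V L)
           \<circ>\<^sub>p [:0, of_int \<epsilon>:]))"

text \<open>
  The lattices \<open>H\<^sup>\<epsilon>\<^sub>r\<close> of all ranks are realized in the type \<open>nat \<Rightarrow> 'a\<close> with pointwise scalar
  multiplication; every quadratic lattice has an isometric copy there. The quotient is imposed
  only where its denominator is nonzero, which can fail only at \<open>k = 0\<close>; infinitely many values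
  remain, so the polynomial is unique.
\<close>

definition siegel_series ::
  "('a::field \<Rightarrow> int) \<Rightarrow> ('a, 'b::ab_group_add) quad_space \<Rightarrow> 'b set \<Rightarrow> int \<Rightarrow> real poly" where
  "siegel_series v V L \<epsilon> =
     (THE P. \<forall>k (W :: ('a, nat \<Rightarrow> 'a) quad_space) M.
        scl W = (\<lambda>c x i. c * x i) \<longrightarrow> is_H v \<epsilon> (rank V L + 2 * k) W M \<longrightarrow>
        (let X = 1 / real (residue_card v) ^ k in
         poly (Nor_poly v V L \<epsilon>) X \<noteq> 0 \<longrightarrow>
         poly P X = local_density v W M V L / poly (Nor_poly v V L \<epsilon>) X))"

end

theory Submission
  imports Defs
begin

text \<open>
  A linear map \<open>\<phi>\<close> from \<open>L\<close> to \<open>M\<close> that respects the forms modulo a high power of \<open>\<varpi>\<close> determines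
  the integral overlattice \<open>L' = \<phi>\<^sup>-\<^sup>1(M)\<close> of \<open>L\<close>, on which it is injective modulo \<open>\<varpi>\<close>. Grouping the
  maps by \<open>L'\<close> writes the density as the sum of the primitive densities of the lattices \<open>L'\<close>, with
  weights \<open>q\<^bsup>(n + 1 - m) \<ell>(L'/L)\<^esup>\<close>. Over the self-dual lattice \<open>M\<close>, families that are independent
  modulo \<open>\<varpi>\<close> have dual vectors, so approximate isometries lift as in Hensel's lemma, and the
  primitive density of \<open>L'\<close> is a normalized number of isometric embeddings of \<open>L' \<otimes> \<kappa>\<close> into
  \<open>M \<otimes> \<kappa>\<close>. These are counted by choosing images of an orthogonal basis one by one: a vector of unit
  norm splits off a line, an isotropic one a hyperbolic plane, and the number of choices is given by
  quadratic character sums. Finally, \<open>H\<^sup>\<epsilon>\<^sub>r\<close> exists for all \<open>r \<ge> 1\<close>, so the Siegel series is determined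
  by its values at infinitely many points.
\<close>

section \<open>Counting cosets\<close>

text \<open>The obstacle is that \<open>L\<close> may sit unevenly in an overlattice
  \<open>L'\<close>. If f is a basis of \<open>L'\<close> such that the \<pi>^(a_i) f_i form a basis
  of \<open>L\<close>, then a condition modulo \<varpi>^N on \<open>L\<close> prescribes the entry
  (i, j) of the Gram matrix of the images only modulo \<varpi>^(N - a_i - a_j). Lifting is therefore
  proved for arbitrary families of exponents that are at least 1. The weight comes from here: with l
  the sum of the a_i, the a_i + a_j add up to (n + 1) l over i \<le> j, and passing from moduli
  \<varpi>^N to \<varpi>^(N - a_i) costs m l. If A bounds the valuations of the norms of an
  orthogonal basis of \<open>L\<close>, all a_i are at most A, and the normalized counts are
  constant for N > 2A. The variable is X = q^(-k). Up to two sign factors, embedding numbers are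
  products of 1 - q^(-2i) over an interval of indices; cutting it at i = k separates the normalizing
  polynomial from the weight polynomial.\<close>

definition subgrp :: "'b::ab_group_add set \<Rightarrow> bool" where
  "subgrp S \<longleftrightarrow> 0 \<in> S \<and> (\<forall>x\<in>S. \<forall>y\<in>S. x - y \<in> S)"

lemma subgrp_zero: "subgrp S \<Longrightarrow> 0 \<in> S"
  by (simp add: subgrp_def)

lemma subgrp_diff: "subgrp S \<Longrightarrow> x \<in> S \<Longrightarrow> y \<in> S \<Longrightarrow> x - y \<in> S"
  by (simp add: subgrp_def)

lemma subgrp_uminus: "subgrp S \<Longrightarrow> x \<in> S \<Longrightarrow> - x \<in> S"
  by (metis diff_0 subgrp_def)

lemma subgrp_add: "subgrp S \<Longrightarrow> x \<in> S \<Longrightarrow> y \<in> S \<Longrightarrow> x + y \<in> S"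
  by (metis diff_minus_eq_add subgrp_diff subgrp_uminus)

lemma subgrp_diff_swap: "subgrp S \<Longrightarrow> x - y \<in> S \<longleftrightarrow> y - x \<in> S"
  by (metis minus_diff_eq subgrp_uminus)

lemma subgrp_diff_cong:
  assumes "subgrp S" "x - y \<in> S"
  shows "x - z \<in> S \<longleftrightarrow> y - z \<in> S"
proof
  assume "x - z \<in> S"
  then have "(x - z) - (x - y) \<in> S" using assms subgrp_diff by blast
  then show "y - z \<in> S" by simp
next
  assume "y - z \<in> S"
  then have "(x - y) + (y - z) \<in> S" using assms subgrp_add by blast
  then show "x - z \<in> S" by simp
qed

lemma mem_coset: "y \<in> coset S x \<longleftrightarrow> y - x \<in> S"
  by (force simp: coset_def image_iff)

lemma coset_eq_iff:
  assumes "subgrp S"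
  shows "coset S x = coset S y \<longleftrightarrow> x - y \<in> S"
proof
  assume "coset S x = coset S y"
  moreover have "x \<in> coset S x" using assms by (simp add: mem_coset subgrp_zero)
  ultimately show "x - y \<in> S" by (simp add: mem_coset)
next
  assume "x - y \<in> S"
  then show "coset S x = coset S y"
    using subgrp_diff_cong[OF assms \<open>x - y \<in> S\<close>] subgrp_diff_swap[OF assms]
    by (auto simp: mem_coset)
qed

text \<open>An image is determined up to bijection by the fibres of the map. This compares quotients
  of sets that need not be closed under addition, and it transfers finiteness as well, since
  \<open>card\<close> is 0 on infinite sets.\<close>

lemma same_kernel_card:
  assumes "\<And>x y. x \<in> X \<Longrightarrow> y \<in> X \<Longrightarrow> f x = f y \<longleftrightarrow> g x = g y"
  shows "card (f ` X) = card (g ` X)" "finite (f ` X) \<longleftrightarrow> finite (g ` X)"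
proof -
  define h where "h A = g (SOME x. x \<in> X \<and> f x = A)" for A
  have h: "h (f x) = g x" if "x \<in> X" for x
  proof -
    have "(SOME y. y \<in> X \<and> f y = f x) \<in> X \<and> f (SOME y. y \<in> X \<and> f y = f x) = f x"
      using that by (metis (mono_tags, lifting) someI_ex)
    then show ?thesis unfolding h_def using assms that by blast
  qed
  have "inj_on h (f ` X)" unfolding inj_on_def using h assms by auto
  moreover have "h ` f ` X = g ` X" unfolding image_image using h by simp
  ultimately have "bij_betw h (f ` X) (g ` X)" by (simp add: bij_betw_def)
  then show "card (f ` X) = card (g ` X)" "finite (f ` X) \<longleftrightarrow> finite (g ` X)"
    by (simp_all add: bij_betw_same_card bij_betw_finite)
qed

lemma quot_card_image:
  assumes "subgrp K"
    and "\<And>x y. x \<in> X \<Longrightarrow> y \<in> X \<Longrightarrow> F x = F y \<longleftrightarrow> x - y \<in> K"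
    and "F ` X = Y"
  shows "card (quot X K) = card Y" "finite (quot X K) \<longleftrightarrow> finite Y"
  using same_kernel_card[of X "coset K" F] assms by (auto simp: quot_def coset_eq_iff)

text \<open>The standard comparison of two counts below: \<open>f\<close> only has to be onto up to
  \<open>K'\<close>, so it may go between sets of representatives that are not unions of
  cosets.\<close>

lemma quot_card_cong:
  assumes K: "subgrp K" "subgrp K'"
    and f: "\<And>x. x \<in> X \<Longrightarrow> f x \<in> Y"
    and surj: "\<And>y. y \<in> Y \<Longrightarrow> \<exists>x\<in>X. f x - y \<in> K'"
    and inj: "\<And>x y. x \<in> X \<Longrightarrow> y \<in> X \<Longrightarrow> f x - f y \<in> K' \<longleftrightarrow> x - y \<in> K"
  shows "card (quot X K) = card (quot Y K')" "finite (quot X K) \<longleftrightarrow> finite (quot Y K')"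
proof -
  have "(\<lambda>x. coset K' (f x)) ` X = quot Y K'"
  proof
    show "quot Y K' \<subseteq> (\<lambda>x. coset K' (f x)) ` X"
    proof
      fix A assume "A \<in> quot Y K'"
      then obtain y where "y \<in> Y" "A = coset K' y" by (auto simp: quot_def)
      then show "A \<in> (\<lambda>x. coset K' (f x)) ` X"
        using surj[of y] coset_eq_iff[OF K(2)] by (metis imageI)
    qed
  qed (use f in \<open>auto simp: quot_def\<close>)
  then show "card (quot X K) = card (quot Y K')" "finite (quot X K) \<longleftrightarrow> finite (quot Y K')"
    using quot_card_image[OF K(1), of X "\<lambda>x. coset K' (f x)"] inj
    by (auto simp: coset_eq_iff[OF K(2)])
qed

lemma reps_exist:
  assumes "subgrp K"
  shows "\<exists>R\<subseteq>Z. (\<forall>z\<in>Z. \<exists>!r. r \<in> R \<and> z - r \<in> K) \<and> card R = card (quot Z K) \<and>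
     (finite (quot Z K) \<longrightarrow> finite R)"
proof -
  define s where "s A = (SOME z. z \<in> Z \<and> coset K z = A)" for A
  have s: "s A \<in> Z \<and> coset K (s A) = A" if "A \<in> quot Z K" for A
    unfolding s_def by (rule someI_ex) (use that in \<open>auto simp: quot_def\<close>)
  have inj: "inj_on s (quot Z K)"
    by (metis inj_onI s)
  have "\<exists>!r. r \<in> s ` quot Z K \<and> z - r \<in> K" if "z \<in> Z" for z
  proof (rule ex1I[of _ "s (coset K z)"])
    have "coset K z \<in> quot Z K" using that by (simp add: quot_def)
    then show "s (coset K z) \<in> s ` quot Z K \<and> z - s (coset K z) \<in> K"
      using s[of "coset K z"] coset_eq_iff[OF assms] by (metis imageI)
  next
    fix r assume "r \<in> s ` quot Z K \<and> z - r \<in> K"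
    then show "r = s (coset K z)"
      using s coset_eq_iff[OF assms] by (metis image_iff)
  qed
  then have "\<forall>z\<in>Z. \<exists>!r. r \<in> s ` quot Z K \<and> z - r \<in> K" by blast
  moreover have "s ` quot Z K \<subseteq> Z" using s by blast
  moreover have "card (s ` quot Z K) = card (quot Z K)" using inj by (rule card_image)
  moreover have "finite (quot Z K) \<longrightarrow> finite (s ` quot Z K)" by simp
  ultimately show ?thesis by blast
qed

text \<open>Counting along a fibration. The fibres are taken up to \<open>K'\<close> over a system
  of representatives \<open>R\<close>; compatibility of \<open>g\<close> with the cosets keeps
  distinct fibres disjoint after passing to cosets of \<open>K\<close>.\<close>

lemma quot_fib_sum:
  assumes K: "subgrp K" "subgrp K'" and "finite R"
    and g: "\<And>x y. x \<in> X \<Longrightarrow> y \<in> X \<Longrightarrow> x - y \<in> K \<Longrightarrow> g x - g y \<in> K'"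
    and R: "\<And>x. x \<in> X \<Longrightarrow> \<exists>!r. r \<in> R \<and> g x - r \<in> K'"
    and fin: "\<And>r. r \<in> R \<Longrightarrow> finite (quot {x\<in>X. g x - r \<in> K'} K)"
  shows "card (quot X K) = (\<Sum>r\<in>R. card (quot {x\<in>X. g x - r \<in> K'} K))"
    and "finite (quot X K)"
proof -
  have eq: "quot X K = (\<Union>r\<in>R. quot {x\<in>X. g x - r \<in> K'} K)"
  proof -
    have "X = (\<Union>r\<in>R. {x\<in>X. g x - r \<in> K'})" using R by fast
    then show ?thesis unfolding quot_def by (metis image_UN)
  qed
  show "finite (quot X K)" unfolding eq using \<open>finite R\<close> fin by simp
  show "card (quot X K) = (\<Sum>r\<in>R. card (quot {x\<in>X. g x - r \<in> K'} K))"
    unfolding eq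
  proof (rule card_UN_disjoint)
    show "\<forall>r\<in>R. \<forall>r'\<in>R. r \<noteq> r' \<longrightarrow>
        quot {x \<in> X. g x - r \<in> K'} K \<inter> quot {x \<in> X. g x - r' \<in> K'} K = {}"
    proof (intro ballI impI, rule ccontr)
      fix r r' assume rr: "r \<in> R" "r' \<in> R" "r \<noteq> r'"
        and "quot {x \<in> X. g x - r \<in> K'} K \<inter> quot {x \<in> X. g x - r' \<in> K'} K \<noteq> {}"
      then obtain x y where x: "x \<in> X" "g x - r \<in> K'" and y: "y \<in> X" "g y - r' \<in> K'"
        and "coset K x = coset K y" by (auto simp: quot_def)
      then have "g x - g y \<in> K'" using g coset_eq_iff[OF K(1)] by blast
      then have "g x - r' \<in> K'" using y subgrp_diff_cong[OF K(2)] by blast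
      then show False using R[OF x(1)] rr x by blast
    qed
  qed (use fin \<open>finite R\<close> in auto)
qed

lemma quot_fib_const:
  assumes K: "subgrp K" "subgrp K'" and Z: "finite (quot Z K')"
    and gZ: "\<And>x. x \<in> X \<Longrightarrow> g x \<in> Z"
    and g: "\<And>x y. x \<in> X \<Longrightarrow> y \<in> X \<Longrightarrow> x - y \<in> K \<Longrightarrow> g x - g y \<in> K'"
    and fin: "\<And>z. z \<in> Z \<Longrightarrow> finite (quot {x\<in>X. g x - z \<in> K'} K)"
    and card: "\<And>z. z \<in> Z \<Longrightarrow> card (quot {x\<in>X. g x - z \<in> K'} K) = c"
  shows "card (quot X K) = card (quot Z K') * c" "finite (quot X K)"
proof -
  obtain R where R: "R \<subseteq> Z" "\<forall>z\<in>Z. \<exists>!r. r \<in> R \<and> z - r \<in> K'" "card R = card (quot Z K')" "finite R"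
    using reps_exist[OF K(2), of Z] Z by blast
  note * = quot_fib_sum[OF K R(4), of X g]
  have "card (quot X K) = (\<Sum>r\<in>R. card (quot {x\<in>X. g x - r \<in> K'} K))"
    by (rule *) (use g gZ R fin in auto)
  also have "\<dots> = (\<Sum>r\<in>R. c)" by (rule sum.cong) (use R card in auto)
  finally show "card (quot X K) = card (quot Z K') * c" using R by simp
  show "finite (quot X K)" by (rule *) (use g gZ R fin in auto)
qed

text \<open>Multiplicativity of the index. As \<open>X\<close> is stable under \<open>K2\<close>,
  each fibre over a class modulo \<open>K2\<close> is a translate of \<open>K2\<close>.\<close>

lemma quot_tower:
  assumes K: "subgrp K1" "subgrp K2" "K1 \<subseteq> K2"
    and X: "\<And>x k. x \<in> X \<Longrightarrow> k \<in> K2 \<Longrightarrow> x + k \<in> X"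
    and fin: "finite (quot X K2)" "finite (quot K2 K1)"
  shows "card (quot X K1) = card (quot X K2) * card (quot K2 K1)" "finite (quot X K1)"
proof -
  have *: "card (quot K2 K1) = card (quot {x\<in>X. x - z \<in> K2} K1)"
     "finite (quot K2 K1) \<longleftrightarrow> finite (quot {x\<in>X. x - z \<in> K2} K1)" if "z \<in> X" for z
  proof -
    have "\<And>y. y \<in> {x \<in> X. x - z \<in> K2} \<Longrightarrow> \<exists>x\<in>K2. z + x - y \<in> K1"
      by (rule_tac x = "y - z" in bexI) (use K subgrp_zero in auto)
    then show "card (quot K2 K1) = card (quot {x\<in>X. x - z \<in> K2} K1)"
     "finite (quot K2 K1) \<longleftrightarrow> finite (quot {x\<in>X. x - z \<in> K2} K1)"
      using quot_card_cong[OF K(1) K(1), of K2 "\<lambda>k. z + k" "{x\<in>X. x - z \<in> K2}"] X that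
      by auto
  qed
  show "card (quot X K1) = card (quot X K2) * card (quot K2 K1)" "finite (quot X K1)"
    using quot_fib_const[OF K(1,2) fin(1), of X "\<lambda>x. x" "card (quot K2 K1)"] * K fin
    by auto
qed

text \<open>Meant for \<open>h\<close> the saturation of a homomorphism, which depends only on the
  class of the homomorphism.\<close>

lemma quot_UN_disjoint:
  assumes K: "subgrp K" and "finite I"
    and stable: "\<And>x y. x \<in> X \<Longrightarrow> y \<in> X \<Longrightarrow> x - y \<in> K \<Longrightarrow> h x = h y"
    and h: "\<And>x. x \<in> X \<Longrightarrow> h x \<in> I"
    and fin: "finite (quot X K)"
  shows "card (quot X K) = (\<Sum>i\<in>I. card (quot {x\<in>X. h x = i} K))"
proof -
  have eq: "quot X K = (\<Union>i\<in>I. quot {x\<in>X. h x = i} K)"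
    unfolding quot_def using h by blast
  have "quot {x\<in>X. h x = i} K \<subseteq> quot X K" for i by (auto simp: quot_def)
  then have f: "finite (quot {x\<in>X. h x = i} K)" for i using fin finite_subset by blast
  show ?thesis unfolding eq
  proof (rule card_UN_disjoint)
    show "\<forall>i\<in>I. \<forall>j\<in>I. i \<noteq> j \<longrightarrow> quot {x\<in>X. h x = i} K \<inter> quot {x\<in>X. h x = j} K = {}"
      using stable by (auto simp: quot_def coset_eq_iff[OF K])
  qed (use f \<open>finite I\<close> in auto)
qed

lemma quot_mono: "X \<subseteq> Y \<Longrightarrow> finite (quot Y K) \<Longrightarrow> finite (quot X K)"
  unfolding quot_def by (meson finite_subset image_mono)

text \<open>Values beyond \<open>n\<close> are fixed to 0, so a tuple is determined by its
  \<open>n\<close> entries and tuples inherit the pointwise group structure of functions.\<close>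

definition TupI :: "nat \<Rightarrow> (nat \<Rightarrow> 'b::zero set) \<Rightarrow> (nat \<Rightarrow> 'b) set" where
  "TupI n A = {x. (\<forall>i<n. x i \<in> A i) \<and> (\<forall>i\<ge>n. x i = 0)}"

abbreviation "Tup n A \<equiv> TupI n (\<lambda>_. A)"

lemma subgrp_TupI: "(\<And>i. i < n \<Longrightarrow> subgrp (B i)) \<Longrightarrow> subgrp (TupI n B)"
  by (auto simp: subgrp_def TupI_def)

lemma TupI_0: "TupI 0 A = {\<lambda>_. 0}"
  by (auto simp: TupI_def)

text \<open>The last coordinate is a fibration; resetting it to 0 identifies each fibre with the
  shorter tuples.\<close>

lemma card_quot_TupI:
  assumes "\<And>i. i < n \<Longrightarrow> subgrp (B i)" "\<And>i. i < n \<Longrightarrow> finite (quot (A i) (B i))"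
  shows "card (quot (TupI n A) (TupI n B)) = (\<Prod>i<n. card (quot (A i) (B i))) \<and>
    finite (quot (TupI n A) (TupI n B))"
  using assms
proof (induction n)
  case 0
  then show ?case by (simp add: TupI_0 quot_def)
next
  case (Suc n)
  then have IH: "card (quot (TupI n A) (TupI n B)) = (\<Prod>i<n. card (quot (A i) (B i)))"
    "finite (quot (TupI n A) (TupI n B))" by auto
  have sg: "subgrp (TupI n B)" "subgrp (TupI (Suc n) B)" "subgrp (B n)"
    using subgrp_TupI[of n B] subgrp_TupI[of "Suc n" B] Suc.prems by auto
  have fib: "card (quot {x \<in> TupI (Suc n) A. x n - z \<in> B n} (TupI (Suc n) B))
      = card (quot (TupI n A) (TupI n B))"
    "finite (quot {x \<in> TupI (Suc n) A. x n - z \<in> B n} (TupI (Suc n) B)) =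
      finite (quot (TupI n A) (TupI n B))" if "z \<in> A n" for z
  proof -
    have a: "x(n := 0) \<in> TupI n A" if "x \<in> {x \<in> TupI (Suc n) A. x n - z \<in> B n}" for x
      using that by (auto simp: TupI_def le_Suc_eq not_less_eq_eq)
    have b: "\<exists>x\<in>{x \<in> TupI (Suc n) A. x n - z \<in> B n}. x(n := 0) - y \<in> TupI n B"
      if "y \<in> TupI n A" for y
      using that \<open>z \<in> A n\<close> sg Suc.prems(1)
      by (intro bexI[of _ "y(n := z)"]) (auto simp: TupI_def subgrp_zero less_Suc_eq fun_diff_def)
    have c: "x(n := 0) - y(n := 0) \<in> TupI n B \<longleftrightarrow> x - y \<in> TupI (Suc n) B"
      if "x \<in> {x \<in> TupI (Suc n) A. x n - z \<in> B n}" "y \<in> {x \<in> TupI (Suc n) A. x n - z \<in> B n}" for x y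
    proof -
      have "(x n - z) - (y n - z) \<in> B n" using that sg subgrp_diff by blast
      then show ?thesis using that
        by (auto simp: TupI_def less_Suc_eq not_less_eq_eq fun_diff_def)
    qed
    show "card (quot {x \<in> TupI (Suc n) A. x n - z \<in> B n} (TupI (Suc n) B))
      = card (quot (TupI n A) (TupI n B))"
    "finite (quot {x \<in> TupI (Suc n) A. x n - z \<in> B n} (TupI (Suc n) B)) =
      finite (quot (TupI n A) (TupI n B))"
      using quot_card_cong[OF sg(2,1), of "{x \<in> TupI (Suc n) A. x n - z \<in> B n}" "\<lambda>x. x(n := 0)"
          "TupI n A"] a b c by blast+
  qed
  have "card (quot (TupI (Suc n) A) (TupI (Suc n) B))
      = card (quot (A n) (B n)) * card (quot (TupI n A) (TupI n B))"
    "finite (quot (TupI (Suc n) A) (TupI (Suc n) B))"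
    using quot_fib_const[OF sg(2,3), of "A n" "TupI (Suc n) A" "\<lambda>x. x n"] fib IH Suc.prems
    by (auto simp: TupI_def)
  then show ?case using IH by simp
qed

section \<open>Local fields of odd residue characteristic\<close>

locale odd_local_field = nonarch_local_field v for v :: "'a::field \<Rightarrow> int" +
  assumes odd_char: "odd (residue_char v)"
begin

abbreviation PP :: "int \<Rightarrow> 'a set" where "PP N \<equiv> ideal_pow v N"
abbreviation \<O> :: "'a set" where "\<O> \<equiv> ideal_pow v 0"
abbreviation q :: nat where "q \<equiv> residue_card v"

lemma PP_iff: "x \<in> PP N \<longleftrightarrow> x = 0 \<or> N \<le> v x"
  by (simp add: ideal_pow_def)

lemma v_one [simp]: "v 1 = 0"
  using val_mult[of 1 1] by simp

lemma v_uminus [simp]: "v (- x) = v x"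
proof (cases "x = 0")
  case False
  have "v (-1) = 0" using val_mult[of "-1" "-1"] by simp
  then show ?thesis using val_mult[of "-1" x] False by simp
qed simp

lemma v_inverse: "x \<noteq> 0 \<Longrightarrow> v (inverse x) = - v x"
  using val_mult[of x "inverse x"] by simp

lemma v_divide: "x \<noteq> 0 \<Longrightarrow> y \<noteq> 0 \<Longrightarrow> v (x / y) = v x - v y"
  by (simp add: divide_inverse val_mult v_inverse)

lemma v_power: "x \<noteq> 0 \<Longrightarrow> v (x ^ k) = int k * v x"
  by (induction k) (auto simp: val_mult algebra_simps)

lemma v_powi: "x \<noteq> 0 \<Longrightarrow> v (x powi k) = k * v x"
  by (cases "k \<ge> 0") (auto simp: power_int_def v_power v_inverse)

lemma PP_zero [simp]: "0 \<in> PP N" by (simp add: PP_iff)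

lemma PP_uminus [simp]: "- x \<in> PP N \<longleftrightarrow> x \<in> PP N" by (simp add: PP_iff)

lemma PP_add: "x \<in> PP N \<Longrightarrow> y \<in> PP N \<Longrightarrow> x + y \<in> PP N"
  using val_add[of x y] by (cases "x = 0 \<or> y = 0 \<or> x + y = 0") (auto simp: PP_iff)

lemma PP_diff: "x \<in> PP N \<Longrightarrow> y \<in> PP N \<Longrightarrow> x - y \<in> PP N"
  using PP_add[of x N "- y"] by simp

lemma PP_sum: "(\<And>i. i \<in> I \<Longrightarrow> f i \<in> PP N) \<Longrightarrow> sum f I \<in> PP N"
  by (induction I rule: infinite_finite_induct) (auto intro: PP_add)

lemma PP_mult: "x \<in> PP i \<Longrightarrow> y \<in> PP j \<Longrightarrow> x * y \<in> PP (i + j)"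
  by (cases "x = 0"; cases "y = 0") (auto simp: PP_iff val_mult)

lemma PP_mono: "i \<le> j \<Longrightarrow> x \<in> PP j \<Longrightarrow> x \<in> PP i"
  by (auto simp: PP_iff)

lemma PP_mult_O: "x \<in> \<O> \<Longrightarrow> y \<in> PP j \<Longrightarrow> x * y \<in> PP j"
  using PP_mult[of x 0 y j] by simp

lemma PP_mult_O': "x \<in> PP j \<Longrightarrow> y \<in> \<O> \<Longrightarrow> x * y \<in> PP j"
  using PP_mult[of x j y 0] by simp

lemma O_one [simp]: "1 \<in> \<O>" by (simp add: PP_iff)

lemma O_mult: "x \<in> \<O> \<Longrightarrow> y \<in> \<O> \<Longrightarrow> x * y \<in> \<O>"
  using PP_mult_O by blast

lemma O_power: "x \<in> \<O> \<Longrightarrow> x ^ k \<in> \<O>"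
  by (induction k) (auto intro: O_mult)

lemma O_prod: "(\<And>i. i \<in> I \<Longrightarrow> f i \<in> \<O>) \<Longrightarrow> prod f I \<in> \<O>"
  by (induction I rule: infinite_finite_induct) (auto intro: O_mult)

lemma subgrp_PP [simp]: "subgrp (PP N)"
  by (simp add: subgrp_def PP_diff)

lemma PP_diff_cong: "x - y \<in> PP N \<Longrightarrow> x - z \<in> PP N \<longleftrightarrow> y - z \<in> PP N"
  using subgrp_diff_cong subgrp_PP by blast

lemma PP_add_iff: "y \<in> PP N \<Longrightarrow> x + y \<in> PP N \<longleftrightarrow> x \<in> PP N"
  using PP_add[of x N y] PP_diff[of "x + y" N y] by auto

lemma PP_mult_cancel: "c \<noteq> 0 \<Longrightarrow> c * x \<in> PP N \<longleftrightarrow> x \<in> PP (N - v c)"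
  by (cases "x = 0") (auto simp: PP_iff val_mult)

lemma PP_divide_iff: "c \<noteq> 0 \<Longrightarrow> x / c \<in> PP N \<longleftrightarrow> x \<in> PP (N + v c)"
  by (cases "x = 0") (auto simp: PP_iff v_divide)

lemma unit_iff: "x \<in> \<O> \<and> x \<notin> PP 1 \<longleftrightarrow> x \<noteq> 0 \<and> v x = 0"
  by (auto simp: PP_iff)

definition \<pi> :: 'a where "\<pi> = (SOME w. w \<noteq> 0 \<and> v w = 1)"

lemma pi_nz [simp]: "\<pi> \<noteq> 0" and v_pi [simp]: "v \<pi> = 1"
  using someI_ex[OF uniformizer_exists] by (auto simp: \<pi>_def)

lemma v_pi_power [simp]: "v (\<pi> ^ k) = int k"
  by (simp add: v_power)

lemma pi_power_mem: "\<pi> ^ k * x \<in> PP N \<longleftrightarrow> x \<in> PP (N - int k)"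
  by (simp add: PP_mult_cancel)

lemma PP_pi: "int i \<le> j \<Longrightarrow> x \<in> PP j \<Longrightarrow> \<exists>y \<in> PP (j - int i). x = \<pi> ^ i * y"
  by (rule bexI[of _ "x / \<pi> ^ i"]) (simp_all add: PP_divide_iff)

text \<open>If 2 were a nonunit, it would be the least positive integer in the maximal ideal,
  because 1 is not there; the residue characteristic would be even.\<close>

lemma two_unit [simp]: "(2::'a) \<noteq> 0" "v 2 = 0"
proof -
  have "(2::'a) \<notin> PP 1"
  proof
    assume *: "(2::'a) \<in> PP 1"
    let ?Q = "\<lambda>p. 0 < p \<and> of_nat p \<in> PP 1"
    have Q2: "?Q 2" using * by simp
    have "?Q (LEAST p. ?Q p)" "(LEAST p. ?Q p) \<le> 2"
      using LeastI[of ?Q, OF Q2] Least_le[of ?Q, OF Q2] by auto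
    moreover have "\<not> ?Q 1" by (simp add: PP_iff)
    ultimately have "(LEAST p. ?Q p) = 2"
      by (metis One_nat_def Suc_leI le_antisym not_less_eq_eq numeral_2_eq_2)
    then show False using odd_char by (simp add: residue_char_def)
  qed
  moreover have "(2::'a) \<in> \<O>" using PP_add[of 1 0 1] by simp
  ultimately show "(2::'a) \<noteq> 0" "v 2 = 0" using unit_iff[of 2] by auto
qed

lemma finite_quot_residue: "finite (quot \<O> (PP 1))"
  by (rule finite_residue_field)

lemma quot_PP: "i \<le> j \<Longrightarrow> card (quot (PP i) (PP j)) = q ^ nat (j - i) \<and> finite (quot (PP i) (PP j))"
proof -
  have "card (quot (PP i) (PP (i + int k))) = q ^ k \<and> finite (quot (PP i) (PP (i + int k)))" for k
  proof (induction k)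
    case 0
    have "quot (PP i) (PP i) = {PP i}"
    proof -
      have "coset (PP i) x = coset (PP i) 0" if "x \<in> PP i" for x
        using that by (simp add: coset_eq_iff)
      moreover have "coset (PP i) 0 = PP i" by (auto simp: mem_coset)
      ultimately show ?thesis unfolding quot_def by (auto simp: image_iff intro!: exI[of _ 0])
    qed
    then show ?case by simp
  next
    case (Suc k)
    \<comment> \<open>Multiplication by an element of valuation i + k identifies the residue field
      with the next graded piece of the filtration by fractional ideals.\<close>
    define c where "c = \<pi> powi (i + int k)"
    have c: "c \<noteq> 0" "v c = i + int k" by (simp_all add: c_def v_powi)
    have "card (quot \<O> (PP 1)) = card (quot (PP (i + int k)) (PP (i + int (Suc k))))"
      "finite (quot \<O> (PP 1)) = finite (quot (PP (i + int k)) (PP (i + int (Suc k))))"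
    proof -
      have 1: "c * x \<in> PP (i + int k)" if "x \<in> \<O>" for x
        using that by (simp add: PP_mult_cancel c)
      have 2: "\<exists>x\<in>\<O>. c * x - y \<in> PP (i + int (Suc k))" if "y \<in> PP (i + int k)" for y
        using that c by (intro bexI[of _ "y / c"]) (auto simp: PP_divide_iff)
      have 3: "c * x - c * y \<in> PP (i + int (Suc k)) \<longleftrightarrow> x - y \<in> PP 1" for x y
        using PP_mult_cancel[OF c(1), of "x - y"] by (simp add: c algebra_simps)
      show "card (quot \<O> (PP 1)) = card (quot (PP (i + int k)) (PP (i + int (Suc k))))"
        "finite (quot \<O> (PP 1)) = finite (quot (PP (i + int k)) (PP (i + int (Suc k))))"
        using quot_card_cong[of "PP 1" "PP (i + int (Suc k))" \<O> "\<lambda>x. c * x" "PP (i + int k)"]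
          1 2 3 by auto
    qed
    then have *: "card (quot (PP (i + int k)) (PP (i + int (Suc k)))) = q"
      "finite (quot (PP (i + int k)) (PP (i + int (Suc k))))"
      using finite_quot_residue by (simp_all add: residue_card_def)
    have sub: "PP (i + int (Suc k)) \<subseteq> PP (i + int k)"
      using PP_mono[of "i + int k" "i + int (Suc k)"] by auto
    show ?case
      using quot_tower[of "PP (i + int (Suc k))" "PP (i + int k)" "PP i"] * Suc
        PP_add PP_mono[of i "i + int k"] sub by (auto simp del: of_nat_Suc)
  qed
  from this[of "nat (j - i)"] show "i \<le> j \<Longrightarrow> ?thesis" by simp
qed

lemma q_gt_1: "q > 1"
proof -
  have "{coset (PP 1) 0, coset (PP 1) 1} \<subseteq> quot \<O> (PP 1)" by (auto simp: quot_def)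
  moreover have "coset (PP 1) 0 \<noteq> coset (PP 1) 1" by (simp add: coset_eq_iff PP_iff)
  ultimately show ?thesis unfolding residue_card_def
    by (metis One_nat_def Suc_le_lessD card_2_iff card_mono finite_quot_residue numeral_2_eq_2)
qed

end

section \<open>The quadratic character of the residue field\<close>

context odd_local_field
begin

lemma O_cases: "x \<in> \<O> \<Longrightarrow> (x \<in> PP 1 \<Longrightarrow> Q) \<Longrightarrow> (x \<noteq> 0 \<Longrightarrow> v x = 0 \<Longrightarrow> Q) \<Longrightarrow> Q"
  using unit_iff by blast

lemma P1_subset_O: "x \<in> PP 1 \<Longrightarrow> x \<in> \<O>"
  using PP_mono[of 0 1] by simp

lemma unit_O: "x \<noteq> 0 \<Longrightarrow> v x = 0 \<Longrightarrow> x \<in> \<O>"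
  by (simp add: PP_iff)

lemma unit_not_P1: "x \<noteq> 0 \<Longrightarrow> v x = 0 \<Longrightarrow> x \<notin> PP 1"
  by (simp add: PP_iff)

lemma unit_mult_PP: "c \<noteq> 0 \<Longrightarrow> v c = 0 \<Longrightarrow> c * x \<in> PP N \<longleftrightarrow> x \<in> PP N"
  by (simp add: PP_mult_cancel)

lemma unit_divide_PP: "c \<noteq> 0 \<Longrightarrow> v c = 0 \<Longrightarrow> x / c \<in> PP N \<longleftrightarrow> x \<in> PP N"
  by (simp add: PP_divide_iff)

lemma P1_prime: "x \<in> \<O> \<Longrightarrow> y \<in> \<O> \<Longrightarrow> x * y \<in> PP 1 \<longleftrightarrow> x \<in> PP 1 \<or> y \<in> PP 1"
  by (cases "x = 0 \<or> y = 0") (auto simp: PP_iff val_mult)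

lemma P1_power: "x \<in> \<O> \<Longrightarrow> x\<^sup>2 \<in> PP 1 \<longleftrightarrow> x \<in> PP 1"
  by (simp add: power2_eq_square P1_prime)

lemma PP_mult_diff:
  assumes "x - x' \<in> PP N" "y - y' \<in> PP N" "x' \<in> \<O>" "y \<in> \<O>"
  shows "x * y - x' * y' \<in> PP N"
proof -
  have "x * y - x' * y' = (x - x') * y + x' * (y - y')" by (simp add: algebra_simps)
  then show ?thesis using assms by (simp add: PP_add PP_mult_O PP_mult_O')
qed

lemma cong_O: "x - y \<in> PP 1 \<Longrightarrow> x \<in> \<O> \<longleftrightarrow> y \<in> \<O>"
  using PP_diff_cong[of x y 0 0] P1_subset_O[of "x - y"] by simp

lemma cong_P1: "x - y \<in> PP 1 \<Longrightarrow> x \<in> PP 1 \<longleftrightarrow> y \<in> PP 1"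
  using PP_diff_cong[of x y 1 0] by simp

lemma cong_unit: "x - y \<in> PP 1 \<Longrightarrow> y \<noteq> 0 \<Longrightarrow> v y = 0 \<Longrightarrow> x \<noteq> 0 \<and> v x = 0"
  using cong_O[of x y] cong_P1[of x y] unit_iff by blast

text \<open>The quadratic character of the residue field, extended by zero. The case distinction is
  essential, as \<open>quad_symbol\<close> takes nonzero values at nonunits of even
  valuation.\<close>

definition \<chi> :: "'a \<Rightarrow> int" where "\<chi> x = (if x \<in> PP 1 then 0 else quad_symbol v x)"

lemma quad_symbol_unit:
  assumes "x \<noteq> 0" "v x = 0"
  shows "quad_symbol v x = (if \<exists>c. x - c\<^sup>2 \<in> PP 1 then 1 else - 1)"
  using assms by (simp add: quad_symbol_def)

lemma chi_unit:
  assumes "x \<noteq> 0" "v x = 0"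
  shows "\<chi> x = (if \<exists>c. x - c\<^sup>2 \<in> PP 1 then 1 else - 1)"
  using assms by (simp add: \<chi>_def unit_not_P1 quad_symbol_unit)

lemma chi_P1: "x \<in> PP 1 \<Longrightarrow> \<chi> x = 0"
  by (simp add: \<chi>_def)

lemma chi_unit_values: "x \<noteq> 0 \<Longrightarrow> v x = 0 \<Longrightarrow> \<chi> x = 1 \<or> \<chi> x = - 1"
  by (simp add: chi_unit)

lemma chi_cong:
  assumes "x - y \<in> PP 1" "x \<in> \<O>"
  shows "\<chi> x = \<chi> y"
proof (cases rule: O_cases[OF assms(2)])
  case 1
  then show ?thesis using cong_P1[OF assms(1)] by (simp add: chi_P1)
next
  case 2
  then have y: "y \<noteq> 0 \<and> v y = 0"
    using cong_unit[of y x] assms(1) subgrp_diff_swap[of "PP 1" x y] by simp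
  have "x - c\<^sup>2 \<in> PP 1 \<longleftrightarrow> y - c\<^sup>2 \<in> PP 1" for c
    by (rule PP_diff_cong[OF assms(1)])
  then show ?thesis using 2 y by (simp add: chi_unit)
qed

lemma sqrt_unit:
  assumes "x \<noteq> 0" "v x = 0" "x - c\<^sup>2 \<in> PP 1"
  shows "c \<noteq> 0 \<and> v c = 0"
proof -
  have "c\<^sup>2 \<noteq> 0 \<and> v (c\<^sup>2) = 0"
    using cong_unit[of "c\<^sup>2" x] assms subgrp_diff_swap[of "PP 1" x "c\<^sup>2"] by simp
  then show ?thesis by (auto simp: v_power)
qed

lemma chi_square_mult:
  assumes "c \<noteq> 0" "v c = 0" "x \<in> \<O>"
  shows "\<chi> (c\<^sup>2 * x) = \<chi> x"
proof (cases rule: O_cases[OF assms(3)])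
  case 1
  then show ?thesis using assms by (simp add: chi_P1 unit_mult_PP v_power)
next
  case 2
  have "(\<exists>d. c\<^sup>2 * x - d\<^sup>2 \<in> PP 1) \<longleftrightarrow> (\<exists>d. x - d\<^sup>2 \<in> PP 1)"
  proof
    assume "\<exists>d. c\<^sup>2 * x - d\<^sup>2 \<in> PP 1"
    then obtain d where "c\<^sup>2 * x - d\<^sup>2 \<in> PP 1" ..
    moreover have "c\<^sup>2 * x - d\<^sup>2 = c\<^sup>2 * (x - (d / c)\<^sup>2)" using assms by (simp add: field_simps)
    ultimately have "x - (d / c)\<^sup>2 \<in> PP 1" using assms unit_mult_PP[of "c\<^sup>2"] by (simp add: v_power)
    then show "\<exists>d. x - d\<^sup>2 \<in> PP 1" ..
  next
    assume "\<exists>d. x - d\<^sup>2 \<in> PP 1"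
    then obtain d where "x - d\<^sup>2 \<in> PP 1" ..
    then have "c\<^sup>2 * (x - d\<^sup>2) \<in> PP 1" using assms unit_mult_PP[of "c\<^sup>2"] by (simp add: v_power)
    then show "\<exists>d. c\<^sup>2 * x - d\<^sup>2 \<in> PP 1"
      by (intro exI[of _ "c * d"]) (simp add: power_mult_distrib algebra_simps)
  qed
  then show ?thesis using 2 assms by (simp add: chi_unit val_mult v_power)
qed

lemma chi_one [simp]: "\<chi> 1 = 1"
proof -
  have "1 - 1\<^sup>2 \<in> PP 1" by simp
  then have "\<exists>c. 1 - c\<^sup>2 \<in> PP 1" by blast
  then show ?thesis by (simp add: chi_unit)
qed

definition Rs :: "'a set" where
  "Rs = (SOME R. R \<subseteq> \<O> \<and> (\<forall>z\<in>\<O>. \<exists>!r. r \<in> R \<and> z - r \<in> PP 1) \<and> card R = q \<and> finite R)"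

lemma Rs: "Rs \<subseteq> \<O>" "z \<in> \<O> \<Longrightarrow> \<exists>!r. r \<in> Rs \<and> z - r \<in> PP 1" "card Rs = q" "finite Rs"
proof -
  have "\<exists>R. R \<subseteq> \<O> \<and> (\<forall>z\<in>\<O>. \<exists>!r. r \<in> R \<and> z - r \<in> PP 1) \<and> card R = q \<and> finite R"
    using reps_exist[of "PP 1" \<O>] finite_quot_residue by (auto simp: residue_card_def)
  from someI_ex[OF this] show "Rs \<subseteq> \<O>" "z \<in> \<O> \<Longrightarrow> \<exists>!r. r \<in> Rs \<and> z - r \<in> PP 1"
    "card Rs = q" "finite Rs" unfolding Rs_def by blast+
qed

lemma Rs_O: "x \<in> Rs \<Longrightarrow> x \<in> \<O>" using Rs(1) by blast

lemma Rs_eq: "x \<in> Rs \<Longrightarrow> y \<in> Rs \<Longrightarrow> x - y \<in> PP 1 \<Longrightarrow> x = y"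
  using Rs(2)[of x] Rs(1) by (metis PP_zero diff_self subsetD)

definition \<rho> :: "'a \<Rightarrow> 'a" where "\<rho> z = (THE r. r \<in> Rs \<and> z - r \<in> PP 1)"

lemma rho: assumes "z \<in> \<O>" shows "\<rho> z \<in> Rs" "z - \<rho> z \<in> PP 1"
  using theI'[OF Rs(2)[OF assms]] by (auto simp: \<rho>_def)

lemma rho_eq_iff: "z \<in> \<O> \<Longrightarrow> r \<in> Rs \<Longrightarrow> \<rho> z = r \<longleftrightarrow> z - r \<in> PP 1"
  using Rs(2) rho by blast

text \<open>An injective self-map of the finite residue field is a permutation, and a function of
  residue classes does not see which representatives are used.\<close>

lemma sum_Rs_reparam:
  fixes f :: "'a \<Rightarrow> 'c::comm_monoid_add"
  assumes f: "\<And>x y. x \<in> \<O> \<Longrightarrow> y \<in> \<O> \<Longrightarrow> x - y \<in> PP 1 \<Longrightarrow> f x = f y"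
    and h: "\<And>x. x \<in> Rs \<Longrightarrow> h x \<in> \<O>"
    and inj: "\<And>x y. x \<in> Rs \<Longrightarrow> y \<in> Rs \<Longrightarrow> h x - h y \<in> PP 1 \<Longrightarrow> x - y \<in> PP 1"
  shows "(\<Sum>r\<in>Rs. f (h r)) = (\<Sum>r\<in>Rs. f r)"
proof -
  have inj': "inj_on (\<lambda>r. \<rho> (h r)) Rs"
  proof (rule inj_onI)
    fix x y assume xy: "x \<in> Rs" "y \<in> Rs" "\<rho> (h x) = \<rho> (h y)"
    have "(h x - \<rho> (h x)) - (h y - \<rho> (h y)) \<in> PP 1" using PP_diff rho(2) h xy by meson
    then show "x = y" using xy inj[of x y] Rs_eq[of x y] by simp
  qed
  have "(\<lambda>r. \<rho> (h r)) ` Rs \<subseteq> Rs" using h rho by blast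
  then have "bij_betw (\<lambda>r. \<rho> (h r)) Rs Rs"
    using inj' Rs(4) by (simp add: bij_betw_def endo_inj_surj)
  then have "(\<Sum>r\<in>Rs. f (\<rho> (h r))) = (\<Sum>r\<in>Rs. f r)" by (rule sum.reindex_bij_betw)
  moreover have "f (h r) = f (\<rho> (h r))" if "r \<in> Rs" for r
    using that h rho f Rs_O by meson
  ultimately show ?thesis by simp
qed

lemma sum_Rs_affine:
  fixes f :: "'a \<Rightarrow> 'c::comm_monoid_add"
  assumes f: "\<And>x y. x \<in> \<O> \<Longrightarrow> y \<in> \<O> \<Longrightarrow> x - y \<in> PP 1 \<Longrightarrow> f x = f y"
    and "a \<noteq> 0" "v a = 0" "b \<in> \<O>"
  shows "(\<Sum>r\<in>Rs. f (a * r + b)) = (\<Sum>r\<in>Rs. f r)"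
proof (rule sum_Rs_reparam[OF f])
  show "a * x + b \<in> \<O>" if "x \<in> Rs" for x
    using that assms PP_add[OF O_mult[OF unit_O[of a] Rs_O]] by simp
  show "x - y \<in> PP 1" if "a * x + b - (a * y + b) \<in> PP 1" for x y
  proof -
    have "a * (x - y) \<in> PP 1" using that by (simp add: algebra_simps)
    then show ?thesis using assms unit_mult_PP by blast
  qed
qed auto

section \<open>Square roots in the residue field and sums of the quadratic character\<close>

lemma card_square_roots:
  assumes "a \<in> \<O>"
  shows "int (card {x\<in>Rs. x\<^sup>2 - a \<in> PP 1}) = 1 + \<chi> a"
proof (cases rule: O_cases[OF assms])
  case 1
  have "x\<^sup>2 - a \<in> PP 1 \<longleftrightarrow> x = \<rho> 0" if "x \<in> Rs" for x
  proof -
    have "x\<^sup>2 - a \<in> PP 1 \<longleftrightarrow> x\<^sup>2 \<in> PP 1" using PP_add_iff[of "- a" 1 "x\<^sup>2"] 1 by simp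
    also have "\<dots> \<longleftrightarrow> x \<in> PP 1" using P1_power Rs_O that by blast
    also have "\<dots> \<longleftrightarrow> x = \<rho> 0" using rho_eq_iff[of 0 x] that by auto
    finally show ?thesis .
  qed
  then have "{x\<in>Rs. x\<^sup>2 - a \<in> PP 1} = {\<rho> 0}" using rho(1)[of 0] by auto
  then show ?thesis using 1 by (simp add: chi_P1)
next
  case 2
  show ?thesis
  proof (cases "\<exists>c. a - c\<^sup>2 \<in> PP 1")
    case True
    then obtain c where c: "a - c\<^sup>2 \<in> PP 1" ..
    then have cu: "c \<noteq> 0" "v c = 0" using sqrt_unit 2 by blast+
    then have cO: "c \<in> \<O>" "- c \<in> \<O>" by (simp_all add: unit_O)
    have "x\<^sup>2 - a \<in> PP 1 \<longleftrightarrow> x = \<rho> c \<or> x = \<rho> (- c)" if "x \<in> Rs" for x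
    proof -
      have xO: "x \<in> \<O>" using that Rs_O by blast
      have "x\<^sup>2 - a \<in> PP 1 \<longleftrightarrow> x\<^sup>2 - c\<^sup>2 \<in> PP 1"
        using PP_diff_cong[OF c, of "x\<^sup>2"] subgrp_diff_swap[OF subgrp_PP] by blast
      also have "x\<^sup>2 - c\<^sup>2 = (x - c) * (x + c)" by (simp add: power2_eq_square algebra_simps)
      also have "\<dots> \<in> PP 1 \<longleftrightarrow> x - c \<in> PP 1 \<or> x + c \<in> PP 1"
        using P1_prime[OF PP_diff[OF xO cO(1)] PP_add[OF xO cO(1)]] .
      also have "x - c \<in> PP 1 \<longleftrightarrow> x = \<rho> c"
        using rho_eq_iff[OF cO(1) that] subgrp_diff_swap[of "PP 1" x c] by auto
      also have "x + c \<in> PP 1 \<longleftrightarrow> x = \<rho> (- c)"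
        using rho_eq_iff[OF cO(2) that] PP_uminus[of "x + c"] by (auto simp: algebra_simps)
      finally show ?thesis .
    qed
    then have "{x\<in>Rs. x\<^sup>2 - a \<in> PP 1} = {\<rho> c, \<rho> (- c)}" using rho(1) cO by auto
    \<comment> \<open>The two roots stay distinct because 2 is a unit.\<close>
    moreover have "\<rho> c \<noteq> \<rho> (- c)"
    proof
      assume *: "\<rho> c = \<rho> (- c)"
      have "(c - \<rho> c) - (- c - \<rho> (- c)) \<in> PP 1" by (intro PP_diff rho cO)
      then have "2 * c \<in> PP 1" using * by simp
      then show False using cu by (simp add: PP_iff val_mult)
    qed
    ultimately show ?thesis using 2 True by (simp add: chi_unit)
  next
    case False
    then have "{x\<in>Rs. x\<^sup>2 - a \<in> PP 1} = {}"
      using subgrp_diff_swap[OF subgrp_PP] by blast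
    then have "card {x\<in>Rs. x\<^sup>2 - a \<in> PP 1} = 0" by (simp only: card.empty)
    then show ?thesis using 2 False by (simp add: chi_unit)
  qed
qed

text \<open>The terms are grouped by the class \<open>u\<close> of the square, which has
  \<open>1 + \<chi> u\<close> square roots.\<close>

lemma sum_over_squares:
  fixes F :: "'a \<Rightarrow> int"
  assumes F: "\<And>x y. x \<in> \<O> \<Longrightarrow> y \<in> \<O> \<Longrightarrow> x - y \<in> PP 1 \<Longrightarrow> F x = F y"
  shows "(\<Sum>x\<in>Rs. F (x\<^sup>2)) = (\<Sum>u\<in>Rs. (1 + \<chi> u) * F u)"
proof -
  have sq: "x\<^sup>2 \<in> \<O>" if "x \<in> Rs" for x using that by (intro O_power Rs_O)
  have "(\<Sum>x\<in>Rs. F (x\<^sup>2)) = (\<Sum>x\<in>Rs. F (\<rho> (x\<^sup>2)))"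
    by (rule sum.cong) (use F sq rho Rs_O in blast)+
  also have "\<dots> = (\<Sum>u\<in>Rs. \<Sum>x\<in>{x\<in>Rs. \<rho> (x\<^sup>2) = u}. F (\<rho> (x\<^sup>2)))"
    by (rule sum.group[symmetric]) (use Rs rho sq in auto)
  also have "\<dots> = (\<Sum>u\<in>Rs. \<Sum>x\<in>{x\<in>Rs. x\<^sup>2 - u \<in> PP 1}. F u)"
    by (intro sum.cong) (use rho_eq_iff sq in auto)
  also have "\<dots> = (\<Sum>u\<in>Rs. (1 + \<chi> u) * F u)"
    by (rule sum.cong) (simp_all add: card_square_roots Rs_O)
  finally show ?thesis .
qed

lemma sum_chi: "(\<Sum>u\<in>Rs. \<chi> u) = 0"
proof -
  \<comment> \<open>For the constant function 1 the grouping by squares reads q = q + (sum of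
    \<open>\<chi>\<close>).\<close>
  have "(\<Sum>x\<in>Rs. (1::int)) = (\<Sum>u\<in>Rs. (1 + \<chi> u) * 1)"
    using sum_over_squares[of "\<lambda>_. 1"] by simp
  then show ?thesis by (simp add: sum.distrib)
qed

lemma sum_chi_affine: "a \<noteq> 0 \<Longrightarrow> v a = 0 \<Longrightarrow> b \<in> \<O> \<Longrightarrow> (\<Sum>u\<in>Rs. \<chi> (a * u + b)) = 0"
  using sum_Rs_affine[of \<chi> a b] chi_cong sum_chi by simp

text \<open>Without nonsquare units \<open>\<chi>\<close> would be nonnegative with the positive
  value 1 at 1, so it could not sum to zero.\<close>

lemma exists_nonsquare: "\<exists>u. u \<noteq> 0 \<and> v u = 0 \<and> \<chi> u = - 1"
proof (rule ccontr)
  assume none: "\<not> ?thesis"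
  have nn: "\<chi> u \<ge> 0" if "u \<in> Rs" for u
    using that
  proof (cases rule: O_cases[OF Rs_O[OF that]])
    case 1
    then show ?thesis by (simp add: chi_P1)
  next
    case 2
    then show ?thesis using none chi_unit_values[of u] by auto
  qed
  have "\<chi> (\<rho> 1) = 1" using chi_cong[OF rho(2)[of 1]] by simp
  moreover have "\<chi> (\<rho> 1) \<le> (\<Sum>u\<in>Rs. \<chi> u)"
    by (rule member_le_sum) (use Rs rho nn in auto)
  ultimately show False using sum_chi by simp
qed

text \<open>For nonsquare units \<open>x\<close> and \<open>y\<close>: as \<open>\<chi>\<close> sums to zero, multiplication by \<open>x\<close> must turn all
  nonsquares into squares, since it turns the equally many squares into nonsquares.\<close>

lemma chi_mult:
  assumes "x \<in> \<O>" "y \<in> \<O>"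
  shows "\<chi> (x * y) = \<chi> x * \<chi> y"
proof -
  have sq: "\<chi> (x * y) = \<chi> y" if x: "x \<noteq> 0" "v x = 0" "\<chi> x = 1" and y: "y \<in> \<O>" for x y
  proof -
    obtain c where c: "x - c\<^sup>2 \<in> PP 1" using x by (metis chi_unit one_neq_neg_one)
    then have cu: "c \<noteq> 0" "v c = 0" using sqrt_unit x by blast+
    have "x * y - c\<^sup>2 * y \<in> PP 1" using PP_mult_O'[OF c y] by (simp add: algebra_simps)
    then have "\<chi> (x * y) = \<chi> (c\<^sup>2 * y)" by (rule chi_cong) (intro O_mult unit_O x y)
    then show ?thesis using chi_square_mult cu y by simp
  qed
  consider "x \<in> PP 1 \<or> y \<in> PP 1" | "x \<noteq> 0" "v x = 0" "\<chi> x = 1" | "y \<noteq> 0" "v y = 0" "\<chi> y = 1"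
    | "x \<noteq> 0" "v x = 0" "\<chi> x = - 1" "y \<noteq> 0" "v y = 0" "\<chi> y = - 1"
    using assms chi_unit_values by (metis O_cases)
  then show ?thesis
  proof cases
    case 1
    then show ?thesis using assms P1_prime by (auto simp: chi_P1)
  next
    case 2
    then show ?thesis using sq assms by simp
  next
    case 3
    then show ?thesis using sq[of y x] assms by (simp add: mult.commute)
  next
    case 4
    have sum0: "(\<Sum>u\<in>Rs. \<chi> (x * u) + \<chi> u) = 0"
      using sum_chi_affine[of x 0] 4 sum_chi by (simp add: sum.distrib)
    have nn: "\<chi> (x * u) + \<chi> u \<le> 0" if "u \<in> Rs" for u
    proof (cases rule: O_cases[OF Rs_O[OF that]])
      case 1
      then show ?thesis using assms PP_mult_O by (simp add: chi_P1)
    next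
      case 2
      have xu: "x * u \<noteq> 0 \<and> v (x * u) = 0" using 2 4 by (simp add: val_mult)
      then show ?thesis
        using sq[of u x] chi_unit_values[of u] chi_unit_values[of "x * u"] 2 4 assms
        by (auto simp: mult.commute)
    qed
    have "\<chi> (x * u) + \<chi> u = 0" if "u \<in> Rs" for u
    proof -
      have "(\<Sum>u\<in>Rs. - (\<chi> (x * u) + \<chi> u)) = 0"
        using sum0 by (simp only: sum_negf minus_zero)
      then have "\<forall>u\<in>Rs. - (\<chi> (x * u) + \<chi> u) = 0"
        using nn sum_nonneg_eq_0_iff[OF Rs(4), of "\<lambda>u. - (\<chi> (x * u) + \<chi> u)"] by force
      then have "- (\<chi> (x * u) + \<chi> u) = 0" using that by (rule bspec)
      then show ?thesis by simp
    qed
    then have "\<chi> (x * \<rho> y) + \<chi> (\<rho> y) = 0" using rho assms by blast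
    moreover have "\<chi> y = \<chi> (\<rho> y)" using chi_cong rho assms by blast
    moreover have "\<chi> (x * y) = \<chi> (x * \<rho> y)"
    proof (rule chi_cong)
      show "x * y - x * \<rho> y \<in> PP 1"
        using PP_mult_O[OF assms(1) rho(2)[OF assms(2)]] by (simp add: algebra_simps)
    qed (intro O_mult assms)
    ultimately have "\<chi> (x * y) = 1" using 4 by linarith
    then show ?thesis using 4 by simp
  qed
qed

text \<open>For a nonunit \<open>a\<close> only the class of x = 0 gives zero, and all others give
  \<open>\<chi> (- g)\<close>. For a unit \<open>a\<close>, sum over u = x^2 with multiplicity
  \<open>1 + \<chi> u\<close>. The part without \<open>\<chi> u\<close> is a complete linear sum; in
  the other part u (a - g u) equals a/u - g up to the square u^2, and u -> 1/u turns it into a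
  linear sum that misses its value at 0.\<close>

lemma chi_sum_quadratic:
  assumes "a \<in> \<O>" "g \<noteq> 0" "v g = 0"
  shows "(\<Sum>x\<in>Rs. \<chi> (a - g * x\<^sup>2)) = (if a \<in> PP 1 then (int q - 1) * \<chi> (- g) else - \<chi> (- g))"
proof (cases rule: O_cases[OF assms(1)])
  case 1
  have "\<chi> (a - g * x\<^sup>2) = \<chi> (- g) - (if x = \<rho> 0 then \<chi> (- g) else 0)" if "x \<in> Rs" for x
  proof -
    have xO: "x \<in> \<O>" "x\<^sup>2 \<in> \<O>" using that by (simp_all add: O_power Rs_O)+
    have gO: "g \<in> \<O>" "- g \<in> \<O>" using assms by (simp_all add: unit_O)
    have "\<chi> (a - g * x\<^sup>2) = \<chi> (- g * x\<^sup>2)"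
      by (rule chi_cong) (use 1 xO gO assms PP_diff O_mult in auto)
    also have "\<dots> = \<chi> (- g) * \<chi> (x\<^sup>2)" using chi_mult gO xO by blast
    also have "\<chi> (x\<^sup>2) = (if x = \<rho> 0 then 0 else 1)"
    proof (cases "x \<in> PP 1")
      case True
      then show ?thesis using that P1_power[OF xO(1)] rho_eq_iff[of 0 x] by (simp add: chi_P1)
    next
      case False
      then show ?thesis using that chi_square_mult[of x 1] rho_eq_iff[of 0 x] xO unit_iff[of x] by auto
    qed
    finally show ?thesis by simp
  qed
  then have "(\<Sum>x\<in>Rs. \<chi> (a - g * x\<^sup>2)) =
      (\<Sum>x\<in>Rs. \<chi> (- g)) - (\<Sum>x\<in>Rs. if x = \<rho> 0 then \<chi> (- g) else 0)"
    by (simp add: sum_subtractf)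
  also have "\<dots> = (int q - 1) * \<chi> (- g)"
    using Rs rho(1)[of 0] by (simp add: algebra_simps)
  finally show ?thesis using 1 by simp
next
  case 2
  have gO: "g \<in> \<O>" "- g \<in> \<O>" using assms by (simp_all add: unit_O)
  have per: "\<chi> (a - g * x) = \<chi> (a - g * y)" if "x \<in> \<O>" "y \<in> \<O>" "x - y \<in> PP 1" for x y
  proof (rule chi_cong)
    have "- g * (x - y) \<in> PP 1" using that gO PP_mult_O by blast
    then show "a - g * x - (a - g * y) \<in> PP 1" by (simp add: algebra_simps)
  qed (intro PP_diff O_mult that gO assms)
  \<comment> \<open>Inversion of residue classes, sending the zero class to itself so that it is a
    permutation.\<close>
  define h where "h u = (if u \<in> PP 1 then 0 else inverse u)" for u :: 'a
  have hO: "h u \<in> \<O>" if "u \<in> \<O>" for u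
    using that unit_iff[of u] by (auto simp: h_def PP_iff v_inverse)
  have hinj: "x - y \<in> PP 1" if xy: "x \<in> Rs" "y \<in> Rs" and hd: "h x - h y \<in> PP 1" for x y
  proof -
    have xyO: "x \<in> \<O>" "y \<in> \<O>" using xy Rs_O by auto
    have hP: "h x \<in> PP 1 \<longleftrightarrow> x \<in> PP 1" "h y \<in> PP 1 \<longleftrightarrow> y \<in> PP 1"
      using unit_iff[of x] unit_iff[of y] xyO by (auto simp: h_def PP_iff v_inverse)
    show ?thesis
    proof (cases "x \<in> PP 1")
      case True
      then show ?thesis using hP cong_P1[OF hd] PP_diff[of x 1 y] by blast
    next
      case False
      then have y: "y \<notin> PP 1" using hP cong_P1[OF hd] by blast
      have nz: "x \<noteq> 0" "y \<noteq> 0" using False y by auto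
      have "- (x * y) * (inverse x - inverse y) \<in> PP 1"
        using hd False y xyO O_mult PP_mult_O PP_uminus by (auto simp: h_def)
      moreover have "- (x * y) * (inverse x - inverse y) = x - y"
        using nz by (simp add: field_simps)
      ultimately show ?thesis by metis
    qed
  qed
  have summand: "\<chi> u * \<chi> (a - g * u) = \<chi> (a * h u + - g) - (if u = \<rho> 0 then \<chi> (- g) else 0)"
    if u: "u \<in> Rs" for u
  proof (cases rule: O_cases[OF Rs_O[OF u]])
    case 1
    then show ?thesis using rho_eq_iff[of 0 u] u by (simp add: chi_P1 h_def)
  next
    case u2: 2
    then have uP: "u \<notin> PP 1" by (simp add: unit_not_P1)
    have uO: "u \<in> \<O>" using u by (rule Rs_O)
    then have uO': "a - g * u \<in> \<O>" by (intro PP_diff O_mult assms gO)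
    have "\<chi> u * \<chi> (a - g * u) = \<chi> (u * (a - g * u))" using chi_mult uO uO' by simp
    also have "u * (a - g * u) = u\<^sup>2 * (a * h u + - g)"
      using uP u2 by (simp add: h_def field_simps power2_eq_square)
    also have "\<chi> \<dots> = \<chi> (a * h u + - g)"
      by (rule chi_square_mult) (intro u2 PP_add O_mult hO uO gO assms)+
    finally show ?thesis using rho_eq_iff[of 0 u] u uP by auto
  qed
  have "(\<Sum>x\<in>Rs. \<chi> (a - g * x\<^sup>2)) = (\<Sum>u\<in>Rs. (1 + \<chi> u) * \<chi> (a - g * u))"
    by (rule sum_over_squares[of "\<lambda>u. \<chi> (a - g * u)"]) (rule per)
  also have "\<dots> = (\<Sum>u\<in>Rs. \<chi> (- g * u + a)) + (\<Sum>u\<in>Rs. \<chi> u * \<chi> (a - g * u))"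
    by (simp add: algebra_simps sum.distrib)
  also have "(\<Sum>u\<in>Rs. \<chi> (- g * u + a)) = 0"
    by (rule sum_chi_affine) (use assms in auto)
  also have "(\<Sum>u\<in>Rs. \<chi> u * \<chi> (a - g * u)) =
      (\<Sum>u\<in>Rs. \<chi> (a * h u + - g)) - (\<Sum>u\<in>Rs. if u = \<rho> 0 then \<chi> (- g) else 0)"
    by (simp add: summand sum_subtractf)
  also have "(\<Sum>u\<in>Rs. \<chi> (a * h u + - g)) = (\<Sum>u\<in>Rs. \<chi> (a * u + - g))"
  proof (rule sum_Rs_reparam[of "\<lambda>w. \<chi> (a * w + - g)" h])
    show "\<chi> (a * x + - g) = \<chi> (a * y + - g)" if "x \<in> \<O>" "y \<in> \<O>" "x - y \<in> PP 1" for x y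
    proof (rule chi_cong)
      have "a * (x - y) \<in> PP 1" using that assms PP_mult_O by blast
      then show "a * x + - g - (a * y + - g) \<in> PP 1" by (simp add: algebra_simps)
    qed (intro PP_add O_mult that gO assms)
  qed (use hO hinj Rs_O in auto)
  also have "\<dots> = 0" by (rule sum_chi_affine) (use gO 2 in auto)
  also have "(\<Sum>u\<in>Rs. if u = \<rho> 0 then \<chi> (- g) else 0) = \<chi> (- g)"
    using Rs rho(1)[of 0] by simp
  finally show ?thesis using 2 by (simp add: unit_not_P1)
qed

section \<open>Zeros of diagonal quadratic forms over the residue field\<close>

definition diag_zeros :: "(nat \<Rightarrow> 'a) \<Rightarrow> nat \<Rightarrow> 'a \<Rightarrow> nat" where
  "diag_zeros g m a = card (quot {x \<in> Tup m \<O>. (\<Sum>i<m. g i * (x i)\<^sup>2) - a \<in> PP 1} (Tup m (PP 1)))"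

lemma finite_quot_Tup: "i \<le> j \<Longrightarrow> finite (quot (Tup m (PP i)) (Tup m (PP j)))"
  using card_quot_TupI[of m "\<lambda>_. PP j" "\<lambda>_. PP i"] quot_PP by auto

lemma diag_zeros_0: "diag_zeros g 0 a = (if a \<in> PP 1 then 1 else 0)"
  by (auto simp: diag_zeros_def TupI_0 quot_def)

lemma diag_zeros_Suc:
  assumes g: "\<And>i. i < Suc m \<Longrightarrow> g i \<in> \<O>"
  shows "diag_zeros g (Suc m) a = (\<Sum>r\<in>Rs. diag_zeros g m (a - g m * r\<^sup>2))"
proof -
  define X where "X = {x \<in> Tup (Suc m) \<O>. (\<Sum>i<Suc m. g i * (x i)\<^sup>2) - a \<in> PP 1}"
  define K where "K n = Tup n (PP 1)" for n
  have sK: "subgrp (K n)" for n by (simp add: K_def subgrp_TupI)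
  define Y where "Y r = {x \<in> Tup m \<O>. (\<Sum>i<m. g i * (x i)\<^sup>2) - (a - g m * r\<^sup>2) \<in> PP 1}" for r
  have fin: "finite (quot (Tup n \<O>) (K n))" for n
    unfolding K_def by (rule finite_quot_Tup) simp
  have XF: "{x\<in>X. x m - r \<in> PP 1} \<subseteq> Tup (Suc m) \<O>" for r by (auto simp: X_def)
  have fib: "card (quot {x\<in>X. x m - r \<in> PP 1} (K (Suc m))) = card (quot (Y r) (K m))"
    if r: "r \<in> Rs" for r
  proof -
    have rO: "r \<in> \<O>" using r Rs_O by blast
    have key: "(\<Sum>i<m. g i * (x i)\<^sup>2) - (a - g m * r\<^sup>2) \<in> PP 1 \<longleftrightarrow>
        (\<Sum>i<Suc m. g i * (x i)\<^sup>2) - a \<in> PP 1" if "x m - r \<in> PP 1" "x m \<in> \<O>" for x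
    proof -
      have "(x m)\<^sup>2 - r\<^sup>2 \<in> PP 1" unfolding power2_eq_square
        by (rule PP_mult_diff) (use that rO in auto)
      then have "g m * ((x m)\<^sup>2 - r\<^sup>2) \<in> PP 1" using PP_mult_O g by blast
      moreover have "(\<Sum>i<Suc m. g i * (x i)\<^sup>2) - a =
          ((\<Sum>i<m. g i * (x i)\<^sup>2) - (a - g m * r\<^sup>2)) + g m * ((x m)\<^sup>2 - r\<^sup>2)"
        by (simp add: algebra_simps)
      ultimately show ?thesis by (simp only: PP_add_iff)
    qed
    show ?thesis
    proof (rule quot_card_cong(1)[where f = "\<lambda>x. x(m := 0)"])
      show "x(m := 0) \<in> Y r" if "x \<in> {x\<in>X. x m - r \<in> PP 1}" for x
        using that key[of x] by (auto simp: X_def Y_def TupI_def not_less_eq_eq le_Suc_eq)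
      show "\<exists>x\<in>{x\<in>X. x m - r \<in> PP 1}. x(m := 0) - y \<in> K m" if y: "y \<in> Y r" for y
      proof (rule bexI[of _ "y(m := r)"])
        show "(y(m := r))(m := 0) - y \<in> K m"
          using y by (auto simp: Y_def TupI_def K_def fun_diff_def)
        show "y(m := r) \<in> {x\<in>X. x m - r \<in> PP 1}"
          using y key[of "y(m := r)"] rO by (auto simp: X_def Y_def TupI_def less_Suc_eq)
      qed
      show "x(m := 0) - y(m := 0) \<in> K m \<longleftrightarrow> x - y \<in> K (Suc m)"
        if "x \<in> {x\<in>X. x m - r \<in> PP 1}" "y \<in> {x\<in>X. x m - r \<in> PP 1}" for x y
      proof -
        have "(x m - r) - (y m - r) \<in> PP 1" using that PP_diff by blast
        then show ?thesis using that
          by (auto simp: X_def TupI_def K_def less_Suc_eq not_less_eq_eq fun_diff_def)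
      qed
    qed (use sK in auto)
  qed
  have "card (quot X (K (Suc m))) = (\<Sum>r\<in>Rs. card (quot {x\<in>X. x m - r \<in> PP 1} (K (Suc m))))"
  proof (rule quot_fib_sum(1)[where g = "\<lambda>x. x m"])
    show "finite (quot {x\<in>X. x m - r \<in> PP 1} (K (Suc m)))" for r
      using quot_mono[OF XF] fin by blast
  qed (use sK Rs in \<open>auto simp: K_def X_def TupI_def\<close>)
  also have "\<dots> = (\<Sum>r\<in>Rs. card (quot (Y r) (K m)))"
    by (rule sum.cong) (use fib in auto)
  finally show ?thesis unfolding diag_zeros_def X_def Y_def K_def .
qed

lemma prod_unit:
  assumes "\<And>i. i \<in> I \<Longrightarrow> g i \<noteq> 0 \<and> v (g i) = 0"
  shows "prod g I \<noteq> 0 \<and> v (prod g I) = 0"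
  using assms by (induction I rule: infinite_finite_induct) (auto simp: val_mult)

text \<open>The classical numbers of points on affine quadrics over a finite field, by an induction
  that alternates parities: from even to odd rank one counts square roots, from odd to even rank one
  needs \<open>chi_sum_quadratic\<close>. The division by q is not simplified so that the even
  formula also holds in rank 0, where the induction starts.\<close>

lemma diag_zeros_aux:
  assumes "\<And>i. i < 2 * k + 1 \<Longrightarrow> g i \<noteq> 0 \<and> v (g i) = 0"
  shows "(\<forall>a\<in>\<O>. real (diag_zeros g (2 * k) a) = real q ^ (2 * k) / real q +
      of_int (\<chi> ((-1) ^ k * (\<Prod>i<2*k. g i))) * real q ^ k * ((if a \<in> PP 1 then 1 else 0) - 1 / real q)) \<and>
    (\<forall>a\<in>\<O>. real (diag_zeros g (2 * k + 1) a) = real q ^ (2 * k) +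
      of_int (\<chi> ((-1) ^ k * (\<Prod>i<2*k+1. g i) * a)) * real q ^ k)"
proof -
  have q0: "real q \<noteq> 0" using q_gt_1 by simp
  have gO: "g i \<in> \<O>" if "i < 2 * k + 1" for i using that assms unit_O by blast
  have m1: "(-1) ^ j \<in> \<O>" for j :: nat by (simp add: O_power)
  have argO: "a - g m * r\<^sup>2 \<in> \<O>" if "a \<in> \<O>" "m < 2 * k + 1" "r \<in> Rs" for a m r
    using that by (auto intro!: PP_diff O_mult O_power intro: Rs_O gO)
  have odd: "\<forall>a\<in>\<O>. real (diag_zeros g (2 * j + 1) a) = real q ^ (2 * j) +
      of_int (\<chi> ((-1) ^ j * (\<Prod>i<2*j+1. g i) * a)) * real q ^ j"
    if "j \<le> k" and even: "\<forall>a\<in>\<O>. real (diag_zeros g (2 * j) a) = real q ^ (2 * j) / real q +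
      of_int (\<chi> ((-1) ^ j * (\<Prod>i<2*j. g i))) * real q ^ j * ((if a \<in> PP 1 then 1 else 0) - 1 / real q)" for j
  proof
    fix a assume a: "a \<in> \<O>"
    define \<eta> where "\<eta> = \<chi> ((-1) ^ j * (\<Prod>i<2*j. g i))"
    have gj: "g (2*j) \<noteq> 0" "v (g (2*j)) = 0" "g (2*j) \<in> \<O>" using assms gO that(1) by auto
    \<comment> \<open>The count in even rank depends on its right-hand side only through the
      question whether that is a nonunit, so the sum over the last coordinate asks for the r with g
      r^2 = a.\<close>
    have cnt: "(\<Sum>r\<in>Rs. if a - g (2*j) * r\<^sup>2 \<in> PP 1 then 1 else 0) = 1 + \<chi> (g (2*j) * a)"
    proof -
      have *: "a - g (2*j) * r\<^sup>2 \<in> PP 1 \<longleftrightarrow> r\<^sup>2 - a / g (2*j) \<in> PP 1" for r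
      proof -
        have "a - g (2*j) * r\<^sup>2 = - g (2*j) * (r\<^sup>2 - a / g (2*j))" using gj by (simp add: field_simps)
        then show ?thesis using unit_mult_PP[of "- g (2*j)"] gj by simp
      qed
      have "(\<Sum>r\<in>Rs. if a - g (2*j) * r\<^sup>2 \<in> PP 1 then 1 else 0) =
          int (card {r\<in>Rs. r\<^sup>2 - a / g (2*j) \<in> PP 1})"
        using * Rs(4) by (simp add: sum.If_cases Int_def conj_commute)
      also have "\<dots> = 1 + \<chi> (a / g (2*j))"
        by (rule card_square_roots) (use gj a unit_divide_PP in blast)
      also have "\<chi> (a / g (2*j)) = \<chi> ((g (2*j))\<^sup>2 * (a / g (2*j)))"
        using chi_square_mult gj a unit_divide_PP by presburger
      also have "(g (2*j))\<^sup>2 * (a / g (2*j)) = g (2*j) * a" using gj by (simp add: power2_eq_square)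
      finally show ?thesis .
    qed
    have "real (diag_zeros g (2 * j + 1) a) = (\<Sum>r\<in>Rs. real (diag_zeros g (2*j) (a - g (2*j) * r\<^sup>2)))"
      using diag_zeros_Suc[of "2*j" g a] gO that(1) by simp
    also have "\<dots> = (\<Sum>r\<in>Rs. (real q ^ (2 * j) / real q - of_int \<eta> * real q ^ j / real q) +
        of_int \<eta> * real q ^ j * of_int (if a - g (2*j) * r\<^sup>2 \<in> PP 1 then 1 else 0))"
    proof (rule sum.cong)
      fix r assume "r \<in> Rs"
      then have "a - g (2*j) * r\<^sup>2 \<in> \<O>" using argO a that(1) by simp
      then show "real (diag_zeros g (2*j) (a - g (2*j) * r\<^sup>2)) =
        (real q ^ (2 * j) / real q - of_int \<eta> * real q ^ j / real q) +
        of_int \<eta> * real q ^ j * of_int (if a - g (2*j) * r\<^sup>2 \<in> PP 1 then 1 else 0)"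
        using even unfolding \<eta>_def by (auto simp: algebra_simps)
    qed simp
    also have "\<dots> = real q * (real q ^ (2 * j) / real q - of_int \<eta> * real q ^ j / real q) +
        of_int \<eta> * real q ^ j * of_int (1 + \<chi> (g (2*j) * a))"
      unfolding sum.distrib sum_distrib_left[symmetric] of_int_sum[symmetric] cnt
      by (simp add: Rs)
    also have "\<dots> = real q ^ (2 * j) + of_int (\<eta> * \<chi> (g (2*j) * a)) * real q ^ j"
      using q0 by (simp add: algebra_simps)
    also have "\<eta> * \<chi> (g (2*j) * a) = \<chi> (((-1) ^ j * (\<Prod>i<2*j. g i)) * (g (2*j) * a))"
      unfolding \<eta>_def by (rule chi_mult[symmetric]) (use a gj m1 gO that(1) in \<open>auto intro!: O_mult O_prod\<close>)
    also have "((-1) ^ j * (\<Prod>i<2*j. g i)) * (g (2*j) * a) = (-1) ^ j * (\<Prod>i<2*j+1. g i) * a"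
      by (simp add: algebra_simps)
    finally show "real (diag_zeros g (2 * j + 1) a) = real q ^ (2 * j) +
      of_int (\<chi> ((-1) ^ j * (\<Prod>i<2*j+1. g i) * a)) * real q ^ j" .
  qed
  have even: "\<forall>a\<in>\<O>. real (diag_zeros g (2 * j) a) = real q ^ (2 * j) / real q +
      of_int (\<chi> ((-1) ^ j * (\<Prod>i<2*j. g i))) * real q ^ j * ((if a \<in> PP 1 then 1 else 0) - 1 / real q)"
    if "j \<le> k" for j
    using that
  proof (induction j)
    case 0
    then show ?case by (simp add: diag_zeros_0)
  next
    case (Suc j)
    show ?case
    proof
      fix a assume a: "a \<in> \<O>"
      define m where "m = 2 * j + 1"
      have mk: "m < 2 * k + 1" using Suc.prems by (simp add: m_def)
      define D where "D = (-1) ^ j * (\<Prod>i<m. g i)"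
      have gm: "g m \<noteq> 0" "v (g m) = 0" "g m \<in> \<O>" using assms gO mk by auto
      have DO: "D \<in> \<O>" unfolding D_def using m1 gO mk by (auto intro!: O_mult O_prod)
      have "real (diag_zeros g (2 * Suc j) a) = (\<Sum>r\<in>Rs. real (diag_zeros g m (a - g m * r\<^sup>2)))"
        using diag_zeros_Suc[of m g a] gO mk by (simp add: m_def)
      also have "\<dots> = (\<Sum>r\<in>Rs. real q ^ (2 * j) + of_int (\<chi> D) * real q ^ j * of_int (\<chi> (a - g m * r\<^sup>2)))"
      proof (rule sum.cong)
        fix r assume "r \<in> Rs"
        then have r: "a - g m * r\<^sup>2 \<in> \<O>" using argO a mk by simp
        have "real (diag_zeros g m (a - g m * r\<^sup>2)) = real q ^ (2 * j) + of_int (\<chi> (D * (a - g m * r\<^sup>2))) * real q ^ j"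
          using odd[of j] Suc r unfolding D_def m_def by simp
        then show "real (diag_zeros g m (a - g m * r\<^sup>2)) =
            real q ^ (2 * j) + of_int (\<chi> D) * real q ^ j * of_int (\<chi> (a - g m * r\<^sup>2))"
          using chi_mult[OF DO r] by simp
      qed simp
      also have "\<dots> = real q * real q ^ (2 * j) + of_int (\<chi> D) * real q ^ j *
          of_int (if a \<in> PP 1 then (int q - 1) * \<chi> (- g m) else - \<chi> (- g m))"
        unfolding sum.distrib sum_distrib_left[symmetric] of_int_sum[symmetric]
          chi_sum_quadratic[OF a gm(1,2)] by (simp add: Rs)
      also have "\<dots> = real q * real q ^ (2 * j) + of_int (\<chi> D * \<chi> (- g m)) * real q ^ j *
          (if a \<in> PP 1 then real q - 1 else - 1)"
        by (simp add: algebra_simps)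
      also have "\<chi> D * \<chi> (- g m) = \<chi> (D * (- g m))"
        by (rule chi_mult[symmetric]) (use DO gm in auto)
      also have "D * (- g m) = (-1) ^ Suc j * (\<Prod>i<2 * Suc j. g i)"
        by (simp add: D_def m_def algebra_simps)
      finally show "real (diag_zeros g (2 * Suc j) a) = real q ^ (2 * Suc j) / real q +
        of_int (\<chi> ((-1) ^ Suc j * (\<Prod>i<2*Suc j. g i))) * real q ^ Suc j *
        ((if a \<in> PP 1 then 1 else 0) - 1 / real q)"
        using q0 by (simp add: field_simps split: if_splits)
    qed
  qed
  show ?thesis using even[of k] odd[of k] by blast
qed

end

section \<open>Lattices in quadratic spaces\<close>

locale qspace = odd_local_field v for v :: "'a::field \<Rightarrow> int" +
  fixes V :: "('a, 'b::ab_group_add) quad_space"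
  assumes qs: "quadratic_space V"
begin

sublocale vs: vector_space "scl V"
  using qs by (simp add: quadratic_space_def)

abbreviation sc :: "'a \<Rightarrow> 'b \<Rightarrow> 'b" (infixr "\<cdot>" 75) where "c \<cdot> x \<equiv> scl V c x"
abbreviation B :: "'b \<Rightarrow> 'b \<Rightarrow> 'a" where "B \<equiv> frm V"

lemma B_sym: "B x y = B y x"
  using qs by (simp add: quadratic_space_def)

lemma B_linear: "B x (y + z) = B x y + B x z" "B x (c \<cdot> y) = c * B x y"
proof -
  have "Vector_Spaces.linear (scl V) (*) (B x)"
    using qs by (simp add: quadratic_space_def)
  then interpret l: Vector_Spaces.linear "scl V" "(*)" "B x" .
  show "B x (y + z) = B x y + B x z" "B x (c \<cdot> y) = c * B x y"
    by (rule l.add, rule l.scale)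
qed

lemma B_linear': "B (y + z) x = B y x + B z x" "B (c \<cdot> y) x = c * B y x"
  by (metis B_linear(1) B_sym, metis B_linear(2) B_sym)

lemma B_zero [simp]: "B x 0 = 0" "B 0 x = 0"
  using B_linear(2)[of x 0 0] by (simp_all add: B_sym)

lemma B_uminus: "B x (- y) = - B x y" "B (- y) x = - B y x"
  using B_linear(1)[of x y "- y"] B_linear'(1)[of y "- y" x] by (simp_all add: eq_neg_iff_add_eq_0 add.commute)

lemma B_diff: "B x (y - z) = B x y - B x z" "B (y - z) x = B y x - B z x"
  using B_linear(1)[of x y "- z"] B_linear'(1)[of y "- z" x] by (simp_all add: B_uminus)

lemma B_sum: "B x (sum f I) = (\<Sum>i\<in>I. B x (f i))" "B (sum f I) x = (\<Sum>i\<in>I. B (f i) x)"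
  by (induction I rule: infinite_finite_induct) (auto simp: B_linear B_linear')

lemmas B_simps = B_linear B_linear' B_uminus B_diff B_sum

abbreviation submod :: "'b set \<Rightarrow> bool" where "submod S \<equiv> is_submodule v V S"

lemma submod_zero: "submod S \<Longrightarrow> 0 \<in> S"
  and submod_add: "submod S \<Longrightarrow> x \<in> S \<Longrightarrow> y \<in> S \<Longrightarrow> x + y \<in> S"
  and submod_scale: "submod S \<Longrightarrow> c \<in> \<O> \<Longrightarrow> x \<in> S \<Longrightarrow> c \<cdot> x \<in> S"
  by (auto simp: is_submodule_def)

lemma submod_uminus: "submod S \<Longrightarrow> x \<in> S \<Longrightarrow> - x \<in> S"
  using submod_scale[of S "-1" x] by simp

lemma submod_diff: "submod S \<Longrightarrow> x \<in> S \<Longrightarrow> y \<in> S \<Longrightarrow> x - y \<in> S"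
  using submod_add[of S x "- y"] submod_uminus[of S y] by simp

lemma submod_subgrp: "submod S \<Longrightarrow> subgrp S"
  by (simp add: subgrp_def submod_zero submod_diff)

lemma submod_sum: "submod S \<Longrightarrow> (\<And>i. i \<in> I \<Longrightarrow> f i \<in> S) \<Longrightarrow> sum f I \<in> S"
  by (induction I rule: infinite_finite_induct) (auto simp: submod_zero submod_add)

lemma submod_Int: "submod S \<Longrightarrow> submod T \<Longrightarrow> submod (S \<inter> T)"
  by (auto simp: is_submodule_def)

section \<open>Linear combinations of indexed families, and lattices given by coordinates\<close>

definition lc :: "nat \<Rightarrow> (nat \<Rightarrow> 'b) \<Rightarrow> (nat \<Rightarrow> 'a) \<Rightarrow> 'b" where
  "lc n e c = (\<Sum>i<n. c i \<cdot> e i)"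

lemma lc_cong: "(\<And>i. i < n \<Longrightarrow> c i = d i) \<Longrightarrow> (\<And>i. i < n \<Longrightarrow> e i = f i) \<Longrightarrow> lc n e c = lc n f d"
  by (simp add: lc_def)

lemma lc_add: "lc n e c + lc n e d = lc n e (\<lambda>i. c i + d i)"
  by (simp add: lc_def vs.scale_left_distrib sum.distrib)

lemma lc_diff: "lc n e c - lc n e d = lc n e (\<lambda>i. c i - d i)"
  by (simp add: lc_def vs.scale_left_diff_distrib sum_subtractf)

lemma lc_scale: "a \<cdot> lc n e c = lc n e (\<lambda>i. a * c i)"
  by (simp add: lc_def vs.scale_sum_right)

lemma lc_zero: "lc n e (\<lambda>_. 0) = 0"
  by (simp add: lc_def)

lemma lc_single:
  assumes "i < n"
  shows "lc n e (\<lambda>j. if j = i then a else 0) = a \<cdot> e i"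
proof -
  have "lc n e (\<lambda>j. if j = i then a else 0) = (\<Sum>j<n. if j = i then a \<cdot> e i else 0)"
    unfolding lc_def by (rule sum.cong) auto
  then show ?thesis using assms by simp
qed

lemma lc_Suc: "lc (Suc n) e c = lc n e c + c n \<cdot> e n"
  by (simp add: lc_def)

lemma lc_lc: "lc n (\<lambda>i. lc m f (P i)) c = lc m f (\<lambda>j. \<Sum>i<n. c i * P i j)"
proof -
  have "lc n (\<lambda>i. lc m f (P i)) c = (\<Sum>i<n. \<Sum>j<m. (c i * P i j) \<cdot> f j)"
    by (simp add: lc_def vs.scale_sum_right)
  also have "\<dots> = (\<Sum>j<m. \<Sum>i<n. (c i * P i j) \<cdot> f j)" by (rule sum.swap)
  finally show ?thesis by (simp add: lc_def vs.scale_sum_left)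
qed

lemma lc_scaled: "lc n (\<lambda>i. d i \<cdot> e i) c = lc n e (\<lambda>i. c i * d i)"
  by (simp add: lc_def)

lemma lc_sum_vectors: "lc n (\<lambda>i. e i + f i) c = lc n e c + lc n f c"
  by (simp add: lc_def vs.scale_right_distrib sum.distrib)

lemma lc_diff_vectors: "lc n (\<lambda>i. e i - f i) c = lc n e c - lc n f c"
  by (simp add: lc_def vs.scale_right_diff_distrib sum_subtractf)

lemma B_lc: "B (lc n e c) x = (\<Sum>i<n. c i * B (e i) x)" "B x (lc n e c) = (\<Sum>i<n. c i * B x (e i))"
  by (simp_all add: lc_def B_simps)

lemma B_lc_lc: "B (lc n e c) (lc m f d) = (\<Sum>i<n. \<Sum>j<m. c i * d j * B (e i) (f j))"
proof -
  have "B (lc n e c) (lc m f d) = (\<Sum>i<n. c i * B (e i) (lc m f d))" by (rule B_lc(1))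
  also have "\<dots> = (\<Sum>i<n. c i * (\<Sum>j<m. d j * B (e i) (f j)))" by (simp only: B_lc(2))
  finally show ?thesis by (simp add: sum_distrib_left mult.assoc)
qed

text \<open>Independence of a family, so that a repeated vector counts as a dependence.\<close>

definition ind :: "nat \<Rightarrow> (nat \<Rightarrow> 'b) \<Rightarrow> bool" where
  "ind n e \<longleftrightarrow> (\<forall>c. lc n e c = 0 \<longrightarrow> (\<forall>i<n. c i = 0))"

lemma ind_eq:
  assumes "ind n e" "lc n e c = lc n e d" "i < n"
  shows "c i = d i"
proof -
  have "lc n e (\<lambda>i. c i - d i) = 0" using assms(2) by (simp add: lc_diff[symmetric])
  then have "c i - d i = 0" using assms by (simp only: ind_def) blast
  then show ?thesis by simp
qed

lemma ind_Suc: "ind (Suc n) e \<Longrightarrow> ind n e"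
proof (unfold ind_def, intro allI impI)
  fix c i assume *: "\<forall>c. lc (Suc n) e c = 0 \<longrightarrow> (\<forall>i<Suc n. c i = 0)" and c: "lc n e c = 0" "i < n"
  have "lc (Suc n) e (\<lambda>i. if i < n then c i else 0) = lc n e c"
    by (simp add: lc_Suc) (rule lc_cong, auto)
  then have "\<forall>j<Suc n. (if j < n then c j else 0) = 0"
    using *[rule_format, of "\<lambda>i. if i < n then c i else 0"] c(1) by presburger
  then have "(if i < n then c i else 0) = 0" using c(2) less_SucI by blast
  then show "c i = 0" using c by simp
qed

lemma ind_iff: "ind n e \<longleftrightarrow> inj_on e {..<n} \<and> \<not> vs.dependent (e ` {..<n})"
proof
  assume e: "ind n e"
  have inj: "inj_on e {..<n}"
  proof (rule inj_onI, rule ccontr)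
    fix i j assume ij: "i \<in> {..<n}" "j \<in> {..<n}" "e i = e j" "i \<noteq> j"
    have "lc n e (\<lambda>k. if k = i then 1 else 0) = lc n e (\<lambda>k. if k = j then 1 else 0)"
      using ij by (simp add: lc_single)
    from ind_eq[OF e this, of i] ij show False by simp
  qed
  moreover have "\<not> vs.dependent (e ` {..<n})"
  proof (rule vs.independent_if_scalars_zero)
    fix f x assume f: "(\<Sum>x\<in>e ` {..<n}. f x \<cdot> x) = 0" and x: "x \<in> e ` {..<n}"
    have "lc n e (\<lambda>i. f (e i)) = 0" using f inj by (simp add: lc_def sum.reindex)
    then show "f x = 0" using x e by (auto simp: ind_def)
  qed simp
  ultimately show "inj_on e {..<n} \<and> \<not> vs.dependent (e ` {..<n})" ..
next
  assume e: "inj_on e {..<n} \<and> \<not> vs.dependent (e ` {..<n})"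
  show "ind n e" unfolding ind_def
  proof (intro allI impI)
    fix c i assume c: "lc n e c = 0" and i: "i < n"
    define u where "u = (\<lambda>x. c (the_inv_into {..<n} e x))"
    have u: "u (e j) = c j" if "j < n" for j
      using that e by (simp add: u_def the_inv_into_f_f)
    have "(\<Sum>x\<in>e ` {..<n}. u x \<cdot> x) = lc n e c" using e u by (simp add: lc_def sum.reindex)
    then have "u (e i) = 0" using vs.independentD[of "e ` {..<n}" "e ` {..<n}" u "e i"] e c i by auto
    then show "c i = 0" using u i by simp
  qed
qed

lemma ind_card: "ind n e \<Longrightarrow> card (e ` {..<n}) = n"
  by (simp add: ind_iff card_image)

lemma lc_in_span: "(\<And>i. i < n \<Longrightarrow> e i \<in> vs.span S) \<Longrightarrow> lc n e c \<in> vs.span S"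
  unfolding lc_def by (auto intro!: vs.span_sum vs.span_scale)

lemma span_eq_lc: "vs.span (e ` {..<n}) = {lc n e c | c. True}"
proof
  have "vs.subspace {lc n e c | c. True}"
  proof (rule vs.subspaceI)
    show "0 \<in> {lc n e c | c. True}" using lc_zero[of n e] by force
  qed (auto simp: lc_add lc_scale)
  moreover have "e ` {..<n} \<subseteq> {lc n e c | c. True}"
  proof
    fix x assume "x \<in> e ` {..<n}"
    then obtain i where "i < n" "x = e i" by blast
    then have "x = lc n e (\<lambda>j. if j = i then 1 else 0)" by (simp add: lc_single)
    then show "x \<in> {lc n e c | c. True}" by blast
  qed
  ultimately show "vs.span (e ` {..<n}) \<subseteq> {lc n e c | c. True}" by (rule vs.span_minimal[rotated])
  show "{lc n e c | c. True} \<subseteq> vs.span (e ` {..<n})"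
    by (auto intro: lc_in_span vs.span_base)
qed

text \<open>Coordinatewise exponents cover with one basis everything needed later: scalings of a
  lattice, the dual of an orthogonal lattice, and sublattices in the position of the elementary
  divisor theorem.\<close>

definition lat :: "nat \<Rightarrow> (nat \<Rightarrow> 'b) \<Rightarrow> (nat \<Rightarrow> int) \<Rightarrow> 'b set" where
  "lat n e p = {lc n e c | c. \<forall>i<n. c i \<in> PP (p i)}"

abbreviation "osp n e \<equiv> lat n e (\<lambda>_. 0)"

lemma latI: "(\<And>i. i < n \<Longrightarrow> c i \<in> PP (p i)) \<Longrightarrow> lc n e c \<in> lat n e p"
  by (auto simp: lat_def)

lemma lat_extend: "lat n e p = {lc n e c | c. (\<forall>i<n. c i \<in> PP (p i)) \<and> (\<forall>i\<ge>n. c i = 0)}"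
proof -
  have "\<exists>d. lc n e c = lc n e d \<and> (\<forall>i<n. d i \<in> PP (p i)) \<and> (\<forall>i\<ge>n. d i = 0)" if "\<forall>i<n. c i \<in> PP (p i)" for c
    using that by (intro exI[of _ "\<lambda>i. if i < n then c i else 0"]) (auto intro: lc_cong)
  then show ?thesis unfolding lat_def by blast
qed

lemma lat_mem_iff:
  assumes "ind n e"
  shows "lc n e c \<in> lat n e p \<longleftrightarrow> (\<forall>i<n. c i \<in> PP (p i))"
proof
  assume "lc n e c \<in> lat n e p"
  then obtain d where d: "lc n e c = lc n e d" "\<forall>i<n. d i \<in> PP (p i)" by (auto simp: lat_def)
  then show "\<forall>i<n. c i \<in> PP (p i)" using ind_eq[OF assms d(1)] by simp
qed (auto intro: latI)

lemma submod_lat: "submod (lat n e p)"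
  unfolding is_submodule_def
proof (intro conjI ballI)
  show "0 \<in> lat n e p" using latI[of n "\<lambda>_. 0" p e] by (simp add: lc_zero)
next
  fix x y assume "x \<in> lat n e p" "y \<in> lat n e p"
  then obtain c d where "x = lc n e c" "y = lc n e d" "\<forall>i<n. c i \<in> PP (p i)" "\<forall>i<n. d i \<in> PP (p i)"
    by (auto simp: lat_def)
  then show "x + y \<in> lat n e p" by (simp add: lc_add) (rule latI, simp add: PP_add)
next
  fix c x assume "c \<in> \<O>" "x \<in> lat n e p"
  then obtain d where "x = lc n e d" "\<forall>i<n. d i \<in> PP (p i)" by (auto simp: lat_def)
  then show "c \<cdot> x \<in> lat n e p"
    using \<open>c \<in> \<O>\<close> by (simp add: lc_scale) (rule latI, simp add: PP_mult_O)
qed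

lemma subgrp_lat: "subgrp (lat n e p)"
  by (rule submod_subgrp[OF submod_lat])

lemma lat_base: "i < n \<Longrightarrow> p i \<le> 0 \<Longrightarrow> e i \<in> lat n e p"
  using latI[of n "\<lambda>j. if j = i then 1 else 0" p e] by (auto simp: lc_single PP_iff)

lemma osp_base: "i < n \<Longrightarrow> e i \<in> osp n e"
  by (rule lat_base) auto

lemma lc_in_submod: "submod S \<Longrightarrow> (\<And>i. i < n \<Longrightarrow> c i \<in> \<O> \<and> e i \<in> S) \<Longrightarrow> lc n e c \<in> S"
  unfolding lc_def by (intro submod_sum) (auto simp: submod_scale)

lemma osp_subset: "submod S \<Longrightarrow> (\<And>i. i < n \<Longrightarrow> e i \<in> S) \<Longrightarrow> osp n e \<subseteq> S"
  by (auto simp: lat_def intro!: lc_in_submod)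

lemma lat_scaled:
  assumes "\<And>i. i < n \<Longrightarrow> d i \<noteq> 0"
  shows "lat n (\<lambda>i. d i \<cdot> e i) p = lat n e (\<lambda>i. p i + v (d i))"
proof
  show "lat n (\<lambda>i. d i \<cdot> e i) p \<subseteq> lat n e (\<lambda>i. p i + v (d i))"
  proof
    fix x assume "x \<in> lat n (\<lambda>i. d i \<cdot> e i) p"
    then obtain c where c: "x = lc n e (\<lambda>i. c i * d i)" "\<forall>i<n. c i \<in> PP (p i)"
      by (auto simp: lat_def lc_scaled)
    have "c i * d i \<in> PP (p i + v (d i))" if "i < n" for i
      using c that by (intro PP_mult) (auto simp: PP_iff)
    then show "x \<in> lat n e (\<lambda>i. p i + v (d i))" unfolding c(1) by (intro latI)
  qed
  show "lat n e (\<lambda>i. p i + v (d i)) \<subseteq> lat n (\<lambda>i. d i \<cdot> e i) p"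
  proof
    fix x assume "x \<in> lat n e (\<lambda>i. p i + v (d i))"
    then obtain c where c: "x = lc n e c" "\<forall>i<n. c i \<in> PP (p i + v (d i))" by (auto simp: lat_def)
    have "x = lc n (\<lambda>i. d i \<cdot> e i) (\<lambda>i. c i / d i)"
      unfolding c lc_scaled using assms by (intro lc_cong) auto
    moreover have "c i / d i \<in> PP (p i)" if "i < n" for i
      using that c assms by (simp add: PP_divide_iff)
    ultimately show "x \<in> lat n (\<lambda>i. d i \<cdot> e i) p" by (simp add: latI)
  qed
qed

lemma ind_scaled:
  assumes "ind n e" "\<And>i. i < n \<Longrightarrow> d i \<noteq> 0"
  shows "ind n (\<lambda>i. d i \<cdot> e i)"
  using assms by (auto simp: ind_def lc_scaled)

lemma span_lat: "vs.span (lat n e p) = vs.span (e ` {..<n})"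
proof
  show "vs.span (lat n e p) \<subseteq> vs.span (e ` {..<n})"
  proof (rule vs.span_minimal)
    show "lat n e p \<subseteq> vs.span (e ` {..<n})" by (auto simp: span_eq_lc lat_def)
  qed (rule vs.subspace_span)
  have "e i \<in> vs.span (lat n e p)" if "i < n" for i
  proof -
    define c where "c = \<pi> powi (p i)"
    have c: "c \<noteq> 0" "v c = p i" by (auto simp: c_def v_powi)
    have "c \<cdot> e i \<in> lat n e p"
      using latI[of n "\<lambda>j. if j = i then c else 0" p e] that c by (auto simp: lc_single PP_iff)
    then have "inverse c \<cdot> c \<cdot> e i \<in> vs.span (lat n e p)" by (intro vs.span_scale vs.span_base)
    then show ?thesis using c by simp
  qed
  then show "vs.span (e ` {..<n}) \<subseteq> vs.span (lat n e p)"
    by (intro vs.span_minimal) auto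
qed

definition lbas :: "nat \<Rightarrow> (nat \<Rightarrow> 'b) \<Rightarrow> 'b set \<Rightarrow> bool" where
  "lbas n e L \<longleftrightarrow> ind n e \<and> L = osp n e"

lemma lbas_span: "lbas n e L \<Longrightarrow> rational_span V L = vs.span (e ` {..<n})"
  by (simp add: lbas_def rational_span_def span_lat)

lemma lbas_rank: "lbas n e L \<Longrightarrow> rank V L = n"
proof -
  assume e: "lbas n e L"
  have "vs.dim L = vs.dim (vs.span L)" by simp
  also have "vs.span L = vs.span (e ` {..<n})" using e by (simp add: lbas_def span_lat)
  also have "vs.dim \<dots> = card (e ` {..<n})"
    by (rule vs.dim_span_eq_card_independent) (use e in \<open>simp add: lbas_def ind_iff\<close>)
  also have "\<dots> = n" using e by (simp add: lbas_def ind_card)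
  finally show ?thesis by (simp add: rank_def)
qed

lemma lbas_submod: "lbas n e L \<Longrightarrow> submod L"
  by (simp add: lbas_def submod_lat)

lemma lbas_mem: "lbas n e L \<Longrightarrow> lc n e c \<in> L \<longleftrightarrow> (\<forall>i<n. c i \<in> \<O>)"
  by (simp add: lbas_def lat_mem_iff)

lemma lbas_base: "lbas n e L \<Longrightarrow> i < n \<Longrightarrow> e i \<in> L"
  by (simp add: lbas_def osp_base)

lemma lbas_obtain:
  assumes "lbas n e L" "x \<in> L"
  obtains c where "x = lc n e c" "\<And>i. i < n \<Longrightarrow> c i \<in> \<O>" "\<And>i. i \<ge> n \<Longrightarrow> c i = 0"
  using assms by (auto simp: lbas_def lat_extend)

lemma lbas_obtain_span:
  assumes "lbas n e L" "x \<in> rational_span V L"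
  obtains c where "x = lc n e c" "\<And>i. i \<ge> n \<Longrightarrow> c i = 0"
proof -
  obtain c where "x = lc n e c" using assms by (auto simp: lbas_span span_eq_lc)
  then have "x = lc n e (\<lambda>i. if i < n then c i else 0)" by (auto intro: lc_cong)
  then show ?thesis using that by simp
qed

lemma lc_in_rational_span: "lbas n e L \<Longrightarrow> lc n e c \<in> rational_span V L"
  by (auto simp: lbas_span span_eq_lc)

lemma lattice_basis_lbas:
  assumes "lattice_basis v V L es"
  shows "lbas (length es) (nth es) L"
proof -
  have "nth es ` {..<length es} = set es"
    by (auto simp: in_set_conv_nth)
  then have "ind (length es) (nth es)"
    using assms by (auto simp: lattice_basis_def ind_iff inj_on_nth)
  moreover have "L = osp (length es) (nth es)"
  proof -
    have "\<exists>d. lc (length es) (nth es) c = lc (length es) (nth es) d \<and> (\<forall>i. d i \<in> \<O>)"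
      if "\<forall>i<length es. c i \<in> \<O>" for c
      using that by (intro exI[of _ "\<lambda>i. if i < length es then c i else 0"]) (auto intro: lc_cong)
    then show ?thesis
      using assms by (auto simp: lattice_basis_def lat_def lin_comb_def lc_def)
  qed
  ultimately show ?thesis by (simp add: lbas_def)
qed

lemma lbas_lattice_basis:
  assumes "lbas n e L"
  shows "lattice_basis v V L (map e [0..<n])"
proof -
  have s: "set (map e [0..<n]) = e ` {..<n}" by auto
  have "distinct (map e [0..<n])" "\<not> vs.dependent (set (map e [0..<n]))"
    using assms by (auto simp: lbas_def ind_iff distinct_map s atLeast0LessThan)
  moreover have "lin_comb V (map e [0..<n]) c = lc n e c" for c
    by (simp add: lin_comb_def lc_def)
  moreover have "L = {lc n e c | c. \<forall>i. c i \<in> \<O>}"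
  proof -
    have "\<exists>d. lc n e c = lc n e d \<and> (\<forall>i. d i \<in> \<O>)" if "\<forall>i<n. c i \<in> \<O>" for c
      using that by (intro exI[of _ "\<lambda>i. if i < n then c i else 0"]) (auto intro: lc_cong)
    then show ?thesis using assms by (auto simp: lbas_def lat_def)
  qed
  ultimately show ?thesis by (simp add: lattice_basis_def)
qed

lemma is_lattice_iff: "is_lattice v V L \<longleftrightarrow> (\<exists>n e. lbas n e L)"
  unfolding is_lattice_def using lattice_basis_lbas lbas_lattice_basis by blast

text \<open>Only generation has to be checked: \<open>n\<close> vectors whose span contains an
  independent family of \<open>n\<close> vectors are independent, since dropping a redundant one
  would leave too few generators.\<close>

lemma lbas_exchange:
  assumes e: "lbas n e L" and e': "\<And>i. i < n \<Longrightarrow> e' i \<in> L" and gen: "\<And>i. i < n \<Longrightarrow> e i \<in> osp n e'"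
  shows "lbas n e' L"
proof -
  have "L \<subseteq> osp n e'" using e gen osp_subset[OF submod_lat] by (simp add: lbas_def)
  moreover have "osp n e' \<subseteq> L" using osp_subset[OF lbas_submod[OF e]] e' by blast
  moreover have "ind n e'"
  proof -
    have ie: "ind n e" using e by (simp add: lbas_def)
    have sp: "e ` {..<n} \<subseteq> vs.span (e' ` {..<n})"
      using gen by (auto simp: span_eq_lc lat_def)
    have bound: "n \<le> card T" if "finite T" "vs.span (e' ` {..<n}) \<subseteq> vs.span T" for T
      using vs.independent_span_bound[of T "e ` {..<n}"] that sp ie by (auto simp: ind_iff card_image)
    have "n \<le> card (e' ` {..<n})" by (rule bound) auto
    then have card: "card (e' ` {..<n}) = card {..<n}"
      using card_image_le[of "{..<n}" e'] by simp
    then have "inj_on e' {..<n}" by (simp add: eq_card_imp_inj_on)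
    moreover have "\<not> vs.dependent (e' ` {..<n})"
    proof
      assume "vs.dependent (e' ` {..<n})"
      then obtain a where a: "a \<in> e' ` {..<n}" "a \<in> vs.span (e' ` {..<n} - {a})"
        using vs.dependent_def by auto
      have "vs.span (insert a (e' ` {..<n} - {a})) = vs.span (e' ` {..<n} - {a})"
        by (rule vs.span_redundant[OF a(2)])
      moreover have "insert a (e' ` {..<n} - {a}) = e' ` {..<n}" using a by blast
      ultimately have "n \<le> card (e' ` {..<n} - {a})" by (intro bound) auto
      moreover have "n > 0" using a by auto
      ultimately show False using card a by (simp add: card_Diff_singleton)
    qed
    ultimately show ?thesis by (simp add: ind_iff)
  qed
  ultimately show ?thesis by (simp add: lbas_def)
qed

lemma lbas_perm:
  assumes "lbas n e L" "bij_betw \<sigma> {..<n} {..<n}"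
  shows "lbas n (e \<circ> \<sigma>) L"
proof (rule lbas_exchange[OF assms(1)])
  show "(e \<circ> \<sigma>) i \<in> L" if "i < n" for i
    using that assms(2) lbas_base[OF assms(1), of "\<sigma> i"] by (auto simp: bij_betw_def)
  show "e i \<in> osp n (e \<circ> \<sigma>)" if i: "i < n" for i
  proof -
    have "i \<in> \<sigma> ` {..<n}" using assms(2) i by (simp add: bij_betw_def)
    then obtain j where "j < n" "\<sigma> j = i" by auto
    then show ?thesis using osp_base[of j n "e \<circ> \<sigma>"] by simp
  qed
qed

lemma lbas_replace:
  assumes e: "lbas n e L" and c: "\<And>i. i < n \<Longrightarrow> c i \<in> \<O>" and k: "k < n" "c k \<noteq> 0" "v (c k) = 0"
  shows "lbas n (e(k := lc n e c)) L"
proof (rule lbas_exchange[OF e])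
  show "(e(k := lc n e c)) i \<in> L" if "i < n" for i
    using that lbas_base[OF e] lbas_mem[OF e] c by simp
  show "e i \<in> osp n (e(k := lc n e c))" if i: "i < n" for i
  proof (cases "i = k")
    case False
    then show ?thesis using osp_base[of i n "e(k := lc n e c)"] i by simp
  next
    case True
    let ?S = "osp n (e(k := lc n e c))"
    have S: "submod ?S" by (rule submod_lat)
    have "lc n e c = c k \<cdot> e k + (\<Sum>j\<in>{..<n}-{k}. c j \<cdot> e j)"
      unfolding lc_def using k by (simp add: sum.remove)
    then have "c k \<cdot> e k = lc n e c - (\<Sum>j\<in>{..<n}-{k}. c j \<cdot> e j)" by simp
    also have "\<dots> \<in> ?S"
    proof (intro submod_diff[OF S] submod_sum[OF S])
      show "lc n e c \<in> ?S" using osp_base[OF k(1), of "e(k := lc n e c)"] by simp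
      show "c j \<cdot> e j \<in> ?S" if "j \<in> {..<n} - {k}" for j
        using that osp_base[of j n "e(k := lc n e c)"] c submod_scale[OF S] by simp
    qed
    finally have "inverse (c k) \<cdot> c k \<cdot> e k \<in> ?S"
      by (rule submod_scale[OF S, rotated]) (use k in \<open>auto simp: PP_iff v_inverse\<close>)
    then show ?thesis using k True by simp
  qed
qed

lemma lbas_swap:
  assumes "lbas n e L" "j < n" "k < n"
  shows "lbas n (e \<circ> Transposition.transpose j k) L"
  by (rule lbas_perm[OF assms(1)]) (use assms in \<open>auto simp: bij_betw_def inj_on_def transpose_def\<close>)

lemma lbas_replace_swap:
  assumes e: "lbas n e L" and c: "\<And>i. i < n \<Longrightarrow> c i \<in> \<O>"
    and k: "k < n" "c k \<noteq> 0" "v (c k) = 0" and l: "l < n"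
  shows "\<exists>e'. lbas n e' L \<and> e' l = lc n e c"
proof -
  have "lbas n (e(k := lc n e c)) L" by (rule lbas_replace) (use e c k in auto)
  then have "lbas n (e(k := lc n e c) \<circ> Transposition.transpose l k) L"
    by (rule lbas_swap) (use l k in auto)
  moreover have "(e(k := lc n e c) \<circ> Transposition.transpose l k) l = lc n e c" by simp
  ultimately show ?thesis by blast
qed

subsection \<open>Orthogonal bases\<close>

lemma lbas_split_last:
  assumes e: "lbas (Suc m) e L" and g: "lbas m g (osp m e)"
  shows "lbas (Suc m) (g(m := e m)) L"
proof (rule lbas_exchange[OF e])
  have S: "submod (osp (Suc m) e)" "submod (osp (Suc m) (g(m := e m)))" by (rule submod_lat)+
  show "(g(m := e m)) i \<in> L" if "i < Suc m" for i
  proof -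
    have "osp m e \<subseteq> osp (Suc m) e" by (rule osp_subset[OF S(1)]) (simp add: osp_base)
    then show ?thesis using that lbas_base[OF g, of i] e by (auto simp: lbas_def osp_base less_Suc_eq)
  qed
  have "osp m g \<subseteq> osp (Suc m) (g(m := e m))"
  proof (rule osp_subset[OF S(2)])
    show "g i \<in> osp (Suc m) (g(m := e m))" if "i < m" for i
      using that osp_base[of i "Suc m" "g(m := e m)"] by simp
  qed
  then show "e i \<in> osp (Suc m) (g(m := e m))" if "i < Suc m" for i
    using that g osp_base[of i m e] osp_base[of m "Suc m" "g(m := e m)"]
    by (auto simp: lbas_def less_Suc_eq)
qed

definition orth :: "nat \<Rightarrow> (nat \<Rightarrow> 'b) \<Rightarrow> bool" where
  "orth n g \<longleftrightarrow> (\<forall>i<n. \<forall>j<n. i \<noteq> j \<longrightarrow> B (g i) (g j) = 0)"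

lemma B_osp_PP:
  assumes "\<And>i j. i < n \<Longrightarrow> j < n \<Longrightarrow> B (e i) (e j) \<in> PP N" "x \<in> osp n e" "y \<in> osp n e"
  shows "B x y \<in> PP N"
  using assms by (auto simp: lat_def B_lc_lc intro!: PP_sum PP_mult_O O_mult)

text \<open>If \<open>B\<close> takes its minimal valuation only off the diagonal of the Gram matrix, at \<open>(i, j)\<close>,
  then \<open>e\<^sub>i + e\<^sub>j\<close> has norm of this minimal valuation because \<open>2\<close> is a unit.\<close>

lemma minimal_norm_vector:
  assumes e: "lbas n e L" and nz: "i0 < n" "j0 < n" "B (e i0) (e j0) \<noteq> 0"
  shows "\<exists>e'. \<exists>k<n. lbas n e' L \<and> B (e' k) (e' k) \<noteq> 0 \<and>
    (\<forall>x\<in>L. \<forall>y\<in>L. B x y \<in> PP (v (B (e' k) (e' k))))"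
proof -
  define Z where "Z = (\<lambda>(i, j). v (B (e i) (e j))) ` {(i, j). i < n \<and> j < n \<and> B (e i) (e j) \<noteq> 0}"
  have "finite {(i, j). i < n \<and> j < n \<and> B (e i) (e j) \<noteq> 0}"
    by (rule finite_subset[of _ "{..<n} \<times> {..<n}"]) auto
  then have fin: "finite Z" by (simp add: Z_def)
  have "Z \<noteq> {}" using nz by (auto simp: Z_def)
  define \<mu> where "\<mu> = Min Z"
  have "\<mu> \<in> Z" using fin \<open>Z \<noteq> {}\<close> by (simp add: \<mu>_def)
  then obtain i j where ij: "i < n" "j < n" "B (e i) (e j) \<noteq> 0" "v (B (e i) (e j)) = \<mu>"
    by (auto simp: Z_def)
  have PPe: "B (e k) (e l) \<in> PP \<mu>" if "k < n" "l < n" for k l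
  proof (cases "B (e k) (e l) = 0")
    case False
    then have "v (B (e k) (e l)) \<in> Z" using that by (force simp: Z_def)
    then show ?thesis using fin by (simp add: PP_iff \<mu>_def)
  qed simp
  have PPL: "B x y \<in> PP \<mu>" if "x \<in> L" "y \<in> L" for x y
    using B_osp_PP[OF PPe] that e by (simp add: lbas_def)
  show ?thesis
  proof (cases "\<exists>k<n. B (e k) (e k) \<noteq> 0 \<and> v (B (e k) (e k)) = \<mu>")
    case True
    then show ?thesis using e PPL by blast
  next
    case False
    then have dg: "B (e k) (e k) \<in> PP (\<mu> + 1)" if "k < n" for k
      using PPe[OF that that] that by (auto simp: PP_iff)
    have "i \<noteq> j" using ij dg[OF ij(1)] by (auto simp: PP_iff)
    define c where "c k = (if k = i then 1 else 0) + (if k = j then 1 else (0::'a))" for k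
    have x: "lc n e c = e i + e j" unfolding c_def lc_add[symmetric] using ij by (simp add: lc_single)
    have bas: "lbas n (e(i := lc n e c)) L"
      by (rule lbas_replace[OF e]) (use \<open>i \<noteq> j\<close> ij in \<open>auto simp: c_def\<close>)
    have "B (e i + e j) (e i + e j) = 2 * B (e i) (e j) + (B (e i) (e i) + B (e j) (e j))"
      using B_sym[of "e j" "e i"] by (simp add: B_simps)
    moreover have "B (e i) (e i) + B (e j) (e j) \<in> PP (\<mu> + 1)" using dg ij PP_add by blast
    moreover have two: "2 * B (e i) (e j) \<noteq> 0" "v (2 * B (e i) (e j)) = \<mu>" using ij by (simp_all add: val_mult)
    ultimately have b: "B (e i + e j) (e i + e j) \<notin> PP (\<mu> + 1)" "B (e i + e j) (e i + e j) \<in> PP \<mu>"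
      using PP_add_iff[of "B (e i) (e i) + B (e j) (e j)" "\<mu> + 1" "2 * B (e i) (e j)"]
        PP_add_iff[of "B (e i) (e i) + B (e j) (e j)" \<mu> "2 * B (e i) (e j)"] PP_mono[of \<mu> "\<mu> + 1"]
      by (auto simp: PP_iff[of "2 * B (e i) (e j)"])
    then have "B (e i + e j) (e i + e j) \<noteq> 0" "v (B (e i + e j) (e i + e j)) = \<mu>"
      by (auto simp: PP_iff)
    then show ?thesis using bas x ij PPL
      by (intro exI[of _ "e(i := lc n e c)"] exI[of _ i]) simp
  qed
qed

text \<open>One Gram-Schmidt step. The assumption \<open>min\<close> keeps its coefficients
  integral; it holds when the last vector has a norm of minimal valuation, or a unit norm in an
  integral lattice.\<close>

lemma lbas_orthogonalize_last:
  assumes e: "lbas (Suc m) e L" and x: "B (e m) (e m) \<noteq> 0"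
    and min: "\<And>y. y \<in> L \<Longrightarrow> B y (e m) / B (e m) (e m) \<in> \<O>"
  shows "\<exists>e'. lbas (Suc m) e' L \<and> e' m = e m \<and> (\<forall>i<m. B (e' i) (e m) = 0)"
proof -
  define e' where "e' i = (if i < m then e i - (B (e i) (e m) / B (e m) (e m)) \<cdot> e m else e i)" for i
  have "lbas (Suc m) e' L"
  proof (rule lbas_exchange[OF e])
    show "e' i \<in> L" if "i < Suc m" for i
      unfolding e'_def using lbas_base[OF e] that min submod_diff[OF lbas_submod[OF e]]
        submod_scale[OF lbas_submod[OF e]] by simp
    show "e i \<in> osp (Suc m) e'" if i: "i < Suc m" for i
    proof (cases "i = m")
      case True
      then show ?thesis using osp_base[of m "Suc m" e'] by (simp add: e'_def)
    next
      case False
      then have "e i = e' i + (B (e i) (e m) / B (e m) (e m)) \<cdot> e' m" using i by (simp add: e'_def)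
      also have "\<dots> \<in> osp (Suc m) e'"
        using i osp_base[of _ "Suc m" e'] min lbas_base[OF e]
        by (intro submod_add[OF submod_lat] submod_scale[OF submod_lat]) auto
      finally show ?thesis .
    qed
  qed
  moreover have "B (e' i) (e m) = 0" if "i < m" for i
    using that x by (simp add: e'_def B_simps)
  ultimately show ?thesis by (intro exI[of _ e']) (auto simp: e'_def)
qed

lemma orth_extend:
  assumes "orth m g" "\<And>i. i < m \<Longrightarrow> B (g i) x = 0"
  shows "orth (Suc m) (g(m := x))"
  using assms B_sym[of x] by (auto simp: orth_def less_Suc_eq)

text \<open>Gram-Schmidt stays integral when it starts with a vector whose norm has minimal
  valuation among all values of the form. Once the form vanishes identically, any basis will
  do.\<close>

lemma orthogonal_basis:
  assumes "lbas n e L"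
  shows "\<exists>g. lbas n g L \<and> orth n g"
  using assms
proof (induction n arbitrary: e L)
  case 0
  then show ?case by (auto simp: orth_def)
next
  case (Suc m)
  show ?case
  proof (cases "\<forall>i<Suc m. \<forall>j<Suc m. B (e i) (e j) = 0")
    case True
    then show ?thesis using Suc.prems by (auto simp: orth_def)
  next
    case False
    then obtain i j where "i < Suc m" "j < Suc m" "B (e i) (e j) \<noteq> 0" by blast
    from minimal_norm_vector[OF Suc.prems this] obtain e1 k where e1: "k < Suc m" "lbas (Suc m) e1 L"
      "B (e1 k) (e1 k) \<noteq> 0" "\<forall>x\<in>L. \<forall>y\<in>L. B x y \<in> PP (v (B (e1 k) (e1 k)))" by blast
    define e2 where "e2 = e1 \<circ> Transposition.transpose m k"
    have e2: "lbas (Suc m) e2 L" "e2 m = e1 k"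
      using lbas_swap[OF e1(2), of m k] e1(1) by (simp_all add: e2_def)
    have "B y (e2 m) / B (e2 m) (e2 m) \<in> \<O>" if "y \<in> L" for y
      using that e1 e2 lbas_base[OF e1(2) e1(1)] by (simp add: PP_divide_iff)
    then obtain e3 where e3: "lbas (Suc m) e3 L" "e3 m = e2 m" "\<forall>i<m. B (e3 i) (e2 m) = 0"
      using lbas_orthogonalize_last[OF e2(1)] e1 e2 by auto
    have "lbas m e3 (osp m e3)" using e3 ind_Suc by (auto simp: lbas_def)
    then obtain g where g: "lbas m g (osp m e3)" "orth m g" using Suc.IH by blast
    have "B (g i) (e3 m) = 0" if i: "i < m" for i
    proof -
      obtain c where "g i = lc m e3 c" using lbas_base[OF g(1) i] by (auto simp: lat_def)
      then show ?thesis using e3 by (simp add: B_lc)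
    qed
    then have "orth (Suc m) (g(m := e3 m))" using g by (intro orth_extend)
    then show ?thesis using lbas_split_last[OF e3(1) g(1)] by blast
  qed
qed

lemma orth_perm:
  assumes "orth n g" "bij_betw \<sigma> {..<n} {..<n}"
  shows "orth n (g \<circ> \<sigma>)"
  unfolding orth_def
proof (intro allI impI)
  fix i j assume ij: "i < n" "j < n" "i \<noteq> j"
  then have "\<sigma> i < n" "\<sigma> j < n" "\<sigma> i \<noteq> \<sigma> j"
    using assms(2) by (auto simp: bij_betw_def inj_on_def)
  then show "B ((g \<circ> \<sigma>) i) ((g \<circ> \<sigma>) j) = 0" using assms(1) by (simp add: orth_def)
qed

lemma sorted_orthogonal_basis:
  assumes "lbas n e L"
  shows "\<exists>g. lbas n g L \<and> orth n g \<and> (\<forall>i j. i \<le> j \<longrightarrow> j < n \<longrightarrow> v (B (g i) (g i)) \<le> v (B (g j) (g j)))"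
proof -
  obtain g where g: "lbas n g L" "orth n g" using orthogonal_basis[OF assms] by blast
  define w where "w i = v (B (g i) (g i))" for i
  define xs where "xs = sort_key w [0..<n]"
  have xs: "length xs = n" "distinct xs" "set xs = {..<n}" "sorted (map w xs)"
    by (auto simp: xs_def)
  have b: "bij_betw (nth xs) {..<n} {..<n}"
    by (rule bij_betw_nth) (use xs in auto)
  have "w (xs ! i) \<le> w (xs ! j)" if "i \<le> j" "j < n" for i j
  proof -
    have "map w xs ! i \<le> map w xs ! j" by (rule sorted_nth_mono) (use that xs in auto)
    then show ?thesis using that xs by simp
  qed
  then show ?thesis using lbas_perm[OF g(1) b] orth_perm[OF g(2) b]
    by (intro exI[of _ "g \<circ> nth xs"]) (auto simp: w_def)
qed

subsection \<open>Stacked bases\<close>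

abbreviation spow :: "nat \<Rightarrow> 'b set \<Rightarrow> 'b set" where "spow N S \<equiv> (\<lambda>x. \<pi> ^ N \<cdot> x) ` S"

lemma scaled_lattice_eq:
  assumes "submod S"
  shows "scaled_lattice v V N S = spow N S"
proof
  show "scaled_lattice v V N S \<subseteq> spow N S"
  proof
    fix y assume "y \<in> scaled_lattice v V N S"
    then obtain c x where "y = c \<cdot> x" "c \<in> PP (int N)" "x \<in> S" by (auto simp: scaled_lattice_def)
    moreover obtain d where "c = \<pi> ^ N * d" "d \<in> \<O>" using PP_pi[of N "int N" c] calculation by auto
    ultimately show "y \<in> spow N S" using submod_scale[OF assms] by (force simp: image_iff)
  qed
  have "\<pi> ^ N \<in> PP (int N)" by (simp add: PP_iff)
  then show "spow N S \<subseteq> scaled_lattice v V N S" by (auto simp: scaled_lattice_def)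
qed

lemma spow_lat: "spow N (lat n e p) = lat n e (\<lambda>i. p i + int N)"
proof -
  have "spow N (lat n e p) = lat n (\<lambda>i. \<pi> ^ N \<cdot> e i) p"
  proof -
    have "\<pi> ^ N \<cdot> lc n e c = lc n (\<lambda>i. \<pi> ^ N \<cdot> e i) c" for c
      by (simp add: lc_scale lc_scaled mult.commute)
    then show ?thesis unfolding lat_def by (auto simp: image_iff) metis+
  qed
  also have "\<dots> = lat n e (\<lambda>i. p i + int N)" using lat_scaled[of n "\<lambda>_. \<pi> ^ N" e p] by simp
  finally show ?thesis .
qed

lemma lbas_spow: "lbas n e L \<Longrightarrow> spow N L = lat n e (\<lambda>_. int N)"
  by (simp add: lbas_def spow_lat)

lemma spow_subset: "submod S \<Longrightarrow> spow N S \<subseteq> S"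
  by (auto intro!: submod_scale simp: PP_iff)

lemma submod_spow: "submod S \<Longrightarrow> submod (spow N S)"
proof (unfold is_submodule_def, intro conjI ballI, goal_cases)
  case 1
  then show ?case by (auto intro!: image_eqI[of _ _ 0])
next
  case (2 x y)
  then show ?case by (auto simp flip: vs.scale_right_distrib)
next
  case (3 c x)
  then obtain y where "x = \<pi> ^ N \<cdot> y" "y \<in> S" by blast
  then have "c \<cdot> x = \<pi> ^ N \<cdot> (c \<cdot> y)" "c \<cdot> y \<in> S" using 3 by (auto simp: mult.commute)
  then show ?case by blast
qed

text \<open>The elementary divisor theorem over a valuation ring. Choose a maximal with S contained
  in \<pi>^a L. An element of S outside \<pi>^(a+1) L is \<pi>^a y with y primitive, so y can be the
  last vector of a basis of \<open>L\<close>. Then S is the sum of the multiples of \<pi>^a y and of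
  its intersection with the span of the other basis vectors, to which the induction applies.\<close>

lemma stacked_basis:
  assumes "lbas n e L" "submod S" "spow A L \<subseteq> S" "S \<subseteq> L"
  shows "\<exists>f a. lbas n f L \<and> S = lat n f (\<lambda>i. int (a i)) \<and> (\<forall>i<n. a i \<le> A)"
  using assms
proof (induction n arbitrary: e L S)
  case 0
  then have "L = {0}" by (auto simp: lbas_def lat_def lc_def)
  then have "S = {0}" using 0 submod_zero by blast
  moreover have "lat 0 e p = {0}" for p by (auto simp: lat_def lc_def)
  ultimately show ?case using 0 by auto
next
  case (Suc m)
  note e = Suc.prems(1) and S = Suc.prems(2)
  have L: "submod L" using e by (rule lbas_submod)
  \<comment> \<open>This bounds the search for a: \<pi>^A e_0 lies in S, but not in \<pi>^(A+1)
    L.\<close>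
  have ex: "\<not> S \<subseteq> spow (Suc A) L"
  proof
    assume "S \<subseteq> spow (Suc A) L"
    then have "\<pi> ^ A \<cdot> e 0 \<in> lat (Suc m) e (\<lambda>_. int (Suc A))"
      using Suc.prems(3) lbas_base[OF e, of 0] lbas_spow[OF e] by blast
    then have "lc (Suc m) e (\<lambda>j. if j = 0 then \<pi> ^ A else 0) \<in> lat (Suc m) e (\<lambda>_. int (Suc A))"
      by (simp add: lc_single)
    then show False using e lat_mem_iff by (auto simp: lbas_def PP_iff)
  qed
  \<comment> \<open>The least a for which S is not in \<pi>^(a+1) L is the largest one for which it
    is in \<pi>^a L.\<close>
  define a where "a = (LEAST a. \<not> S \<subseteq> spow (Suc a) L)"
  have a1: "\<not> S \<subseteq> spow (Suc a) L" unfolding a_def by (rule LeastI[of _ A]) (rule ex)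
  have aA: "a \<le> A" unfolding a_def by (rule Least_le) (rule ex)
  have a2: "S \<subseteq> spow a L"
  proof (cases a)
    case 0
    then show ?thesis using Suc.prems(4) by simp
  next
    case (Suc b)
    then show ?thesis using not_less_Least[of b "\<lambda>a. \<not> S \<subseteq> spow (Suc a) L"] by (simp add: a_def)
  qed
  obtain x where x: "x \<in> S" "x \<notin> spow (Suc a) L" using a1 by blast
  then obtain y where y: "y \<in> L" "x = \<pi> ^ a \<cdot> y" using a2 by blast
  obtain c where c: "y = lc (Suc m) e c" "\<And>i. i < Suc m \<Longrightarrow> c i \<in> \<O>"
    using lbas_obtain[OF e y(1)] by blast
  have "\<exists>k<Suc m. c k \<notin> PP 1"
  proof (rule ccontr)
    assume "\<not> ?thesis"
    then have "y \<in> lat (Suc m) e (\<lambda>_. int 1)" unfolding c by (intro latI) auto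
    then have "y \<in> spow 1 L" using lbas_spow[OF e] by blast
    then show False using x y by (auto simp: mult.commute)
  qed
  then obtain k where k: "k < Suc m" "c k \<noteq> 0" "v (c k) = 0" using c unit_iff by blast
  obtain e' where e': "lbas (Suc m) e' L" "e' m = y"
    using lbas_replace_swap[of "Suc m" e L c k m] e c k by auto
  have ie': "ind (Suc m) e'" "L = osp (Suc m) e'" using e' by (auto simp: lbas_def)
  define L1 where "L1 = osp m e'"
  define S1 where "S1 = S \<inter> L1"
  have L1: "lbas m e' L1" "L1 \<subseteq> L"
    using ie' ind_Suc osp_subset[OF L, of m e'] lbas_base[OF e'(1)] by (auto simp: lbas_def L1_def)
  have "spow A L1 \<subseteq> S1"
    using Suc.prems(3) L1 spow_subset[OF lbas_submod[OF L1(1)]] by (auto simp: S1_def)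
  then obtain f b where f: "lbas m f L1" "S1 = lat m f (\<lambda>i. int (b i))" "\<forall>i<m. b i \<le> A"
    using Suc.IH[OF L1(1), of S1] submod_Int[OF S lbas_submod[OF L1(1)]] by (auto simp: S1_def)
  define f' where "f' = f(m := y)"
  define b' where "b' = b(m := a)"
  have f': "lbas (Suc m) f' L"
    using lbas_split_last[OF e'(1), of f] f(1) e'(2) by (simp add: f'_def L1_def)
  have lf: "lc m f' d = lc m f d" for d by (rule lc_cong) (auto simp: f'_def)
  have "S = lat (Suc m) f' (\<lambda>i. int (b' i))"
  proof
    show "S \<subseteq> lat (Suc m) f' (\<lambda>i. int (b' i))"
    proof
      fix s assume s: "s \<in> S"
      then have "s \<in> lat (Suc m) f' (\<lambda>_. int a)" using a2 lbas_spow[OF f'] by blast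
      then obtain d where d: "s = lc (Suc m) f' d" "\<forall>i<Suc m. d i \<in> PP (int a)" by (auto simp: lat_def)
      then obtain u where u: "u \<in> \<O>" "d m = \<pi> ^ a * u" using PP_pi[of a "int a" "d m"] by auto
      have "s = lc m f d + d m \<cdot> f' m" using d by (simp add: lc_Suc lf)
      \<comment> \<open>As S lies in \<pi>^a L, the last coordinate of s is divisible by \<pi>^a and
        a multiple of x removes it.\<close>
      then have "lc m f d = s - u \<cdot> x" using u y by (simp add: f'_def mult.commute)
      then have "lc m f d \<in> S" using s x u S submod_diff submod_scale by metis
      moreover have "lc m f d \<in> L1"
        using lbas_mem[OF f(1)] d PP_mono[of 0 "int a"] by auto
      ultimately have "lc m f d \<in> lat m f (\<lambda>i. int (b i))" using f(2) by (auto simp: S1_def)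
      then have "\<forall>i<m. d i \<in> PP (int (b i))" using lat_mem_iff f(1) by (auto simp: lbas_def)
      then show "s \<in> lat (Suc m) f' (\<lambda>i. int (b' i))"
        unfolding d(1) using d(2) by (intro latI) (auto simp: b'_def less_Suc_eq)
    qed
    show "lat (Suc m) f' (\<lambda>i. int (b' i)) \<subseteq> S"
    proof
      fix s assume "s \<in> lat (Suc m) f' (\<lambda>i. int (b' i))"
      then obtain d where d: "s = lc (Suc m) f' d" "\<forall>i<Suc m. d i \<in> PP (int (b' i))" by (auto simp: lat_def)
      then have "d m \<in> PP (int (b' m))" by blast
      then have "d m \<in> PP (int a)" by (simp add: b'_def)
      then obtain u where u: "u \<in> \<O>" "d m = \<pi> ^ a * u" using PP_pi[of a "int a" "d m"] by auto
      have "\<forall>i<m. d i \<in> PP (int (b i))"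
      proof (intro allI impI)
        fix i assume "i < m"
        then show "d i \<in> PP (int (b i))" using d(2)[rule_format, of i] by (simp add: b'_def)
      qed
      then have "lc m f d \<in> S1" unfolding f(2) by (intro latI) auto
      moreover have "s = lc m f d + d m \<cdot> f' m" using d by (simp add: lc_Suc lf)
      then have "s = lc m f d + u \<cdot> x" using u y by (simp add: f'_def mult.commute)
      ultimately show "s \<in> S" using u x S submod_add submod_scale by (auto simp: S1_def)
    qed
  qed
  moreover have "\<forall>i<Suc m. b' i \<le> A" using f aA by (auto simp: b'_def less_Suc_eq)
  ultimately show ?case using f' by blast
qed

subsection \<open>Indices of lattices\<close>

lemma quot_lat:
  assumes e: "ind n e" and "\<And>i. i < n \<Longrightarrow> p i \<le> r i"
  shows "card (quot (lat n e p) (lat n e r)) = q ^ (\<Sum>i<n. nat (r i - p i))"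
    "finite (quot (lat n e p) (lat n e r))"
proof -
  have sg: "subgrp (TupI n (\<lambda>i. PP (r i)))" by (rule subgrp_TupI) simp
  have A: "lc n e x \<in> lat n e p" if "x \<in> TupI n (\<lambda>i. PP (p i))" for x
      using that by (intro latI) (auto simp: TupI_def)
  have B: "\<exists>x\<in>TupI n (\<lambda>i. PP (p i)). lc n e x - y \<in> lat n e r" if "y \<in> lat n e p" for y
    proof -
      obtain c where "y = lc n e c \<and> (\<forall>i<n. c i \<in> PP (p i)) \<and> (\<forall>i\<ge>n. c i = 0)"
        using \<open>y \<in> lat n e p\<close> unfolding lat_extend by auto
      then have "c \<in> TupI n (\<lambda>i. PP (p i))" "y = lc n e c" by (simp_all add: TupI_def)
      then show ?thesis using submod_zero[OF submod_lat] by (intro bexI[of _ c]) auto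
    qed
  have C: "lc n e x - lc n e y \<in> lat n e r \<longleftrightarrow> x - y \<in> TupI n (\<lambda>i. PP (r i))"
      if "x \<in> TupI n (\<lambda>i. PP (p i))" "y \<in> TupI n (\<lambda>i. PP (p i))" for x y
      using that by (auto simp: lc_diff lat_mem_iff[OF e] TupI_def fun_diff_def)
  note quot_card_cong[OF sg subgrp_lat, of "TupI n (\<lambda>i. PP (p i))" "lc n e" "lat n e p" n e r, OF A B C]
  moreover have "card (quot (TupI n (\<lambda>i. PP (p i))) (TupI n (\<lambda>i. PP (r i)))) = (\<Prod>i<n. q ^ nat (r i - p i)) \<and>
     finite (quot (TupI n (\<lambda>i. PP (p i))) (TupI n (\<lambda>i. PP (r i))))"
    using card_quot_TupI[of n "\<lambda>i. PP (r i)" "\<lambda>i. PP (p i)"] quot_PP assms(2) by simp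
  ultimately show "card (quot (lat n e p) (lat n e r)) = q ^ (\<Sum>i<n. nat (r i - p i))"
    "finite (quot (lat n e p) (lat n e r))" by (simp_all add: power_sum)
qed

end

section \<open>Gram determinants\<close>

context odd_local_field
begin

lemma det_in_O:
  assumes A: "A \<in> carrier_mat n n" and "\<And>i j. i < n \<Longrightarrow> j < n \<Longrightarrow> A $$ (i, j) \<in> \<O>"
  shows "det A \<in> \<O>"
  unfolding det_def'[OF A]
proof (rule PP_sum)
  fix p assume "p \<in> {p. p permutes {0..<n}}"
  then have "p i < n" if "i < n" for i using that permutes_in_image[of p "{0..<n}" i] by auto
  then have "(\<Prod>i = 0..<n. A $$ (i, p i)) \<in> \<O>" using assms by (intro O_prod) auto
  then show "signof p * (\<Prod>i = 0..<n. A $$ (i, p i)) \<in> \<O>"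
    by (cases "evenperm p") (auto simp: sign_def)
qed

lemma det_cong_P1:
  assumes A: "A \<in> carrier_mat n n" "A' \<in> carrier_mat n n"
    and O: "\<And>i j. i < n \<Longrightarrow> j < n \<Longrightarrow> A $$ (i, j) \<in> \<O>"
    and c: "\<And>i j. i < n \<Longrightarrow> j < n \<Longrightarrow> A $$ (i, j) - A' $$ (i, j) \<in> PP 1"
  shows "det A - det A' \<in> PP 1"
proof -
  have prod: "finite I \<Longrightarrow> (\<And>i. i \<in> I \<Longrightarrow> f i \<in> \<O> \<and> f i - h i \<in> PP 1) \<Longrightarrow> prod f I - prod h I \<in> PP 1"
    for I :: "nat set" and f h
  proof (induction I rule: finite_induct)
    case (insert x I)
    have "h i \<in> \<O>" if "i \<in> insert x I" for i using insert.prems[OF that] cong_O[of "f i" "h i"] by blast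
    then have "f x * prod f I - h x * prod h I \<in> PP 1"
      using insert by (intro PP_mult_diff O_prod) auto
    then show ?case using insert by simp
  qed simp
  have "det A - det A' = (\<Sum>p\<in>{p. p permutes {0..<n}}. signof p * ((\<Prod>i = 0..<n. A $$ (i, p i)) - (\<Prod>i = 0..<n. A' $$ (i, p i))))"
    unfolding det_def'[OF A(1)] det_def'[OF A(2)] by (simp add: sum_subtractf right_diff_distrib)
  also have "\<dots> \<in> PP 1"
  proof (rule PP_sum)
    fix p assume "p \<in> {p. p permutes {0..<n}}"
    then have "p i < n" if "i < n" for i using that permutes_in_image[of p "{0..<n}" i] by auto
    then have "(\<Prod>i = 0..<n. A $$ (i, p i)) - (\<Prod>i = 0..<n. A' $$ (i, p i)) \<in> PP 1"
      using O c by (intro prod) auto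
    moreover have "signof p \<in> \<O>" by (cases "evenperm p") (auto simp: sign_def)
    ultimately show "signof p * ((\<Prod>i = 0..<n. A $$ (i, p i)) - (\<Prod>i = 0..<n. A' $$ (i, p i))) \<in> PP 1"
      by (intro PP_mult_O)
  qed
  finally show ?thesis .
qed

end

context qspace
begin

definition gram :: "nat \<Rightarrow> (nat \<Rightarrow> 'b) \<Rightarrow> 'a mat" where
  "gram n e = mat n n (\<lambda>(i, j). B (e i) (e j))"

lemma gram_carrier [simp]: "gram n e \<in> carrier_mat n n"
  by (simp add: gram_def)

lemma gram_change:
  assumes "\<And>i. i < n \<Longrightarrow> e' i = lc n e (P i)"
  shows "det (gram n e') = (det (mat n n (\<lambda>(i, j). P i j)))\<^sup>2 * det (gram n e)"
proof -
  let ?P = "mat n n (\<lambda>(i, j). P i j)"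
  have "gram n e' = ?P * gram n e * transpose_mat ?P"
  proof (rule eq_matI)
    fix i j assume "i < dim_row (?P * gram n e * transpose_mat ?P)" "j < dim_col (?P * gram n e * transpose_mat ?P)"
    then have ij: "i < n" "j < n" by auto
    have "(?P * gram n e * transpose_mat ?P) $$ (i, j)
        = (\<Sum>k<n. (\<Sum>l<n. P i l * B (e l) (e k)) * P j k)"
      using ij by (simp add: scalar_prod_def gram_def atLeast0LessThan)
    also have "\<dots> = (\<Sum>k<n. P j k * B (e' i) (e k))"
      using ij assms by (simp add: B_lc mult.commute)
    also have "\<dots> = gram n e' $$ (i, j)"
      using ij assms by (simp add: gram_def B_lc(2))
    finally show "gram n e' $$ (i, j) = (?P * gram n e * transpose_mat ?P) $$ (i, j)" by simp
  qed (auto simp: gram_def)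
  moreover have c: "?P \<in> carrier_mat n n" by simp
  moreover have "det (?P * gram n e * transpose_mat ?P) = det ?P * det (gram n e) * det (transpose_mat ?P)"
    using det_mult[OF mult_carrier_mat[OF c gram_carrier[of n e]], of "transpose_mat ?P"]
      det_mult[OF c gram_carrier[of n e]] by simp
  moreover have "det (transpose_mat ?P) = det ?P" by (rule det_transpose[OF c])
  ultimately show ?thesis by (simp only: power2_eq_square mult.commute mult.left_commute)
qed

lemma lbas_ex: "lbas n e L \<Longrightarrow> x \<in> L \<Longrightarrow> \<exists>c. x = lc n e c \<and> (\<forall>i<n. c i \<in> \<O>)"
  by (auto simp: lbas_def lat_def)

lemma lbas_family:
  assumes "lbas n e L" "\<forall>i<k. x i \<in> L"
  shows "\<exists>P. (\<forall>i<k. x i = lc n e (P i)) \<and> (\<forall>i<k. \<forall>j<n. P i j \<in> \<O>)"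
proof -
  have "\<forall>i\<in>{..<k}. \<exists>c. x i = lc n e c \<and> (\<forall>j<n. c j \<in> \<O>)"
    using lbas_ex[OF assms(1)] assms(2) by simp
  from bchoice[OF this] obtain P where "\<forall>i\<in>{..<k}. x i = lc n e (P i) \<and> (\<forall>j<n. P i j \<in> \<O>)" ..
  then show ?thesis by (intro exI[of _ P]) simp
qed

lemma lbas_span_family:
  assumes "lbas n e L" "\<forall>i<k. x i \<in> rational_span V L"
  shows "\<exists>P. \<forall>i<k. x i = lc n e (P i)"
proof -
  have "\<forall>i\<in>{..<k}. \<exists>c. x i = lc n e c"
    using assms(2) by (simp add: lbas_span[OF assms(1)] span_eq_lc)
  from bchoice[OF this] obtain P where "\<forall>i\<in>{..<k}. x i = lc n e (P i)" ..
  then show ?thesis by (intro exI[of _ P]) simp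
qed

lemma lattice_subset_span: "L \<subseteq> rational_span V L"
  unfolding rational_span_def by (rule vs.span_superset)

lemma base_change_inverse:
  assumes e: "ind n e" and P: "\<And>i. i < n \<Longrightarrow> e' i = lc n e (P i)" and Q: "\<And>i. i < n \<Longrightarrow> e i = lc n e' (Q i)"
  shows "det (mat n n (\<lambda>(i, j). Q i j)) * det (mat n n (\<lambda>(i, j). P i j)) = 1"
proof -
  let ?P = "mat n n (\<lambda>(i, j). P i j)" and ?Q = "mat n n (\<lambda>(i, j). Q i j)"
  have "?Q * ?P = 1\<^sub>m n"
  proof (rule eq_matI)
    fix i j assume "i < dim_row (1\<^sub>m n :: 'a mat)" "j < dim_col (1\<^sub>m n :: 'a mat)"
    then have ij: "i < n" "j < n" by auto
    have "e i = lc n (\<lambda>k. lc n e (P k)) (Q i)" using Q[OF ij(1)] P by (auto intro: lc_cong)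
    then have "lc n e (\<lambda>j. if j = i then 1 else 0) = lc n e (\<lambda>j. \<Sum>k<n. Q i k * P k j)"
      using ij by (simp add: lc_lc lc_single)
    from ind_eq[OF e this ij(2)] show "(?Q * ?P) $$ (i, j) = 1\<^sub>m n $$ (i, j)"
      using ij by (auto simp: scalar_prod_def atLeast0LessThan)
  qed auto
  then have "det (?Q * ?P) = 1" by simp
  then show ?thesis by (simp add: det_mult[of _ n])
qed

lemma gram_lattice_change:
  assumes "lbas n e L" "lbas n e' L"
  shows "\<exists>d. d \<noteq> 0 \<and> v d = 0 \<and> det (gram n e') = d\<^sup>2 * det (gram n e)"
proof -
  obtain P where P: "\<forall>i<n. e' i = lc n e (P i)" "\<forall>i<n. \<forall>j<n. P i j \<in> \<O>"
    using lbas_family[OF assms(1), of n e'] lbas_base[OF assms(2)] by auto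
  obtain Q where Q: "\<forall>i<n. e i = lc n e' (Q i)" "\<forall>i<n. \<forall>j<n. Q i j \<in> \<O>"
    using lbas_family[OF assms(2), of n e] lbas_base[OF assms(1)] by auto
  have ie: "ind n e" using assms(1) by (simp add: lbas_def)
  define d d' where "d = det (mat n n (\<lambda>(i, j). P i j))" and "d' = det (mat n n (\<lambda>(i, j). Q i j))"
  have dd: "d' * d = 1"
    unfolding d_def d'_def by (rule base_change_inverse[OF ie P(1)[rule_format] Q(1)[rule_format]])
  have "d \<in> \<O>" "d' \<in> \<O>" unfolding d_def d'_def using P Q by (auto intro!: det_in_O)
  moreover have "d \<noteq> 0" "d' \<noteq> 0" using dd by auto
  moreover have "v d' + v d = 0" using dd val_mult[of d' d] \<open>d \<noteq> 0\<close> \<open>d' \<noteq> 0\<close> by simp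
  ultimately have "d \<noteq> 0 \<and> v d = 0" by (auto simp: PP_iff)
  then show ?thesis using gram_change[of n e' e P, OF P(1)[rule_format]] d_def by blast
qed

lemma gram_span_change:
  assumes "lbas n e L" "lbas n e' L'" "rational_span V L = rational_span V L'"
  shows "\<exists>d. d \<noteq> 0 \<and> det (gram n e') = d\<^sup>2 * det (gram n e)"
proof -
  have "e' i \<in> rational_span V L" "e i \<in> rational_span V L'" if "i < n" for i
    using that lbas_base[OF assms(1)] lbas_base[OF assms(2)] assms(3)
      lattice_subset_span[of L] lattice_subset_span[of L'] by auto
  then obtain P Q where P: "\<forall>i<n. e' i = lc n e (P i)" and Q: "\<forall>i<n. e i = lc n e' (Q i)"
    using lbas_span_family[OF assms(1), of n e'] lbas_span_family[OF assms(2), of n e] by auto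
  have ie: "ind n e" using assms(1) by (simp add: lbas_def)
  have "det (mat n n (\<lambda>(i, j). Q i j)) * det (mat n n (\<lambda>(i, j). P i j)) = 1"
    by (rule base_change_inverse[OF ie P[rule_format] Q[rule_format]])
  then have "det (mat n n (\<lambda>(i, j). P i j)) \<noteq> 0" by auto
  then show ?thesis using gram_change[of n e' e P, OF P[rule_format]] by blast
qed

lemma det_gram_orth:
  assumes "orth n g"
  shows "det (gram n g) = (\<Prod>i<n. B (g i) (g i))"
proof -
  have "det (gram n g) = prod_list (diag_mat (gram n g))"
    by (rule det_upper_triangular[of _ n])
      (use assms in \<open>auto simp: upper_triangular_def gram_def orth_def\<close>)
  also have "\<dots> = (\<Prod>i<n. B (g i) (g i))"
    by (simp add: prod_list_diag_prod gram_def atLeast0LessThan)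
  finally show ?thesis .
qed

section \<open>Unimodular lattices\<close>

text \<open>Self-duality in diagonal form; \<open>is_H_unimod\<close> provides it for the target
  lattices.\<close>

definition unimod :: "nat \<Rightarrow> (nat \<Rightarrow> 'b) \<Rightarrow> 'b set \<Rightarrow> bool" where
  "unimod m g M \<longleftrightarrow> lbas m g M \<and> orth m g \<and> (\<forall>i<m. B (g i) (g i) \<noteq> 0 \<and> v (B (g i) (g i)) = 0)"

abbreviation dprod :: "nat \<Rightarrow> (nat \<Rightarrow> 'b) \<Rightarrow> 'a" where
  "dprod m g \<equiv> \<Prod>i<m. B (g i) (g i)"

lemma unimod_lbas: "unimod m g M \<Longrightarrow> lbas m g M"
  by (simp add: unimod_def)

lemma unimod_submod: "unimod m g M \<Longrightarrow> submod M"
  using unimod_lbas lbas_submod by blast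

lemma unimod_dprod: "unimod m g M \<Longrightarrow> dprod m g \<noteq> 0 \<and> v (dprod m g) = 0"
  by (rule prod_unit) (simp add: unimod_def)

lemma unimod_integral:
  assumes "unimod m g M" "x \<in> M" "y \<in> M"
  shows "B x y \<in> \<O>"
proof (rule B_osp_PP)
  show "B (g i) (g j) \<in> \<O>" if "i < m" "j < m" for i j
    using assms(1) that by (cases "i = j") (auto simp: unimod_def orth_def PP_iff)
qed (use assms in \<open>auto simp: unimod_def lbas_def\<close>)

text \<open>The product of the new norms differs from the old one by the square of a unit. It is a
  unit and its factors are integral, so every factor is a unit.\<close>

lemma unimod_change:
  assumes M: "unimod m g M" and g': "lbas m g' M" "orth m g'"
  shows "unimod m g' M" "\<chi> (dprod m g') = \<chi> (dprod m g)"
proof -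
  obtain d where d: "d \<noteq> 0" "v d = 0" "det (gram m g') = d\<^sup>2 * det (gram m g)"
    using gram_lattice_change[OF unimod_lbas[OF M] g'(1)] by blast
  have eq: "dprod m g' = d\<^sup>2 * dprod m g"
    using d(3) g'(2) M det_gram_orth by (simp add: unimod_def)
  then have u: "dprod m g' \<noteq> 0" "v (dprod m g') = 0"
    using unimod_dprod[OF M] d by (simp_all add: val_mult v_power)
  have nz: "B (g' i) (g' i) \<noteq> 0" if "i < m" for i using u that by auto
  have nn: "B (g' i) (g' i) \<in> \<O>" if "i < m" for i
    using unimod_integral[OF M] lbas_base[OF g'(1) that] by blast
  have "v (dprod m g') = v (B (g' i) (g' i)) + v (\<Prod>j\<in>{..<m}-{i}. B (g' j) (g' j))" if "i < m" for i
    using that nz by (subst prod.remove[of _ i]) (auto simp: val_mult)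
  moreover have "v (\<Prod>j\<in>{..<m}-{i}. B (g' j) (g' j)) \<ge> 0" for i
  proof -
    have "(\<Prod>j\<in>{..<m}-{i}. B (g' j) (g' j)) \<in> \<O>" using nn by (intro O_prod) auto
    moreover have "(\<Prod>j\<in>{..<m}-{i}. B (g' j) (g' j)) \<noteq> 0" using nz by auto
    ultimately show ?thesis by (simp add: PP_iff)
  qed
  moreover have "v (B (g' i) (g' i)) \<ge> 0" if "i < m" for i
    using nn[OF that] nz[OF that] by (simp add: PP_iff)
  ultimately have "v (B (g' i) (g' i)) = 0" if "i < m" for i
    using that u(2) by (smt (verit, best))
  then show "unimod m g' M" using g' nz by (simp add: unimod_def)
  show "\<chi> (dprod m g') = \<chi> (dprod m g)"
    unfolding eq using d unimod_dprod[OF M] by (intro chi_square_mult) (auto simp: unit_O)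
qed

abbreviation perp :: "'b set \<Rightarrow> 'b \<Rightarrow> 'b set" where "perp M u \<equiv> {y\<in>M. B y u = 0}"

text \<open>A vector of unit norm is primitive: with all coordinates in the maximal ideal its norm
  would be there too. It is therefore part of a basis, and Gram-Schmidt against it is
  integral.\<close>

lemma unimod_perp:
  assumes M: "unimod m g M" and u: "u \<in> M" "B u u \<noteq> 0" "v (B u u) = 0"
  shows "\<exists>k g'. m = Suc k \<and> unimod k g' (perp M u) \<and> \<chi> (dprod m g) = \<chi> (B u u) * \<chi> (dprod k g')"
proof -
  have L: "lbas m g M" using M by (rule unimod_lbas)
  obtain c where c: "u = lc m g c" "\<And>i. i < m \<Longrightarrow> c i \<in> \<O>" using lbas_obtain[OF L u(1)] by blast
  have "\<exists>k<m. c k \<notin> PP 1"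
  proof (rule ccontr)
    assume "\<not> ?thesis"
    then have "B u u \<in> PP 1" unfolding c(1) B_lc(1)
      using unimod_integral[OF M lbas_base[OF L] u(1)] by (auto intro!: PP_sum PP_mult_O' simp: c(1))
    then show False using u by (simp add: PP_iff)
  qed
  then obtain l where l: "l < m" "c l \<noteq> 0" "v (c l) = 0" using c unit_iff by blast
  then obtain k where k: "m = Suc k" by (cases m) auto
  obtain e where e: "lbas (Suc k) e M" "e k = u"
    using lbas_replace_swap[OF L, of c l k] c l k by auto
  have "B y (e k) / B (e k) (e k) \<in> \<O>" if "y \<in> M" for y
    using unimod_integral[OF M that u(1)] u e by (simp add: unit_divide_PP)
  then obtain e' where e': "lbas (Suc k) e' M" "e' k = u" "\<forall>i<k. B (e' i) u = 0"
    using lbas_orthogonalize_last[OF e(1)] e u by auto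
  have perp: "perp M u = osp k e'"
  proof
    show "perp M u \<subseteq> osp k e'"
    proof
      fix y assume "y \<in> perp M u"
      then obtain a where a: "y = lc (Suc k) e' a" "\<And>i. i < Suc k \<Longrightarrow> a i \<in> \<O>" "B y u = 0"
        using lbas_obtain[OF e'(1), of y] by auto
      have "B y u = a k * B u u" using a(1) e' by (simp add: lc_Suc B_simps B_lc)
      then have "y = lc k e' a" using a u by (simp add: lc_Suc)
      then show "y \<in> osp k e'" using a by (simp add: latI)
    qed
    show "osp k e' \<subseteq> perp M u"
    proof
      fix y assume "y \<in> osp k e'"
      moreover have "osp k e' \<subseteq> M" by (rule osp_subset) (use e' lbas_submod lbas_base in auto)
      ultimately show "y \<in> perp M u" using e' by (auto simp: lat_def B_lc)
    qed
  qed
  have "lbas k e' (perp M u)" using e'(1) ind_Suc unfolding perp by (simp add: lbas_def)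
  then obtain g' where g': "lbas k g' (perp M u)" "orth k g'" using orthogonal_basis by blast
  have g1: "lbas (Suc k) (g'(k := u)) M"
    using lbas_split_last[OF e'(1), of g'] g' e' perp by simp
  have o1: "orth (Suc k) (g'(k := u))"
    using g' lbas_base[OF g'(1)] by (intro orth_extend) auto
  have U: "unimod (Suc k) (g'(k := u)) M" "\<chi> (dprod (Suc k) (g'(k := u))) = \<chi> (dprod m g)"
    using unimod_change[of "Suc k" g M, OF _ g1 o1] M k by auto
  have dp: "dprod (Suc k) (g'(k := u)) = dprod k g' * B u u" by simp
  have U': "unimod k g' (perp M u)"
    unfolding unimod_def
  proof (intro conjI allI impI g')
    fix i assume "i < k"
    then show "B (g' i) (g' i) \<noteq> 0" "v (B (g' i) (g' i)) = 0"
      using U(1) by (auto simp: unimod_def dest!: spec[of _ i] split: if_splits)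
  qed
  have "\<chi> (dprod m g) = \<chi> (B u u) * \<chi> (dprod k g')"
    using U(2) dp chi_mult[of "dprod k g'" "B u u"] u unimod_dprod[OF U']
    by (simp add: unit_O mult.commute)
  then show ?thesis using U' k by blast
qed

section \<open>Families that are independent modulo the uniformizer, and their dual vectors\<close>

definition indm :: "nat \<Rightarrow> 'b set \<Rightarrow> (nat \<Rightarrow> 'b) \<Rightarrow> bool" where
  "indm n M x \<longleftrightarrow> (\<forall>c. (\<forall>i. c i \<in> \<O>) \<longrightarrow> lc n x c \<in> spow 1 M \<longrightarrow> (\<forall>i<n. c i \<in> PP 1))"

lemma indmI:
  assumes "\<And>c i. (\<And>i. c i \<in> \<O>) \<Longrightarrow> lc n x c \<in> spow 1 M \<Longrightarrow> i < n \<Longrightarrow> c i \<in> PP 1"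
  shows "indm n M x"
  using assms by (auto simp: indm_def)

lemma indmD:
  assumes "indm n M x" "lc n x c \<in> spow 1 M" "\<And>i. i < n \<Longrightarrow> c i \<in> \<O>" "i < n"
  shows "c i \<in> PP 1"
proof -
  define d where "d i = (if i < n then c i else 0)" for i
  have "\<forall>i. d i \<in> \<O>" using assms(3) by (simp add: d_def)
  moreover have "lc n x d \<in> spow 1 M" using assms(2) lc_cong[of n d c x x] by (simp add: d_def)
  ultimately have "d i \<in> PP 1" using assms(1,4) unfolding indm_def by blast
  then show ?thesis using assms(4) by (simp add: d_def)
qed

lemma indm_Suc: assumes "indm (Suc n) M x" shows "indm n M x"
proof (rule indmI)
  fix c i assume c: "\<And>i. c i \<in> \<O>" "lc n x c \<in> spow 1 M" "i < n"
  have "lc n x (c(n := 0)) = lc n x c" by (rule lc_cong) auto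
  then have "lc (Suc n) x (c(n := 0)) \<in> spow 1 M" using c by (simp add: lc_Suc)
  from indmD[OF assms this, of i] show "c i \<in> PP 1" using c by (auto split: if_splits)
qed

lemma indm_cong:
  assumes M: "submod M" and "\<And>i. i < n \<Longrightarrow> x i - y i \<in> spow 1 M" and x: "indm n M x"
  shows "indm n M y"
proof (rule indmI)
  fix c i assume c: "\<And>i. c i \<in> \<O>" "lc n y c \<in> spow 1 M" "i < n"
  have "lc n (\<lambda>i. x i - y i) c \<in> spow 1 M"
    by (rule lc_in_submod[OF submod_spow[OF M]]) (use assms(2) c in auto)
  then have "lc n y c + lc n (\<lambda>i. x i - y i) c \<in> spow 1 M" using submod_add[OF submod_spow[OF M]] c by blast
  moreover have "lc n y c + lc n (\<lambda>i. x i - y i) c = lc n x c" by (simp add: lc_diff_vectors)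
  ultimately show "c i \<in> PP 1" using indmD[OF x] c by simp
qed

lemma lc_extend: "n \<le> m \<Longrightarrow> lc n e c = lc m e (\<lambda>i. if i < n then c i else 0)"
  unfolding lc_def by (rule sum.mono_neutral_cong_left) auto

text \<open>A form of Nakayama's lemma, by exchange: the next vector must have a unit coordinate at
  a position not yet used, since otherwise it would be a combination of the preceding ones modulo
  \<open>\<pi>\<close>.\<close>

lemma indm_extend_basis:
  assumes "lbas m e M" "\<And>i. i < n \<Longrightarrow> x i \<in> M" "indm n M x"
  shows "n \<le> m \<and> (\<exists>e'. lbas m e' M \<and> (\<forall>i<n. e' i = x i))"
  using assms(2,3)
proof (induction n)
  case 0
  then show ?case using assms(1) by auto
next
  case (Suc n)
  have "n \<le> m \<and> (\<exists>e'. lbas m e' M \<and> (\<forall>i<n. e' i = x i))"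
    by (rule Suc.IH) (use Suc.prems indm_Suc in auto)
  then obtain e' where e': "n \<le> m" "lbas m e' M" "\<forall>i<n. e' i = x i" by auto
  obtain c where "x n = lc m e' c \<and> (\<forall>i<m. c i \<in> \<O>)"
    using lbas_ex[OF e'(2), of "x n"] Suc.prems(1) by auto
  then have c: "x n = lc m e' c" "\<And>i. i < m \<Longrightarrow> c i \<in> \<O>" by auto
  have "\<exists>k. n \<le> k \<and> k < m \<and> c k \<notin> PP 1"
  proof (rule ccontr)
    assume no: "\<not> ?thesis"
    have "lc n x c = lc m e' (\<lambda>i. if i < n then c i else 0)"
      using lc_extend[OF e'(1), of e' c] e'(3) lc_cong[of n c c x e'] by simp
    then have "lc n x c - x n = lc m e' (\<lambda>i. (if i < n then c i else 0) - c i)"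
      using c by (simp add: lc_diff)
    also have "\<dots> \<in> lat m e' (\<lambda>_. int 1)" using no by (intro latI) auto
    also have "lat m e' (\<lambda>_. int 1) = spow 1 M" using lbas_spow[OF e'(2), of 1] by simp
    \<comment> \<open>This relation modulo \<open>\<pi>\<close> has the unit -1 as its coefficient
      at n, contrary to independence.\<close>
    finally have "lc (Suc n) x (c(n := - 1)) \<in> spow 1 M"
      using lc_cong[of n "c(n := - 1)" c x x] by (simp add: lc_Suc)
    moreover have "(c(n := - 1)) i \<in> \<O>" if "i < Suc n" for i using that c e'(1) by (cases "i = n") auto
    ultimately have "(c(n := - 1)) n \<in> PP 1" by (intro indmD[OF Suc.prems(2)]) (simp_all only: lessI)
    then show False by (simp add: PP_iff[of 1])
  qed
  then obtain k where k: "n \<le> k" "k < m" "c k \<noteq> 0" "v (c k) = 0" using c unit_iff by blast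
  define e'' where "e'' = e'(k := x n) \<circ> Transposition.transpose n k"
  have "lbas m (e'(k := x n)) M" unfolding c(1) by (rule lbas_replace) (use e' c k in auto)
  then have "lbas m e'' M" unfolding e''_def by (rule lbas_swap) (use k in auto)
  moreover have "e'' i = x i" if "i < Suc n" for i
    using that e' k by (cases "i = n") (auto simp: e''_def transpose_def)
  ultimately show ?case using k by fastforce
qed

text \<open>Complete the family to a basis of \<open>M\<close>. Its coordinate functions are
  pairings with vectors of \<open>M\<close> because \<open>M\<close> is self-dual.\<close>

lemma dual_vectors:
  assumes M: "unimod m g M" and x: "\<And>i. i < n \<Longrightarrow> x i \<in> M" "indm n M x"
  shows "\<exists>y. (\<forall>j<n. y j \<in> M) \<and> (\<forall>i<n. \<forall>j<n. B (x i) (y j) = (if i = j then 1 else 0))"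
proof -
  have L: "lbas m g M" using M by (rule unimod_lbas)
  obtain e where e: "n \<le> m" "lbas m e M" "\<forall>i<n. e i = x i"
    using indm_extend_basis[OF L x] by blast
  obtain a where a: "\<forall>k<m. g k = lc m e (a k)" "\<forall>k<m. \<forall>j<m. a k j \<in> \<O>"
    using lbas_family[OF e(2), of m g] lbas_base[OF L] by auto
  \<comment> \<open>Chosen such that pairing \<open>g k\<close> with \<open>y j\<close> gives the
    j-th coordinate of \<open>g k\<close> in the basis \<open>e\<close>. The norms in the
    denominators are units, so \<open>y j\<close> stays in \<open>M\<close>.\<close>
  define y where "y j = lc m g (\<lambda>k. a k j / B (g k) (g k))" for j
  have "y j \<in> M" if "j < n" for j
    unfolding y_def lbas_mem[OF L] using that a e M by (simp add: unit_divide_PP unimod_def)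
  moreover have "B (x i) (y j) = (if i = j then 1 else 0)" if ij: "i < n" "j < n" for i j
  proof -
    obtain b where b: "x i = lc m g b" using lbas_ex[OF L x(1)[OF ij(1)]] by auto
    have gy: "B (g k) (y j) = a k j" if "k < m" for k
    proof -
      have "B (g k) (y j) = (\<Sum>l<m. a l j / B (g l) (g l) * B (g k) (g l))"
        by (simp add: y_def B_lc(2))
      also have "\<dots> = (\<Sum>l<m. if l = k then a k j else 0)"
        by (rule sum.cong) (use that M in \<open>auto simp: unimod_def orth_def\<close>)
      finally show ?thesis using that by simp
    qed
    have "lc m g b = lc m (\<lambda>k. lc m e (a k)) b" using a by (intro lc_cong) auto
    then have "lc m e (\<lambda>j. if j = i then 1 else 0) = lc m e (\<lambda>j. \<Sum>k<m. b k * a k j)"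
      using b e ij by (simp add: lc_lc lc_single)
    then have "(if j = i then 1 else 0) = (\<Sum>k<m. b k * a k j)"
      by (rule ind_eq[of m e _ _ j, rotated]) (use e ij in \<open>auto simp: lbas_def\<close>)
    then show ?thesis using gy by (auto simp: b B_lc(1))
  qed
  ultimately show ?thesis by blast
qed

section \<open>Lifting approximate isometries\<close>

lemma spow_B:
  assumes "unimod m g M" "x \<in> spow i M" "y \<in> spow j M"
  shows "B x y \<in> PP (int (i + j))"
proof -
  obtain x' y' where "x = \<pi> ^ i \<cdot> x'" "y = \<pi> ^ j \<cdot> y'" "x' \<in> M" "y' \<in> M" using assms by blast
  then have "B x y = \<pi> ^ (i + j) * B x' y'" "B x' y' \<in> \<O>"
    using unimod_integral[OF assms(1)] by (auto simp: B_simps power_add mult.assoc)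
  then show ?thesis by (simp add: pi_power_mem del: of_nat_add)
qed

lemma spow_mono: "submod M \<Longrightarrow> i \<le> j \<Longrightarrow> spow j M \<subseteq> spow i M"
proof
  fix x assume M: "submod M" and ij: "i \<le> j" "x \<in> spow j M"
  then obtain y where "y \<in> M" "x = \<pi> ^ i \<cdot> (\<pi> ^ (j - i) \<cdot> y)"
    by (auto simp: power_add[symmetric])
  moreover have "\<pi> ^ (j - i) \<cdot> y \<in> M" using submod_scale[OF M] \<open>y \<in> M\<close> by (simp add: PP_iff)
  ultimately show "x \<in> spow i M" by blast
qed

lemma B_cong_spow:
  assumes M: "unimod m g M" and xy: "x - x' \<in> spow N M" "y - y' \<in> spow N M" "x' \<in> M" "y \<in> M"
  shows "B x y - B x' y' \<in> PP (int N)"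
proof -
  have "B x y - B x' y' = B (x - x') y + B x' (y - y')" by (simp add: B_simps)
  moreover have "B (x - x') y \<in> PP (int N)" "B x' (y - y') \<in> PP (int N)"
    using spow_B[OF M xy(1), of y 0] spow_B[OF M _ xy(2), of x' 0] xy by auto
  ultimately show ?thesis by (simp add: PP_add)
qed

abbreviation upper :: "nat \<Rightarrow> (nat \<times> nat) set" where "upper n \<equiv> {(i, j). i \<le> j \<and> j < n}"

lemma finite_upper: "finite (upper n)"
  by (rule finite_subset[of _ "{..<n} \<times> {..<n}"]) auto

text \<open>The precision may differ from entry to entry, as it does for images of a stacked basis.
  By symmetry of the form the entries with i \<le> j suffice.\<close>

definition approx :: "nat \<Rightarrow> 'b set \<Rightarrow> (nat \<Rightarrow> nat \<Rightarrow> 'a) \<Rightarrow> (nat \<times> nat \<Rightarrow> nat) \<Rightarrow> (nat \<Rightarrow> 'b) set" where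
  "approx n M T c = {x \<in> Tup n M. \<forall>(i, j) \<in> upper n. B (x i) (x j) - T i j \<in> PP (int (c (i, j)))}"

lemma approx_iff: "x \<in> approx n M T c \<longleftrightarrow> x \<in> Tup n M \<and>
    (\<forall>i j. i \<le> j \<longrightarrow> j < n \<longrightarrow> B (x i) (x j) - T i j \<in> PP (int (c (i, j))))"
  by (auto simp: approx_def)

lemma card_quot_spow_Tup:
  assumes "lbas m g M" "i \<le> j"
  shows "card (quot (Tup n (spow i M)) (Tup n (spow j M))) = q ^ ((j - i) * m * n)"
    "finite (quot (Tup n (spow i M)) (Tup n (spow j M)))"
proof -
  have ind: "ind m g" using assms by (simp add: lbas_def)
  have "nat (int j - int i) = j - i" by simp
  then have 1: "card (quot (spow i M) (spow j M)) = q ^ (m * (j - i))" "finite (quot (spow i M) (spow j M))"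
    using quot_lat[OF ind, of "\<lambda>_. int i" "\<lambda>_. int j"] assms(2)
    by (simp_all only: lbas_spow[OF assms(1)]) auto
  have sg: "subgrp (spow j M)" using submod_subgrp submod_spow lbas_submod assms by blast
  have "(q ^ (m * (j - i))) ^ n = q ^ ((j - i) * m * n)"
    by (simp add: power_mult[symmetric] mult.commute mult.left_commute)
  then show "card (quot (Tup n (spow i M)) (Tup n (spow j M))) = q ^ ((j - i) * m * n)"
    "finite (quot (Tup n (spow i M)) (Tup n (spow j M)))"
    using card_quot_TupI[of n "\<lambda>_. spow j M" "\<lambda>_. spow i M"] 1 sg by simp_all
qed

text \<open>Lowering the largest of the exponents \<open>c (i, j)\<close> by one multiplies the number of solutions in
  a fixed class modulo \<open>\<varpi>\<close> by \<open>q\<close>: translating one vector by a multiple of \<open>\<varpi>\<^sup>d\<close> of a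
  dual vector changes a single entry of the Gram matrix modulo \<open>\<varpi>\<^sup>d\<^sup>+\<^sup>1\<close>.\<close>

lemma count_lifts:
  assumes M: "unimod m g M" and x0: "x0 \<in> approx n M T (\<lambda>_. 1)" "indm n M x0"
    and c: "\<And>p. p \<in> upper n \<Longrightarrow> 1 \<le> c p \<and> c p \<le> N" and N: "1 \<le> N"
  shows "card (quot {x \<in> approx n M T c. x - x0 \<in> Tup n (spow 1 M)} (Tup n (spow N M))) *
      q ^ (\<Sum>p\<in>upper n. c p - 1) = q ^ ((N - 1) * m * n)"
  using c
proof (induction "\<Sum>p\<in>upper n. c p - 1" arbitrary: c)
  case 0
  have L: "lbas m g M" and sM: "submod M" using M unimod_lbas unimod_submod by blast+
  have c1: "c p = 1" if "p \<in> upper n" for p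
  proof -
    have "c p - 1 = 0" using 0(1) sum_eq_0_iff[OF finite_upper, of "\<lambda>p. c p - 1" n] that by auto
    then show ?thesis using 0(2)[OF that] by simp
  qed
  have x0M: "x0 \<in> Tup n M" using x0 by (simp add: approx_def)
  have sub: "Tup n (spow 1 M) \<subseteq> Tup n M" using spow_subset[OF sM, of 1] by (auto simp: TupI_def)
  have mem: "x0 + k \<in> {x \<in> approx n M T c. x - x0 \<in> Tup n (spow 1 M)}" if k: "k \<in> Tup n (spow 1 M)" for k
  proof -
    have "B ((x0 + k) i) ((x0 + k) j) - T i j \<in> PP (int (c (i, j)))" if ij: "i \<le> j" "j < n" for i j
    proof -
      have "B ((x0 + k) i) ((x0 + k) j) - B (x0 i) (x0 j) \<in> PP (int 1)"
      proof (rule B_cong_spow[OF M])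
        have "k j \<in> M" "x0 j \<in> M" using k sub x0M ij by (auto simp: TupI_def)
        then show "(x0 + k) j \<in> M" using submod_add[OF sM] by simp
      qed (use ij k x0M in \<open>auto simp: TupI_def\<close>)
      moreover have "B (x0 i) (x0 j) - T i j \<in> PP 1" using x0 ij by (simp add: approx_iff)
      ultimately have "(B ((x0 + k) i) ((x0 + k) j) - B (x0 i) (x0 j)) + (B (x0 i) (x0 j) - T i j) \<in> PP 1"
        by (simp only: PP_add of_nat_1)
      then show ?thesis using c1[of "(i, j)"] ij by simp
    qed
    moreover have "k \<in> Tup n M" using k sub by blast
    ultimately show ?thesis using k x0M submod_add[OF sM] by (simp add: approx_iff TupI_def)
  qed
  have sg: "subgrp (Tup n (spow N M))" by (intro subgrp_TupI submod_subgrp submod_spow sM)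
  have "card (quot (Tup n (spow 1 M)) (Tup n (spow N M))) =
      card (quot {x \<in> approx n M T c. x - x0 \<in> Tup n (spow 1 M)} (Tup n (spow N M)))"
  proof (rule quot_card_cong(1)[OF sg sg, where f = "\<lambda>k. x0 + k"])
    show "\<exists>x\<in>Tup n (spow 1 M). x0 + x - y \<in> Tup n (spow N M)"
      if "y \<in> {x \<in> approx n M T c. x - x0 \<in> Tup n (spow 1 M)}" for y
      using that subgrp_zero[OF sg] by (intro bexI[of _ "y - x0"]) auto
  qed (use mem in auto)
  then have "card (quot {x \<in> approx n M T c. x - x0 \<in> Tup n (spow 1 M)} (Tup n (spow N M))) =
      q ^ ((N - 1) * m * n)" using card_quot_spow_Tup(1)[OF L N, of n] by (simp only:)
  then show ?case by (simp only: 0(1)[symmetric] power_0 mult_1_right)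
next
  case (Suc s)
  have L: "lbas m g M" and sM: "submod M" using M unimod_lbas unimod_submod by blast+
  have x0M: "x0 \<in> Tup n M" using x0 by (simp add: approx_def)
  have "upper n \<noteq> {}"
  proof
    assume "upper n = {}"
    then have "(\<Sum>p\<in>upper n. c p - 1) = 0" by (simp only: sum.empty)
    then show False using Suc(2) by (simp only: nat.distinct)
  qed
  \<comment> \<open>A largest exponent is lowered: the translation below is controlled modulo
    \<varpi>^(d+1), which by maximality is enough for all the other conditions.\<close>
  define cm where "cm = Max (c ` upper n)"
  have "cm \<in> c ` upper n" unfolding cm_def using finite_upper \<open>upper n \<noteq> {}\<close> by (intro Max_in) auto
  then obtain i0 j0 where p0: "(i0, j0) \<in> upper n" "c (i0, j0) = cm" by auto
  have cmax: "c p \<le> cm" if "p \<in> upper n" for p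
    unfolding cm_def using that finite_upper by (intro Max_ge) auto
  have "\<exists>p\<in>upper n. c p - 1 \<noteq> 0"
    using Suc(2) by (metis (no_types, lifting) nat.distinct(1) sum.neutral)
  then obtain p where "p \<in> upper n" "c p \<ge> 2" by fastforce
  then have "cm \<ge> 2" using cmax[of p] by simp
  define d where "d = cm - 1"
  have d: "cm = Suc d" "1 \<le> d" using \<open>cm \<ge> 2\<close> by (auto simp: d_def)
  define c' where "c' = c((i0, j0) := d)"
  have c': "1 \<le> c' p \<and> c' p \<le> N" if "p \<in> upper n" for p
    using Suc.prems[OF that] Suc.prems[OF p0(1)] p0 d by (auto simp: c'_def)
  have cle: "c p \<le> Suc d" if "p \<in> upper n" for p using cmax[OF that] d by simp
  have ssum: "s = (\<Sum>p\<in>upper n. c' p - 1)"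
  proof -
    have "(\<Sum>p\<in>upper n. c p - 1) = (c (i0, j0) - 1) + (\<Sum>p\<in>upper n - {(i0, j0)}. c p - 1)"
      using p0 finite_upper by (intro sum.remove) auto
    moreover have "(\<Sum>p\<in>upper n. c' p - 1) = (c' (i0, j0) - 1) + (\<Sum>p\<in>upper n - {(i0, j0)}. c' p - 1)"
      using p0 finite_upper by (intro sum.remove) auto
    moreover have "(\<Sum>p\<in>upper n - {(i0, j0)}. c' p - 1) = (\<Sum>p\<in>upper n - {(i0, j0)}. c p - 1)"
      by (rule sum.cong) (auto simp: c'_def)
    ultimately show ?thesis using Suc(2) p0 d by (simp add: c'_def)
  qed
  have ij0: "i0 \<le> j0" "j0 < n" using p0 by auto
  define K where "K = Tup n (spow N M)"
  have sg: "subgrp K" unfolding K_def by (intro subgrp_TupI submod_subgrp submod_spow sM)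
  define E where "E c = {x \<in> approx n M T c. x - x0 \<in> Tup n (spow 1 M)}" for c
  define F where "F = {x \<in> Tup n M. x - x0 \<in> Tup n (spow 1 M)}"
  have EF: "E c \<subseteq> F" for c by (auto simp: E_def F_def approx_def)
  have EM: "x i \<in> M" "x i - x0 i \<in> spow 1 M" if "x \<in> F" "i < n" for x i
    using that by (auto simp: F_def TupI_def)
  have IH: "card (quot (E c') K) * q ^ s = q ^ ((N - 1) * m * n)"
    using Suc.hyps(1)[OF ssum] c' ssum unfolding E_def K_def by simp
  \<comment> \<open>The digit of the entry (i0, j0) that is free under the exponents
    \<open>c'\<close> and must vanish under \<open>c\<close>.\<close>
  define h where "h x = (B (x i0) (x j0) - T i0 j0) / \<pi> ^ d" for x
  have E_iff: "x \<in> E c \<longleftrightarrow> x \<in> E c' \<and> h x \<in> PP 1" for x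
  proof -
    have 1: "h x \<in> PP 1 \<longleftrightarrow> B (x i0) (x j0) - T i0 j0 \<in> PP (int (c (i0, j0)))"
      using p0 d by (simp add: h_def PP_divide_iff)
    have 2: "B (x i0) (x j0) - T i0 j0 \<in> PP (int (c (i0, j0))) \<Longrightarrow> B (x i0) (x j0) - T i0 j0 \<in> PP (int d)"
      by (rule PP_mono[of _ "int (c (i0, j0))"]) (use p0 d in auto)
    show ?thesis unfolding 1 E_def approx_iff c'_def using 2 ij0 by auto
  qed
  have x0i: "x0 i \<in> M" if "i < n" for i using x0M that by (simp add: TupI_def)
  from dual_vectors[OF M x0i x0(2)] obtain y where yy: "\<forall>j<n. y j \<in> M"
    "\<forall>i<n. \<forall>j<n. B (x0 i) (y j) = (if i = j then 1 else 0)" by blast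
  have y: "y j \<in> M" "i < n \<Longrightarrow> B (x0 i) (y j) = (if i = j then 1 else 0)" if "j < n" for i j
    using yy that by simp_all
  have i0n: "i0 < n" using ij0 by simp
  have fiber: "card (quot (E c) K) = card (quot {x \<in> E c'. h x - z \<in> PP 1} K)" if z: "z \<in> \<O>" for z
  proof -
    \<comment> \<open>On the diagonal, adding w to x changes the norm by 2 B x w + B w w, hence the
      division by 2.\<close>
    define s where "s = (if i0 = j0 then z / 2 else z)"
    have sO: "s \<in> \<O>" using z by (simp add: s_def unit_divide_PP)
    define w where "w = (\<pi> ^ d * s) \<cdot> y i0"
    \<comment> \<open>Only the vector with index j0 is moved, in the direction dual to x_i0. To
      first order this changes exactly the entry (i0, j0).\<close>
    define W where "W = (\<lambda>k. if k = j0 then w else 0)"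
    have w: "w \<in> spow d M" unfolding w_def using sO y(1)[OF i0n] submod_scale[OF sM]
      by (auto simp flip: vs.scale_scale)
    have w1: "w \<in> spow 1 M" using w spow_mono[OF sM d(2)] by blast
    have wM: "w \<in> M" using w spow_subset[OF sM] by blast
    have Bw: "B (x k) w - (if k = i0 then \<pi> ^ d * s else 0) \<in> PP (int (Suc d))"
      if "x \<in> F" "k < n" for x k
    proof -
      have "B (x k) (y i0) - B (x0 k) (y i0) \<in> PP (int 1)"
      proof (rule B_cong_spow[OF M EM(2)[OF that]])
        show "y i0 - y i0 \<in> spow 1 M"
          using submod_zero[OF submod_spow[OF sM], of 1] by (simp only: diff_self)
      qed (use that x0i y i0n in auto)
      then have "(\<pi> ^ d * s) * (B (x k) (y i0) - (if k = i0 then 1 else 0)) \<in> PP (int d + 1)"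
        using y(2)[OF i0n that(2)] sO by (intro PP_mult) (auto simp: pi_power_mem)
      then show ?thesis by (cases "k = i0") (auto simp: w_def B_simps algebra_simps)
    qed
    \<comment> \<open>The second-order term has valuation at least 2d, which is at least d + 1
      because d is positive.\<close>
    have Bww: "B w w \<in> PP (int (Suc d))"
      using spow_B[OF M w w] PP_mono[of "int (Suc d)" "int (d + d)"] d by simp
    have change: "B ((x + W) k) ((x + W) l) - B (x k) (x l) - (if (k, l) = (i0, j0) then \<pi> ^ d * z else 0)
        \<in> PP (int (Suc d))" if x: "x \<in> F" and kl: "k \<le> l" "l < n" for x k l
    proof -
      have kn: "k < n" using kl by simp
      consider "l = j0" "k \<noteq> j0" | "k = j0" "l \<noteq> j0" | "k = j0" "l = j0" | "k \<noteq> j0" "l \<noteq> j0" by blast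
      then show ?thesis
      proof cases
        case 1
        then have "B ((x + W) k) ((x + W) l) - B (x k) (x l) - (if (k, l) = (i0, j0) then \<pi> ^ d * z else 0)
            = B (x k) w - (if k = i0 then \<pi> ^ d * s else 0)"
          by (auto simp: W_def B_simps s_def)
        then show ?thesis using Bw[OF x kn] by simp
      next
        case 2
        then have "l \<noteq> i0" using ij0 kl by auto
        then have "B ((x + W) k) ((x + W) l) - B (x k) (x l) - (if (k, l) = (i0, j0) then \<pi> ^ d * z else 0)
            = B (x l) w - (if l = i0 then \<pi> ^ d * s else 0)"
          using 2 B_sym[of "x l"] by (auto simp: W_def B_simps)
        then show ?thesis using Bw[OF x kl(2)] by simp
      next
        case 3
        have "\<pi> ^ d * z = 2 * (\<pi> ^ d * s)" if "i0 = j0" using that by (simp add: s_def)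
        then have "B ((x + W) k) ((x + W) l) - B (x k) (x l) - (if (k, l) = (i0, j0) then \<pi> ^ d * z else 0)
            = (B (x k) w - (if k = i0 then \<pi> ^ d * s else 0)) + (B (x k) w - (if k = i0 then \<pi> ^ d * s else 0)) + B w w"
          using 3 B_sym[of "x k" w] by (auto simp: W_def B_simps)
        then show ?thesis using Bw[OF x kn] Bww by (simp only: PP_add)
      next
        case 4
        then show ?thesis using ij0 by (auto simp: W_def)
      qed
    qed
    have hW: "h (x + W) - (h x + z) \<in> PP 1" if x: "x \<in> F" for x
    proof -
      have "(B ((x + W) i0) ((x + W) j0) - B (x i0) (x j0) - \<pi> ^ d * z) / \<pi> ^ d \<in> PP 1"
        using change[OF x ij0] by (simp add: PP_divide_iff)
      then show ?thesis by (simp add: h_def field_simps)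
    qed
    have FW: "x + W \<in> F" "x - W \<in> F" if x: "x \<in> F" for x
    proof -
      have "x + W \<in> Tup n M" "x - W \<in> Tup n M"
        using x wM submod_add[OF sM] submod_diff[OF sM] ij0 by (auto simp: F_def TupI_def W_def)
      moreover have "(x k - x0 k) + w \<in> spow 1 M" "(x k - x0 k) - w \<in> spow 1 M" if "k < n" for k
        using EM(2)[OF x that] w1 submod_add[OF submod_spow[OF sM]] submod_diff[OF submod_spow[OF sM]]
        by blast+
      then have "x + W - x0 \<in> Tup n (spow 1 M)" "x - W - x0 \<in> Tup n (spow 1 M)"
        using x ij0 by (auto simp: F_def TupI_def W_def algebra_simps)
      ultimately show "x + W \<in> F" "x - W \<in> F" by (auto simp: F_def)
    qed
    have translate: "x + W \<in> E c' \<longleftrightarrow> x \<in> E c'" if x: "x \<in> F" for x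
    proof -
      have "B ((x + W) k) ((x + W) l) - T k l \<in> PP (int (c' (k, l))) \<longleftrightarrow> B (x k) (x l) - T k l \<in> PP (int (c' (k, l)))"
        if kl: "k \<le> l" "l < n" for k l
      proof -
        \<comment> \<open>No condition is finer than \<varpi>^(d+1), and the one at (i0, j0) has
          just been lowered to \<varpi>^d, so it does not notice the shift by \<pi>^d z.\<close>
        have cle': "int (c' (k, l)) \<le> int (Suc d)" using cle[of "(k, l)"] kl by (auto simp: c'_def)
        have "(if (k, l) = (i0, j0) then \<pi> ^ d * z else 0) \<in> PP (int (c' (k, l)))"
          using z by (auto simp: c'_def pi_power_mem)
        moreover note PP_mono[OF cle' change[OF x kl]]
        ultimately have "(if (k, l) = (i0, j0) then \<pi> ^ d * z else 0) +
           (B ((x + W) k) ((x + W) l) - B (x k) (x l) - (if (k, l) = (i0, j0) then \<pi> ^ d * z else 0))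
            \<in> PP (int (c' (k, l)))"
          by (intro PP_add)
        moreover have "e + (a - b - e) = a - b" for e a b :: 'a by simp
        ultimately have "B ((x + W) k) ((x + W) l) - B (x k) (x l) \<in> PP (int (c' (k, l)))" by (simp only:)
        then have "(B (x k) (x l) - T k l) + (B ((x + W) k) ((x + W) l) - B (x k) (x l)) \<in> PP (int (c' (k, l)))
           \<longleftrightarrow> B (x k) (x l) - T k l \<in> PP (int (c' (k, l)))"
          by (rule PP_add_iff)
        moreover have "(b - t) + (a - b) = a - t" for a b t :: 'a by simp
        ultimately show ?thesis by (simp only:)
      qed
      then show ?thesis using x FW(1)[OF x] by (auto simp: E_def F_def approx_iff)
    qed
    have unshift: "x - W \<in> E c'" if "x \<in> E c'" for x
    proof -
      have "x - W \<in> F" using FW that EF by blast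
      from translate[OF this] show ?thesis using that by simp
    qed
    show ?thesis
    proof (rule quot_card_cong(1)[OF sg sg, where f = "\<lambda>x. x + W"])
      show "x + W \<in> {x \<in> E c'. h x - z \<in> PP 1}" if "x \<in> E c" for x
      proof -
        have x: "x \<in> E c'" "h x \<in> PP 1" using E_iff that by auto
        have xF: "x \<in> F" using x(1) EF by blast
        have "(h (x + W) - (h x + z)) + h x \<in> PP 1" using hW[OF xF] x(2) by (rule PP_add)
        then show ?thesis using translate[OF xF] x(1) by (simp add: algebra_simps)
      qed
      show "\<exists>x\<in>E c. x + W - y \<in> K" if "y \<in> {x \<in> E c'. h x - z \<in> PP 1}" for y
      proof -
        have y: "y \<in> E c'" "h y - z \<in> PP 1" using that by auto
        have yF: "y - W \<in> F" using unshift[OF y(1)] EF by blast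
        have "(h y - z) - (h (y - W + W) - (h (y - W) + z)) \<in> PP 1"
          using y(2) hW[OF yF] by (rule PP_diff)
        then have "h (y - W) \<in> PP 1" by simp
        then have "y - W \<in> E c" using E_iff unshift[OF y(1)] by blast
        then show ?thesis using subgrp_zero[OF sg] by (intro bexI[of _ "y - W"]) auto
      qed
    qed auto
  qed
  have fin: "finite (quot {x \<in> E c'. h x - z \<in> PP 1} K)" for z
  proof (rule quot_mono)
    show "{x \<in> E c'. h x - z \<in> PP 1} \<subseteq> Tup n M" by (auto simp: E_def approx_def)
    show "finite (quot (Tup n M) K)"
      using card_quot_spow_Tup(2)[OF L, of 0 N n] by (simp add: K_def)
  qed
  have "card (quot (E c') K) = card (quot \<O> (PP 1)) * card (quot (E c) K)"
  proof (rule quot_fib_const(1)[where g = h])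
    show "h x \<in> \<O>" if "x \<in> E c'" for x
    proof -
      have "B (x i0) (x j0) - T i0 j0 \<in> PP (int (c' (i0, j0)))" using that ij0 by (simp add: E_def approx_iff)
      then have "B (x i0) (x j0) - T i0 j0 \<in> PP (int d)" by (simp add: c'_def)
      then show ?thesis by (simp add: h_def PP_divide_iff)
    qed
    show "h x - h x' \<in> PP 1" if "x \<in> E c'" "x' \<in> E c'" "x - x' \<in> K" for x x'
    proof -
      have "B (x i0) (x j0) - B (x' i0) (x' j0) \<in> PP (int N)"
      proof (rule B_cong_spow[OF M])
        have "x \<in> F" "x' \<in> F" using that EF by blast+
        then show "x' i0 \<in> M" "x j0 \<in> M" using EM ij0 by auto
      qed (use that ij0 in \<open>auto simp: K_def TupI_def\<close>)
      moreover have "int (Suc d) \<le> int N" using Suc.prems[OF p0(1)] p0 d by simp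
      ultimately have "(B (x i0) (x j0) - B (x' i0) (x' j0)) / \<pi> ^ d \<in> PP 1"
        using PP_mono by (simp add: PP_divide_iff)
      then show ?thesis by (simp add: h_def diff_divide_distrib)
    qed
  qed (use sg fin finite_quot_residue fiber in auto)
  then have "card (quot (E c') K) = q * card (quot (E c) K)" by (simp add: residue_card_def)
  then have "card (quot (E c) K) * q ^ Suc s = q ^ ((N - 1) * m * n)"
    using IH by (simp add: mult_ac)
  then show ?case unfolding Suc(2) E_def K_def .
qed

lemma finite_quot_approx:
  assumes "unimod m g M" "X \<subseteq> Tup n M"
  shows "finite (quot X (Tup n (spow N M)))"
  using card_quot_spow_Tup(2)[OF unimod_lbas[OF assms(1)], of 0 N n] quot_mono[OF assms(2)] by simp

lemma subgrp_Tup_spow: "submod M \<Longrightarrow> subgrp (Tup n (spow N M))"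
  by (intro subgrp_TupI submod_subgrp submod_spow)

text \<open>By \<open>count_lifts\<close> every class modulo \<open>\<varpi>\<close> has the same
  number of lifts. Stating it with products on both sides avoids division of natural
  numbers.\<close>

lemma count_approx:
  assumes M: "unimod m g M" and c: "\<And>p. p \<in> upper n \<Longrightarrow> 1 \<le> c p \<and> c p \<le> N" and N: "1 \<le> N"
  shows "card (quot {x \<in> approx n M T c. indm n M x} (Tup n (spow N M))) * q ^ (\<Sum>p\<in>upper n. c p - 1) =
    card (quot {x \<in> approx n M T (\<lambda>_. 1). indm n M x} (Tup n (spow 1 M))) * q ^ ((N - 1) * m * n)"
proof -
  have sM: "submod M" using M by (rule unimod_submod)
  let ?K = "Tup n (spow N M)" and ?K1 = "Tup n (spow 1 M)"
  let ?E = "{x \<in> approx n M T c. indm n M x}" and ?E1 = "{x \<in> approx n M T (\<lambda>_. 1). indm n M x}"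
  define C where "C = q ^ ((N - 1) * m * n) div q ^ (\<Sum>p\<in>upper n. c p - 1)"
  have fib: "card (quot {x \<in> ?E. x - z \<in> ?K1} ?K) * q ^ (\<Sum>p\<in>upper n. c p - 1) = q ^ ((N - 1) * m * n)"
    if z: "z \<in> ?E1" for z
  proof -
    have "indm n M x" if "x - z \<in> ?K1" for x
      by (rule indm_cong[OF sM, where x = z])
        (use that z subgrp_diff_swap[OF submod_subgrp[OF submod_spow[OF sM, of 1]]] in \<open>auto simp: TupI_def\<close>)
    then have "{x \<in> ?E. x - z \<in> ?K1} = {x \<in> approx n M T c. x - z \<in> ?K1}" by auto
    moreover have "card (quot {x \<in> approx n M T c. x - z \<in> ?K1} ?K) * q ^ (\<Sum>p\<in>upper n. c p - 1) = q ^ ((N - 1) * m * n)"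
      by (rule count_lifts[OF M _ _ c N]) (use z in auto)
    ultimately show ?thesis by (simp only:)
  qed
  have qpos: "q ^ k > 0" for k using q_gt_1 by simp
  have fibC: "card (quot {x \<in> ?E. x - z \<in> ?K1} ?K) = C" if "z \<in> ?E1" for z
    unfolding C_def fib[OF that, symmetric] using q_gt_1 by simp
  have EE1: "?E \<subseteq> ?E1"
  proof
    fix x assume x: "x \<in> ?E"
    have "B (x i) (x j) - T i j \<in> PP 1" if "i \<le> j" "j < n" for i j
      by (rule PP_mono[of 1 "int (c (i, j))"]) (use x c[of "(i, j)"] that in \<open>auto simp: approx_iff\<close>)
    then show "x \<in> ?E1" using x by (auto simp: approx_iff)
  qed
  have card: "card (quot ?E ?K) = card (quot ?E1 ?K1) * C"
  proof (rule quot_fib_const(1)[where g = "\<lambda>x. x"])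
    show "finite (quot ?E1 ?K1)" by (rule finite_quot_approx[OF M]) (auto simp: approx_def)
    show "finite (quot {x \<in> ?E. x - z \<in> ?K1} ?K)" for z
      by (rule finite_quot_approx[OF M]) (auto simp: approx_def)
    show "x - y \<in> ?K1" if "x - y \<in> ?K" for x y
      using that spow_mono[OF sM N] by (auto simp: TupI_def)
  qed (use subgrp_Tup_spow[OF sM, of n] subgrp_Tup_spow[OF sM, of n 1] EE1 fibC in auto)
  \<comment> \<open>That \<open>C\<close> is an exact quotient is known only through an actual
    class, so the empty case is separate.\<close>
  show ?thesis
  proof (cases "?E1 = {}")
    case True
    then have "?E = {}" using EE1 by blast
    then show ?thesis by (simp only: True quot_def image_empty card.empty mult_0)
  next
    case False
    then obtain z where z: "z \<in> ?E1" by blast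
    have "C * q ^ (\<Sum>p\<in>upper n. c p - 1) = q ^ ((N - 1) * m * n)"
      using fib[OF z] fibC[OF z] by (simp only:)
    then show ?thesis using card by (simp only: mult.assoc)
  qed
qed

section \<open>Counting isometric embeddings modulo the uniformizer\<close>

text \<open>Lifts of the isometric embeddings into M / \<varpi>M of the diagonal form with entries
  \<open>T i\<close>. Zeros of the form modulo \<varpi> are allowed among the entries, so
  injectivity is a condition of its own.\<close>

definition emb :: "nat \<Rightarrow> 'b set \<Rightarrow> (nat \<Rightarrow> 'a) \<Rightarrow> (nat \<Rightarrow> 'b) set" where
  "emb n M T = {x \<in> approx n M (\<lambda>i j. if i = j then T i else 0) (\<lambda>_. 1). indm n M x}"

lemma emb_iff: "x \<in> emb n M T \<longleftrightarrow> x \<in> Tup n M \<and> indm n M x \<and>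
    (\<forall>i j. i \<le> j \<longrightarrow> j < n \<longrightarrow> B (x i) (x j) - (if i = j then T i else 0) \<in> PP 1)"
  by (auto simp: emb_def approx_iff)

lemma emb_cong:
  assumes M: "unimod m g M" and x: "x \<in> Tup n M" "y \<in> Tup n M" "x - y \<in> Tup n (spow 1 M)"
  shows "x \<in> emb n M T \<longleftrightarrow> y \<in> emb n M T"
proof -
  have *: "y \<in> emb n M T" if xy: "x \<in> emb n M T" "y \<in> Tup n M" "x - y \<in> Tup n (spow 1 M)" for x y
  proof -
    have d: "x i - y i \<in> spow 1 M" if "i < n" for i using xy that by (auto simp: TupI_def)
    have xM: "x i \<in> M" "y i \<in> M" if "i < n" for i using xy that by (auto simp: emb_iff TupI_def)
    have "indm n M y" by (rule indm_cong[OF unimod_submod[OF M] d]) (use xy in \<open>auto simp: emb_iff\<close>)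
    moreover have "B (y i) (y j) - (if i = j then T i else 0) \<in> PP 1" if "i \<le> j" "j < n" for i j
    proof -
      have "B (x i) (x j) - B (y i) (y j) \<in> PP (int 1)"
        by (rule B_cong_spow[OF M]) (use d xM that in auto)
      moreover have "B (x i) (x j) - (if i = j then T i else 0) \<in> PP 1" using xy(1) that by (simp add: emb_iff)
      ultimately show ?thesis using PP_diff_cong[of "B (x i) (x j)" "B (y i) (y j)" 1] by simp
    qed
    ultimately show ?thesis using xy by (simp add: emb_iff)
  qed
  have "y - x \<in> Tup n (spow 1 M)"
    using x(3) subgrp_diff_swap[OF subgrp_Tup_spow[OF unimod_submod[OF M]]] by blast
  then show ?thesis using *[of x y] *[of y x] x by blast
qed

lemma not_spow_1_unit: "unimod m g M \<Longrightarrow> v (B u u) = 0 \<Longrightarrow> B u u \<noteq> 0 \<Longrightarrow> u \<notin> spow 1 M"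
  using spow_B[of m g M u 1 u 1] by (auto simp: PP_iff)

lemma indm_last:
  assumes "submod M" "indm (Suc n) M x" "x n \<in> M"
  shows "x n \<notin> spow 1 M"
proof
  assume "x n \<in> spow 1 M"
  then have "lc (Suc n) x (\<lambda>j. if j = n then 1 else 0) \<in> spow 1 M" by (simp add: lc_single)
  then have "(\<lambda>j. if j = n then 1 else (0::'a)) n \<in> PP 1"
    using indmD[OF assms(2), of "\<lambda>j. if j = n then 1 else 0" n] by auto
  then show False by (simp add: PP_iff)
qed

lemma indm_single:
  assumes M: "submod M" and x: "x 0 \<in> M" "x 0 \<notin> spow 1 M"
  shows "indm 1 M x"
proof (rule indmI)
  fix c i assume c: "\<And>i. c i \<in> \<O>" "lc 1 x c \<in> spow 1 M" "i < (1::nat)"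
  show "c i \<in> PP 1"
  proof (rule ccontr)
    assume "c i \<notin> PP 1"
    then have "c 0 \<noteq> 0" "v (c 0) = 0" using c unit_iff[of "c 0"] by auto
    have "inverse (c 0) \<cdot> c 0 \<cdot> x 0 \<in> spow 1 M"
    proof (rule submod_scale[OF submod_spow[OF M]])
      show "c 0 \<cdot> x 0 \<in> spow 1 M" using c(2) by (simp add: lc_def)
    qed (use \<open>c 0 \<noteq> 0\<close> \<open>v (c 0) = 0\<close> in \<open>simp add: PP_iff v_inverse\<close>)
    then show False using x \<open>c 0 \<noteq> 0\<close> by simp
  qed
qed

lemma spow_1_iff: "x \<in> spow 1 M \<longleftrightarrow> inverse \<pi> \<cdot> x \<in> M"
proof
  assume "inverse \<pi> \<cdot> x \<in> M"
  then have "\<pi> ^ 1 \<cdot> (inverse \<pi> \<cdot> x) \<in> spow 1 M" by blast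
  then show "x \<in> spow 1 M" by simp
qed auto

lemma spow_perp: "y \<in> perp M u \<Longrightarrow> y \<in> spow 1 (perp M u) \<longleftrightarrow> y \<in> spow 1 M"
  by (auto simp: spow_1_iff[of y] B_simps)

lemma card_norm_vectors:
  assumes M: "unimod m g M"
  shows "card (quot {u \<in> M. B u u - a \<in> PP 1} (spow 1 M)) = diag_zeros (\<lambda>i. B (g i) (g i)) m a"
  unfolding diag_zeros_def
proof (rule quot_card_cong(1)[where f = "lc m g", symmetric])
  have L: "lbas m g M" using M by (rule unimod_lbas)
  show "subgrp (Tup m (PP 1))" by (simp add: subgrp_TupI)
  show "subgrp (spow 1 M)" using submod_subgrp submod_spow unimod_submod M by blast
  have norm: "B (lc m g x) (lc m g x) = (\<Sum>i<m. B (g i) (g i) * (x i)\<^sup>2)" for x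
  proof -
    have "B (lc m g x) (lc m g x) = (\<Sum>i<m. \<Sum>j<m. x i * x j * B (g i) (g j))" by (rule B_lc_lc)
    also have "\<dots> = (\<Sum>i<m. \<Sum>j<m. if j = i then B (g i) (g i) * (x i)\<^sup>2 else 0)"
      by (intro sum.cong) (use M in \<open>auto simp: unimod_def orth_def power2_eq_square\<close>)
    finally show ?thesis by simp
  qed
  show "lc m g x \<in> {u \<in> M. B u u - a \<in> PP 1}"
    if "x \<in> {x \<in> Tup m \<O>. (\<Sum>i<m. B (g i) (g i) * (x i)\<^sup>2) - a \<in> PP 1}" for x
    using that lbas_mem[OF L] by (auto simp: norm TupI_def)
  show "\<exists>x\<in>{x \<in> Tup m \<O>. (\<Sum>i<m. B (g i) (g i) * (x i)\<^sup>2) - a \<in> PP 1}. lc m g x - y \<in> spow 1 M"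
    if y: "y \<in> {u \<in> M. B u u - a \<in> PP 1}" for y
  proof -
    from y obtain c where "c \<in> Tup m \<O>" "y = lc m g c" using L by (auto simp: lbas_def lat_extend TupI_def)
    then show ?thesis using y norm submod_zero[OF submod_spow[OF unimod_submod[OF M], of 1]]
      by (intro bexI[of _ c]) auto
  qed
  show "lc m g x - lc m g y \<in> spow 1 M \<longleftrightarrow> x - y \<in> Tup m (PP 1)"
    if "x \<in> {x \<in> Tup m \<O>. (\<Sum>i<m. B (g i) (g i) * (x i)\<^sup>2) - a \<in> PP 1}"
      "y \<in> {x \<in> Tup m \<O>. (\<Sum>i<m. B (g i) (g i) * (x i)\<^sup>2) - a \<in> PP 1}" for x y
    using that L lbas_spow[OF L, of 1] by (auto simp: lc_diff lbas_def lat_mem_iff TupI_def)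
qed

lemma Tup_Suc_upd: "y \<in> Tup n A \<Longrightarrow> A \<subseteq> A' \<Longrightarrow> u \<in> A' \<Longrightarrow> y(n := u) \<in> Tup (Suc n) A'"
  by (auto simp: TupI_def)

text \<open>Fibration over the image of the last basis vector, which is nonzero modulo
  \<open>\<varpi>\<close> by independence.\<close>

lemma quot_emb_Suc:
  assumes M: "unimod m g M"
    and fib: "\<And>u. u \<in> M \<Longrightarrow> u \<notin> spow 1 M \<Longrightarrow> B u u - T n \<in> PP 1 \<Longrightarrow>
      card (quot {x \<in> emb (Suc n) M T. x n - u \<in> spow 1 M} (Tup (Suc n) (spow 1 M))) = C"
  shows "card (quot (emb (Suc n) M T) (Tup (Suc n) (spow 1 M))) =
    card (quot {u \<in> M. u \<notin> spow 1 M \<and> B u u - T n \<in> PP 1} (spow 1 M)) * C"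
proof (rule quot_fib_const(1)[where g = "\<lambda>x. x n"])
  have sM: "submod M" using M by (rule unimod_submod)
  show "subgrp (Tup (Suc n) (spow 1 M))" by (rule subgrp_Tup_spow[OF sM])
  show "subgrp (spow 1 M)" using submod_subgrp submod_spow sM by blast
  show "finite (quot {u \<in> M. u \<notin> spow 1 M \<and> B u u - T n \<in> PP 1} (spow 1 M))"
  proof (rule quot_mono)
    have L: "lbas m g M" using M by (rule unimod_lbas)
    show "finite (quot M (spow 1 M))"
      using quot_lat(2)[of m g "\<lambda>_. 0" "\<lambda>_. int 1"] lbas_spow[OF L, of 1] L by (simp add: lbas_def)
  qed auto
  show "x n \<in> {u \<in> M. u \<notin> spow 1 M \<and> B u u - T n \<in> PP 1}" if x: "x \<in> emb (Suc n) M T" for x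
  proof -
    have "x n \<in> M" "indm (Suc n) M x"
      using x by (auto simp: emb_iff TupI_def)
    moreover have "B (x n) (x n) - (if n = n then T n else 0) \<in> PP 1"
      using x unfolding emb_iff by blast
    ultimately have "x n \<in> M" "indm (Suc n) M x" "B (x n) (x n) - T n \<in> PP 1" by simp_all
    then show ?thesis using indm_last[OF sM] by blast
  qed
  show "x n - y n \<in> spow 1 M" if "x - y \<in> Tup (Suc n) (spow 1 M)" for x y
    using that by (auto simp: TupI_def)
  show "finite (quot {x \<in> emb (Suc n) M T. x n - z \<in> spow 1 M} (Tup (Suc n) (spow 1 M)))" for z
    by (rule finite_quot_approx[OF M]) (auto simp: emb_iff)
qed (use fib in auto)

text \<open>With the last image congruent to u, the other images are orthogonal to u modulo
  \<open>\<varpi>\<close>. Since u has unit norm, orthogonal projection to its complement moves them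
  only within their classes, so the fibre is the set of embeddings of the other vectors into the
  complement.\<close>

lemma emb_fiber_unit:
  assumes M: "unimod m g M" and u: "u \<in> M" "B u u \<noteq> 0" "v (B u u) = 0" "B u u - T n \<in> PP 1"
    and P: "unimod k g' (perp M u)"
  shows "card (quot {x \<in> emb (Suc n) M T. x n - u \<in> spow 1 M} (Tup (Suc n) (spow 1 M))) =
    card (quot (emb n (perp M u) T) (Tup n (spow 1 (perp M u))))"
proof (rule quot_card_cong(1)[where f = "\<lambda>y. y(n := u)", symmetric])
  let ?P = "perp M u" and ?F = "{x \<in> emb (Suc n) M T. x n - u \<in> spow 1 M}"
  have sM: "submod M" "submod ?P" using M P unimod_submod by blast+
  have sS: "submod (spow 1 M)" "submod (spow 1 ?P)" using sM submod_spow by blast+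
  show "subgrp (Tup n (spow 1 ?P))" by (rule subgrp_Tup_spow[OF sM(2)])
  show "subgrp (Tup (Suc n) (spow 1 M))" by (rule subgrp_Tup_spow[OF sM(1)])
  have lcu: "lc (Suc n) (y(n := u)) c = lc n y c + c n \<cdot> u" for y c
    using lc_cong[of n c c "y(n := u)" y] by (simp add: lc_Suc)
  have indm_iff: "indm (Suc n) M (y(n := u)) \<longleftrightarrow> indm n ?P y" if y: "y \<in> Tup n ?P" for y
  proof
    have yP: "y i \<in> ?P" if "i < n" for i using y that by (auto simp: TupI_def)
    assume iM: "indm (Suc n) M (y(n := u))"
    show "indm n ?P y"
    proof (rule indmI)
      fix c i assume c: "\<And>i. c i \<in> \<O>" "lc n y c \<in> spow 1 ?P" "i < n"
      have "lc n y c \<in> spow 1 M" using c(2) by auto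
      moreover have "lc n y (c(n := 0)) = lc n y c" by (rule lc_cong) auto
      ultimately have "lc (Suc n) (y(n := u)) (c(n := 0)) \<in> spow 1 M" by (simp add: lcu)
      then have "(c(n := 0)) i \<in> PP 1" by (rule indmD[OF iM]) (use c in auto)
      then show "c i \<in> PP 1" using c by simp
    qed
  next
    have yP: "y i \<in> ?P" if "i < n" for i using y that by (auto simp: TupI_def)
    assume iP: "indm n ?P y"
    show "indm (Suc n) M (y(n := u))"
    proof (rule indmI)
      fix c i assume c: "\<And>i. c i \<in> \<O>" "lc (Suc n) (y(n := u)) c \<in> spow 1 M" "i < Suc n"
      have s: "lc n y c + c n \<cdot> u \<in> spow 1 M" using c(2) by (simp add: lcu)
      have yu: "B (lc n y c) u = 0" using yP by (simp add: B_lc)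
      \<comment> \<open>Pairing with u isolates the last coefficient, as the other vectors are
        orthogonal to u.\<close>
      have "B (lc n y c + c n \<cdot> u) u \<in> PP 1" using spow_B[OF M s, of u 0] u(1) by simp
      then have "c n * B u u \<in> PP 1" by (simp add: B_simps yu)
      then have cn: "c n \<in> PP 1" using u unit_mult_PP[of "B u u" "c n" 1] by (simp add: mult.commute)
      then obtain d where "d \<in> \<O>" "c n = \<pi> ^ 1 * d" using PP_pi[of 1 1 "c n"] by auto
      then have "c n \<cdot> u = \<pi> ^ 1 \<cdot> (d \<cdot> u)" "d \<cdot> u \<in> M" using u(1) submod_scale[OF sM(1)] by auto
      then have "c n \<cdot> u \<in> spow 1 M" by blast
      then have "lc n y c + c n \<cdot> u - c n \<cdot> u \<in> spow 1 M" by (rule submod_diff[OF sS(1) s])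
      moreover have "lc n y c \<in> ?P" by (rule lc_in_submod[OF sM(2)]) (use c yP in auto)
      ultimately have "lc n y c \<in> spow 1 ?P" using spow_perp[of "lc n y c" M u] by simp
      then have "c i \<in> PP 1" if "i < n" using indmD[OF iP, of c i] c that by blast
      then show "c i \<in> PP 1" using cn c(3) by (cases "i = n") auto
    qed
  qed
  have emb_iff': "y(n := u) \<in> emb (Suc n) M T \<longleftrightarrow> y \<in> emb n ?P T" if y: "y \<in> Tup n ?P" for y
  proof -
    have yP: "y i \<in> ?P" if "i < n" for i using y that by (auto simp: TupI_def)
    have "y(n := u) \<in> Tup (Suc n) M" using Tup_Suc_upd[OF y _ u(1)] by blast
    moreover have "(\<forall>i j. i \<le> j \<longrightarrow> j < Suc n \<longrightarrow> B ((y(n := u)) i) ((y(n := u)) j) - (if i = j then T i else 0) \<in> PP 1)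
      \<longleftrightarrow> (\<forall>i j. i \<le> j \<longrightarrow> j < n \<longrightarrow> B (y i) (y j) - (if i = j then T i else 0) \<in> PP 1)" (is "?l \<longleftrightarrow> ?r")
    proof
      assume l: ?l
      show ?r
      proof (intro allI impI)
        fix i j assume "i \<le> j" "j < n"
        then show "B (y i) (y j) - (if i = j then T i else 0) \<in> PP 1"
          using l[rule_format, of i j] by simp
      qed
    next
      assume r: ?r
      show ?l
      proof (intro allI impI)
        fix i j assume "i \<le> j" "j < Suc n"
        then show "B ((y(n := u)) i) ((y(n := u)) j) - (if i = j then T i else 0) \<in> PP 1"
          using r[rule_format, of i j] u(4) yP[of i] by (cases "j = n"; cases "i = n") auto
      qed
    qed
    ultimately show ?thesis using indm_iff[OF y] y by (auto simp: emb_iff)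
  qed
  show "y(n := u) \<in> ?F" if "y \<in> emb n ?P T" for y
    using that emb_iff'[of y] submod_zero[OF sS(1)] by (auto simp: emb_iff[of y])
  show "\<exists>y\<in>emb n ?P T. y(n := u) - x \<in> Tup (Suc n) (spow 1 M)" if x: "x \<in> ?F" for x
  proof -
    have xM: "x i \<in> M" if "i < Suc n" for i using x that by (auto simp: emb_iff TupI_def)
    \<comment> \<open>Orthogonal projection away from u; the correction is divisible by
      \<open>\<pi>\<close> because \<open>x i\<close> is orthogonal to u modulo
      \<open>\<varpi>\<close>.\<close>
    define y where "y i = (if i < n then x i - (B (x i) u / B u u) \<cdot> u else 0)" for i
    have xu: "B (x i) u \<in> PP 1" if "i < n" for i
    proof -
      have "\<forall>i j. i \<le> j \<longrightarrow> j < Suc n \<longrightarrow> B (x i) (x j) - (if i = j then T i else 0) \<in> PP 1"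
        using x unfolding mem_Collect_eq emb_iff by blast
      from this[rule_format, of i n] have "B (x i) (x n) \<in> PP 1" using that by simp
      moreover have "B (x i) (x n) - B (x i) u \<in> PP (int 1)"
        by (rule B_cong_spow[OF M]) (use x xM that submod_zero[OF sS(1)] in auto)
      ultimately show ?thesis using cong_P1 by simp
    qed
    have small: "(B (x i) u / B u u) \<cdot> u \<in> spow 1 M" if "i < n" for i
    proof -
      have "B (x i) u / B u u \<in> PP 1" using xu[OF that] u by (simp add: unit_divide_PP)
      then obtain d where "d \<in> \<O>" "B (x i) u / B u u = \<pi> ^ 1 * d" using PP_pi[of 1 1] by auto
      then have "(B (x i) u / B u u) \<cdot> u = \<pi> ^ 1 \<cdot> (d \<cdot> u)" "d \<cdot> u \<in> M" using u(1) submod_scale[OF sM(1)] by auto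
      then show ?thesis by blast
    qed
    have "y i \<in> ?P" if "i < n" for i
    proof -
      have "y i \<in> M" using subsetD[OF spow_subset[OF sM(1)] small[OF that]] xM[of i] submod_diff[OF sM(1)] that
        by (simp add: y_def)
      moreover have "B (y i) u = 0" using u that by (simp add: y_def B_simps)
      ultimately show ?thesis by simp
    qed
    then have yT: "y \<in> Tup n ?P" by (auto simp: TupI_def y_def)
    have "x n - u \<in> spow 1 M" using x by simp
    then have d: "y(n := u) - x \<in> Tup (Suc n) (spow 1 M)"
      using small submod_uminus[OF sS(1)] subgrp_diff_swap[OF submod_subgrp[OF sS(1)]] x
      by (auto simp: TupI_def y_def less_Suc_eq emb_iff)
    have "y(n := u) \<in> Tup (Suc n) M" using Tup_Suc_upd[OF yT _ u(1)] by blast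
    then have "y(n := u) \<in> emb (Suc n) M T"
      using emb_cong[OF M _ _ d] x by (auto simp: emb_iff[of x])
    then show ?thesis using emb_iff'[OF yT] d by blast
  qed
  show "x(n := u) - y(n := u) \<in> Tup (Suc n) (spow 1 M) \<longleftrightarrow> x - y \<in> Tup n (spow 1 ?P)"
    if "x \<in> emb n ?P T" "y \<in> emb n ?P T" for x y
  proof -
    have "x i - y i \<in> ?P" if "i < n" for i
      using that \<open>x \<in> emb n ?P T\<close> \<open>y \<in> emb n ?P T\<close> submod_diff[OF sM(2)] by (auto simp: emb_iff TupI_def)
    then have "x i - y i \<in> spow 1 ?P \<longleftrightarrow> x i - y i \<in> spow 1 M" if "i < n" for i
      using spow_perp that by blast
    then show ?thesis using that submod_zero[OF sS(1)]
      by (auto simp: TupI_def emb_iff less_Suc_eq not_less_eq_eq)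
  qed
qed

text \<open>An isotropic vector \<open>u\<close> modulo \<open>\<varpi>\<close> is completed by \<open>w\<close> to a unimodular plane of
  discriminant \<open>-1\<close>; it has a unit norm vector \<open>z\<close>, so that the plane can be split off in two steps.\<close>

lemma unimod_perp_plane:
  assumes M: "unimod m g M" and u: "u \<in> M" "u \<notin> spow 1 M" "B u u \<in> PP 1"
  shows "\<exists>w k g'. w \<in> M \<and> B u w = 1 \<and> m = Suc (Suc k) \<and> unimod k g' (perp (perp M w) u) \<and>
    \<chi> (dprod m g) = \<chi> (-1) * \<chi> (dprod k g')"
proof -
  have "indm 1 M (\<lambda>_. u)" by (rule indm_single[OF unimod_submod[OF M]]) (use u in auto)
  from dual_vectors[OF M _ this] u obtain y :: "nat \<Rightarrow> 'b" where y: "\<forall>j<1. y j \<in> M"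
    "\<forall>i<(1::nat). \<forall>j<1. B u (y j) = (if i = j then 1 else 0)" by auto
  define w where "w = y (0::nat)"
  have w: "w \<in> M" "B u w = 1" using y by (auto simp: w_def)
  \<comment> \<open>If w has nonunit norm, the norm of u + w is congruent to 2 B u w = 2, a
    unit.\<close>
  define z where "z = (if B w w \<in> PP 1 then u + w else w)"
  have zM: "z \<in> M" using u w submod_add[OF unimod_submod[OF M]] by (simp add: z_def)
  have wwO: "B w w \<in> \<O>" "B u u \<in> \<O>" using unimod_integral[OF M] w u by blast+
  have uz: "B u z \<noteq> 0" "v (B u z) = 0"
  proof -
    have "B u z - 1 \<in> PP 1" using w u by (auto simp: z_def B_simps)
    then show "B u z \<noteq> 0" "v (B u z) = 0" using cong_unit[of "B u z" 1] by auto
  qed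
  have zz: "B z z \<noteq> 0" "v (B z z) = 0"
  proof -
    have "B z z \<noteq> 0 \<and> v (B z z) = 0"
    proof (cases "B w w \<in> PP 1")
      case True
      have "B z z = 2 + (B u u + B w w)" using True w B_sym[of w u] by (simp add: z_def B_simps)
      then have "B z z - 2 \<in> PP 1" using True u PP_add by simp
      then show ?thesis using cong_unit[of "B z z" 2] by simp
    next
      case False
      then show ?thesis using wwO unit_iff[of "B w w"] by (simp add: z_def)
    qed
    then show "B z z \<noteq> 0" "v (B z z) = 0" by auto
  qed
  obtain k1 g1 where g1: "m = Suc k1" "unimod k1 g1 (perp M z)" "\<chi> (dprod m g) = \<chi> (B z z) * \<chi> (dprod k1 g1)"
    using unimod_perp[OF M zM zz] by blast
  define u1 where "u1 = u - (B u z / B z z) \<cdot> z"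
  have bO: "B u z / B z z \<in> \<O>" using uz zz by (simp add: unit_divide_PP unit_O)
  have u1: "u1 \<in> perp M z"
    using u zM zz bO submod_diff[OF unimod_submod[OF M]] submod_scale[OF unimod_submod[OF M]]
    by (simp add: u1_def B_simps)
  \<comment> \<open>The Gram determinant of the plane spanned by u and z. As B u u vanishes modulo
    \<open>\<varpi>\<close>, it is minus a square there.\<close>
  have uu1: "B z z * B u1 u1 = - ((B u z)\<^sup>2) + B u u * B z z"
    using zz B_sym[of z u] by (simp add: u1_def B_simps field_simps power2_eq_square)
  have prod_cong: "B z z * B u1 u1 - (- ((B u z)\<^sup>2)) \<in> PP 1"
    using uu1 u zz by (simp add: PP_mult_O' unit_O)
  have uz2: "- ((B u z)\<^sup>2) \<noteq> 0" "v (- ((B u z)\<^sup>2)) = 0" using uz by (simp_all add: v_power)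
  have "B z z * B u1 u1 \<noteq> 0 \<and> v (B z z * B u1 u1) = 0" using cong_unit[OF prod_cong uz2] .
  then have u1u: "B u1 u1 \<noteq> 0" "v (B u1 u1) = 0" using zz by (auto simp: val_mult)
  obtain k g' where g': "k1 = Suc k" "unimod k g' (perp (perp M z) u1)"
    "\<chi> (dprod k1 g1) = \<chi> (B u1 u1) * \<chi> (dprod k g')"
    using unimod_perp[OF g1(2) u1 u1u] by blast
  have "\<chi> (B z z) * \<chi> (B u1 u1) = \<chi> (B z z * B u1 u1)" using chi_mult zz u1u unit_O by simp
  also have "\<dots> = \<chi> (- ((B u z)\<^sup>2))"
    by (rule chi_cong[OF prod_cong]) (use zz u1u unit_O O_mult in auto)
  also have "\<dots> = \<chi> (-1)" using chi_square_mult[OF uz, of "-1"] by (simp add: PP_iff)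
  finally have "\<chi> (dprod m g) = \<chi> (-1) * \<chi> (dprod k g')" using g1 g' by (simp add: mult.assoc[symmetric])
  moreover have "unimod k g' (perp (perp M w) u)"
  proof -
    \<comment> \<open>The pairs z, u1 and w, u span the same plane, hence have the same orthogonal
      complement.\<close>
    have "B y z = 0 \<and> B y u1 = 0 \<longleftrightarrow> B y w = 0 \<and> B y u = 0" for y
      by (auto simp: u1_def z_def B_simps)
    then have "perp (perp M z) u1 = perp (perp M w) u" by auto
    then show ?thesis using g'(2) by (simp only:)
  qed
  moreover have "m = Suc (Suc k)" using g1 g' by simp
  ultimately show ?thesis using w by blast
qed

lemma P1_scale: "submod M \<Longrightarrow> c \<in> PP 1 \<Longrightarrow> u \<in> M \<Longrightarrow> c \<cdot> u \<in> spow 1 M"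
proof -
  assume M: "submod M" and c: "c \<in> PP 1" and u: "u \<in> M"
  obtain d where "d \<in> \<O>" "c = \<pi> ^ 1 * d" using PP_pi[of 1 1 c] c by auto
  then have "c \<cdot> u = \<pi> ^ 1 \<cdot> (d \<cdot> u)" "d \<cdot> u \<in> M" using u submod_scale[OF M] by auto
  then show ?thesis by blast
qed

lemma emb_forms: "x \<in> emb n M T \<Longrightarrow> i \<le> j \<Longrightarrow> j < n \<Longrightarrow> B (x i) (x j) - (if i = j then T i else 0) \<in> PP 1"
  unfolding emb_iff by blast

text \<open>The other images lie modulo \<open>\<varpi>\<close> in the complement of u, which is the
  sum of P, the complement of the plane of u and w, and the line of u itself. The line is the
  radical of this sum, so the u-components of the n images are arbitrary, which gives q^n, while
  their P-components form an embedding into P.\<close>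

lemma emb_fiber_isotropic:
  assumes M: "unimod m g M" and u: "u \<in> M" "u \<notin> spow 1 M" "B u u \<in> PP 1" "T n \<in> PP 1"
    and w: "w \<in> M" "B u w = 1" and P: "unimod k g' (perp (perp M w) u)"
  shows "card (quot {x \<in> emb (Suc n) M T. x n - u \<in> spow 1 M} (Tup (Suc n) (spow 1 M))) =
    q ^ n * card (quot (emb n (perp (perp M w) u) T) (Tup n (spow 1 (perp (perp M w) u))))"
proof -
  let ?P = "perp (perp M w) u"
  define X where "X = {x \<in> emb (Suc n) M T. x n - u \<in> spow 1 M}"
  have sM: "submod M" "submod ?P" using M P unimod_submod by blast+
  have sS: "submod (spow 1 M)" "submod (spow 1 ?P)" using submod_spow[OF sM(1)] submod_spow[OF sM(2)] .
  have sgK: "subgrp (Tup (Suc n) (spow 1 M))" "subgrp (Tup n (spow 1 ?P))"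
    using subgrp_Tup_spow[OF sM(1)] subgrp_Tup_spow[OF sM(2)] .
  have sg1: "subgrp (Tup n (PP 1))" by (simp add: subgrp_TupI)
  have PM: "?P \<subseteq> M" by blast
  have zeroS: "0 \<in> spow 1 M" by (rule submod_zero[OF sS(1)])
  have sPP: "y \<in> spow 1 ?P \<longleftrightarrow> y \<in> spow 1 M" if "y \<in> ?P" for y
    using that spow_perp[of y "perp M w" u] spow_perp[of y M w] by blast
  \<comment> \<open>Up to sign the Gram determinant of the plane of u and w, where B u w =
    1.\<close>
  define \<Delta> where "\<Delta> = 1 - B u u * B w w"
  have uuO: "B u u \<in> \<O>" "B w w \<in> \<O>" using unimod_integral[OF M] u w by blast+
  have \<Delta>: "\<Delta> \<noteq> 0" "v \<Delta> = 0"
  proof -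
    have "\<Delta> - 1 \<in> PP 1" using PP_mult_O'[OF u(3) uuO(2)] by (simp add: \<Delta>_def)
    then show "\<Delta> \<noteq> 0" "v \<Delta> = 0" using cong_unit[of \<Delta> 1] by auto
  qed
  \<comment> \<open>Cramer's rule for the coordinates of the projection of y to the plane:
    \<open>al\<close> belongs to u and \<open>be\<close> to w.\<close>
  define al where "al y = (B y w - B w w * B y u) / \<Delta>" for y
  define be where "be y = (B y u - B u u * B y w) / \<Delta>" for y
  define pr where "pr y = y - al y \<cdot> u - be y \<cdot> w" for y
  have alO: "al y \<in> \<O>" "be y \<in> \<O>" if "y \<in> M" for y
    unfolding al_def be_def unit_divide_PP[OF \<Delta>]
    using unimod_integral[OF M that] u(1) w(1) uuO by (auto intro!: PP_diff O_mult)
  have beP: "be y \<in> PP 1" if "y \<in> M" "B y u \<in> PP 1" for y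
    unfolding be_def unit_divide_PP[OF \<Delta>]
    using unimod_integral[OF M that(1)] w(1) that u(3) by (auto intro!: PP_diff PP_mult_O')
  have pru: "B (pr y) u = 0" "B (pr y) w = 0" for y
  proof -
    have "\<Delta> * B (pr y) u = \<Delta> * B y u - (\<Delta> * al y) * B u u - \<Delta> * be y"
      using w B_sym[of w u] by (simp add: pr_def B_simps algebra_simps)
    also have "\<dots> = 0" using \<Delta> by (simp add: al_def be_def) (simp add: \<Delta>_def algebra_simps)
    finally show "B (pr y) u = 0" using \<Delta> by simp
    have "\<Delta> * B (pr y) w = \<Delta> * B y w - \<Delta> * al y - (\<Delta> * be y) * B w w"
      using w by (simp add: pr_def B_simps algebra_simps)
    also have "\<dots> = 0" using \<Delta> by (simp add: al_def be_def) (simp add: \<Delta>_def algebra_simps)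
    finally show "B (pr y) w = 0" using \<Delta> by simp
  qed
  have prP: "pr y \<in> ?P" if "y \<in> M" for y
  proof -
    have "pr y \<in> M" unfolding pr_def
      using alO[OF that] that u(1) w(1) submod_diff[OF sM(1)] submod_scale[OF sM(1)] by simp
    then show ?thesis using pru by simp
  qed
  have al_P: "al (y + z \<cdot> u) = z" if "y \<in> ?P" for y z
  proof -
    have "\<Delta> * al (y + z \<cdot> u) = z * \<Delta>"
      using that w \<Delta> by (simp add: al_def B_simps) (simp add: \<Delta>_def algebra_simps)
    then show ?thesis using \<Delta> by simp
  qed
  have al_cong: "al y - al y' \<in> PP 1" if "y - y' \<in> spow 1 M" for y y'
  proof -
    have "B (y - y') w \<in> PP 1" "B (y - y') u \<in> PP 1"
      using spow_B[OF M that, of w 0] spow_B[OF M that, of u 0] u(1) w(1) by auto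
    then have "(B (y - y') w - B w w * B (y - y') u) / \<Delta> \<in> PP 1"
      unfolding unit_divide_PP[OF \<Delta>] using uuO by (auto intro!: PP_diff PP_mult_O)
    moreover have "(B (y - y') w - B w w * B (y - y') u) / \<Delta> = al y - al y'"
      using \<Delta> by (simp add: al_def B_simps field_simps)
    ultimately show ?thesis by simp
  qed
  have XM: "x i \<in> M" if "x \<in> X" "i < Suc n" for x i using that by (auto simp: X_def emb_iff TupI_def)
  have xu: "B (x i) u \<in> PP 1" if "x \<in> X" "i < n" for x i
  proof -
    have "B (x i) (x n) - (if i = n then T i else 0) \<in> PP 1"
      by (rule emb_forms[where n = "Suc n"]) (use that in \<open>auto simp: X_def\<close>)
    then have "B (x i) (x n) \<in> PP 1" using that by simp
    moreover have "B (x i) (x n) - B (x i) u \<in> PP (int 1)"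
    proof (rule B_cong_spow[OF M])
      show "x i - x i \<in> spow 1 M" using zeroS by (simp only: diff_self)
    qed (use that XM in \<open>auto simp: X_def\<close>)
    ultimately show ?thesis using cong_P1 by simp
  qed
  \<comment> \<open>The u-components of the images, as a tuple; its classes modulo
    \<open>\<varpi>\<close> are the base of the fibration.\<close>
  define h where "h x i = (if i < n then al (x i) else 0)" for x and i :: nat
  have fiber: "card (quot {x \<in> X. h x - z \<in> Tup n (PP 1)} (Tup (Suc n) (spow 1 M))) =
      card (quot (emb n ?P T) (Tup n (spow 1 ?P)))" if z: "z \<in> Tup n \<O>" for z
  proof (rule quot_card_cong(1)[OF sgK(2) sgK(1), symmetric])
    have zO: "z i \<in> \<O>" if "i < n" for i using z that by (simp add: TupI_def)
    \<comment> \<open>The inverse parametrization of the fibre over z: families in P are shifted by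
      the multiples z_i u.\<close>
    define F where "F y = (\<lambda>i. if i < n then y i + z i \<cdot> u else 0)(n := u)" for y :: "nat \<Rightarrow> 'b"
    have Fi: "F y i = y i + z i \<cdot> u" "F y n = u" if "i < n" for y i using that by (auto simp: F_def)
    have Fn: "F y n = u" for y by (simp add: F_def)
    have FT: "F y \<in> Tup (Suc n) M" if y: "y \<in> Tup n ?P" for y
      using y zO u(1) submod_add[OF sM(1)] submod_scale[OF sM(1)] PM
      by (auto simp: TupI_def F_def less_Suc_eq)
    have lcF: "lc (Suc n) (F y) c = lc n y c + ((\<Sum>i<n. c i * z i) + c n) \<cdot> u" for y c
    proof -
      have "lc n (F y) c = lc n (\<lambda>i. y i + z i \<cdot> u) c" by (rule lc_cong) (auto simp: Fi)
      also have "\<dots> = lc n y c + (\<Sum>i<n. c i * z i) \<cdot> u"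
        by (simp add: lc_sum_vectors) (simp add: lc_def vs.scale_sum_left)
      finally show ?thesis by (simp add: lc_Suc Fn vs.scale_left_distrib add.assoc)
    qed
    have indm_iff: "indm (Suc n) M (F y) \<longleftrightarrow> indm n ?P y" if y: "y \<in> Tup n ?P" for y
    proof
      assume iM: "indm (Suc n) M (F y)"
      show "indm n ?P y"
      proof (rule indmI)
        fix c i assume c: "\<And>i. c i \<in> \<O>" "lc n y c \<in> spow 1 ?P" "i < n"
        \<comment> \<open>The coefficient of the last vector u is chosen to cancel the u-components
          of the others.\<close>
        define c' where "c' = c(n := - (\<Sum>i<n. c i * z i))"
        have "lc (Suc n) (F y) c' = lc n y c"
          unfolding lcF by (simp add: c'_def) (rule lc_cong, auto)
        moreover have "lc n y c \<in> spow 1 M" using c(2) PM by blast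
        ultimately have "lc (Suc n) (F y) c' \<in> spow 1 M" by simp
        then have "c' i \<in> PP 1"
          by (rule indmD[OF iM]) (use c zO in \<open>auto simp: c'_def intro!: PP_sum O_mult\<close>)
        then show "c i \<in> PP 1" using c(3) by (simp add: c'_def)
      qed
    next
      have yP: "y i \<in> ?P" if "i < n" for i using y that by (auto simp: TupI_def)
      assume iP: "indm n ?P y"
      show "indm (Suc n) M (F y)"
      proof (rule indmI)
        fix c i assume c: "\<And>i. c i \<in> \<O>" "lc (Suc n) (F y) c \<in> spow 1 M" "i < Suc n"
        define \<beta> where "\<beta> = (\<Sum>i<n. c i * z i) + c n"
        have s: "lc n y c + \<beta> \<cdot> u \<in> spow 1 M" using c(2) by (simp only: lcF \<beta>_def)
        \<comment> \<open>Pairing with w isolates the total coefficient of u, since B u w = 1 and P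
          is orthogonal to w.\<close>
        have "B (lc n y c) w = 0" using yP by (simp add: B_lc)
        then have "B (lc n y c + \<beta> \<cdot> u) w = \<beta>" using w by (simp add: B_simps)
        then have \<beta>: "\<beta> \<in> PP 1" using spow_B[OF M s, of w 0] w(1) by simp
        have "lc n y c + \<beta> \<cdot> u - \<beta> \<cdot> u \<in> spow 1 M"
          by (rule submod_diff[OF sS(1) s P1_scale[OF sM(1) \<beta> u(1)]])
        moreover have "lc n y c \<in> ?P" by (rule lc_in_submod[OF sM(2)]) (use c yP in auto)
        ultimately have "lc n y c \<in> spow 1 ?P" using sPP by simp
        then have ci: "c i \<in> PP 1" if "i < n" for i using indmD[OF iP, of c i] c(1) that by blast
        have "(\<Sum>i<n. c i * z i) \<in> PP 1" using ci zO by (intro PP_sum PP_mult_O') auto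
        then have "c n \<in> PP 1" using \<beta> PP_add_iff[of "\<Sum>i<n. c i * z i" 1 "c n"] by (simp add: \<beta>_def add.commute)
        then show "c i \<in> PP 1" using ci c(3) by (cases "i = n") auto
      qed
    qed
    have form: "B (F y i) (F y j) - (B (y i) (y j)) \<in> PP 1" if "y \<in> Tup n ?P" "i < n" "j < n" for y i j
    proof -
      have "B (y i) u = 0" "B u (y j) = 0" using that B_sym[of u] by (auto simp: TupI_def)
      then have "B (F y i) (F y j) - B (y i) (y j) = (z i * z j) * B u u"
        using that by (simp add: Fi B_simps algebra_simps)
      then show ?thesis using u(3) zO that by (auto intro!: PP_mult_O O_mult)
    qed
    have formn: "B (F y i) (F y n) \<in> PP 1" if "y \<in> Tup n ?P" "i < n" for y i
    proof -
      have "B (y i) u = 0" using that by (auto simp: TupI_def)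
      then have "B (F y i) (F y n) = z i * B u u" using that by (simp add: Fi B_simps)
      then show ?thesis using u(3) zO that by (auto intro!: PP_mult_O)
    qed
    have emb_iff': "F y \<in> emb (Suc n) M T \<longleftrightarrow> y \<in> emb n ?P T" if y: "y \<in> Tup n ?P" for y
    proof -
      have "(\<forall>i j. i \<le> j \<longrightarrow> j < Suc n \<longrightarrow> B (F y i) (F y j) - (if i = j then T i else 0) \<in> PP 1)
        \<longleftrightarrow> (\<forall>i j. i \<le> j \<longrightarrow> j < n \<longrightarrow> B (y i) (y j) - (if i = j then T i else 0) \<in> PP 1)" (is "?l \<longleftrightarrow> ?r")
      proof
        assume l: ?l
        show ?r
        proof (intro allI impI)
          fix i j assume ij: "i \<le> j" "j < n"
          then have "B (F y i) (F y j) - (if i = j then T i else 0) \<in> PP 1" using l by simp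
          then show "B (y i) (y j) - (if i = j then T i else 0) \<in> PP 1"
            using PP_diff_cong[OF form[OF y, of i j]] ij by simp
        qed
      next
        assume r: ?r
        show ?l
        proof (intro allI impI)
          fix i j assume ij: "i \<le> j" "j < Suc n"
          consider "j < n" | "i < n" "j = n" | "i = n" "j = n" using ij by linarith
          then show "B (F y i) (F y j) - (if i = j then T i else 0) \<in> PP 1"
          proof cases
            case 1
            then show ?thesis using r ij PP_diff_cong[OF form[OF y, of i j]] by simp
          next
            case 2
            then show ?thesis using formn[OF y] by simp
          next
            case 3
            then show ?thesis using u PP_diff by (simp add: Fn)
          qed
        qed
      qed
      then show ?thesis using indm_iff[OF y] FT[OF y] y by (simp add: emb_iff)
    qed
    have hF: "h (F y) - z \<in> Tup n (PP 1)" if "y \<in> Tup n ?P" for y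
      using that z al_P by (auto simp: TupI_def h_def Fi)
    show "F y \<in> {x \<in> X. h x - z \<in> Tup n (PP 1)}" if "y \<in> emb n ?P T" for y
    proof -
      have y: "y \<in> Tup n ?P" using that by (simp add: emb_iff)
      have "F y n - u \<in> spow 1 M" using zeroS by (simp only: Fn diff_self)
      then show ?thesis using emb_iff'[OF y] that hF[OF y] by (simp add: X_def)
    qed
    show "\<exists>y\<in>emb n ?P T. F y - x \<in> Tup (Suc n) (spow 1 M)" if x: "x \<in> {x \<in> X. h x - z \<in> Tup n (PP 1)}" for x
    proof -
      have xX: "x \<in> X" using x by simp
      define y where "y i = (if i < n then pr (x i) else 0)" for i
      have yT: "y \<in> Tup n ?P" using prP XM[OF xX] by (auto simp: TupI_def y_def)
      have xE: "x \<in> emb (Suc n) M T" and xT: "x \<in> Tup (Suc n) M" using xX by (auto simp: X_def emb_iff)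
      have d: "F y - x \<in> Tup (Suc n) (spow 1 M)"
      proof -
        have "(F y - x) i \<in> spow 1 M" if "i < Suc n" for i
        proof (cases "i = n")
          case True
          have "x n - u \<in> spow 1 M" using xX by (simp add: X_def)
          then have "u - x n \<in> spow 1 M" using subgrp_diff_swap[OF submod_subgrp[OF sS(1)]] by blast
          then show ?thesis using True by (simp add: Fn)
        next
          case False
          then have i: "i < n" using that by simp
          have "al (x i) - z i \<in> PP 1" using x i by (auto simp: TupI_def h_def)
          then have "- (al (x i) - z i) \<in> PP 1" by (simp only: PP_uminus)
          \<comment> \<open>The error has a u-component, small by the choice of the fibre, and a
            w-component, small because \<open>x i\<close> is orthogonal to u modulo
            \<open>\<varpi>\<close>.\<close>
          then have "(- (al (x i) - z i)) \<cdot> u - be (x i) \<cdot> w \<in> spow 1 M"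
            using beP XM[OF xX that] xu[OF xX i] u(1) w(1)
            by (intro submod_diff[OF sS(1)] P1_scale[OF sM(1)]) auto
          moreover have "(F y - x) i = (- (al (x i) - z i)) \<cdot> u - be (x i) \<cdot> w"
            using i by (simp add: Fi y_def pr_def vs.scale_left_diff_distrib)
          ultimately show ?thesis by (simp only:)
        qed
        then show ?thesis using xT by (auto simp: TupI_def F_def)
      qed
      then have "F y \<in> emb (Suc n) M T" using emb_cong[OF M FT[OF yT] xT d] xE by blast
      then show ?thesis using emb_iff'[OF yT] d by blast
    qed
    show "F x - F y \<in> Tup (Suc n) (spow 1 M) \<longleftrightarrow> x - y \<in> Tup n (spow 1 ?P)"
      if xy: "x \<in> emb n ?P T" "y \<in> emb n ?P T" for x y
    proof -
      have T: "x \<in> Tup n ?P" "y \<in> Tup n ?P" using xy by (auto simp: emb_iff)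
      have "x i - y i \<in> spow 1 ?P \<longleftrightarrow> x i - y i \<in> spow 1 M" if "i < n" for i
      proof (rule sPP)
        have "x i \<in> ?P" "y i \<in> ?P" using T that by (auto simp: TupI_def)
        then show "x i - y i \<in> ?P" by (rule submod_diff[OF sM(2)])
      qed
      moreover have "F x - F y \<in> Tup (Suc n) (spow 1 M) \<longleftrightarrow> (\<forall>i<n. x i - y i \<in> spow 1 M)"
        using zeroS by (auto simp: TupI_def F_def less_Suc_eq)
      moreover have "x - y \<in> Tup n (spow 1 ?P) \<longleftrightarrow> (\<forall>i<n. x i - y i \<in> spow 1 ?P)"
        using T by (auto simp: TupI_def)
      ultimately show ?thesis by blast
    qed
  qed
  have "card (quot X (Tup (Suc n) (spow 1 M))) =
      card (quot (Tup n \<O>) (Tup n (PP 1))) * card (quot (emb n ?P T) (Tup n (spow 1 ?P)))"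
  proof (rule quot_fib_const(1)[where g = h])
    show "finite (quot (Tup n \<O>) (Tup n (PP 1)))" by (rule finite_quot_Tup) simp
    show "h x \<in> Tup n \<O>" if "x \<in> X" for x using that alO XM by (auto simp: h_def TupI_def)
    show "h x - h y \<in> Tup n (PP 1)" if "x - y \<in> Tup (Suc n) (spow 1 M)" for x y
      using that al_cong by (auto simp: h_def TupI_def)
    show "finite (quot {x \<in> X. h x - z \<in> Tup n (PP 1)} (Tup (Suc n) (spow 1 M)))" for z
      by (rule finite_quot_approx[OF M]) (auto simp: X_def emb_iff)
  qed (use sgK sg1 fiber in auto)
  moreover have "card (quot (Tup n \<O>) (Tup n (PP 1))) = q ^ n"
    using card_quot_TupI[of n "\<lambda>_. PP 1" "\<lambda>_. \<O>"] finite_quot_residue by (simp add: residue_card_def)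
  ultimately show ?thesis by (simp add: X_def)
qed

text \<open>The 1 accounts for the zero class, which is isotropic but cannot be the image of a basis
  vector.\<close>

lemma card_isotropic_vectors:
  assumes M: "unimod m g M" and a: "a \<in> PP 1"
  shows "card (quot {u \<in> M. u \<notin> spow 1 M \<and> B u u - a \<in> PP 1} (spow 1 M)) + 1 =
    diag_zeros (\<lambda>i. B (g i) (g i)) m 0"
proof -
  have sM: "submod M" using M by (rule unimod_submod)
  have sg: "subgrp (spow 1 M)" by (rule submod_subgrp[OF submod_spow[OF sM]])
  have L: "lbas m g M" using M by (rule unimod_lbas)
  let ?X = "{u \<in> M. B u u - 0 \<in> PP 1}" and ?Y = "{u \<in> M. u \<notin> spow 1 M \<and> B u u - a \<in> PP 1}"
  have fin: "finite (quot ?X (spow 1 M))"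
  proof (rule quot_mono)
    show "finite (quot M (spow 1 M))"
      using quot_lat(2)[of m g "\<lambda>_. 0" "\<lambda>_. int 1"] lbas_spow[OF L, of 1] L by (simp add: lbas_def)
  qed auto
  have iso: "B u u - a \<in> PP 1 \<longleftrightarrow> B u u - 0 \<in> PP 1" for u
    using PP_add_iff[of "- a" 1 "B u u"] a by simp
  have eq: "quot ?X (spow 1 M) = insert (coset (spow 1 M) 0) (quot ?Y (spow 1 M))"
  proof
    show "quot ?X (spow 1 M) \<subseteq> insert (coset (spow 1 M) 0) (quot ?Y (spow 1 M))"
    proof
      fix A assume "A \<in> quot ?X (spow 1 M)"
      then obtain u where u: "u \<in> ?X" "A = coset (spow 1 M) u" by (auto simp: quot_def)
      show "A \<in> insert (coset (spow 1 M) 0) (quot ?Y (spow 1 M))"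
      proof (cases "u \<in> spow 1 M")
        case True
        then have "u - 0 \<in> spow 1 M" by (simp only: diff_zero)
        then show ?thesis using u coset_eq_iff[OF sg] by blast
      next
        case False
        then have "u \<in> ?Y" using u iso by blast
        then show ?thesis using u unfolding quot_def by blast
      qed
    qed
    show "insert (coset (spow 1 M) 0) (quot ?Y (spow 1 M)) \<subseteq> quot ?X (spow 1 M)"
      using submod_zero[OF sM] iso by (auto simp: quot_def)
  qed
  have nin: "coset (spow 1 M) 0 \<notin> quot ?Y (spow 1 M)"
  proof
    assume "coset (spow 1 M) 0 \<in> quot ?Y (spow 1 M)"
    then obtain u where u: "u \<in> ?Y" "coset (spow 1 M) 0 = coset (spow 1 M) u" unfolding quot_def by blast
    then have "u - 0 \<in> spow 1 M" using coset_eq_iff[OF sg, of u 0] by simp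
    then show False using u by (simp only: diff_zero mem_Collect_eq) blast
  qed
  have "finite (quot ?Y (spow 1 M))" using fin unfolding eq by (simp only: finite_insert)
  then have "card (quot ?X (spow 1 M)) = Suc (card (quot ?Y (spow 1 M)))"
    unfolding eq using nin by (rule card_insert_disjoint)
  then show ?thesis using card_norm_vectors[OF M, of 0] by simp
qed

end

section \<open>The primitive local density\<close>

context odd_local_field
begin

text \<open>The sign of a unimodular form of rank \<open>m\<close> and determinant \<open>x\<close>.
  By \<open>disc_sign\<close> the power of -1 is the one in the discriminant.\<close>

definition sg :: "nat \<Rightarrow> 'a \<Rightarrow> int" where "sg m x = \<chi> ((-1) ^ (m div 2) * x)"

lemma disc_sign: "(-1) ^ (m * (m - 1) div 2) = ((-1) ^ (m div 2) :: 'a)"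
proof (cases "even m")
  case True
  then obtain j where j: "m = 2 * j" by blast
  then have "m * (m - 1) div 2 = j * (2 * j - 1)" by simp
  moreover have "even (j * (2 * j - 1)) \<longleftrightarrow> even j" by (cases j) auto
  ultimately show ?thesis using j by (simp add: minus_one_power_iff)
next
  case False
  then obtain j where j: "m = 2 * j + 1" by (metis oddE)
  then have "m * (m - 1) div 2 = j * (2 * j + 1)" by simp
  then show ?thesis using j by (simp add: minus_one_power_iff)
qed

lemma sg_values: "x \<noteq> 0 \<Longrightarrow> v x = 0 \<Longrightarrow> sg m x = 1 \<or> sg m x = - 1"
  unfolding sg_def by (rule chi_unit_values) (simp_all add: val_mult v_power)

lemma sg_cong: "x \<in> \<O> \<Longrightarrow> y \<in> \<O> \<Longrightarrow> \<chi> x = \<chi> y \<Longrightarrow> sg m x = sg m y"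
  by (simp add: sg_def chi_mult O_power)

lemma diag_zeros_cong:
  assumes "\<And>i. i < m \<Longrightarrow> g i = h i"
  shows "diag_zeros g m a = diag_zeros h m a"
  using assms by (simp add: diag_zeros_def)

abbreviation Q :: real where "Q \<equiv> real q"

lemma Q_pos: "Q > 0" "Q \<noteq> 0" "Q > 1"
  using q_gt_1 by auto

lemma diag_zeros_even:
  assumes "\<And>i. i < 2 * j \<Longrightarrow> g i \<noteq> 0 \<and> v (g i) = 0" "a \<in> \<O>"
  shows "real (diag_zeros g (2 * j) a) = Q ^ (2 * j) / Q +
      of_int (sg (2 * j) (\<Prod>i<2*j. g i)) * Q ^ j * ((if a \<in> PP 1 then 1 else 0) - 1 / Q)"
proof -
  \<comment> \<open>The preceding point count speaks of 2j + 1 unit coefficients at once; the one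
    beyond the rank is set to 1.\<close>
  define h where "h i = (if i < 2 * j then g i else 1)" for i
  have "diag_zeros g (2 * j) a = diag_zeros h (2 * j) a" by (rule diag_zeros_cong) (simp add: h_def)
  moreover have "(\<Prod>i<2*j. g i) = (\<Prod>i<2*j. h i)" by (rule prod.cong) (auto simp: h_def)
  ultimately show ?thesis
    using diag_zeros_aux[of j h] assms by (simp add: h_def sg_def)
qed

lemma diag_zeros_odd:
  assumes "\<And>i. i < 2 * j + 1 \<Longrightarrow> g i \<noteq> 0 \<and> v (g i) = 0" "a \<in> \<O>"
  shows "real (diag_zeros g (2 * j + 1) a) = Q ^ (2 * j) +
      of_int (sg (2 * j) ((\<Prod>i<2*j+1. g i) * a)) * Q ^ j"
  using diag_zeros_aux[of j g] assms by (simp add: sg_def mult.assoc)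

definition zeta_factor :: "int \<Rightarrow> real" where "zeta_factor i = 1 - Q powi (- 2 * i)"

text \<open>
  The normalized number of embeddings of a diagonal form with \<open>t\<close> zeros modulo \<open>\<varpi>\<close> and \<open>m - m'\<close>
  units into a unimodular form of rank \<open>m\<close> and sign \<open>\<eta>\<close>; \<open>\<zeta>\<close> is the sign of the complement, of rank
  \<open>m'\<close>, of the unit part.
\<close>

definition emb_density :: "nat \<Rightarrow> nat \<Rightarrow> nat \<Rightarrow> int \<Rightarrow> int \<Rightarrow> real" where
  "emb_density m m' t \<eta> \<zeta> = (1 - (if even m then of_int \<eta> * Q powi (- int (m div 2)) else 0)) *
     (1 + (if even m' then of_int \<zeta> * Q powi (int t - int (m' div 2)) else 0)) *
     (\<Prod>i\<in>{i. int m' - 2 * int t < 2 * i \<and> 2 * i < int m}. zeta_factor i)"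

text \<open>The dimension as an integer: it becomes negative when \<open>n\<close> is large against
  \<open>m\<close>, and the induction for isotropic vectors passes through such cases.\<close>

definition emb_dim :: "nat \<Rightarrow> nat \<Rightarrow> int" where "emb_dim m n = int m * int n - int (n * (n + 1) div 2)"

lemma emb_dim_0: "emb_dim m 0 = 0"
  by (simp add: emb_dim_def)

lemma emb_dim_Suc: "emb_dim m (Suc n) = emb_dim m n + int m - int n - 1"
proof -
  have "Suc n * (Suc n + 1) div 2 = n * (n + 1) div 2 + Suc n" by simp
  then have "int (Suc n * (Suc n + 1) div 2) = int (n * (n + 1) div 2) + int n + 1" by linarith
  then show ?thesis unfolding emb_dim_def by (simp add: algebra_simps)
qed

lemma emb_dim_Suc_m: "emb_dim (Suc m) n = emb_dim m n + int n"
  by (simp add: emb_dim_def algebra_simps)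

section \<open>Recursions for the embedding density: the normalized number of choices for one vector
  is split off\<close>

lemma emb_density_unit_even:
  assumes "odd k" "m' \<le> k"
  shows "emb_density (Suc k) m' t \<eta> \<zeta> = (1 - of_int \<eta> * Q powi (- int (Suc k div 2))) * emb_density k m' t \<eta>' \<zeta>"
proof -
  have "{i. int m' - 2 * int t < 2 * i \<and> 2 * i < int (Suc k)} = {i. int m' - 2 * int t < 2 * i \<and> 2 * i < int k}"
  proof -
    obtain j where "k = 2 * j + 1" using assms(1) by (rule oddE)
    then have "2 * i < int (Suc k) \<longleftrightarrow> 2 * i < int k" for i :: int by presburger
    then show ?thesis by simp
  qed
  then show ?thesis using assms(1) by (simp add: emb_density_def)
qed

lemma zeta_factor_split: "\<eta> = 1 \<or> \<eta> = - 1 \<Longrightarrow> (1 + of_int \<eta> * Q powi (- i)) * (1 - of_int \<eta> * Q powi (- i)) = zeta_factor i"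
proof -
  have "Q powi (- 2 * i) = Q powi (- i) * Q powi (- i)"
    using Q_pos by (simp flip: power_int_add)
  then show "\<eta> = 1 \<or> \<eta> = - 1 \<Longrightarrow> ?thesis" by (auto simp: zeta_factor_def algebra_simps)
qed

lemma finite_even_interval: "finite {i::int. a < 2 * i \<and> 2 * i < b}"
  by (rule finite_subset[of _ "{min a 0..max b 0}"]) auto

text \<open>The index k/2 enters the product. Its factor splits into 1 + \<eta>' q^(-k/2), the
  normalized number of choices, and 1 - \<eta>' q^(-k/2), the first factor of the density for the
  even rank k.\<close>

lemma emb_density_unit_odd:
  assumes "even k" "int m' - 2 * int t < int k" "\<eta>' = 1 \<or> \<eta>' = - 1"
  shows "emb_density (Suc k) m' t \<eta> \<zeta> = (1 + of_int \<eta>' * Q powi (- int (k div 2))) * emb_density k m' t \<eta>' \<zeta>"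
proof -
  obtain j where j: "k = 2 * j" using assms(1) by blast
  have "{i. int m' - 2 * int t < 2 * i \<and> 2 * i < int (Suc k)} =
      insert (int j) {i. int m' - 2 * int t < 2 * i \<and> 2 * i < int k}"
    using assms(2) j by auto
  moreover have "int j \<notin> {i. int m' - 2 * int t < 2 * i \<and> 2 * i < int k}" using j by simp
  ultimately have "(\<Prod>i\<in>{i. int m' - 2 * int t < 2 * i \<and> 2 * i < int (Suc k)}. zeta_factor i) =
      zeta_factor (int j) * (\<Prod>i\<in>{i. int m' - 2 * int t < 2 * i \<and> 2 * i < int k}. zeta_factor i)"
    using finite_even_interval by simp
  then show ?thesis using j zeta_factor_split[OF assms(3), of "int j"] by (simp add: emb_density_def mult_ac)
qed

text \<open>Removing a plane together with one isotropic vector lowers m' by 2 and t by 1, so the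
  lower end m' - 2t of the range is unchanged and only one index at the upper end
  disappears.\<close>

lemma emb_density_isotropic_even:
  assumes "even k" "t \<ge> 1" "\<eta> = 1 \<or> \<eta> = - 1"
  shows "emb_density (Suc (Suc k)) (Suc (Suc k)) (Suc t) \<eta> \<eta> =
    (1 - of_int \<eta> * Q powi (- int (k div 2) - 1)) * (1 + of_int \<eta> * Q powi (- int (k div 2))) * emb_density k k t \<eta> \<eta>"
proof -
  obtain j where j: "k = 2 * j" using assms(1) by blast
  have "{i. int (Suc (Suc k)) - 2 * int (Suc t) < 2 * i \<and> 2 * i < int (Suc (Suc k))} =
      insert (int j) {i. int k - 2 * int t < 2 * i \<and> 2 * i < int k}"
    using assms(2) j by auto
  moreover have "int j \<notin> {i. int k - 2 * int t < 2 * i \<and> 2 * i < int k}" using j by simp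
  ultimately have "(\<Prod>i\<in>{i. int (Suc (Suc k)) - 2 * int (Suc t) < 2 * i \<and> 2 * i < int (Suc (Suc k))}. zeta_factor i) =
      zeta_factor (int j) * (\<Prod>i\<in>{i. int k - 2 * int t < 2 * i \<and> 2 * i < int k}. zeta_factor i)"
    using finite_even_interval by simp
  then have "emb_density (Suc (Suc k)) (Suc (Suc k)) (Suc t) \<eta> \<eta> =
      (1 - of_int \<eta> * Q powi (- int j - 1)) * (1 + of_int \<eta> * Q powi (int t - int j)) *
      (zeta_factor (int j) * (\<Prod>i\<in>{i. int k - 2 * int t < 2 * i \<and> 2 * i < int k}. zeta_factor i))"
  proof -
    assume *: "(\<Prod>i\<in>{i. int (Suc (Suc k)) - 2 * int (Suc t) < 2 * i \<and> 2 * i < int (Suc (Suc k))}. zeta_factor i) =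
      zeta_factor (int j) * (\<Prod>i\<in>{i. int k - 2 * int t < 2 * i \<and> 2 * i < int k}. zeta_factor i)"
    have ab: "- int (Suc (Suc k) div 2) = - int j - 1" "int (Suc t) - int (Suc (Suc k) div 2) = int t - int j"
      using j by auto
    show ?thesis unfolding emb_density_def * ab using j by simp
  qed
  moreover have "emb_density k k t \<eta> \<eta> = (1 - of_int \<eta> * Q powi (- int j)) * (1 + of_int \<eta> * Q powi (int t - int j)) *
      (\<Prod>i\<in>{i. int k - 2 * int t < 2 * i \<and> 2 * i < int k}. zeta_factor i)"
    unfolding emb_density_def using j by simp
  moreover have "k div 2 = j" using j by simp
  ultimately show ?thesis using zeta_factor_split[OF assms(3), of "int j", symmetric] by (simp only: mult_ac)
qed

lemma emb_density_isotropic_odd: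
  assumes "odd k" "t \<ge> 1"
  shows "emb_density (Suc (Suc k)) (Suc (Suc k)) (Suc t) \<eta> \<eta> = zeta_factor (int (Suc k div 2)) * emb_density k k t \<eta>' \<eta>'"
proof -
  obtain j where j: "k = 2 * j + 1" using assms(1) by (rule oddE)
  have "{i. int (Suc (Suc k)) - 2 * int (Suc t) < 2 * i \<and> 2 * i < int (Suc (Suc k))} =
      insert (int j + 1) {i. int k - 2 * int t < 2 * i \<and> 2 * i < int k}"
    using assms(2) j by auto
  moreover have "int j + 1 \<notin> {i. int k - 2 * int t < 2 * i \<and> 2 * i < int k}" using j by simp
  ultimately have "(\<Prod>i\<in>{i. int (Suc (Suc k)) - 2 * int (Suc t) < 2 * i \<and> 2 * i < int (Suc (Suc k))}. zeta_factor i) =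
      zeta_factor (int j + 1) * (\<Prod>i\<in>{i. int k - 2 * int t < 2 * i \<and> 2 * i < int k}. zeta_factor i)"
    using finite_even_interval by simp
  moreover have "int (Suc k div 2) = int j + 1" using j by simp
  ultimately show ?thesis unfolding emb_density_def using j by (simp add: add.commute)
qed

text \<open>Unimodular forms of rank below 2 have no nonzero isotropic vectors modulo
  \<open>\<varpi>\<close>, and the formula agrees: in rank 0 the first factor vanishes, in rank 1
  the product contains the index 0.\<close>

lemma emb_density_small:
  assumes "m < 2" "t \<ge> 1" "m = 0 \<Longrightarrow> \<eta> = 1"
  shows "emb_density m m t \<eta> \<eta> = 0"
proof (cases "m = 0")
  case True
  then show ?thesis using assms by (simp add: emb_density_def)
next
  case False
  then have m: "m = 1" using assms by simp
  have "0 \<in> {i. int m - 2 * int t < 2 * i \<and> 2 * i < int m}" using m assms by simp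
  moreover have "zeta_factor 0 = 0" by (simp add: zeta_factor_def)
  ultimately have "(\<Prod>i\<in>{i. int m - 2 * int t < 2 * i \<and> 2 * i < int m}. zeta_factor i) = 0"
    using finite_even_interval by (meson prod_zero)
  then show ?thesis by (simp add: emb_density_def)
qed

lemma pow_as_powi: "Q ^ a = Q powi (int a)" "Q ^ a / Q = Q powi (int a - 1)"
  using Q_pos by (simp_all add: power_int_diff)

text \<open>Both sides equal (q^(j+1) - \<eta>) (q^j + \<eta>), the number of nonzero isotropic
  vectors in rank 2j + 2.\<close>

lemma isotropic_count_even:
  assumes "\<eta> = 1 \<or> \<eta> = - 1"
  shows "Q ^ (2 * Suc j) / Q + of_int \<eta> * Q ^ Suc j * (1 - 1 / Q) - 1 =
    Q powi (2 * int j + 1) * ((1 - of_int \<eta> * Q powi (- int j - 1)) * (1 + of_int \<eta> * Q powi (- int j)))"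
proof -
  have pj: "Q ^ (2 * j) = Q ^ j * Q ^ j" by (metis mult_2 power_add)
  have 1: "Q powi (2 * int j + 1) = Q * (Q ^ j * Q ^ j)"
  proof -
    have "Q powi (2 * int j + 1) = Q powi int (2 * j + 1)" by (simp add: add.commute)
    also have "\<dots> = Q ^ (2 * j + 1)" by (rule power_int_of_nat)
    finally show ?thesis using pj by simp
  qed
  have 2: "Q powi (- int j - 1) = 1 / (Q * Q ^ j)" "Q powi (- int j) = 1 / Q ^ j"
    using Q_pos by (simp_all add: power_int_diff power_int_minus field_simps)
  have "Q ^ (2 * Suc j) / Q = Q * (Q ^ j * Q ^ j)"
    using Q_pos pj by simp
  then show ?thesis unfolding 1 2 using assms Q_pos by (auto simp: field_simps)
qed

end

context qspace
begin

section \<open>The number of embeddings, by induction on the vectors\<close>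

lemma card_emb_0: "card (quot (emb 0 M T) (Tup 0 (spow 1 M))) = 1"
proof -
  have "emb 0 M T = {\<lambda>_. 0}" by (auto simp: emb_iff TupI_0 indm_def)
  then show ?thesis by (simp add: quot_def)
qed

text \<open>The common size of the fibres is known only as a real expression \<open>R\<close>. If no
  vector has the required norm, \<open>R\<close> need not be a cardinality, but both sides
  vanish.\<close>

lemma quot_emb_Suc_real:
  assumes M: "unimod m g M"
    and fib: "\<And>u. u \<in> M \<Longrightarrow> u \<notin> spow 1 M \<Longrightarrow> B u u - T n \<in> PP 1 \<Longrightarrow>
      real (card (quot {x \<in> emb (Suc n) M T. x n - u \<in> spow 1 M} (Tup (Suc n) (spow 1 M)))) = R"
  shows "real (card (quot (emb (Suc n) M T) (Tup (Suc n) (spow 1 M)))) =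
    real (card (quot {u \<in> M. u \<notin> spow 1 M \<and> B u u - T n \<in> PP 1} (spow 1 M))) * R"
proof (cases "{u \<in> M. u \<notin> spow 1 M \<and> B u u - T n \<in> PP 1} = {}")
  case True
  then have "card (quot (emb (Suc n) M T) (Tup (Suc n) (spow 1 M))) =
    card (quot {u \<in> M. u \<notin> spow 1 M \<and> B u u - T n \<in> PP 1} (spow 1 M)) * 0"
    by (intro quot_emb_Suc[OF M]) blast
  then show ?thesis unfolding True by (simp add: quot_def)
next
  case False
  then obtain u0 where u0: "u0 \<in> M" "u0 \<notin> spow 1 M" "B u0 u0 - T n \<in> PP 1" by blast
  define C where "C = card (quot {x \<in> emb (Suc n) M T. x n - u0 \<in> spow 1 M} (Tup (Suc n) (spow 1 M)))"
  have R: "real C = R" unfolding C_def by (rule fib[OF u0])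
  have "card (quot (emb (Suc n) M T) (Tup (Suc n) (spow 1 M))) =
    card (quot {u \<in> M. u \<notin> spow 1 M \<and> B u u - T n \<in> PP 1} (spow 1 M)) * C"
  proof (rule quot_emb_Suc[OF M])
    fix u assume "u \<in> M" "u \<notin> spow 1 M" "B u u - T n \<in> PP 1"
    from fib[OF this] show "card (quot {x \<in> emb (Suc n) M T. x n - u \<in> spow 1 M} (Tup (Suc n) (spow 1 M))) = C"
      using R by linarith
  qed
  then show ?thesis using R by simp
qed

text \<open>Each isotropic vector takes a hyperbolic plane out of \<open>M\<close>. The case t = 0
  really differs: for even \<open>m\<close> the formula would give 1 - q^(-m) instead of 1. Hence
  the last vector is treated separately in every case below.\<close>

lemma card_emb_isotropic:
  assumes "unimod m g M" "\<forall>i<t. T i \<in> PP 1" "t \<ge> 1"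
  shows "real (card (quot (emb t M T) (Tup t (spow 1 M)))) =
    Q powi emb_dim m t * emb_density m m t (sg m (dprod m g)) (sg m (dprod m g))"
  using assms
proof (induction t arbitrary: m g M)
  case 0
  then show ?case by simp
next
  case (Suc t)
  note M = Suc.prems(1)
  define \<eta> where "\<eta> = sg m (dprod m g)"
  have D: "dprod m g \<noteq> 0" "v (dprod m g) = 0" using unimod_dprod[OF M] by auto
  have eta: "\<eta> = 1 \<or> \<eta> = - 1" unfolding \<eta>_def by (rule sg_values[OF D])
  have Tt: "T t \<in> PP 1" using Suc.prems(2) by simp
  let ?U = "quot {u \<in> M. u \<notin> spow 1 M \<and> B u u - T t \<in> PP 1} (spow 1 M)"
  have plane: "\<exists>w k g'. w \<in> M \<and> B u w = 1 \<and> m = Suc (Suc k) \<and> unimod k g' (perp (perp M w) u) \<and>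
    \<chi> (dprod m g) = \<chi> (-1) * \<chi> (dprod k g')"
    if "u \<in> M" "u \<notin> spow 1 M" "B u u - T t \<in> PP 1" for u
    using unimod_perp_plane[OF M that(1,2)] cong_P1[OF that(3)] Tt by blast
  show ?case
  proof (cases "m < 2")
    case True
    have "real (card (quot (emb (Suc t) M T) (Tup (Suc t) (spow 1 M)))) = real (card ?U) * 0"
      by (rule quot_emb_Suc_real[OF M]) (use plane True in fastforce)
    moreover have "emb_density m m (Suc t) \<eta> \<eta> = 0"
      by (rule emb_density_small) (use True in \<open>auto simp: \<eta>_def sg_def\<close>)
    ultimately show ?thesis by (simp add: \<eta>_def)
  next
    case False
    then obtain k where k: "m = Suc (Suc k)" by (metis Suc_le_D less_2_cases_iff not_less_eq_eq nat.exhaust)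
    \<comment> \<open>The factor q^t is the freedom of the u-components in
      \<open>emb_fiber_isotropic\<close>; for t = 0 there is a single empty embedding.\<close>
    define R where "R = Q ^ t * (if t = 0 then 1 else Q powi emb_dim k t * emb_density k k t \<eta> \<eta>)"
    have "real (card (quot (emb (Suc t) M T) (Tup (Suc t) (spow 1 M)))) = real (card ?U) * R"
    proof (rule quot_emb_Suc_real[OF M])
      fix u assume u: "u \<in> M" "u \<notin> spow 1 M" "B u u - T t \<in> PP 1"
      then obtain w k' g' where w: "w \<in> M" "B u w = 1" "m = Suc (Suc k')" "unimod k' g' (perp (perp M w) u)"
        "\<chi> (dprod m g) = \<chi> (-1) * \<chi> (dprod k' g')" using plane by blast
      have k': "k' = k" using w(3) k by simp
      have P: "unimod k g' (perp (perp M w) u)" using w(4) k' by simp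
      have uP: "B u u \<in> PP 1" using cong_P1[OF u(3)] Tt by blast
      have fib: "card (quot {x \<in> emb (Suc t) M T. x t - u \<in> spow 1 M} (Tup (Suc t) (spow 1 M))) =
        q ^ t * card (quot (emb t (perp (perp M w) u) T) (Tup t (spow 1 (perp (perp M w) u))))"
        using M u(1,2) uP Tt w(1,2) P by (rule emb_fiber_isotropic)
      have d': "dprod k g' \<in> \<O>" using unimod_dprod[OF P] unit_O by blast
      have m1: "(-1::'a) \<in> \<O>" "(-1::'a) ^ j \<in> \<O>" for j :: nat by (simp_all add: O_power PP_iff[of "-1"])
      have "sg k (dprod k g') = \<eta>"
      proof -
        \<comment> \<open>The sign is preserved: the plane contributes -1 to the determinant, and m
          div 2 drops by one.\<close>
        have "\<eta> = \<chi> ((-1) ^ (k div 2) * (-1)) * \<chi> (dprod m g)"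
        proof -
          have pw: "(-1) ^ (m div 2) = (-1) ^ (k div 2) * (-1::'a)" by (simp add: k)
          show ?thesis unfolding \<eta>_def sg_def pw by (rule chi_mult[OF O_mult[OF m1(2) m1(1)] unit_O[OF D]])
        qed
        also have "\<dots> = \<chi> ((-1) ^ (k div 2)) * (\<chi> (-1) * \<chi> (-1)) * \<chi> (dprod k g')"
          using w(5) k' chi_mult[OF m1(2) m1(1), of "k div 2"] by simp
        also have "\<chi> (-1) * \<chi> (-1) = 1" using chi_mult[OF m1(1) m1(1)] by simp
        finally show ?thesis using chi_mult[OF m1(2) d'] by (simp add: sg_def)
      qed
      then have "real (card (quot (emb t (perp (perp M w) u) T) (Tup t (spow 1 (perp (perp M w) u))))) =
          (if t = 0 then 1 else Q powi emb_dim k t * emb_density k k t \<eta> \<eta>)"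
        using Suc.IH[OF P] Suc.prems(2) card_emb_0 by (cases "t = 0") auto
      then show "real (card (quot {x \<in> emb (Suc t) M T. x t - u \<in> spow 1 M} (Tup (Suc t) (spow 1 M)))) = R"
        unfolding fib R_def by (simp only: of_nat_mult of_nat_power)
    qed
    moreover have "real (card ?U) * R = Q powi emb_dim m (Suc t) * emb_density m m (Suc t) \<eta> \<eta>"
    proof -
      have U: "real (card ?U) = real (diag_zeros (\<lambda>i. B (g i) (g i)) m 0) - 1"
        using card_isotropic_vectors[OF M Tt] by linarith
      have gu: "B (g i) (g i) \<noteq> 0 \<and> v (B (g i) (g i)) = 0" if "i < m" for i
        using M that by (simp add: unimod_def)
      have Em: "Q powi emb_dim m (Suc t) = Q powi (int k + 1) * (Q ^ t * Q powi emb_dim k t)"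
        using Q_pos by (simp add: k emb_dim_Suc emb_dim_Suc_m flip: power_int_of_nat power_int_add)
          (simp add: algebra_simps)
      show ?thesis
      proof (cases "even k")
        case True
        then obtain j where j: "k = 2 * j" by blast
        have "real (diag_zeros (\<lambda>i. B (g i) (g i)) (2 * Suc j) 0) = Q ^ (2 * Suc j) / Q +
            of_int \<eta> * Q ^ Suc j * ((if (0::'a) \<in> PP 1 then 1 else 0) - 1 / Q)"
          using diag_zeros_even[of "Suc j" "\<lambda>i. B (g i) (g i)" 0] gu k j by (simp add: \<eta>_def)
        then have Uv: "real (card ?U) = Q powi (int k + 1) *
            ((1 - of_int \<eta> * Q powi (- int j - 1)) * (1 + of_int \<eta> * Q powi (- int j)))"
          using U isotropic_count_even[OF eta, of j] k j by simp
        show ?thesis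
        proof (cases "t = 0")
          case True
          have "emb_density m m (Suc t) \<eta> \<eta> = (1 - of_int \<eta> * Q powi (- int j - 1)) * (1 + of_int \<eta> * Q powi (- int j))"
          proof -
            have "{i. int m - 2 * int (Suc t) < 2 * i \<and> 2 * i < int m} = {}" using True k j by auto
            moreover have "- int (m div 2) = - int j - 1" "int (Suc t) - int (m div 2) = - int j"
              using True k j by auto
            moreover have "even m" using k j by simp
            ultimately show ?thesis unfolding emb_density_def by (simp only: if_True prod.empty mult_1_right)
          qed
          then show ?thesis using True Uv Em by (simp add: R_def emb_dim_0)
        next
          case False
          then have "emb_density m m (Suc t) \<eta> \<eta> =
            (1 - of_int \<eta> * Q powi (- int j - 1)) * (1 + of_int \<eta> * Q powi (- int j)) * emb_density k k t \<eta> \<eta>"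
            using emb_density_isotropic_even[OF \<open>even k\<close> _ eta, of t] k j by simp
          then show ?thesis using False Uv Em by (simp add: R_def mult_ac)
        qed
      next
        case odd: False
        then obtain j where j: "k = 2 * j + 1" by (rule oddE)
        have "real (diag_zeros (\<lambda>i. B (g i) (g i)) (2 * (j + 1) + 1) 0) = Q ^ (2 * (j + 1))"
          using diag_zeros_odd[of "j + 1" "\<lambda>i. B (g i) (g i)" 0] gu k j by (simp add: sg_def chi_P1)
        then have "real (card ?U) = Q ^ (2 * (j + 1)) - 1" using U k j by simp
        also have "\<dots> = Q powi (int k + 1) * zeta_factor (int j + 1)"
        proof -
          have "Q powi (int k + 1) * Q powi (- 2 * (int j + 1)) = 1"
            using Q_pos j by (simp flip: power_int_add)
          moreover have "Q powi (int k + 1) = Q ^ (2 * (j + 1))"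
            using j by (simp only: pow_as_powi(1)) (simp add: algebra_simps)
          ultimately show ?thesis by (simp add: zeta_factor_def right_diff_distrib)
        qed
        finally have Uv: "real (card ?U) = Q powi (int k + 1) * zeta_factor (int j + 1)" .
        show ?thesis
        proof (cases "t = 0")
          case True
          have "{i. int m - 2 * int (Suc t) < 2 * i \<and> 2 * i < int m} = {int j + 1}" using True k j by auto
          then have "emb_density m m (Suc t) \<eta> \<eta> = zeta_factor (int j + 1)" using k j by (simp add: emb_density_def)
          then show ?thesis using True Uv Em by (simp add: R_def emb_dim_0)
        next
          case False
          then have "emb_density m m (Suc t) \<eta> \<eta> = zeta_factor (int j + 1) * emb_density k k t \<eta> \<eta>"
            using emb_density_isotropic_odd[OF odd, of t \<eta> \<eta>] k j by (simp add: add.commute)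
          then show ?thesis using False Uv Em by (simp add: R_def mult_ac)
        qed
      qed
    qed
    ultimately show ?thesis by (simp add: \<eta>_def)
  qed
qed

lemma card_unit_norm_vectors:
  assumes M: "unimod m g M" and a: "a \<noteq> 0" "v a = 0"
  shows "card (quot {u \<in> M. u \<notin> spow 1 M \<and> B u u - a \<in> PP 1} (spow 1 M)) =
    diag_zeros (\<lambda>i. B (g i) (g i)) m a"
proof -
  have "{u \<in> M. u \<notin> spow 1 M \<and> B u u - a \<in> PP 1} = {u \<in> M. B u u - a \<in> PP 1}"
    using not_spow_1_unit[OF M] cong_unit[OF _ a] by blast
  then show ?thesis using card_norm_vectors[OF M, of a] by simp
qed

text \<open>The entries of unit norm stand last and are embedded first, each replacing
  \<open>M\<close> by an orthogonal complement. The difference m - r and the sign of the complement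
  of all unit vectors are invariant in this induction, and the isotropic case remains at its
  end.\<close>

lemma card_emb:
  assumes "unimod m g M" "\<forall>i<t. T i \<in> PP 1" "\<forall>i. t \<le> i \<longrightarrow> i < t + r \<longrightarrow> T i \<noteq> 0 \<and> v (T i) = 0"
    "t \<ge> 1 \<or> r \<ge> 1" "r \<le> m"
  shows "real (card (quot (emb (t + r) M T) (Tup (t + r) (spow 1 M)))) = Q powi emb_dim m (t + r) *
    emb_density m (m - r) t (sg m (dprod m g)) (sg (m - r) (dprod m g * (\<Prod>i\<in>{t..<t+r}. T i)))"
  using assms
proof (induction r arbitrary: m g M)
  case 0
  then show ?case using card_emb_isotropic[of m g M t T] by simp
next
  case (Suc r)
  note M = Suc.prems(1)
  define n where "n = t + r"
  have Tn: "T n \<noteq> 0" "v (T n) = 0" "T n \<in> \<O>" using Suc.prems(3) unit_O by (auto simp: n_def)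
  obtain k where k: "m = Suc k" using Suc.prems(5) by (cases m) auto
  have D: "dprod m g \<noteq> 0" "v (dprod m g) = 0" "dprod m g \<in> \<O>" using unimod_dprod[OF M] unit_O by auto
  define \<eta> \<eta>' \<zeta> where "\<eta> = sg m (dprod m g)" and "\<eta>' = sg k (dprod m g * T n)"
    and "\<zeta> = sg (m - Suc r) (dprod m g * (\<Prod>i\<in>{t..<t+Suc r}. T i))"
  have eta': "\<eta>' = 1 \<or> \<eta>' = - 1" unfolding \<eta>'_def by (rule sg_values) (use D Tn in \<open>auto simp: val_mult\<close>)
  let ?U = "quot {u \<in> M. u \<notin> spow 1 M \<and> B u u - T n \<in> PP 1} (spow 1 M)"
  define R where "R = (if n = 0 then 1 else Q powi emb_dim k n * emb_density k (k - r) t \<eta>' \<zeta>)"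
  have "real (card (quot (emb (Suc n) M T) (Tup (Suc n) (spow 1 M)))) = real (card ?U) * R"
  proof (rule quot_emb_Suc_real[OF M])
    fix u assume u: "u \<in> M" "u \<notin> spow 1 M" "B u u - T n \<in> PP 1"
    have uu: "B u u \<noteq> 0" "v (B u u) = 0" using cong_unit[OF u(3) Tn(1,2)] by auto
    obtain k' g' where P': "m = Suc k'" "unimod k' g' (perp M u)" "\<chi> (dprod m g) = \<chi> (B u u) * \<chi> (dprod k' g')"
      using unimod_perp[OF M u(1) uu] by blast
    then have P: "unimod k g' (perp M u)" "\<chi> (dprod m g) = \<chi> (B u u) * \<chi> (dprod k g')" using k by auto
    have d': "dprod k g' \<in> \<O>" using unimod_dprod[OF P(1)] unit_O by blast
    have "\<chi> (B u u) = \<chi> (T n)" by (rule chi_cong[OF u(3)]) (use uu unit_O in blast)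
    then have "\<chi> (dprod m g * T n) = (\<chi> (T n) * \<chi> (T n)) * \<chi> (dprod k g')"
      using P(2) chi_mult[OF D(3) Tn(3)] by simp
    also have "\<chi> (T n) * \<chi> (T n) = 1" using chi_unit_values[OF Tn(1,2)] by auto
    finally have chi': "\<chi> (dprod m g * T n) = \<chi> (dprod k g')" by simp
    have "real (card (quot (emb n (perp M u) T) (Tup n (spow 1 (perp M u))))) = R"
    proof (cases "n = 0")
      case True
      then show ?thesis using card_emb_0 by (simp add: R_def)
    next
      case False
      have "real (card (quot (emb n (perp M u) T) (Tup n (spow 1 (perp M u))))) = Q powi emb_dim k n *
          emb_density k (k - r) t (sg k (dprod k g')) (sg (k - r) (dprod k g' * (\<Prod>i\<in>{t..<t+r}. T i)))"
        unfolding n_def by (rule Suc.IH[OF P(1)]) (use Suc.prems False k in \<open>auto simp: n_def\<close>)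
      moreover have "sg k (dprod k g') = \<eta>'"
        unfolding \<eta>'_def by (rule sg_cong) (use d' D Tn O_mult chi' in auto)
      \<comment> \<open>Splitting off u moves T n, which is B u u up to a unit square, from the
        entries into the determinant of the complement; the final sign does not change.\<close>
      moreover have "sg (k - r) (dprod k g' * (\<Prod>i\<in>{t..<t+r}. T i)) = \<zeta>"
      proof -
        have TO: "(\<Prod>i\<in>{t..<t+r}. T i) \<in> \<O>" using Suc.prems(3) by (intro O_prod unit_O) auto
        have "dprod m g * (\<Prod>i\<in>{t..<t+Suc r}. T i) = (dprod m g * T n) * (\<Prod>i\<in>{t..<t+r}. T i)"
          by (simp add: n_def mult_ac)
        moreover have "\<chi> ((dprod m g * T n) * (\<Prod>i\<in>{t..<t+r}. T i)) = \<chi> (dprod k g' * (\<Prod>i\<in>{t..<t+r}. T i))"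
          using chi_mult TO d' D Tn O_mult chi' by simp
        ultimately have c: "\<chi> (dprod k g' * (\<Prod>i\<in>{t..<t+r}. T i)) = \<chi> (dprod m g * (\<Prod>i\<in>{t..<t+Suc r}. T i))"
          by (simp only:)
        have "(\<Prod>i\<in>{t..<t+Suc r}. T i) \<in> \<O>" using Suc.prems(3) by (intro O_prod unit_O) auto
        then have "sg (k - r) (dprod k g' * (\<Prod>i\<in>{t..<t+r}. T i)) = sg (k - r) (dprod m g * (\<Prod>i\<in>{t..<t+Suc r}. T i))"
          by (intro sg_cong[OF O_mult[OF d' TO] O_mult[OF D(3)] c])
        moreover have "k - r = m - Suc r" using k by simp
        ultimately show ?thesis unfolding \<zeta>_def by (simp only:)
      qed
      ultimately show ?thesis using False by (simp add: R_def)
    qed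
    then show "real (card (quot {x \<in> emb (Suc n) M T. x n - u \<in> spow 1 M} (Tup (Suc n) (spow 1 M)))) = R"
    proof -
      have "card (quot {x \<in> emb (Suc n) M T. x n - u \<in> spow 1 M} (Tup (Suc n) (spow 1 M))) =
        card (quot (emb n (perp M u) T) (Tup n (spow 1 (perp M u))))"
        using M u(1) uu u(3) P(1) by (rule emb_fiber_unit)
      then show ?thesis using \<open>real _ = R\<close> by (simp only:)
    qed
  qed
  moreover have "real (card ?U) * R = Q powi emb_dim m (Suc n) * emb_density m (k - r) t \<eta> \<zeta>"
  proof -
    have U: "real (card ?U) = real (diag_zeros (\<lambda>i. B (g i) (g i)) m (T n))"
      using card_unit_norm_vectors[OF M Tn(1,2)] by simp
    have gu: "B (g i) (g i) \<noteq> 0 \<and> v (B (g i) (g i)) = 0" if "i < m" for i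
      using M that by (simp add: unimod_def)
    have "emb_dim m (Suc n) = int k + emb_dim k n" by (simp add: k emb_dim_Suc emb_dim_Suc_m)
    then have Em: "Q powi emb_dim m (Suc n) = Q powi (int k) * Q powi emb_dim k n"
      using power_int_add[of Q "int k" "emb_dim k n"] Q_pos(2) by (simp del: power_int_of_nat)
    have TnP: "T n \<notin> PP 1" using Tn by (simp add: unit_not_P1)
    show ?thesis
    proof (cases "even k")
      case False
      then obtain j where j: "k = 2 * j + 1" by (rule oddE)
      have "real (diag_zeros (\<lambda>i. B (g i) (g i)) (2 * (j + 1)) (T n)) = Q ^ (2 * (j + 1)) / Q +
          of_int \<eta> * Q ^ (j + 1) * ((if T n \<in> PP 1 then 1 else 0) - 1 / Q)"
        using diag_zeros_even[of "j + 1" "\<lambda>i. B (g i) (g i)" "T n"] gu k j Tn(3) by (simp add: \<eta>_def)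
      then have "real (card ?U) = Q ^ (2 * (j + 1)) / Q - of_int \<eta> * (Q ^ (j + 1) / Q)"
        using U TnP k j by simp
      also have "\<dots> = Q powi (int k) * (1 - of_int \<eta> * Q powi (- int (Suc k div 2)))"
      proof -
        have "Q powi (int k) * Q powi (- int (Suc k div 2)) = Q powi (int (j + 1) - 1)"
          using Q_pos j by (simp flip: power_int_add)
        moreover have "Q powi (int k) = Q powi (int (2 * (j + 1)) - 1)" using j by simp
        ultimately show ?thesis unfolding pow_as_powi(2) by (simp add: right_diff_distrib mult.left_commute)
      qed
      finally have Uv: "real (card ?U) = Q powi (int k) * (1 - of_int \<eta> * Q powi (- int (Suc k div 2)))" .
      show ?thesis
      proof (cases "n = 0")
        case True
        then have tr: "t = 0" "r = 0" by (auto simp: n_def)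
        then have empty: "{i. int (k - r) - 2 * int t < 2 * i \<and> 2 * i < int m} = {}" using k by auto
        have "odd (k - r)" "even m" using False k tr by auto
        then have "emb_density m (k - r) t \<eta> \<zeta> = 1 - of_int \<eta> * Q powi (- int (Suc k div 2))"
          unfolding emb_density_def empty using k by simp
        then show ?thesis using True Uv Em by (simp add: R_def emb_dim_0)
      next
        case n0: False
        have "emb_density m (k - r) t \<eta> \<zeta> = (1 - of_int \<eta> * Q powi (- int (Suc k div 2))) * emb_density k (k - r) t \<eta>' \<zeta>"
          unfolding k by (rule emb_density_unit_even) (use False in auto)
        then show ?thesis using n0 Uv Em by (simp add: R_def mult_ac)
      qed
    next
      case True
      then obtain j where j: "k = 2 * j" by blast
      have "real (diag_zeros (\<lambda>i. B (g i) (g i)) (2 * j + 1) (T n)) = Q ^ (2 * j) +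
          of_int (sg (2 * j) ((\<Prod>i<2*j+1. B (g i) (g i)) * T n)) * Q ^ j"
        by (rule diag_zeros_odd) (use gu k j Tn(3) in auto)
      then have "real (card ?U) = Q ^ (2 * j) + of_int \<eta>' * Q ^ j"
        using U k j by (simp add: \<eta>'_def)
      also have "\<dots> = Q powi (int k) * (1 + of_int \<eta>' * Q powi (- int (k div 2)))"
      proof -
        have "Q powi (int k) * Q powi (- int (k div 2)) = Q powi (int j)"
          using Q_pos j by (simp flip: power_int_add)
        moreover have "Q powi (int k) = Q powi (int (2 * j))" using j by simp
        ultimately show ?thesis unfolding pow_as_powi(1) by (simp add: distrib_left mult.left_commute)
      qed
      finally have Uv: "real (card ?U) = Q powi (int k) * (1 + of_int \<eta>' * Q powi (- int (k div 2)))" .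
      show ?thesis
      proof (cases "n = 0")
        case n0: True
        then have tr: "t = 0" "r = 0" by (auto simp: n_def)
        then have empty: "{i. int (k - r) - 2 * int t < 2 * i \<and> 2 * i < int m} = {}" using k by auto
        have "\<zeta> = \<eta>'" using tr k by (simp add: \<zeta>_def \<eta>'_def n_def)
        moreover have "even (k - r)" "odd m" "int t - int ((k - r) div 2) = - int (k div 2)" using True k tr by auto
        ultimately have "emb_density m (k - r) t \<eta> \<zeta> = 1 + of_int \<eta>' * Q powi (- int (k div 2))"
          unfolding emb_density_def empty by simp
        then show ?thesis using n0 Uv Em by (simp add: R_def emb_dim_0)
      next
        case False
        have "emb_density m (k - r) t \<eta> \<zeta> = (1 + of_int \<eta>' * Q powi (- int (k div 2))) * emb_density k (k - r) t \<eta>' \<zeta>"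
          unfolding k by (rule emb_density_unit_odd) (use True False Suc.prems(5) k eta' in \<open>auto simp: n_def\<close>)
        then show ?thesis using False Uv Em by (simp add: R_def mult_ac)
      qed
    qed
  qed
  ultimately show ?case using k by (simp add: n_def \<eta>_def \<zeta>_def)
qed

end

section \<open>Integral overlattices\<close>

context qspace
begin

definition nondeg :: "'b set \<Rightarrow> bool" where
  "nondeg L \<longleftrightarrow> (\<forall>x\<in>rational_span V L. (\<forall>y\<in>rational_span V L. B x y = 0) \<longrightarrow> x = 0)"

lemma orth_norm_nonzero:
  assumes g: "lbas n g L" "orth n g" and L: "nondeg L" and i: "i < n"
  shows "B (g i) (g i) \<noteq> 0"
proof
  assume z: "B (g i) (g i) = 0"
  have gi: "g i \<in> rational_span V L" using lbas_base[OF g(1) i] lattice_subset_span by blast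
  have "B (g i) y = 0" if y: "y \<in> rational_span V L" for y
  proof -
    obtain c where c: "y = lc n g c" using lbas_obtain_span[OF g(1) y] by blast
    have "B (g i) (g j) = 0" if "j < n" for j using g(2) i that z by (cases "i = j") (auto simp: orth_def)
    then show ?thesis by (simp add: c B_lc(2))
  qed
  then have "g i = 0" using L gi by (auto simp: nondeg_def)
  then have "lc n g (\<lambda>j. if j = i then 1 else 0) = 0" using i by (simp add: lc_single)
  then have "(\<lambda>j. if j = i then 1 else (0::'a)) i = 0" using g(1) i unfolding lbas_def ind_def by blast
  then show False by simp
qed

lemma B_orth_coeff:
  assumes "orth n g" "i < n"
  shows "B (lc n g c) (g i) = c i * B (g i) (g i)"
proof -
  have "B (lc n g c) (g i) = (\<Sum>j<n. if j = i then c i * B (g i) (g i) else 0)"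
    unfolding B_lc(1) by (rule sum.cong) (use assms in \<open>auto simp: orth_def\<close>)
  then show ?thesis using assms(2) by simp
qed

lemma dual_lattice_orth:
  assumes g: "lbas n g L" "orth n g" and L: "nondeg L"
  shows "dual_lattice v V L = lat n g (\<lambda>i. - v (B (g i) (g i)))"
proof
  show "dual_lattice v V L \<subseteq> lat n g (\<lambda>i. - v (B (g i) (g i)))"
  proof
    fix x assume x: "x \<in> dual_lattice v V L"
    then obtain c where c: "x = lc n g c" using lbas_obtain_span[OF g(1), of x] by (auto simp: dual_lattice_def)
    have "c i \<in> PP (- v (B (g i) (g i)))" if i: "i < n" for i
    proof -
      have "B x (g i) \<in> \<O>" using x lbas_base[OF g(1) i] by (auto simp: dual_lattice_def)
      then have "B (g i) (g i) * c i \<in> \<O>" using B_orth_coeff[OF g(2) i] by (simp add: c mult.commute)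
      then show ?thesis using orth_norm_nonzero[OF g L i] by (simp add: PP_mult_cancel)
    qed
    then show "x \<in> lat n g (\<lambda>i. - v (B (g i) (g i)))" unfolding c by (intro latI)
  qed
  show "lat n g (\<lambda>i. - v (B (g i) (g i))) \<subseteq> dual_lattice v V L"
  proof
    fix x assume "x \<in> lat n g (\<lambda>i. - v (B (g i) (g i)))"
    then obtain c where c: "x = lc n g c" "\<forall>i<n. c i \<in> PP (- v (B (g i) (g i)))" by (auto simp: lat_def)
    have "B x (g i) \<in> \<O>" if "i < n" for i
      using PP_mult[of "c i" "- v (B (g i) (g i))" "B (g i) (g i)" "v (B (g i) (g i))"] c that
        B_orth_coeff[OF g(2) that] by (simp add: PP_iff[of "B _ _"])
    then have "B x y \<in> \<O>" if "y \<in> L" for y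
      using that g(1) by (auto simp: lbas_def lat_def B_lc(2) intro!: PP_sum O_mult)
    then show "x \<in> dual_lattice v V L"
      using lc_in_rational_span[OF g(1)] by (auto simp: dual_lattice_def c(1))
  qed
qed

lemma same_span:
  assumes "L \<subseteq> L'" "L' \<subseteq> rational_span V L"
  shows "rational_span V L' = rational_span V L"
  unfolding rational_span_def
proof
  show "vs.span L \<subseteq> vs.span L'" by (rule vs.span_mono) (rule assms)
  show "vs.span L' \<subseteq> vs.span L"
    by (rule vs.span_minimal) (use assms in \<open>auto simp: rational_span_def vs.subspace_span\<close>)
qed

lemma lat_mono:
  assumes "\<And>i. i < n \<Longrightarrow> r i \<le> p i"
  shows "lat n e p \<subseteq> lat n e r"
  unfolding lat_def using assms PP_mono by blast

lemma overlattice_facts: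
  assumes L: "lbas n e L" "nondeg L" and L': "L' \<in> integral_overlattices v V L"
  shows "\<exists>f. lbas n f L'" "rational_span V L' = rational_span V L" "nondeg L'"
    "L' \<subseteq> dual_lattice v V L" "\<forall>x\<in>L'. \<forall>y\<in>L'. B x y \<in> \<O>"
proof -
  have 1: "is_lattice v V L'" "L \<subseteq> L'" "L' \<subseteq> rational_span V L" "L' \<subseteq> dual_lattice v V L'"
    using L' by (auto simp: integral_overlattices_def)
  show span: "rational_span V L' = rational_span V L" using same_span 1 by blast
  obtain n' f where f: "lbas n' f L'" using 1(1) is_lattice_iff by blast
  have "rank V L' = rank V L" using span by (metis rank_def rational_span_def vs.dim_span)
  then show "\<exists>f. lbas n f L'" using f lbas_rank[OF f] lbas_rank[OF L(1)] by auto
  show "nondeg L'" using L(2) span by (simp add: nondeg_def)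
  show "\<forall>x\<in>L'. \<forall>y\<in>L'. B x y \<in> \<O>" using 1(4) by (auto simp: dual_lattice_def)
  then show "L' \<subseteq> dual_lattice v V L" using 1 by (auto simp: dual_lattice_def)
qed

end

locale two_qspaces = V: qspace v V + W: qspace v W
  for v :: "'a::field \<Rightarrow> int" and V :: "('a, 'b::ab_group_add) quad_space"
    and W :: "('a, 'c::ab_group_add) quad_space"
begin

section \<open>Homomorphisms as linear maps on the rational span\<close>

text \<open>Linear maps on the rational span, set to 0 outside it. Lattices with the same span thus
  have literally the same homomorphisms, and equality can be tested on a basis.\<close>

definition Hom :: "'b set \<Rightarrow> ('b \<Rightarrow> 'c) set" where
  "Hom L = {\<phi>. (\<forall>x\<in>rational_span V L. \<forall>y\<in>rational_span V L. \<phi> (x + y) = \<phi> x + \<phi> y) \<and>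
     (\<forall>c. \<forall>x\<in>rational_span V L. \<phi> (scl V c x) = scl W c (\<phi> x)) \<and>
     (\<forall>x. x \<notin> rational_span V L \<longrightarrow> \<phi> x = 0)}"

lemma Hom_add: "\<phi> \<in> Hom L \<Longrightarrow> x \<in> rational_span V L \<Longrightarrow> y \<in> rational_span V L \<Longrightarrow> \<phi> (x + y) = \<phi> x + \<phi> y"
  and Hom_scale: "\<phi> \<in> Hom L \<Longrightarrow> x \<in> rational_span V L \<Longrightarrow> \<phi> (scl V c x) = scl W c (\<phi> x)"
  by (auto simp: Hom_def)

lemma span_closed: "0 \<in> rational_span V L"
  "x \<in> rational_span V L \<Longrightarrow> y \<in> rational_span V L \<Longrightarrow> x + y \<in> rational_span V L"
  "x \<in> rational_span V L \<Longrightarrow> y \<in> rational_span V L \<Longrightarrow> x - y \<in> rational_span V L"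
  "x \<in> rational_span V L \<Longrightarrow> scl V c x \<in> rational_span V L"
  by (simp_all add: rational_span_def V.vs.span_zero V.vs.span_add V.vs.span_diff V.vs.span_scale)

lemma Hom_zero: "\<phi> \<in> Hom L \<Longrightarrow> \<phi> 0 = 0"
  using Hom_scale[of \<phi> L 0 0] span_closed(1) by simp

lemma Hom_diff: "\<phi> \<in> Hom L \<Longrightarrow> x \<in> rational_span V L \<Longrightarrow> y \<in> rational_span V L \<Longrightarrow> \<phi> (x - y) = \<phi> x - \<phi> y"
  using Hom_add[of \<phi> L x "scl V (-1) y"] Hom_scale[of \<phi> L y "-1"] span_closed(4)[of y L "-1"] by simp

lemma Hom_lc:
  assumes "\<phi> \<in> Hom L" "\<And>i. i < n \<Longrightarrow> f i \<in> rational_span V L"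
  shows "\<phi> (V.lc n f c) = W.lc n (\<lambda>i. \<phi> (f i)) c \<and> V.lc n f c \<in> rational_span V L"
  using assms(2)
proof (induction n)
  case 0
  then show ?case using Hom_zero[OF assms(1)] span_closed(1) by (simp add: V.lc_def W.lc_def)
next
  case (Suc n)
  then have "V.lc n f c \<in> rational_span V L" "scl V (c n) (f n) \<in> rational_span V L"
    "\<phi> (V.lc n f c) = W.lc n (\<lambda>i. \<phi> (f i)) c" using span_closed(4) by auto
  then show ?case using Hom_add[OF assms(1)] Hom_scale[OF assms(1)] Suc.prems span_closed(2)
    by (simp add: V.lc_Suc W.lc_Suc)
qed

lemma Hom_diff_mem: "\<phi> \<in> Hom L \<Longrightarrow> \<psi> \<in> Hom L \<Longrightarrow> \<phi> - \<psi> \<in> Hom L"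
  by (auto simp: Hom_def W.vs.scale_right_diff_distrib)

definition tup :: "nat \<Rightarrow> (nat \<Rightarrow> 'b) \<Rightarrow> ('b \<Rightarrow> 'c) \<Rightarrow> nat \<Rightarrow> 'c" where
  "tup n f \<phi> = (\<lambda>i. if i < n then \<phi> (f i) else 0)"

lemma tup_diff: "tup n f (\<phi> - \<psi>) = tup n f \<phi> - tup n f \<psi>"
  by (auto simp: tup_def)

lemma Hom_ext:
  assumes f: "V.lbas n f L" and z: "\<And>i. i \<ge> n \<Longrightarrow> z i = 0"
  shows "\<exists>\<phi>\<in>Hom L. tup n f \<phi> = z"
proof -
  define crd where "crd x = (SOME c. x = V.lc n f c)" for x
  have crd: "V.lc n f (crd x) = x" if x: "x \<in> rational_span V L" for x
  proof -
    have "\<exists>c. x = V.lc n f c" using V.lbas_obtain_span[OF f x] by blast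
    from someI_ex[OF this] show ?thesis by (simp add: crd_def)
  qed
  have fi: "V.ind n f" using f by (simp add: V.lbas_def)
  have uniq: "W.lc n z (crd (V.lc n f c)) = W.lc n z c" for c
    by (rule W.lc_cong) (use V.ind_eq[OF fi crd[OF V.lc_in_rational_span[OF f]]] in auto)
  define \<phi> where "\<phi> x = (if x \<in> rational_span V L then W.lc n z (crd x) else 0)" for x
  have phi: "\<phi> (V.lc n f c) = W.lc n z c" for c
    using uniq V.lc_in_rational_span[OF f] by (simp add: \<phi>_def)
  have "\<phi> \<in> Hom L"
    unfolding Hom_def
  proof (intro CollectI conjI ballI allI impI)
    fix x y assume "x \<in> rational_span V L" "y \<in> rational_span V L"
    then obtain c d where "x = V.lc n f c" "y = V.lc n f d" using crd by metis
    then show "\<phi> (x + y) = \<phi> x + \<phi> y" by (simp add: phi V.lc_add W.lc_add)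
  next
    fix c x assume "x \<in> rational_span V L"
    then obtain d where "x = V.lc n f d" using crd by metis
    then show "\<phi> (scl V c x) = scl W c (\<phi> x)" by (simp add: phi V.lc_scale W.lc_scale)
  qed (simp add: \<phi>_def)
  moreover have "tup n f \<phi> = z"
  proof
    fix i
    show "tup n f \<phi> i = z i"
    proof (cases "i < n")
      case True
      then show ?thesis using phi[of "\<lambda>j. if j = i then 1 else 0"]
        by (simp add: tup_def V.lc_single W.lc_single)
    qed (use z in \<open>simp add: tup_def\<close>)
  qed
  ultimately show ?thesis by blast
qed

text \<open>A basis turns the count of homomorphisms into a count of tuples of images.\<close>

lemma quot_Hom_tup:
  assumes f: "V.lbas n f L" and K: "subgrp K" "\<And>z i. z \<in> K \<Longrightarrow> i \<ge> n \<Longrightarrow> z i = 0"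
    and Y: "\<And>z i. z \<in> Y \<Longrightarrow> i \<ge> n \<Longrightarrow> z i = 0"
  shows "card (quot {\<phi> \<in> Hom L. tup n f \<phi> \<in> Y} {\<phi> \<in> Hom L. tup n f \<phi> \<in> K}) = card (quot Y K)"
    "finite (quot {\<phi> \<in> Hom L. tup n f \<phi> \<in> Y} {\<phi> \<in> Hom L. tup n f \<phi> \<in> K}) \<longleftrightarrow> finite (quot Y K)"
proof -
  have zero: "0 \<in> Hom L" by (auto simp: Hom_def)
  have sg: "subgrp {\<phi> \<in> Hom L. tup n f \<phi> \<in> K}"
  proof -
    have "tup n f 0 = 0" by (auto simp: tup_def)
    then show ?thesis using K(1) zero Hom_diff_mem by (auto simp: subgrp_def tup_diff)
  qed
  have A: "tup n f \<phi> \<in> Y" if "\<phi> \<in> {\<phi> \<in> Hom L. tup n f \<phi> \<in> Y}" for \<phi> using that by simp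
  have B: "\<exists>\<phi>\<in>{\<phi> \<in> Hom L. tup n f \<phi> \<in> Y}. tup n f \<phi> - z \<in> K" if z: "z \<in> Y" for z
  proof -
    obtain \<phi> where "\<phi> \<in> Hom L" "tup n f \<phi> = z" using Hom_ext[OF f, of z] Y[OF z] by blast
    then show ?thesis using z subgrp_zero[OF K(1)] by auto
  qed
  have C: "tup n f \<phi> - tup n f \<psi> \<in> K \<longleftrightarrow> \<phi> - \<psi> \<in> {\<phi> \<in> Hom L. tup n f \<phi> \<in> K}"
    if "\<phi> \<in> {\<phi> \<in> Hom L. tup n f \<phi> \<in> Y}" "\<psi> \<in> {\<phi> \<in> Hom L. tup n f \<phi> \<in> Y}" for \<phi> \<psi>
    using that Hom_diff_mem by (auto simp: tup_diff)
  show "card (quot {\<phi> \<in> Hom L. tup n f \<phi> \<in> Y} {\<phi> \<in> Hom L. tup n f \<phi> \<in> K}) = card (quot Y K)"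
    "finite (quot {\<phi> \<in> Hom L. tup n f \<phi> \<in> Y} {\<phi> \<in> Hom L. tup n f \<phi> \<in> K}) \<longleftrightarrow> finite (quot Y K)"
    by (rule quot_card_cong[OF sg K(1), of "{\<phi> \<in> Hom L. tup n f \<phi> \<in> Y}" "tup n f" Y, OF A B C];
        assumption)+
qed

text \<open>Linear lifts of the elements of \<open>rep_set\<close>. Two lifts induce the same
  element exactly when they differ by an element of \<open>KN\<close>.\<close>

definition RN :: "'c set \<Rightarrow> 'b set \<Rightarrow> nat \<Rightarrow> ('b \<Rightarrow> 'c) set" where
  "RN M L N = {\<phi> \<in> Hom L. (\<forall>x\<in>L. \<phi> x \<in> M) \<and>
     (\<forall>x\<in>L. \<forall>y\<in>L. frm W (\<phi> x) (\<phi> y) - frm V x y \<in> V.PP (int N))}"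

definition KN :: "'c set \<Rightarrow> 'b set \<Rightarrow> nat \<Rightarrow> ('b \<Rightarrow> 'c) set" where
  "KN M L N = {\<phi> \<in> Hom L. \<forall>x\<in>L. \<phi> x \<in> W.spow N M}"

lemma subgrp_KN: "W.submod M \<Longrightarrow> subgrp (KN M L N)"
  using W.submod_zero[OF W.submod_spow] W.submod_diff[OF W.submod_spow] Hom_diff_mem
  by (auto simp: subgrp_def KN_def) (auto simp: Hom_def)

text \<open>Homomorphisms between the quotients lift to linear maps because \<open>L\<close> is
  free: lift the images of a basis.\<close>

lemma card_rep_set:
  assumes L: "V.lbas n e L" and M: "W.unimod m g M"
  shows "card (rep_set v W M V L N) = card (quot (RN M L N) (KN M L N))"
proof -
  have sL: "V.submod L" using L V.lbas_submod by blast
  have sM: "W.submod M" using M W.unimod_submod by blast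
  have LS: "x \<in> rational_span V L" if "x \<in> L" for x using that V.lattice_subset_span by blast
  let ?SL = "V.spow N L" and ?SM = "W.spow N M"
  have scL: "scaled_lattice v V N L = ?SL" by (rule V.scaled_lattice_eq[OF sL])
  have scM: "scaled_lattice v W N M = ?SM" by (rule W.scaled_lattice_eq[OF sM])
  have sSL: "V.submod ?SL" "subgrp ?SL" using V.submod_spow[OF sL] V.submod_subgrp by blast+
  have sSM: "W.submod ?SM" "subgrp ?SM" using W.submod_spow[OF sM] W.submod_subgrp by blast+
  define F where "F \<phi> = restrict (\<lambda>A. coset ?SM (\<phi> (SOME x. x \<in> L \<and> A = coset ?SL x))) (quot L ?SL)" for \<phi> :: "'b \<Rightarrow> 'c"
  have Fval: "F \<phi> (coset ?SL x) = coset ?SM (\<phi> x)" if phi: "\<phi> \<in> Hom L" "\<forall>x\<in>L. \<phi> x \<in> M" and x: "x \<in> L" for \<phi> x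
  proof -
    define y where "y = (SOME y. y \<in> L \<and> coset ?SL x = coset ?SL y)"
    have "\<exists>y. y \<in> L \<and> coset ?SL x = coset ?SL y" using x by blast
    from someI_ex[OF this] have y: "y \<in> L" "coset ?SL x = coset ?SL y" by (auto simp: y_def)
    then have "y - x \<in> ?SL" using coset_eq_iff[OF sSL(2), of y x] by simp
    then obtain d where d: "d \<in> L" "y - x = scl V (V.\<pi> ^ N) d" by blast
    have "\<phi> y - \<phi> x = scl W (V.\<pi> ^ N) (\<phi> d)"
      using Hom_diff[OF phi(1) LS[OF y(1)] LS[OF x]] Hom_scale[OF phi(1) LS[OF d(1)]] d(2) by simp
    then have "\<phi> y - \<phi> x \<in> ?SM" using phi(2) d(1) by blast
    then have "coset ?SM (\<phi> y) = coset ?SM (\<phi> x)" using coset_eq_iff[OF sSM(2)] by blast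
    then show ?thesis using x by (simp add: F_def quot_def y_def[symmetric])
  qed
  have RNd: "\<phi> \<in> Hom L" "\<forall>x\<in>L. \<phi> x \<in> M" "\<forall>x\<in>L. \<forall>y\<in>L. frm W (\<phi> x) (\<phi> y) - frm V x y \<in> V.PP (int N)"
    if "\<phi> \<in> RN M L N" for \<phi> using that by (auto simp: RN_def)
  have FR: "F \<phi> \<in> rep_set v W M V L N" if phi: "\<phi> \<in> RN M L N" for \<phi>
    unfolding rep_set_def scL scM
  proof (intro CollectI conjI ballI)
    show "F \<phi> \<in> quot L ?SL \<rightarrow>\<^sub>E quot M ?SM"
    proof (rule PiE_I)
      fix A assume "A \<in> quot L ?SL"
      then obtain x where "x \<in> L" "A = coset ?SL x" by (auto simp: quot_def)
      then show "F \<phi> A \<in> quot M ?SM" using Fval[OF RNd(1,2)[OF phi]] RNd(2)[OF phi] by (simp add: quot_def)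
    qed (simp add: F_def)
  next
    fix x y u w assume x: "x \<in> L" and y: "y \<in> L" and u: "u \<in> F \<phi> (coset ?SL x)" and w: "w \<in> F \<phi> (coset ?SL y)"
    have u': "u - \<phi> x \<in> ?SM" "w - \<phi> y \<in> ?SM"
      using u w Fval[OF RNd(1,2)[OF phi]] x y by (simp_all add: mem_coset)
    have "(u - \<phi> x) + (w - \<phi> y) \<in> ?SM" using u' W.submod_add[OF sSM(1)] by blast
    moreover have "(u - \<phi> x) + (w - \<phi> y) = (u + w) - \<phi> (x + y)"
      using Hom_add[OF RNd(1)[OF phi] LS[OF x] LS[OF y]] by simp
    ultimately show "u + w \<in> F \<phi> (coset ?SL (x + y))"
      using Fval[OF RNd(1,2)[OF phi] V.submod_add[OF sL x y]] by (simp only: mem_coset)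
    have "\<phi> x \<in> M" "w \<in> M"
    proof -
      show "\<phi> x \<in> M" using RNd(2)[OF phi] x by blast
      have "w - \<phi> y \<in> M" using u'(2) W.spow_subset[OF sM] by blast
      then have "(w - \<phi> y) + \<phi> y \<in> M" using W.submod_add[OF sM] RNd(2)[OF phi] y by blast
      then show "w \<in> M" by simp
    qed
    then have "frm W u w - frm W (\<phi> x) (\<phi> y) \<in> V.PP (int N)" by (rule W.B_cong_spow[OF M u'])
    then have "(frm W u w - frm W (\<phi> x) (\<phi> y)) + (frm W (\<phi> x) (\<phi> y) - frm V x y) \<in> V.PP (int N)"
      using RNd(3)[OF phi] x y V.PP_add by blast
    then show "frm W u w - frm V x y \<in> V.PP (int N)" by simp
  next
    fix c x u assume c: "c \<in> V.\<O>" and x: "x \<in> L" and u: "u \<in> F \<phi> (coset ?SL x)"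
    have "u - \<phi> x \<in> ?SM" using u Fval[OF RNd(1,2)[OF phi] x] by (simp add: mem_coset)
    then have "scl W c (u - \<phi> x) \<in> ?SM" using W.submod_scale[OF sSM(1) c] by blast
    moreover have "scl W c (u - \<phi> x) = scl W c u - \<phi> (scl V c x)"
      using Hom_scale[OF RNd(1)[OF phi] LS[OF x]] by (simp add: W.vs.scale_right_diff_distrib)
    ultimately show "scl W c u \<in> F \<phi> (coset ?SL (scl V c x))"
      using Fval[OF RNd(1,2)[OF phi] V.submod_scale[OF sL c x]] by (simp only: mem_coset)
  qed
  have surj: "\<exists>\<phi>\<in>RN M L N. F \<phi> = f" if f: "f \<in> rep_set v W M V L N" for f
  proof -
    have fP: "f \<in> quot L ?SL \<rightarrow>\<^sub>E quot M ?SM" using f by (simp add: rep_set_def scL scM)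
    have fadd: "u + w \<in> f (coset ?SL (x + y))" "frm W u w - frm V x y \<in> V.PP (int N)"
      if "x \<in> L" "y \<in> L" "u \<in> f (coset ?SL x)" "w \<in> f (coset ?SL y)" for x y u w
      using f that by (auto simp: rep_set_def scL scM)
    have fscale: "scl W c u \<in> f (coset ?SL (scl V c x))"
      if "c \<in> V.\<O>" "x \<in> L" "u \<in> f (coset ?SL x)" for c x u
      using f that by (auto simp: rep_set_def scL scM)
    have fM: "\<exists>y\<in>M. f (coset ?SL x) = coset ?SM y" if "x \<in> L" for x
    proof -
      have "coset ?SL x \<in> quot L ?SL" using that by (simp add: quot_def)
      then have "f (coset ?SL x) \<in> quot M ?SM" using fP by blast
      then show ?thesis by (auto simp: quot_def)
    qed
    \<comment> \<open>Arbitrary lifts of the images of the basis vectors determine the linear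
      lift.\<close>
    define z where "z i = (if i < n then (SOME y. y \<in> M \<and> f (coset ?SL (e i)) = coset ?SM y) else 0)" for i
    have z: "z i \<in> M" "z i \<in> f (coset ?SL (e i))" if "i < n" for i
    proof -
      have "\<exists>y. y \<in> M \<and> f (coset ?SL (e i)) = coset ?SM y" using fM[OF V.lbas_base[OF L that]] by blast
      from someI_ex[OF this] have *: "z i \<in> M" "f (coset ?SL (e i)) = coset ?SM (z i)" using that by (auto simp: z_def)
      then show "z i \<in> M" "z i \<in> f (coset ?SL (e i))"
        using W.submod_zero[OF sSM(1)] by (simp_all add: mem_coset)
    qed
    obtain \<phi> where phi: "\<phi> \<in> Hom L" "tup n e \<phi> = z" using Hom_ext[OF L, of z] by (auto simp: z_def)
    have phie: "\<phi> (e i) = z i" if "i < n" for i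
      using that fun_cong[OF phi(2), of i] by (simp add: tup_def)
    have key: "W.lc k z c \<in> f (coset ?SL (V.lc k e c)) \<and> V.lc k e c \<in> L"
      if "k \<le> n" "\<And>i. i < n \<Longrightarrow> c i \<in> V.\<O>" for k c
      using that(1)
    proof (induction k)
      case 0
      obtain y where "y \<in> M" "f (coset ?SL 0) = coset ?SM y" using fM[OF V.submod_zero[OF sL]] by blast
      then have "y \<in> f (coset ?SL 0)" using W.submod_zero[OF sSM(1)] by (simp add: mem_coset)
      then have "scl W 0 y \<in> f (coset ?SL (scl V 0 0))"
        using fscale[of 0 0 y] V.submod_zero[OF sL] by simp
      then show ?case using V.submod_zero[OF sL] by (simp add: V.lc_def W.lc_def)
    next
      case (Suc k)
      have k: "k < n" "c k \<in> V.\<O>" using Suc.prems that(2) by auto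
      have "scl W (c k) (z k) \<in> f (coset ?SL (scl V (c k) (e k)))"
        by (rule fscale[OF k(2) V.lbas_base[OF L k(1)] z(2)[OF k(1)]])
      moreover have "scl V (c k) (e k) \<in> L"
        by (rule V.submod_scale[OF sL k(2) V.lbas_base[OF L k(1)]])
      ultimately show ?case using Suc fadd(1) V.submod_add[OF sL] by (simp add: V.lc_Suc W.lc_Suc)
    qed
    have phif: "\<phi> x \<in> f (coset ?SL x)" if x: "x \<in> L" for x
    proof -
      obtain c where c: "x = V.lc n e c \<and> (\<forall>i<n. c i \<in> V.\<O>)" using V.lbas_ex[OF L x] by blast
      have "\<phi> x = W.lc n (\<lambda>i. \<phi> (e i)) c"
        using Hom_lc[OF phi(1), of n e c] LS V.lbas_base[OF L] c by auto
      also have "\<dots> = W.lc n z c" by (rule W.lc_cong) (auto simp: phie)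
      finally show ?thesis using key[of n c] c by simp
    qed
    have fcos: "f (coset ?SL x) = coset ?SM (\<phi> x)" "\<phi> x \<in> M" if x: "x \<in> L" for x
    proof -
      obtain y where y: "y \<in> M" "f (coset ?SL x) = coset ?SM y" using fM[OF x] by blast
      then have d: "\<phi> x - y \<in> ?SM" using phif[OF x] by (simp add: mem_coset)
      then show "f (coset ?SL x) = coset ?SM (\<phi> x)" using y coset_eq_iff[OF sSM(2), of "\<phi> x" y] by simp
      have "(\<phi> x - y) + y \<in> M" using d W.spow_subset[OF sM] y W.submod_add[OF sM] by blast
      then show "\<phi> x \<in> M" by simp
    qed
    have "\<phi> \<in> RN M L N" using phi(1) fcos(2) fadd(2) phif by (auto simp: RN_def)
    moreover have "F \<phi> = f"
    proof (rule PiE_ext)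
      show "F \<phi> \<in> quot L ?SL \<rightarrow>\<^sub>E quot M ?SM" using FR[OF calculation] by (simp add: rep_set_def scL scM)
      show "f \<in> quot L ?SL \<rightarrow>\<^sub>E quot M ?SM" by (rule fP)
      fix A assume "A \<in> quot L ?SL"
      then obtain x where "x \<in> L" "A = coset ?SL x" by (auto simp: quot_def)
      then show "F \<phi> A = f A" using Fval[OF phi(1)] fcos by simp
    qed
    ultimately show ?thesis by blast
  qed
  have "card (quot (RN M L N) (KN M L N)) = card (rep_set v W M V L N)"
  proof (rule quot_card_image(1)[OF subgrp_KN[OF sM]])
    show "F \<phi> = F \<psi> \<longleftrightarrow> \<phi> - \<psi> \<in> KN M L N" if "\<phi> \<in> RN M L N" "\<psi> \<in> RN M L N" for \<phi> \<psi>
    proof -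
      have "F \<phi> = F \<psi> \<longleftrightarrow> (\<forall>x\<in>L. F \<phi> (coset ?SL x) = F \<psi> (coset ?SL x))"
      proof
        assume *: "\<forall>x\<in>L. F \<phi> (coset ?SL x) = F \<psi> (coset ?SL x)"
        show "F \<phi> = F \<psi>"
        proof (rule PiE_ext)
          show "F \<phi> \<in> quot L ?SL \<rightarrow>\<^sub>E quot M ?SM" "F \<psi> \<in> quot L ?SL \<rightarrow>\<^sub>E quot M ?SM"
            using FR that by (simp_all add: rep_set_def scL scM)
        qed (use * in \<open>auto simp: quot_def\<close>)
      qed simp
      also have "\<dots> \<longleftrightarrow> (\<forall>x\<in>L. \<phi> x - \<psi> x \<in> ?SM)"
        using Fval RNd that coset_eq_iff[OF sSM(2)] by simp
      finally show ?thesis using RNd(1) that Hom_diff_mem by (auto simp: KN_def)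
    qed
    show "F ` RN M L N = rep_set v W M V L N" using FR surj by blast
  qed
  then show ?thesis by simp
qed

end

section \<open>Lengths and stacked bases of overlattices\<close>

context qspace
begin

text \<open>The last multiple \<pi>^j x that is still outside \<open>S\<close> generates a copy of
  the residue field in the quotient.\<close>

lemma residue_card_le_quot:
  assumes S: "submod S" "submod T" "S \<subseteq> T" "x \<in> T" "x \<notin> S" and A: "\<pi> ^ A \<cdot> x \<in> S" and fin: "finite (quot T S)"
  shows "q \<le> card (quot T S)"
proof -
  define s where "s = (LEAST s. \<pi> ^ s \<cdot> x \<in> S)"
  have s: "\<pi> ^ s \<cdot> x \<in> S" unfolding s_def by (rule LeastI[of _ A]) (rule A)
  then obtain s' where s': "s = Suc s'" using S(5) by (cases s) auto
  define y where "y = \<pi> ^ s' \<cdot> x"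
  have yS: "y \<notin> S" using not_less_Least[of s' "\<lambda>s. \<pi> ^ s \<cdot> x \<in> S"] s' by (simp add: s_def y_def)
  have yT: "y \<in> T" unfolding y_def by (rule submod_scale[OF S(2) _ S(4)]) (simp add: PP_iff)
  have inj: "inj_on (\<lambda>r. coset S (r \<cdot> y)) Rs"
  proof (rule inj_onI, rule ccontr)
    fix r r' assume r: "r \<in> Rs" "r' \<in> Rs" "coset S (r \<cdot> y) = coset S (r' \<cdot> y)" "r \<noteq> r'"
    have "r \<cdot> y - r' \<cdot> y \<in> S" using r(3) coset_eq_iff[OF submod_subgrp[OF S(1)]] by blast
    then have d: "(r - r') \<cdot> y \<in> S" by (simp add: vs.scale_left_diff_distrib)
    have "r - r' \<notin> PP 1" using Rs_eq r by blast
    moreover have "r - r' \<in> \<O>" using r Rs_O PP_diff by blast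
    ultimately have u: "r - r' \<noteq> 0" "v (r - r') = 0" using unit_iff[of "r - r'"] by auto
    have "inverse (r - r') \<cdot> (r - r') \<cdot> y \<in> S"
      by (rule submod_scale[OF S(1) _ d]) (use u in \<open>simp add: PP_iff v_inverse\<close>)
    then show False using yS u by simp
  qed
  have "(\<lambda>r. coset S (r \<cdot> y)) ` Rs \<subseteq> quot T S"
    using submod_scale[OF S(2) Rs_O yT] by (auto simp: quot_def)
  then show ?thesis using card_inj_on_le[OF inj _ fin] Rs(3) by simp
qed

text \<open>Lowering a single exponent by one gives the next larger lattice; this can be repeated
  until all exponents are zero.\<close>

lemma lattice_chain:
  assumes f: "ind n f"
  shows "\<exists>C. C 0 = lat n f (\<lambda>i. int (a i)) \<and>
    (\<forall>k\<le>\<Sum>i<n. a i. submod (C k) \<and> C 0 \<subseteq> C k \<and> C k \<subseteq> osp n f) \<and> (\<forall>k<\<Sum>i<n. a i. C k \<subset> C (Suc k))"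
proof (induction "\<Sum>i<n. a i" arbitrary: a)
  case 0
  have "lat n f (\<lambda>i. int (a i)) \<subseteq> osp n f" by (rule lat_mono) simp
  then show ?case using submod_lat 0 by (intro exI[of _ "\<lambda>_. lat n f (\<lambda>i. int (a i))"]) auto
next
  case (Suc l)
  have "\<exists>j<n. a j > 0" using Suc(2) by (metis gr0I lessThan_iff nat.distinct(1) sum.neutral)
  then obtain j where j: "j < n" "a j > 0" by blast
  define b where "b = a(j := a j - 1)"
  have "(\<Sum>i<n. a i) = a j + (\<Sum>i\<in>{..<n}-{j}. a i)" using j by (intro sum.remove) auto
  moreover have "(\<Sum>i<n. b i) = b j + (\<Sum>i\<in>{..<n}-{j}. b i)" using j by (intro sum.remove) auto
  moreover have "(\<Sum>i\<in>{..<n}-{j}. b i) = (\<Sum>i\<in>{..<n}-{j}. a i)" by (rule sum.cong) (auto simp: b_def)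
  ultimately have l: "l = (\<Sum>i<n. b i)" using Suc(2) j by (simp add: b_def)
  obtain C where C: "C 0 = lat n f (\<lambda>i. int (b i))"
    "\<forall>k\<le>l. submod (C k) \<and> C 0 \<subseteq> C k \<and> C k \<subseteq> osp n f" "\<forall>k<l. C k \<subset> C (Suc k)"
    using Suc(1)[OF l] l by blast
  define C' where "C' k = (case k of 0 \<Rightarrow> lat n f (\<lambda>i. int (a i)) | Suc k \<Rightarrow> C k)" for k
  have sub: "lat n f (\<lambda>i. int (a i)) \<subseteq> lat n f (\<lambda>i. int (b i))" by (rule lat_mono) (auto simp: b_def)
  have "lc n f (\<lambda>i. if i = j then \<pi> ^ b j else 0) \<in> lat n f (\<lambda>i. int (b i))"
    by (intro latI) (auto simp: PP_iff)
  moreover have "lc n f (\<lambda>i. if i = j then \<pi> ^ b j else 0) \<notin> lat n f (\<lambda>i. int (a i))"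
    unfolding lat_mem_iff[OF f] using j by (auto simp: PP_iff b_def intro!: exI[of _ j])
  ultimately have strict: "lat n f (\<lambda>i. int (a i)) \<subset> C 0" using sub C(1) by blast
  have "submod (C' k) \<and> C' 0 \<subseteq> C' k \<and> C' k \<subseteq> osp n f" if "k \<le> Suc l" for k
  proof (cases k)
    case 0
    have "lat n f (\<lambda>i. int (a i)) \<subseteq> osp n f" by (rule lat_mono) simp
    then show ?thesis using 0 submod_lat by (simp add: C'_def)
  next
    case (Suc k')
    then show ?thesis using that C(2)[rule_format, of k'] strict by (auto simp: C'_def)
  qed
  moreover have "C' k \<subset> C' (Suc k)" if "k < Suc l" for k
    using that C(3) strict by (cases k) (auto simp: C'_def)
  moreover have "C' 0 = lat n f (\<lambda>i. int (a i))" by (simp add: C'_def)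
  ultimately show ?case unfolding Suc(2)[symmetric] by (intro exI[of _ C'] conjI allI impI) blast+
qed

text \<open>The coordinate chain has this length. No chain is longer, since each strict inclusion
  multiplies the index by at least q and the total index is q to this power.\<close>

lemma quot_length_eq:
  assumes f: "lbas n f L'" and L: "L = lat n f (\<lambda>i. int (a i))"
  shows "quot_length v V L' L = (\<Sum>i<n. a i)"
  unfolding quot_length_def
proof (rule Greatest_equality)
  have fi: "ind n f" and L': "L' = osp n f" using f by (auto simp: lbas_def)
  show "\<exists>C. (\<forall>i\<le>\<Sum>i<n. a i. submod (C i) \<and> L \<subseteq> C i \<and> C i \<subseteq> L') \<and> (\<forall>i<\<Sum>i<n. a i. C i \<subset> C (Suc i))"
    using lattice_chain[OF fi, of a] unfolding L L' by metis
  fix l assume "\<exists>C. (\<forall>i\<le>l. submod (C i) \<and> L \<subseteq> C i \<and> C i \<subseteq> L') \<and> (\<forall>i<l. C i \<subset> C (Suc i))"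
  then obtain C where C: "\<And>i. i \<le> l \<Longrightarrow> submod (C i) \<and> L \<subseteq> C i \<and> C i \<subseteq> L'" "\<And>i. i < l \<Longrightarrow> C i \<subset> C (Suc i)"
    by blast
  have card: "card (quot L' L) = q ^ (\<Sum>i<n. a i)" "finite (quot L' L)"
    using quot_lat[OF fi, of "\<lambda>_. 0" "\<lambda>i. int (a i)"] unfolding L L' by auto
  have sL: "subgrp L" unfolding L by (rule subgrp_lat)
  define A where "A = (\<Sum>i<n. a i)"
  have AL: "\<pi> ^ A \<cdot> x \<in> L" if "x \<in> L'" for x
  proof -
    have "\<pi> ^ A \<cdot> x \<in> lat n f (\<lambda>_. int A)" using lbas_spow[OF f, of A] that by blast
    moreover have "lat n f (\<lambda>_. int A) \<subseteq> L" unfolding L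
      by (rule lat_mono) (auto simp: A_def intro!: member_le_sum)
    ultimately show ?thesis by blast
  qed
  have finC: "finite (quot (C i) L)" if "i \<le> l" for i
    using quot_mono[of "C i" L' L] C(1)[OF that] card(2) by blast
  have "q ^ k \<le> card (quot (C k) L)" if "k \<le> l" for k
    using that
  proof (induction k)
    case 0
    have "quot (C 0) L \<noteq> {}" using submod_zero C(1)[of 0] by (auto simp: quot_def)
    then show ?case using finC[of 0] by (simp add: Suc_leI card_gt_0_iff)
  next
    case (Suc k)
    have sC: "submod (C k)" "submod (C (Suc k))" "C k \<subset> C (Suc k)" "L \<subseteq> C k" "C (Suc k) \<subseteq> L'"
      using C Suc.prems by auto
    obtain x where x: "x \<in> C (Suc k)" "x \<notin> C k" using sC(3) by blast
    \<comment> \<open>Cosets of \<open>C k\<close> are unions of cosets of the smaller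
      \<open>L\<close>, so there are finitely many.\<close>
    have fin1: "finite (quot (C (Suc k)) (C k))"
    proof -
      have "coset (C k) ` C (Suc k) = (\<lambda>B. coset (C k) (SOME x. x \<in> C (Suc k) \<and> coset L x = B)) ` quot (C (Suc k)) L"
      proof
        have *: "coset (C k) (SOME y. y \<in> C (Suc k) \<and> coset L y = coset L x) = coset (C k) x"
          if "x \<in> C (Suc k)" for x
        proof -
          have "\<exists>y. y \<in> C (Suc k) \<and> coset L y = coset L x" using that by blast
          from someI_ex[OF this] have "(SOME y. y \<in> C (Suc k) \<and> coset L y = coset L x) - x \<in> L"
            using coset_eq_iff[OF sL] by blast
          then show ?thesis using coset_eq_iff[OF submod_subgrp[OF sC(1)]] sC(4) by blast
        qed
        show "coset (C k) ` C (Suc k) \<subseteq> (\<lambda>B. coset (C k) (SOME x. x \<in> C (Suc k) \<and> coset L x = B)) ` quot (C (Suc k)) L"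
        proof
          fix D assume "D \<in> coset (C k) ` C (Suc k)"
          then obtain x where x: "x \<in> C (Suc k)" "D = coset (C k) x" by blast
          then have "D = (\<lambda>B. coset (C k) (SOME x. x \<in> C (Suc k) \<and> coset L x = B)) (coset L x)"
            using *[OF x(1)] by simp
          then show "D \<in> (\<lambda>B. coset (C k) (SOME x. x \<in> C (Suc k) \<and> coset L x = B)) ` quot (C (Suc k)) L"
            using x(1) unfolding quot_def by blast
        qed
        show "(\<lambda>B. coset (C k) (SOME x. x \<in> C (Suc k) \<and> coset L x = B)) ` quot (C (Suc k)) L \<subseteq> coset (C k) ` C (Suc k)"
          unfolding quot_def using * by auto
      qed
      then show ?thesis using finC[OF Suc.prems] by (simp add: quot_def)
    qed
    have "q \<le> card (quot (C (Suc k)) (C k))"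
    proof (rule residue_card_le_quot[OF sC(1,2) _ x _ fin1])
      show "\<pi> ^ A \<cdot> x \<in> C k" using AL x sC by blast
    qed (use sC in blast)
    moreover have "q ^ k \<le> card (quot (C k) L)" using Suc by simp
    moreover have "card (quot (C (Suc k)) L) = card (quot (C (Suc k)) (C k)) * card (quot (C k) L)"
    proof (rule quot_tower(1)[OF sL submod_subgrp[OF sC(1)] sC(4) _ fin1])
      show "x + y \<in> C (Suc k)" if "x \<in> C (Suc k)" "y \<in> C k" for x y
        using that sC submod_add by blast
      show "finite (quot (C k) L)" by (rule finC) (use Suc.prems in simp)
    qed
    ultimately show ?case using mult_le_mono by simp
  qed
  then have "q ^ l \<le> card (quot (C l) L)" by simp
  also have "\<dots> \<le> card (quot L' L)"
    using card(2) C(1)[of l] by (auto simp: quot_def intro!: card_mono)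
  finally show "l \<le> (\<Sum>i<n. a i)"
    unfolding card using q_gt_1 power_increasing_iff[of q l "\<Sum>i<n. a i"] by simp
qed

lemma norm_bound: "\<exists>A::nat. \<forall>i<(n::nat). v (B (g i) (g i)) \<le> int A"
proof -
  have "v (B (g i) (g i)) \<le> int (\<Sum>i<n. nat \<bar>v (B (g i) (g i))\<bar>)" if "i < n" for i
  proof -
    have "nat \<bar>v (B (g i) (g i))\<bar> \<le> (\<Sum>i<n. nat \<bar>v (B (g i) (g i))\<bar>)"
      by (rule member_le_sum) (use that in auto)
    then show ?thesis by linarith
  qed
  then show ?thesis by blast
qed

lemma overlattice_subset:
  assumes g: "lbas n g L" "orth n g" and L: "nondeg L" and A: "\<forall>i<n. v (B (g i) (g i)) \<le> int A"
    and L': "L' \<in> integral_overlattices v V L"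
  shows "L' \<subseteq> lat n g (\<lambda>_. - int A)"
proof -
  have "L' \<subseteq> lat n g (\<lambda>i. - v (B (g i) (g i)))"
    using overlattice_facts(4)[OF g(1) L L'] dual_lattice_orth[OF g L] by simp
  also have "\<dots> \<subseteq> lat n g (\<lambda>_. - int A)" by (rule lat_mono) (use A in auto)
  finally show ?thesis .
qed

text \<open>All integral overlattices lie in the dual of \<open>L\<close>, hence in \<varpi>^(-A) L,
  and each is determined by its image in the finite quotient of this lattice by
  \<open>L\<close>.\<close>

lemma finite_overlattices:
  assumes e: "lbas n e L" and L: "nondeg L"
  shows "finite (integral_overlattices v V L)"
proof -
  obtain g where g: "lbas n g L" "orth n g" using orthogonal_basis[OF e] by blast
  obtain A :: nat where A: "\<forall>i<n. v (B (g i) (g i)) \<le> int A" using norm_bound by blast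
  let ?D = "lat n g (\<lambda>_. - int A)"
  have fin: "finite (quot ?D L)" using quot_lat(2)[of n g "\<lambda>_. - int A" "\<lambda>_. 0"] g by (simp add: lbas_def)
  have "(\<lambda>L'. quot L' L) ` integral_overlattices v V L \<subseteq> Pow (quot ?D L)"
    using overlattice_subset[OF g L A] by (auto simp: quot_def)
  then have "finite ((\<lambda>L'. quot L' L) ` integral_overlattices v V L)"
    using fin finite_subset by blast
  moreover have "inj_on (\<lambda>L'. quot L' L) (integral_overlattices v V L)"
  proof (rule inj_on_inverseI[where g = Union])
    fix L' assume L': "L' \<in> integral_overlattices v V L"
    obtain f where f: "lbas n f L'" using overlattice_facts(1)[OF e L L'] by blast
    have "L \<subseteq> L'" using L' by (auto simp: integral_overlattices_def)
    show "\<Union> (quot L' L) = L'"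
    proof
      show "\<Union> (quot L' L) \<subseteq> L'"
      proof
        fix y assume "y \<in> \<Union> (quot L' L)"
        then obtain x where x: "x \<in> L'" "y - x \<in> L" by (auto simp: quot_def mem_coset)
        then have "(y - x) + x \<in> L'" using \<open>L \<subseteq> L'\<close> submod_add[OF lbas_submod[OF f]] by blast
        then show "y \<in> L'" by simp
      qed
      show "L' \<subseteq> \<Union> (quot L' L)"
        using submod_zero[OF lbas_submod[OF e]] by (force simp: quot_def mem_coset)
    qed
  qed
  ultimately show ?thesis by (rule finite_imageD)
qed

text \<open>The bound \<open>A\<close> on the exponents is uniform in \<open>L'\<close>, so that one
  precision serves all overlattices.\<close>

lemma overlattice_stacked_basis:
  assumes g: "lbas n g L" "orth n g" and L: "nondeg L" and A: "\<forall>i<n. v (B (g i) (g i)) \<le> int A"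
    and L': "L' \<in> integral_overlattices v V L"
  shows "\<exists>f a. lbas n f L' \<and> L = lat n f (\<lambda>i. int (a i)) \<and> (\<forall>i<n. a i \<le> A)"
proof -
  obtain f where f: "lbas n f L'" using overlattice_facts(1)[OF g(1) L L'] by blast
  have "spow A L' \<subseteq> spow A (lat n g (\<lambda>_. - int A))" using overlattice_subset[OF g L A L'] by blast
  also have "\<dots> = L" using g(1) by (simp add: spow_lat lbas_def)
  finally show ?thesis
    using L' by (intro stacked_basis[OF f lbas_submod[OF g(1)]]) (auto simp: integral_overlattices_def)
qed

lemma min_coeff:
  assumes "\<not> (\<forall>i<(n::nat). c i \<in> PP N)"
  shows "\<exists>j<n. c j \<noteq> 0 \<and> v (c j) < N \<and> (\<forall>i<n. c i \<in> PP (v (c j)))"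
proof -
  define Z where "Z = {i. i < n \<and> c i \<noteq> 0}"
  have "finite Z" by (simp add: Z_def)
  obtain i0 where i0: "i0 < n" "c i0 \<notin> PP N" using assms by blast
  then have i0Z: "i0 \<in> Z" by (auto simp: Z_def)
  define s where "s = Min ((\<lambda>i. v (c i)) ` Z)"
  have "s \<in> (\<lambda>i. v (c i)) ` Z" unfolding s_def using \<open>finite Z\<close> i0Z by (intro Min_in) auto
  then obtain j where j: "j \<in> Z" "v (c j) = s" by auto
  have le: "s \<le> v (c i)" if "i \<in> Z" for i unfolding s_def using \<open>finite Z\<close> that by simp
  have "c i \<in> PP (v (c j))" if "i < n" for i
    using le[of i] that j by (auto simp: PP_iff Z_def)
  moreover have "v (c j) < N" using le[OF i0Z] i0 j by (auto simp: PP_iff)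
  ultimately show ?thesis using j by (auto simp: Z_def)
qed

end

section \<open>Saturation\<close>

context two_qspaces
begin

definition sat :: "'c set \<Rightarrow> 'b set \<Rightarrow> ('b \<Rightarrow> 'c) \<Rightarrow> 'b set" where
  "sat M L \<phi> = {x \<in> rational_span V L. \<phi> x \<in> M}"

text \<open>Suppose a coordinate c_j of x has minimal valuation s < -A. Pairing the image of x with
  the image of g_j gives c_j B(g_j, g_j), of valuation at most s + A, plus an error of valuation at
  least s + N. Since s + A is negative and below s + N, the sum cannot be integral.\<close>

lemma sat_bound:
  assumes M: "W.unimod m h M" and g: "V.lbas n g L" "V.orth n g" and L: "V.nondeg L"
    and A: "\<forall>i<n. v (frm V (g i) (g i)) \<le> int A" and N: "A < N" and phi: "\<phi> \<in> RN M L N"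
  shows "sat M L \<phi> \<subseteq> V.lat n g (\<lambda>_. - int A)"
proof
  fix x assume x: "x \<in> sat M L \<phi>"
  then obtain c where c: "x = V.lc n g c" using V.lbas_obtain_span[OF g(1), of x] by (auto simp: sat_def)
  have gL: "g i \<in> L" if "i < n" for i using V.lbas_base[OF g(1) that] .
  have gS: "g i \<in> rational_span V L" if "i < n" for i using gL[OF that] V.lattice_subset_span by blast
  have H: "\<phi> \<in> Hom L" using phi by (simp add: RN_def)
  have "\<forall>i<n. c i \<in> V.PP (- int A)"
  proof (rule ccontr)
    assume "\<not> ?thesis"
    from V.min_coeff[OF this] obtain j where j: "j < n" "c j \<noteq> 0" "v (c j) < - int A"
      "\<forall>i<n. c i \<in> V.PP (v (c j))" by blast
    define s where "s = v (c j)"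
    define \<epsilon> where "\<epsilon> i = frm W (\<phi> (g i)) (\<phi> (g j)) - frm V (g i) (g j)" for i
    have eps: "\<epsilon> i \<in> V.PP (int N)" if "i < n" for i
      using phi gL[OF that] gL[OF j(1)] by (auto simp: RN_def \<epsilon>_def)
    have "frm W (\<phi> x) (\<phi> (g j)) \<in> V.\<O>"
      using W.unimod_integral[OF M] x phi gL[OF j(1)] by (auto simp: sat_def RN_def)
    moreover have "frm W (\<phi> x) (\<phi> (g j)) = c j * frm V (g j) (g j) + (\<Sum>i<n. c i * \<epsilon> i)"
    proof -
      have "\<phi> x = W.lc n (\<lambda>i. \<phi> (g i)) c" using Hom_lc[of \<phi> L n g c, OF H gS] c by simp
      then have "frm W (\<phi> x) (\<phi> (g j)) = (\<Sum>i<n. c i * frm W (\<phi> (g i)) (\<phi> (g j)))" by (simp add: W.B_lc)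
      also have "\<dots> = (\<Sum>i<n. c i * frm V (g i) (g j)) + (\<Sum>i<n. c i * \<epsilon> i)"
        by (simp add: \<epsilon>_def right_diff_distrib sum_subtractf)
      also have "(\<Sum>i<n. c i * frm V (g i) (g j)) = c j * frm V (g j) (g j)"
        using V.B_orth_coeff[OF g(2) j(1), of c] by (simp add: V.B_lc)
      finally show ?thesis .
    qed
    moreover have "(\<Sum>i<n. c i * \<epsilon> i) \<in> V.PP (s + int N)"
      using j(4) eps by (auto intro!: V.PP_sum V.PP_mult simp: s_def)
    moreover have "c j * frm V (g j) (g j) \<noteq> 0" "v (c j * frm V (g j) (g j)) = s + v (frm V (g j) (g j))"
      using V.orth_norm_nonzero[OF g L j(1)] j(2) by (simp_all add: V.val_mult s_def)
    ultimately have z: "z + y \<in> V.PP 0" "y \<in> V.PP (s + int N)" "z \<noteq> 0" "v z = s + v (frm V (g j) (g j))"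
      if "z = c j * frm V (g j) (g j)" "y = (\<Sum>i<n. c i * \<epsilon> i)" for z y using that by auto
    define z y where "z = c j * frm V (g j) (g j)" and "y = (\<Sum>i<n. c i * \<epsilon> i)"
    note zy = z[OF z_def y_def]
    define t where "t = min 0 (s + int N)"
    have "(z + y) - y \<in> V.PP t"
      by (rule V.PP_diff) (use V.PP_mono[of t 0 "z + y"] V.PP_mono[of t "s + int N" y] zy in \<open>auto simp: t_def\<close>)
    then have "t \<le> v z" using zy by (simp add: V.PP_iff)
    then show False using zy(4) A j N by (auto simp: t_def s_def min_def split: if_splits)
  qed
  then show "x \<in> V.lat n g (\<lambda>_. - int A)" unfolding c by (intro V.latI) auto
qed

lemma sat_submod: "W.submod M \<Longrightarrow> \<phi> \<in> Hom L \<Longrightarrow> V.submod (sat M L \<phi>)"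
  unfolding is_submodule_def sat_def
  by (auto simp: span_closed Hom_zero Hom_add Hom_scale is_submodule_def)

text \<open>The saturation lies between \<open>L\<close> and \<varpi>^(-A) L, so the stacked basis
  theorem makes it a lattice. Its form is integral because it agrees with that of \<open>M\<close>
  up to an integral error.\<close>

lemma sat_overlattice:
  assumes M: "W.unimod m h M" and g: "V.lbas n g L" "V.orth n g" and L: "V.nondeg L"
    and A: "\<forall>i<n. v (frm V (g i) (g i)) \<le> int A" and N: "2 * A < N" and phi: "\<phi> \<in> RN M L N"
  shows "sat M L \<phi> \<in> integral_overlattices v V L"
proof -
  have AN: "A < N" using N by simp
  let ?S = "sat M L \<phi>"
  have H: "\<phi> \<in> Hom L" using phi by (simp add: RN_def)
  have sub: "?S \<subseteq> V.lat n g (\<lambda>_. - int A)" by (rule sat_bound[OF M g L A AN phi])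
  have LS: "L \<subseteq> ?S" using phi V.lattice_subset_span by (auto simp: sat_def RN_def)
  have span: "?S \<subseteq> rational_span V L" by (auto simp: sat_def)
  define b where "b i = scl V (inverse V.\<pi> ^ A) (g i)" for i
  have b: "V.lbas n b (V.lat n g (\<lambda>_. - int A))"
    using V.ind_scaled[of n g "\<lambda>_. inverse V.\<pi> ^ A"] V.lat_scaled[of n "\<lambda>_. inverse V.\<pi> ^ A" g "\<lambda>_. 0"] g(1)
    by (simp add: V.lbas_def b_def[abs_def] V.v_power V.v_inverse)
  have "V.spow A (V.lat n g (\<lambda>_. - int A)) = L" using g(1) by (simp add: V.spow_lat V.lbas_def)
  then have "V.spow A (V.lat n g (\<lambda>_. - int A)) \<subseteq> ?S" using LS by (simp only:)
  from V.stacked_basis[OF b sat_submod[OF W.unimod_submod[OF M] H] this sub]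
  obtain f a where f: "V.lbas n f (V.lat n g (\<lambda>_. - int A))" "?S = V.lat n f (\<lambda>i. int (a i))" by blast
  have "V.lbas n (\<lambda>i. scl V (V.\<pi> ^ a i) (f i)) ?S"
    using V.ind_scaled[of n f "\<lambda>i. V.\<pi> ^ a i"] V.lat_scaled[of n "\<lambda>i. V.\<pi> ^ a i" f "\<lambda>_. 0"] f
    by (simp add: V.lbas_def)
  then have lat: "is_lattice v V ?S" using V.is_lattice_iff by blast
  have "frm V x y \<in> V.\<O>" if x: "x \<in> ?S" and y: "y \<in> ?S" for x y
  proof -
    have xy: "scl V (V.\<pi> ^ A) x \<in> L" "scl V (V.\<pi> ^ A) y \<in> L"
      using sub x y \<open>V.spow A (V.lat n g (\<lambda>_. - int A)) = L\<close> by blast+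
    have "frm W (\<phi> (scl V (V.\<pi> ^ A) x)) (\<phi> (scl V (V.\<pi> ^ A) y)) - frm V (scl V (V.\<pi> ^ A) x) (scl V (V.\<pi> ^ A) y) \<in> V.PP (int N)"
      using phi xy by (auto simp: RN_def)
    moreover have "x \<in> rational_span V L" "y \<in> rational_span V L" using span x y by auto
    \<comment> \<open>Both arguments had to be scaled into \<open>L\<close> by \<pi>^A. This loses
      2A of the precision, whence the bound on N.\<close>
    ultimately have "V.\<pi> ^ A * (V.\<pi> ^ A * (frm W (\<phi> x) (\<phi> y) - frm V x y)) \<in> V.PP (int N)"
      using Hom_scale[OF H] by (simp add: V.B_simps W.B_simps algebra_simps)
    then have "frm W (\<phi> x) (\<phi> y) - frm V x y \<in> V.PP (int N - int A - int A)" by (simp only: V.pi_power_mem)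
    then have "frm W (\<phi> x) (\<phi> y) - frm V x y \<in> V.\<O>" by (rule V.PP_mono[rotated]) (use N in simp)
    moreover have "frm W (\<phi> x) (\<phi> y) \<in> V.\<O>" using W.unimod_integral[OF M] x y by (auto simp: sat_def)
    ultimately have "frm W (\<phi> x) (\<phi> y) - (frm W (\<phi> x) (\<phi> y) - frm V x y) \<in> V.\<O>"
      by (rule V.PP_diff[rotated])
    then show ?thesis by simp
  qed
  then have "?S \<subseteq> dual_lattice v V ?S" using V.lattice_subset_span[of ?S] by (auto simp: dual_lattice_def)
  then show ?thesis using lat LS span by (simp add: integral_overlattices_def)
qed

text \<open>For x in the saturation \<pi>^A x lies in \<open>L\<close>, so the two images of x
  differ by an element of \<varpi>^(N - A) M.\<close>

lemma sat_cong:
  assumes M: "W.unimod m h M" and g: "V.lbas n g L" "V.orth n g" and L: "V.nondeg L"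
    and A: "\<forall>i<n. v (frm V (g i) (g i)) \<le> int A" and N: "A < N"
    and phi: "\<phi> \<in> RN M L N" "\<psi> \<in> RN M L N" "\<phi> - \<psi> \<in> KN M L N"
  shows "sat M L \<phi> = sat M L \<psi>"
proof -
  have sM: "W.submod M" by (rule W.unimod_submod[OF M])
  have *: "sat M L \<phi> \<subseteq> sat M L \<psi>" if phi: "\<phi> \<in> RN M L N" "\<psi> \<in> RN M L N" "\<phi> - \<psi> \<in> KN M L N" for \<phi> \<psi>
  proof
    fix x assume x: "x \<in> sat M L \<phi>"
    have "V.spow A (V.lat n g (\<lambda>_. - int A)) = L" using g(1) by (simp add: V.spow_lat V.lbas_def)
    then have "scl V (V.\<pi> ^ A) x \<in> L" using sat_bound[OF M g L A N phi(1)] x by blast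
    then have "(\<phi> - \<psi>) (scl V (V.\<pi> ^ A) x) \<in> W.spow N M" using phi(3) by (auto simp: KN_def)
    moreover have xS: "x \<in> rational_span V L" using x by (simp add: sat_def)
    have "\<phi> - \<psi> \<in> Hom L" using phi(3) unfolding KN_def by blast
    then have "(\<phi> - \<psi>) (scl V (V.\<pi> ^ A) x) = scl W (V.\<pi> ^ A) ((\<phi> - \<psi>) x)"
      by (rule Hom_scale[OF _ xS])
    ultimately obtain y where y: "y \<in> M" "scl W (V.\<pi> ^ A) ((\<phi> - \<psi>) x) = scl W (V.\<pi> ^ N) y" by auto
    have "V.\<pi> ^ N = V.\<pi> ^ A * V.\<pi> ^ (N - A)" using N by (simp flip: power_add)
    then have "scl W (V.\<pi> ^ A) ((\<phi> - \<psi>) x) = scl W (V.\<pi> ^ A) (scl W (V.\<pi> ^ (N - A)) y)" using y by simp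
    then have "(\<phi> - \<psi>) x = scl W (V.\<pi> ^ (N - A)) y"
      by (metis W.vs.scale_cancel_left V.pi_nz power_not_zero)
    then have "(\<phi> - \<psi>) x \<in> M" using W.submod_scale[OF sM _ y(1)] by (simp add: V.PP_iff)
    then have "\<phi> x - (\<phi> - \<psi>) x \<in> M" using x W.submod_diff[OF sM] by (simp only: sat_def) blast
    then show "x \<in> sat M L \<psi>" using xS by (simp add: sat_def)
  qed
  have "\<psi> - \<phi> \<in> KN M L N" using subgrp_diff_swap[OF subgrp_KN[OF sM]] phi(3) by blast
  then show ?thesis using *[of \<phi> \<psi>] *[of \<psi> \<phi>] phi by blast
qed

lemma Hom_cong: "rational_span V L = rational_span V L' \<Longrightarrow> Hom L = Hom L'"
  by (simp add: Hom_def)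

text \<open>\<open>L\<close> is generated by the \<pi>^(a_i) f_i, so its conditions modulo
  \<varpi>^N become conditions modulo \<varpi>^(N - a_i - a_j) on the images of f. The saturation is
  exactly \<open>L'\<close>, and not larger, if and only if these images are independent modulo
  \<open>\<varpi>\<close>.\<close>

lemma RN_tup:
  assumes f: "V.lbas n f L'" and L: "L = V.lat n f (\<lambda>i. int (a i))" and N: "\<And>i j. i < n \<Longrightarrow> j < n \<Longrightarrow> a i + a j < N"
    and M: "W.unimod m h M"
  shows "{\<phi> \<in> RN M L N. sat M L \<phi> = L'} = {\<phi> \<in> Hom L'. tup n f \<phi> \<in>
      {z \<in> W.approx n M (\<lambda>i j. frm V (f i) (f j)) (\<lambda>(i, j). N - a i - a j). W.indm n M z}}"
    (is "?l = {\<phi> \<in> Hom L'. tup n f \<phi> \<in> ?Y}")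
proof -
  have fi: "V.ind n f" and L': "L' = V.osp n f" using f by (auto simp: V.lbas_def)
  have sM: "W.submod M" by (rule W.unimod_submod[OF M])
  have span: "rational_span V L = rational_span V L'" by (simp add: L L' rational_span_def V.span_lat)
  have HL: "Hom L = Hom L'" by (rule Hom_cong[OF span])
  have LL': "L \<subseteq> L'" unfolding L L' by (rule V.lat_mono) simp
  have fL': "f i \<in> L'" if "i < n" for i by (rule V.lbas_base[OF f that])
  have fS: "f i \<in> rational_span V L'" if "i < n" for i using fL'[OF that] V.lattice_subset_span by blast
  have faL: "scl V (V.\<pi> ^ a i) (f i) \<in> L" if "i < n" for i
    using V.latI[of n "\<lambda>j. if j = i then V.\<pi> ^ a i else 0" "\<lambda>i. int (a i)" f] that
    by (auto simp: V.lc_single V.PP_iff L)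
  have tupi: "tup n f \<phi> i = \<phi> (f i)" if "i < n" for \<phi> i using that by (simp add: tup_def)
  have Hlc: "\<phi> (V.lc n f c) = W.lc n (tup n f \<phi>) c" if "\<phi> \<in> Hom L'" for \<phi> c
    using Hom_lc[OF that fS] W.lc_cong[of n c c "\<lambda>i. \<phi> (f i)" "tup n f \<phi>"] by (simp add: tupi)
  have int_c: "int (N - a i - a j) = int N - int (a i) - int (a j)" if "i < n" "j < n" for i j
    using N[OF that] by simp
  show ?thesis
  proof (intro equalityI subsetI)
    fix \<phi> assume "\<phi> \<in> ?l"
    then have R: "\<phi> \<in> RN M L N" and S: "sat M L \<phi> = L'" by auto
    have H: "\<phi> \<in> Hom L'" using R HL by (simp add: RN_def)
    have phiM: "\<phi> (f i) \<in> M" if "i < n" for i using fL'[OF that] S by (auto simp: sat_def)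
    have T: "tup n f \<phi> \<in> Tup n M" using phiM by (auto simp: TupI_def tup_def)
    have form: "frm W (\<phi> (f i)) (\<phi> (f j)) - frm V (f i) (f j) \<in> V.PP (int N - int (a i) - int (a j))"
      if ij: "i < n" "j < n" for i j
    proof -
      have "frm W (\<phi> (scl V (V.\<pi> ^ a i) (f i))) (\<phi> (scl V (V.\<pi> ^ a j) (f j)))
          - frm V (scl V (V.\<pi> ^ a i) (f i)) (scl V (V.\<pi> ^ a j) (f j)) \<in> V.PP (int N)"
        using R faL ij by (auto simp: RN_def)
      then have "V.\<pi> ^ a j * (V.\<pi> ^ a i * (frm W (\<phi> (f i)) (\<phi> (f j)) - frm V (f i) (f j))) \<in> V.PP (int N)"
        using Hom_scale[OF H fS] ij by (simp add: V.B_simps W.B_simps algebra_simps)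
      then have "frm W (\<phi> (f i)) (\<phi> (f j)) - frm V (f i) (f j) \<in> V.PP (int N - int (a j) - int (a i))"
        by (simp only: V.pi_power_mem)
      then show ?thesis by (simp add: algebra_simps)
    qed
    have "W.indm n M (tup n f \<phi>)"
    proof (rule W.indmI)
      fix c i assume c: "\<And>i. c i \<in> V.\<O>" "W.lc n (tup n f \<phi>) c \<in> W.spow 1 M" "i < n"
      \<comment> \<open>A relation modulo \<open>\<varpi>\<close> puts \<pi>^(-1) times the
        combination of the f_i into the saturation, hence into \<open>L'\<close>.\<close>
      have "\<phi> (V.lc n f c) \<in> W.spow 1 M" using c(2) Hlc[OF H] by simp
      then have "scl W (inverse V.\<pi>) (\<phi> (V.lc n f c)) \<in> M" by (simp only: W.spow_1_iff)
      then have "\<phi> (V.lc n f (\<lambda>i. inverse V.\<pi> * c i)) \<in> M"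
        using Hom_scale[OF H V.lc_in_rational_span[OF f], of "inverse V.\<pi>" c] by (simp add: V.lc_scale)
      then have "V.lc n f (\<lambda>i. inverse V.\<pi> * c i) \<in> L'"
        using S V.lc_in_rational_span[OF f] span by (auto simp: sat_def)
      then have "inverse V.\<pi> * c i \<in> V.\<O>" using V.lbas_mem[OF f, of "\<lambda>i. inverse V.\<pi> * c i"] c(3) by simp
      then show "c i \<in> V.PP 1" by (simp add: V.PP_mult_cancel V.v_inverse)
    qed
    moreover have "frm W (tup n f \<phi> i) (tup n f \<phi> j) - frm V (f i) (f j) \<in> V.PP (int (N - a i - a j))"
      if "i \<le> j" "j < n" for i j
      unfolding int_c[OF le_less_trans[OF that] that(2)]
      using form[of i j] that by (simp add: tupi)
    ultimately show "\<phi> \<in> {\<phi> \<in> Hom L'. tup n f \<phi> \<in> ?Y}" using H T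
      unfolding W.approx_iff mem_Collect_eq prod.case by blast
  next
    fix \<phi> assume "\<phi> \<in> {\<phi> \<in> Hom L'. tup n f \<phi> \<in> ?Y}"
    then have H: "\<phi> \<in> Hom L'" and T: "tup n f \<phi> \<in> Tup n M" and I: "W.indm n M (tup n f \<phi>)"
      and form': "\<And>i j. i \<le> j \<Longrightarrow> j < n \<Longrightarrow>
        frm W (tup n f \<phi> i) (tup n f \<phi> j) - frm V (f i) (f j) \<in> V.PP (int (N - a i - a j))"
      by (auto simp: W.approx_iff)
    have form: "frm W (tup n f \<phi> i) (tup n f \<phi> j) - frm V (f i) (f j) \<in> V.PP (int N - int (a i) - int (a j))"
      if ij: "i < n" "j < n" for i j
    proof (cases "i \<le> j")
      case True
      then show ?thesis using form'[of i j] ij int_c by simp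
    next
      case False
      then show ?thesis using form'[of j i] ij int_c[of j i] W.B_sym V.B_sym by (simp add: algebra_simps)
    qed
    have phiM: "tup n f \<phi> i \<in> M" if "i < n" for i using T that by (auto simp: TupI_def)
    have S: "sat M L \<phi> = L'"
    proof (intro equalityI subsetI)
      fix x assume "x \<in> L'"
      then obtain c where c: "x = V.lc n f c" "\<forall>i<n. c i \<in> V.\<O>" using V.lbas_ex[OF f] by blast
      have "W.lc n (tup n f \<phi>) c \<in> M" by (rule W.lc_in_submod[OF sM]) (use c phiM in auto)
      then show "x \<in> sat M L \<phi>"
        using Hlc[OF H] V.lc_in_rational_span[OF f] span by (simp add: sat_def c(1))
    next
      fix x assume x: "x \<in> sat M L \<phi>"
      then obtain c where c: "x = V.lc n f c"
        using V.lbas_obtain_span[OF f, of x] span by (auto simp: sat_def)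
      have "\<forall>i<n. c i \<in> V.\<O>"
      proof (rule ccontr)
        assume "\<not> ?thesis"
        from V.min_coeff[OF this] obtain j where j: "j < n" "c j \<noteq> 0" "v (c j) < 0"
          "\<forall>i<n. c i \<in> V.PP (v (c j))" by blast
        \<comment> \<open>Scaling x by \<pi>^s makes its coordinates integral with a unit among
          them, while the image becomes divisible by \<open>\<pi>\<close>. This contradicts
          independence.\<close>
        define s where "s = nat (- v (c j))"
        have s: "int s = - v (c j)" "1 \<le> s" using j(3) by (auto simp: s_def)
        have "W.lc n (tup n f \<phi>) (\<lambda>i. V.\<pi> ^ s * c i) = scl W (V.\<pi> ^ s) (\<phi> x)"
          by (simp add: W.lc_scale[symmetric] c Hlc[OF H])
        moreover have "scl W (V.\<pi> ^ s) (\<phi> x) \<in> W.spow s M" using x by (auto simp: sat_def)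
        ultimately have "W.lc n (tup n f \<phi>) (\<lambda>i. V.\<pi> ^ s * c i) \<in> W.spow 1 M"
          using W.spow_mono[OF sM s(2)] by auto
        then have "V.\<pi> ^ s * c j \<in> V.PP 1"
          by (rule W.indmD[OF I, where i = j]) (use j s in \<open>auto simp: V.pi_power_mem\<close>)
        moreover have "v (V.\<pi> ^ s * c j) = 0" using j(2) s by (simp add: V.val_mult V.v_power)
        ultimately show False using j(2) by (simp add: V.PP_iff)
      qed
      then show "x \<in> L'" using V.lbas_mem[OF f] c by simp
    qed
    have "\<phi> x \<in> M" if "x \<in> L" for x using that LL' S by (auto simp: sat_def)
    moreover have "frm W (\<phi> x) (\<phi> y) - frm V x y \<in> V.PP (int N)" if x: "x \<in> L" and y: "y \<in> L" for x y
    proof -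
      obtain c d where c: "x = V.lc n f c" "\<forall>i<n. c i \<in> V.PP (int (a i))"
        and d: "y = V.lc n f d" "\<forall>i<n. d i \<in> V.PP (int (a i))"
        using x y unfolding L V.lat_def by auto
      have "frm W (\<phi> x) (\<phi> y) - frm V x y =
          (\<Sum>i<n. \<Sum>j<n. c i * d j * (frm W (tup n f \<phi> i) (tup n f \<phi> j) - frm V (f i) (f j)))"
        unfolding c d Hlc[OF H] W.B_lc_lc V.B_lc_lc by (simp add: right_diff_distrib sum_subtractf)
      moreover have "c i * d j * (frm W (tup n f \<phi> i) (tup n f \<phi> j) - frm V (f i) (f j)) \<in> V.PP (int N)"
        if ij: "i < n" "j < n" for i j
      proof -
        have "c i * d j \<in> V.PP (int (a i) + int (a j))" using c d ij by (intro V.PP_mult) auto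
        from V.PP_mult[OF this form[OF ij]] show ?thesis by simp
      qed
      ultimately show ?thesis by (simp only:) (rule V.PP_sum, rule V.PP_sum, simp)
    qed
    ultimately show "\<phi> \<in> ?l" using H HL S by (simp add: RN_def)
  qed
qed

lemma KN_tup:
  assumes f: "V.lbas n f L'" and L: "L = V.lat n f (\<lambda>i. int (a i))" and N: "\<And>i. i < n \<Longrightarrow> a i \<le> N"
    and M: "W.submod M"
  shows "KN M L N = {\<phi> \<in> Hom L'. tup n f \<phi> \<in> TupI n (\<lambda>i. W.spow (N - a i) M)}"
proof -
  have L': "L' = V.osp n f" using f by (auto simp: V.lbas_def)
  have span: "rational_span V L = rational_span V L'" by (simp add: L L' rational_span_def V.span_lat)
  have HL: "Hom L = Hom L'" by (rule Hom_cong[OF span])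
  have fS: "f i \<in> rational_span V L'" if "i < n" for i
    using V.lbas_base[OF f that] V.lattice_subset_span by blast
  have split: "V.\<pi> ^ N = V.\<pi> ^ a i * V.\<pi> ^ (N - a i)" if "i < n" for i
    using N[OF that] by (simp flip: power_add)
  show ?thesis
  proof (intro equalityI subsetI)
    fix \<phi> assume phi: "\<phi> \<in> KN M L N"
    then have H: "\<phi> \<in> Hom L'" using HL by (simp add: KN_def)
    have "\<phi> (f i) \<in> W.spow (N - a i) M" if i: "i < n" for i
    proof -
      have "scl V (V.\<pi> ^ a i) (f i) \<in> L"
        using V.latI[of n "\<lambda>j. if j = i then V.\<pi> ^ a i else 0" "\<lambda>i. int (a i)" f] i
        by (auto simp: V.lc_single V.PP_iff L)
      then have "\<phi> (scl V (V.\<pi> ^ a i) (f i)) \<in> W.spow N M" using phi by (simp add: KN_def)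
      then obtain y where y: "y \<in> M" "scl W (V.\<pi> ^ a i) (\<phi> (f i)) = scl W (V.\<pi> ^ N) y"
        using Hom_scale[OF H fS[OF i]] by auto
      then have "scl W (V.\<pi> ^ a i) (\<phi> (f i)) = scl W (V.\<pi> ^ a i) (scl W (V.\<pi> ^ (N - a i)) y)"
        using split[OF i] by simp
      then have "\<phi> (f i) = scl W (V.\<pi> ^ (N - a i)) y"
        by (metis W.vs.scale_cancel_left V.pi_nz power_not_zero)
      then show ?thesis using y by blast
    qed
    then show "\<phi> \<in> {\<phi> \<in> Hom L'. tup n f \<phi> \<in> TupI n (\<lambda>i. W.spow (N - a i) M)}"
      using H by (auto simp: TupI_def tup_def)
  next
    fix \<phi> assume phi: "\<phi> \<in> {\<phi> \<in> Hom L'. tup n f \<phi> \<in> TupI n (\<lambda>i. W.spow (N - a i) M)}"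
    then have H: "\<phi> \<in> Hom L'" by simp
    have pf: "\<phi> (f i) \<in> W.spow (N - a i) M" if "i < n" for i using phi that by (auto simp: TupI_def tup_def)
    have "\<phi> x \<in> W.spow N M" if "x \<in> L" for x
    proof -
      obtain c where c: "x = V.lc n f c" "\<forall>i<n. c i \<in> V.PP (int (a i))"
        using \<open>x \<in> L\<close> unfolding L V.lat_def by blast
      have "\<phi> x = W.lc n (\<lambda>i. \<phi> (f i)) c" using Hom_lc[of \<phi> L' n f c, OF H fS] c by simp
      also have "\<dots> \<in> W.spow N M" unfolding W.lc_def
      proof (rule W.submod_sum[OF W.submod_spow[OF M]])
        fix i assume "i \<in> {..<n}"
        then have i: "i < n" by simp
        obtain d where d: "d \<in> V.\<O>" "c i = V.\<pi> ^ a i * d" using V.PP_pi[of "a i" "int (a i)" "c i"] c i by auto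
        obtain y where y: "y \<in> M" "\<phi> (f i) = scl W (V.\<pi> ^ (N - a i)) y" using pf[OF i] by blast
        have "scl W (c i) (\<phi> (f i)) = scl W (V.\<pi> ^ N) (scl W d y)" using d y split[OF i] by (simp add: mult_ac)
        moreover have "scl W d y \<in> M" by (rule W.submod_scale[OF M d(1) y(1)])
        ultimately show "scl W (c i) (\<phi> (f i)) \<in> W.spow N M" by blast
      qed
      finally show ?thesis .
    qed
    then show "\<phi> \<in> KN M L N" using H HL by (simp add: KN_def)
  qed
qed

end

section \<open>Homomorphisms with a fixed saturation, and the exponents of q in their number\<close>

context qspace
begin

lemma card_quot_spow:
  assumes "lbas m g M" "i \<le> j"
  shows "card (quot (spow i M) (spow j M)) = q ^ ((j - i) * m)" "finite (quot (spow i M) (spow j M))"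
proof -
  have ind: "ind m g" using assms by (simp add: lbas_def)
  have "nat (int j - int i) = j - i" by simp
  then show "card (quot (spow i M) (spow j M)) = q ^ ((j - i) * m)" "finite (quot (spow i M) (spow j M))"
    using quot_lat[OF ind, of "\<lambda>_. int i" "\<lambda>_. int j"] assms(2)
    by (simp_all only: lbas_spow[OF assms(1)]) (auto simp: mult.commute)
qed

end

lemma sum_upper: "(\<Sum>(i, j)\<in>{(i, j). i \<le> j \<and> j < n}. F i j) = (\<Sum>j<n. \<Sum>i\<le>j. F i j)"
  for n :: nat and F :: "nat \<Rightarrow> nat \<Rightarrow> 'd::comm_monoid_add"
proof -
  have "(\<Sum>j<n. \<Sum>i\<le>j. F i j) = (\<Sum>(j, i)\<in>Sigma {..<n} (\<lambda>j. {..j}). F i j)"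
    by (rule sum.Sigma) auto
  also have "\<dots> = (\<Sum>(i, j)\<in>{(i, j). i \<le> j \<and> j < n}. F i j)"
    by (rule sum.reindex_bij_witness[of _ "\<lambda>(i, j). (j, i)" "\<lambda>(j, i). (i, j)"]) auto
  finally show ?thesis by simp
qed

text \<open>Every index occurs n + 1 times in the pairs i \<le> j, twice in the diagonal one. This
  is the n + 1 in the exponent of the weight.\<close>

lemma sum_upper_pairs: "(\<Sum>j<n. \<Sum>i\<le>j. a i + a j) = (n + 1) * (\<Sum>i<n. a i)" for n :: nat and a :: "nat \<Rightarrow> nat"
proof (induction n)
  case (Suc n)
  have "(\<Sum>i\<le>n. a i + a n) = (\<Sum>i<n. a i) + a n + Suc n * a n"
    by (simp add: sum.distrib lessThan_Suc_atMost[symmetric])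
  then show ?case using Suc by (simp add: algebra_simps)
qed simp

lemma card_upper: "(\<Sum>j<n. \<Sum>i\<le>j. (1::nat)) = n * (n + 1) div 2"
  by (induction n) auto

context two_qspaces
begin

text \<open>Both sides count the homomorphisms modulo \<varpi> whose saturation is \<open>L'\<close>
  itself, a set described without a basis. This is where an arbitrary stacked basis is exchanged for
  an orthogonal one.\<close>

lemma card_primitive_residue:
  assumes f: "V.lbas n f L'" and g: "V.lbas n g L'" "V.orth n g" and M: "W.unimod m h M"
  shows "card (quot {z \<in> W.approx n M (\<lambda>i j. frm V (f i) (f j)) (\<lambda>_. 1). W.indm n M z} (Tup n (W.spow 1 M))) =
    card (quot (W.emb n M (\<lambda>i. frm V (g i) (g i))) (Tup n (W.spow 1 M)))"
proof -
  have sM: "W.submod M" by (rule W.unimod_submod[OF M])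
  have *: "card (quot {\<phi> \<in> RN M L' 1. sat M L' \<phi> = L'} (KN M L' 1)) =
    card (quot {z \<in> W.approx n M (\<lambda>i j. frm V (f i) (f j)) (\<lambda>_. 1). W.indm n M z} (Tup n (W.spow 1 M)))"
    if f: "V.lbas n f L'" for f
  proof -
    have L': "L' = V.lat n f (\<lambda>i. int 0)" using f by (simp add: V.lbas_def)
    have "(\<lambda>(i, j). 1 - 0 - 0) = (\<lambda>_::nat \<times> nat. 1::nat)" by auto
    then have 1: "{\<phi> \<in> RN M L' 1. sat M L' \<phi> = L'} = {\<phi> \<in> Hom L'. tup n f \<phi> \<in>
        {z \<in> W.approx n M (\<lambda>i j. frm V (f i) (f j)) (\<lambda>_. 1). W.indm n M z}}"
      using RN_tup[OF f L', of 1 m h M] M by simp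
    have 2: "KN M L' 1 = {\<phi> \<in> Hom L'. tup n f \<phi> \<in> Tup n (W.spow 1 M)}"
      using KN_tup[OF f L', of 1 M] sM by simp
    show ?thesis unfolding 1 2
      by (rule quot_Hom_tup(1)[OF f W.subgrp_Tup_spow[OF sM]]) (auto simp: TupI_def W.approx_def)
  qed
  have "W.approx n M (\<lambda>i j. frm V (g i) (g j)) (\<lambda>_. 1) =
      W.approx n M (\<lambda>i j. if i = j then frm V (g i) (g i) else 0) (\<lambda>_. 1)"
  proof -
    have "frm V (g i) (g j) = (if i = j then frm V (g i) (g i) else 0)" if "i \<le> j" "j < n" for i j
      using g(2) that by (auto simp: V.orth_def)
    then show ?thesis by (auto simp: W.approx_def)
  qed
  then show ?thesis using *[OF f] *[OF g(1)] by (simp add: W.emb_def)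
qed

text \<open>Homomorphisms are tuples modulo the \<varpi>^(N - a_i) M, whereas lifts are counted
  modulo \<varpi>^N M; the index between the two moduli is q^(m l) with l the sum of the
  a_i.\<close>

lemma count_fixed_sat:
  assumes f: "V.lbas n f L'" and L: "L = V.lat n f (\<lambda>i. int (a i))"
    and N: "\<And>i j. i < n \<Longrightarrow> j < n \<Longrightarrow> a i + a j < N" "1 \<le> N"
    and M: "W.unimod m h M" and g: "V.lbas n g L'" "V.orth n g"
  shows "card (quot {\<phi> \<in> RN M L N. sat M L \<phi> = L'} (KN M L N)) *
      residue_card v ^ (m * (\<Sum>i<n. a i) + (\<Sum>(i, j)\<in>{(i, j). i \<le> j \<and> j < n}. N - a i - a j - 1)) =
    card (quot (W.emb n M (\<lambda>i. frm V (g i) (g i))) (Tup n (W.spow 1 M))) * residue_card v ^ ((N - 1) * m * n)"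
    "finite (quot {\<phi> \<in> RN M L N. sat M L \<phi> = L'} (KN M L N))"
proof -
  have sM: "W.submod M" by (rule W.unimod_submod[OF M])
  have LM: "W.lbas m h M" by (rule W.unimod_lbas[OF M])
  define T where "T i j = frm V (f i) (f j)" for i j
  define c where "c = (\<lambda>(i, j). N - a i - a j)"
  define Y where "Y = {z \<in> W.approx n M T c. W.indm n M z}"
  define K where "K = TupI n (\<lambda>i. W.spow (N - a i) M)"
  let ?KN = "Tup n (W.spow N M)"
  have aN: "a i < N" if "i < n" for i using N(1)[OF that that] by simp
  have sK: "subgrp K" unfolding K_def by (intro subgrp_TupI W.submod_subgrp W.submod_spow sM)
  have sKN: "subgrp ?KN" by (rule W.subgrp_Tup_spow[OF sM])
  have YT: "Y \<subseteq> Tup n M" by (auto simp: Y_def W.approx_def)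
  have RNY: "{\<phi> \<in> RN M L N. sat M L \<phi> = L'} = {\<phi> \<in> Hom L'. tup n f \<phi> \<in> Y}"
    unfolding Y_def T_def c_def by (rule RN_tup[OF f L N(1) M])
  have KNK: "KN M L N = {\<phi> \<in> Hom L'. tup n f \<phi> \<in> K}"
    unfolding K_def by (rule KN_tup[OF f L _ sM]) (simp add: aN less_imp_le)
  have finY: "finite (quot Y ?KN)" by (rule W.finite_quot_approx[OF M YT])
  have KNsub: "?KN \<subseteq> K"
    proof -
    have "W.spow N M \<subseteq> W.spow (N - a i) M" for i by (rule W.spow_mono[OF sM]) simp
    then show ?thesis unfolding K_def TupI_def by blast
  qed
  have finK: "finite (quot Y K)"
  proof -
    have "quot Y K = (\<lambda>B. coset K (SOME x. coset ?KN x = B)) ` quot Y ?KN"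
    proof -
      have "coset K (SOME y. coset ?KN y = coset ?KN x) = coset K x" for x
      proof -
        have "coset ?KN (SOME y. coset ?KN y = coset ?KN x) = coset ?KN x"
          by (rule someI[of "\<lambda>y. coset ?KN y = coset ?KN x" x, OF refl])
        then show ?thesis using coset_eq_iff[OF sKN] coset_eq_iff[OF sK] KNsub by blast
      qed
      then show ?thesis by (simp add: quot_def image_image)
    qed
    then show ?thesis using finY by simp
  qed
  have tr: "card (quot {\<phi> \<in> RN M L N. sat M L \<phi> = L'} (KN M L N)) = card (quot Y K)"
    "finite (quot {\<phi> \<in> RN M L N. sat M L \<phi> = L'} (KN M L N)) = finite (quot Y K)"
    unfolding RNY KNK using quot_Hom_tup[OF f sK, of Y] YT by (auto simp: TupI_def K_def)
  show "finite (quot {\<phi> \<in> RN M L N. sat M L \<phi> = L'} (KN M L N))" using tr finK by simp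
  have cardK: "card (quot K ?KN) = residue_card v ^ (m * (\<Sum>i<n. a i))" "finite (quot K ?KN)"
  proof -
    have "card (quot K ?KN) = (\<Prod>i<n. card (quot (W.spow (N - a i) M) (W.spow N M))) \<and> finite (quot K ?KN)"
      unfolding K_def
      by (rule card_quot_TupI) (use W.submod_subgrp[OF W.submod_spow[OF sM]] W.card_quot_spow[OF LM] in auto)
    moreover have "(\<Prod>i<n. card (quot (W.spow (N - a i) M) (W.spow N M))) = (\<Prod>i<n. residue_card v ^ (a i * m))"
      proof (rule prod.cong[OF refl])
      fix i assume "i \<in> {..<n}"
      then have "a i < N" by (simp add: aN)
      then show "card (quot (W.spow (N - a i) M) (W.spow N M)) = residue_card v ^ (a i * m)"
        using W.card_quot_spow(1)[OF LM, of "N - a i" N] by simp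
    qed
    moreover have "(\<Prod>i<n. residue_card v ^ (a i * m)) = residue_card v ^ (m * (\<Sum>i<n. a i))"
      by (simp add: power_sum[symmetric] sum_distrib_left mult.commute)
    ultimately show "card (quot K ?KN) = residue_card v ^ (m * (\<Sum>i<n. a i))" "finite (quot K ?KN)" by simp_all
  qed
  \<comment> \<open>\<open>Y\<close> is stable under \<open>K\<close>: a change of the i-th vector
    modulo \<varpi>^(N - a_i) is invisible to the condition modulo \<varpi>^(N - a_i - a_j) and, as
    a_i < N, to independence modulo \<open>\<varpi>\<close>.\<close>
  have tower: "card (quot Y ?KN) = card (quot Y K) * card (quot K ?KN)"
  proof (rule quot_tower(1)[OF sKN sK KNsub _ finK cardK(2)])
    fix z k assume z: "z \<in> Y" and k: "k \<in> K"
    have zM: "z i \<in> M" and kS: "k i \<in> W.spow (N - a i) M" if "i < n" for i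
      using z k that YT by (auto simp: TupI_def K_def)
    have kM: "k i \<in> M" if "i < n" for i using kS[OF that] W.spow_subset[OF sM] by blast
    have zkM: "z i + k i \<in> M" if "i < n" for i using W.submod_add[OF sM zM[OF that] kM[OF that]] .
    have "z + k \<in> Tup n M"
      using zkM z k YT by (auto simp: TupI_def K_def)
    moreover have "frm W ((z + k) i) ((z + k) j) - T i j \<in> V.PP (int (c (i, j)))" if ij: "i \<le> j" "j < n" for i j
    proof -
      have i: "i < n" using ij by simp
      have "(z + k) i - z i \<in> W.spow (N - a i - a j) M" "(z + k) j - z j \<in> W.spow (N - a i - a j) M"
      proof -
        have "W.spow (N - a i) M \<subseteq> W.spow (N - a i - a j) M" "W.spow (N - a j) M \<subseteq> W.spow (N - a i - a j) M"
          by (rule W.spow_mono[OF sM], simp)+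
        moreover have "(z + k) i - z i = k i" "(z + k) j - z j = k j" by simp_all
        ultimately show "(z + k) i - z i \<in> W.spow (N - a i - a j) M" "(z + k) j - z j \<in> W.spow (N - a i - a j) M"
          using kS[OF i] kS[OF ij(2)] by (simp_all only:) blast+
      qed
      then have "frm W ((z + k) i) ((z + k) j) - frm W (z i) (z j) \<in> V.PP (int (N - a i - a j))"
        by (rule W.B_cong_spow[OF M]) (use zM[OF i] zkM[OF ij(2)] in auto)
      moreover have "frm W (z i) (z j) - T i j \<in> V.PP (int (N - a i - a j))"
        using z ij by (auto simp: Y_def W.approx_iff c_def)
      ultimately have "(frm W ((z + k) i) ((z + k) j) - frm W (z i) (z j)) + (frm W (z i) (z j) - T i j)
          \<in> V.PP (int (N - a i - a j))" by (rule V.PP_add)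
      then show ?thesis by (simp add: c_def)
    qed
    moreover have "W.indm n M (z + k)"
    proof (rule W.indm_cong[OF sM, of n z])
      show "z i - (z + k) i \<in> W.spow 1 M" if "i < n" for i
      proof -
        have "k i \<in> W.spow 1 M" using kS[OF that] aN[OF that]
          by (intro subsetD[OF W.spow_mono[OF sM, of 1 "N - a i"]]) simp_all
        then have "- k i \<in> W.spow 1 M" by (rule W.submod_uminus[OF W.submod_spow[OF sM]])
        moreover have "z i - (z + k) i = - k i" by simp
        ultimately show ?thesis by (simp only:)
      qed
      show "W.indm n M z" using z by (simp add: Y_def)
    qed
    ultimately show "z + k \<in> Y" by (simp add: Y_def W.approx_iff)
  qed
  have "card (quot Y ?KN) * residue_card v ^ (\<Sum>p\<in>{(i, j). i \<le> j \<and> j < n}. c p - 1) =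
      card (quot {z \<in> W.approx n M T (\<lambda>_. 1). W.indm n M z} (Tup n (W.spow 1 M))) * residue_card v ^ ((N - 1) * m * n)"
    unfolding Y_def
  proof (rule W.count_approx[OF M _ N(2)])
    fix p assume "p \<in> {(i::nat, j). i \<le> j \<and> j < n}"
    then obtain i j where p: "p = (i, j)" "i \<le> j" "j < n" by auto
    then show "1 \<le> c p \<and> c p \<le> N" using N(1)[of i j] by (auto simp: c_def)
  qed
  moreover have "card (quot {z \<in> W.approx n M T (\<lambda>_. 1). W.indm n M z} (Tup n (W.spow 1 M))) =
      card (quot (W.emb n M (\<lambda>i. frm V (g i) (g i))) (Tup n (W.spow 1 M)))"
    unfolding T_def by (rule card_primitive_residue[OF f g M])
  moreover have "(\<Sum>p\<in>{(i, j). i \<le> j \<and> j < n}. c p - 1) = (\<Sum>(i, j)\<in>{(i, j). i \<le> j \<and> j < n}. N - a i - a j - 1)"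
    by (rule sum.cong) (auto simp: c_def)
  ultimately show "card (quot {\<phi> \<in> RN M L N. sat M L \<phi> = L'} (KN M L N)) *
      residue_card v ^ (m * (\<Sum>i<n. a i) + (\<Sum>(i, j)\<in>{(i, j). i \<le> j \<and> j < n}. N - a i - a j - 1)) =
    card (quot (W.emb n M (\<lambda>i. frm V (g i) (g i))) (Tup n (W.spow 1 M))) * residue_card v ^ ((N - 1) * m * n)"
    unfolding tr(1) using tower cardK(1) by (simp only: power_add mult.assoc)
qed

lemma sum_upper_exponent:
  assumes "\<And>i j. i < n \<Longrightarrow> j < n \<Longrightarrow> a i + a j < N"
  shows "int (\<Sum>(i, j)\<in>{(i, j). i \<le> j \<and> j < n}. N - a i - a j - 1) =
    (int N - 1) * int (n * (n + 1) div 2) - (int n + 1) * int (\<Sum>i<n. a i)"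
proof -
  have "int (\<Sum>(i, j)\<in>{(i, j). i \<le> j \<and> j < n}. N - a i - a j - 1) =
      (\<Sum>j<n. \<Sum>i\<le>j. int (N - a i - a j - 1))"
    unfolding sum_upper[symmetric] of_nat_sum by (rule sum.cong) auto
  also have "\<dots> = (\<Sum>j<n. \<Sum>i\<le>j. (int N - 1) * int 1 - int (a i + a j))"
  proof (intro sum.cong refl)
    fix j i assume "j \<in> {..<n}" "i \<in> {..j}"
    then have "a i + a j < N" using assms[of i j] by simp
    then show "int (N - a i - a j - 1) = (int N - 1) * int 1 - int (a i + a j)" by simp
  qed
  also have "\<dots> = (int N - 1) * int (\<Sum>j<n. \<Sum>i\<le>j. 1) - int (\<Sum>j<n. \<Sum>i\<le>j. a i + a j)"
    by (simp only: sum_subtractf sum_distrib_left[symmetric] of_nat_sum)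
  also have "\<dots> = (int N - 1) * int (n * (n + 1) div 2) - (int n + 1) * int (\<Sum>i<n. a i)"
    unfolding sum_upper_pairs card_upper by (simp add: algebra_simps)
  finally show ?thesis .
qed

text \<open>The normalized count is constant once every saturation is an integral overlattice and
  every exponent N - a_i - a_j is positive, which N > 2A guarantees.\<close>

lemma density_stable:
  assumes e: "V.lbas n e L" and L: "V.nondeg L" and M: "W.unimod m h M" and mn: "n \<le> m"
    and G: "\<And>L'. L' \<in> integral_overlattices v V L \<Longrightarrow> V.lbas n (G L') L' \<and> V.orth n (G L')"
  shows "\<exists>N0. \<forall>N\<ge>N0. real (card (rep_set v W M V L N)) / real (residue_card v) ^ (N * rep_dim m n) =
    (\<Sum>L'\<in>integral_overlattices v V L. real (residue_card v) powi ((int n + 1 - int m) * int (quot_length v V L' L)) *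
      (real (card (quot (W.emb n M (\<lambda>i. frm V (G L' i) (G L' i))) (Tup n (W.spow 1 M)))) * real (residue_card v) powi (- V.emb_dim m n)))"
proof -
  obtain g where g: "V.lbas n g L" "V.orth n g" using V.orthogonal_basis[OF e] by blast
  obtain A :: nat where A: "\<forall>i<n. v (frm V (g i) (g i)) \<le> int A" using V.norm_bound by blast
  have sM: "W.submod M" by (rule W.unimod_submod[OF M])
  have dim: "int (rep_dim m n) = V.emb_dim m n"
  proof -
    have "n * (n + 1) \<le> 2 * (m * n)"
    proof (cases n)
      case (Suc k)
      then have "n + 1 \<le> 2 * m" using mn by simp
      then have "n * (n + 1) \<le> n * (2 * m)" by (rule mult_le_mono2)
      then show ?thesis by (simp add: mult_ac)
    qed simp
    then have "n * (n + 1) div 2 \<le> m * n" by linarith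
    then show ?thesis unfolding rep_dim_def V.emb_dim_def by (simp add: of_nat_diff)
  qed
  have qnz: "real (residue_card v) \<noteq> 0" using V.q_gt_1 by simp
  show ?thesis
  proof (intro exI[of _ "2 * A + 1"] allI impI)
    fix N assume N: "2 * A + 1 \<le> N"
    then have N1: "1 \<le> N" "2 * A < N" "A < N" by auto
    define X where "X L' = card (quot {\<phi> \<in> RN M L N. sat M L \<phi> = L'} (KN M L N))" for L'
    define P where "P L' = card (quot (W.emb n M (\<lambda>i. frm V (G L' i) (G L' i))) (Tup n (W.spow 1 M)))" for L'
    have each: "finite (quot {\<phi> \<in> RN M L N. sat M L \<phi> = L'} (KN M L N)) \<and>
        real (X L') / real (residue_card v) ^ (N * rep_dim m n) =
        real (residue_card v) powi ((int n + 1 - int m) * int (quot_length v V L' L)) * (real (P L') * real (residue_card v) powi (- V.emb_dim m n))"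
      if L': "L' \<in> integral_overlattices v V L" for L'
    proof -
      obtain f a where f: "V.lbas n f L'" "L = V.lat n f (\<lambda>i. int (a i))" "\<forall>i<n. a i \<le> A"
        using V.overlattice_stacked_basis[OF g L A L'] by blast
      have aN: "a i + a j < N" if "i < n" "j < n" for i j
      proof -
        have "a i \<le> A" "a j \<le> A" using f(3) that by auto
        then show ?thesis using N1(2) by linarith
      qed
      define l where "l = (\<Sum>i<n. a i)"
      define s where "s = (\<Sum>(i, j)\<in>{(i, j). i \<le> j \<and> j < n}. N - a i - a j - 1)"
      have s: "int s = (int N - 1) * int (n * (n + 1) div 2) - (int n + 1) * int l"
        unfolding s_def l_def by (rule sum_upper_exponent[OF aN])
      note count = count_fixed_sat[OF f(1,2) aN N1(1) M G[OF L', THEN conjunct1] G[OF L', THEN conjunct2]]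
      have "X L' * residue_card v ^ (m * l + s) = P L' * residue_card v ^ ((N - 1) * m * n)"
        using count(1) by (simp only: X_def P_def l_def s_def)
      then have "real (X L') * real (residue_card v) powi (int (m * l + s)) = real (P L') * real (residue_card v) powi (int ((N - 1) * m * n))"
        unfolding power_int_of_nat by (metis of_nat_mult of_nat_power)
      then have "real (X L') = real (P L') * real (residue_card v) powi (int ((N - 1) * m * n) - int (m * l + s))"
        using qnz by (simp add: power_int_diff field_simps)
      then have "real (X L') / real (residue_card v) ^ (N * rep_dim m n) =
          real (P L') * real (residue_card v) powi (int ((N - 1) * m * n) - int (m * l + s) - int (N * rep_dim m n))"
        using qnz by (simp add: power_int_diff[of "real (residue_card v)" _ "int (N * rep_dim m n)"] del: of_nat_mult)
      \<comment> \<open>The dependence on N cancels except for one copy of the dimension; l collects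
        n + 1 from the Gram conditions and -m from the change of modulus.\<close>
      also have "int ((N - 1) * m * n) - int (m * l + s) - int (N * rep_dim m n) =
          (int n + 1 - int m) * int l + (- V.emb_dim m n)"
      proof -
        have "int ((N - 1) * m * n) = (int N - 1) * (int m * int n)" using N1(1) by (simp add: of_nat_diff)
        moreover have "int (N * rep_dim m n) = int N * V.emb_dim m n" using dim by simp
        ultimately show ?thesis unfolding of_nat_add s of_nat_mult V.emb_dim_def by (simp add: algebra_simps)
      qed
      also have "real (residue_card v) powi ((int n + 1 - int m) * int l + (- V.emb_dim m n)) =
          real (residue_card v) powi ((int n + 1 - int m) * int l) * real (residue_card v) powi (- V.emb_dim m n)"
        by (rule power_int_add) (use qnz in simp)
      also have "l = quot_length v V L' L" unfolding l_def by (rule V.quot_length_eq[OF f(1,2), symmetric])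
      finally show ?thesis using count(2) by (simp add: mult_ac)
    qed
    have I: "sat M L \<phi> \<in> integral_overlattices v V L" if "\<phi> \<in> RN M L N" for \<phi>
      by (rule sat_overlattice[OF M g L A N1(2) that])
    have finI: "finite (integral_overlattices v V L)" by (rule V.finite_overlattices[OF e L])
    have fin: "finite (quot (RN M L N) (KN M L N))"
    proof -
      have "RN M L N = (\<Union>L'\<in>integral_overlattices v V L. {\<phi> \<in> RN M L N. sat M L \<phi> = L'})" using I by blast
      then have "quot (RN M L N) (KN M L N) =
          (\<Union>L'\<in>integral_overlattices v V L. quot {\<phi> \<in> RN M L N. sat M L \<phi> = L'} (KN M L N))"
        unfolding quot_def by (metis image_UN)
      then show ?thesis using finI each by simp
    qed
    have "card (rep_set v W M V L N) = card (quot (RN M L N) (KN M L N))" by (rule card_rep_set[OF e M])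
    also have "\<dots> = (\<Sum>L'\<in>integral_overlattices v V L. X L')"
      unfolding X_def
      by (rule quot_UN_disjoint[OF subgrp_KN[OF sM] finI sat_cong[OF M g L A N1(3)] I fin])
    finally have "real (card (rep_set v W M V L N)) / real (residue_card v) ^ (N * rep_dim m n) =
        (\<Sum>L'\<in>integral_overlattices v V L. real (X L') / real (residue_card v) ^ (N * rep_dim m n))"
      by (simp add: sum_divide_distrib)
    also have "\<dots> = (\<Sum>L'\<in>integral_overlattices v V L. real (residue_card v) powi ((int n + 1 - int m) * int (quot_length v V L' L)) *
      (real (P L') * real (residue_card v) powi (- V.emb_dim m n)))"
      by (rule sum.cong) (use each in auto)
    finally show "real (card (rep_set v W M V L N)) / real (residue_card v) ^ (N * rep_dim m n) =
      (\<Sum>L'\<in>integral_overlattices v V L. real (residue_card v) powi ((int n + 1 - int m) * int (quot_length v V L' L)) *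
      (real (card (quot (W.emb n M (\<lambda>i. frm V (G L' i) (G L' i))) (Tup n (W.spow 1 M)))) * real (residue_card v) powi (- V.emb_dim m n)))"
      by (simp only: P_def)
  qed
qed

end

section \<open>Discriminant and type\<close>

context odd_local_field
begin

lemma quad_symbol_square_mult:
  assumes "d \<noteq> 0" "a \<noteq> 0"
  shows "quad_symbol v (d\<^sup>2 * a) = quad_symbol v a"
proof -
  have val: "v (d\<^sup>2 * a) = 2 * v d + v a" using assms by (simp add: val_mult v_power)
  have "(\<exists>c. d\<^sup>2 * a - c\<^sup>2 \<in> PP (v (d\<^sup>2 * a) + 1)) \<longleftrightarrow> (\<exists>c. a - c\<^sup>2 \<in> PP (v a + 1))"
  proof -
    have *: "d\<^sup>2 * a - (d * c)\<^sup>2 \<in> PP (v (d\<^sup>2 * a) + 1) \<longleftrightarrow> a - c\<^sup>2 \<in> PP (v a + 1)" for c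
    proof -
      have "d\<^sup>2 * a - (d * c)\<^sup>2 = d\<^sup>2 * (a - c\<^sup>2)" by (simp add: algebra_simps power2_eq_square)
      then show ?thesis using assms val by (simp add: PP_mult_cancel v_power)
    qed
    show ?thesis
    proof
      assume "\<exists>c. d\<^sup>2 * a - c\<^sup>2 \<in> PP (v (d\<^sup>2 * a) + 1)"
      then obtain c where "d\<^sup>2 * a - c\<^sup>2 \<in> PP (v (d\<^sup>2 * a) + 1)" by blast
      then have "d\<^sup>2 * a - (d * (c / d))\<^sup>2 \<in> PP (v (d\<^sup>2 * a) + 1)" using assms by simp
      then show "\<exists>c. a - c\<^sup>2 \<in> PP (v a + 1)" unfolding * by blast
    qed (use * in blast)
  qed
  then show ?thesis unfolding quad_symbol_def val by simp
qed

lemma chi_eq_quad_symbol: "x \<noteq> 0 \<Longrightarrow> v x = 0 \<Longrightarrow> \<chi> x = quad_symbol v x"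
  by (simp add: \<chi>_def PP_iff)

lemma sg_eq_quad_symbol:
  assumes "x \<noteq> 0" "v x = 0"
  shows "quad_symbol v ((-1) ^ (m div 2) * x) = sg m x"
  unfolding sg_def using assms by (subst chi_eq_quad_symbol) (auto simp: val_mult v_power)

lemma quad_symbol_values: "quad_symbol v a \<in> {0, 1, -1}"
  by (simp add: quad_symbol_def)

text \<open>The sign of the orthogonal complement of the unit part, of rank 2k + t, is the product
  of the signs of the whole and of the unit part. For even \<open>t\<close> the powers of -1 agree
  up to a square.\<close>

lemma sg_mult:
  assumes "x \<in> \<O>" "y \<in> \<O>" "even t"
  shows "sg (2 * k + t) (x * y) = sg (r + t + 2 * k) x * sg r y"
proof -
  obtain s where t: "t = 2 * s" using \<open>even t\<close> by blast
  have e: "(r + t + 2 * k) div 2 = r div 2 + s + k" "(2 * k + t) div 2 = k + s"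
    by (simp_all add: t)
  have "(-1) ^ (2 * (r div 2)) = (1::'a)" by (simp add: power_mult)
  then have "(-1) ^ ((2 * k + t) div 2) * (x * y) =
      ((-1) ^ ((r + t + 2 * k) div 2) * x) * ((-1) ^ (r div 2) * y)"
    unfolding e by (simp add: power_add power_mult power2_eq_square mult_ac mult_2 flip: power_mult_distrib)
  then have "sg (2 * k + t) (x * y) = \<chi> (((-1) ^ ((r + t + 2 * k) div 2) * x) * ((-1) ^ (r div 2) * y))"
    unfolding sg_def by (simp only:)
  moreover have O: "(-1) ^ j * z \<in> \<O>" if "z \<in> \<O>" for j :: nat and z :: 'a
    using O_mult[OF O_power that, of "-1" j] by simp
  ultimately show ?thesis unfolding sg_def by (simp only: chi_mult[OF O[OF assms(1)] O[OF assms(2)]])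
qed

end

context qspace
begin

lemma disc_of_list_gram: "disc_of_list V es = (-1) ^ (length es div 2) * det (gram (length es) (nth es))"
  unfolding disc_of_list_def Let_def disc_sign gram_def ..

text \<open>Bases of the same rational span have determinants that differ by a square of the field,
  so the symbol of \<open>L\<close> can be read off from any overlattice.\<close>

lemma lattice_chi_span:
  assumes e: "lbas n e L" and f: "lbas n f L'" "det (gram n f) \<noteq> 0"
    and s: "rational_span V L' = rational_span V L"
  shows "lattice_chi v V L = quad_symbol v ((-1) ^ (n div 2) * det (gram n f))"
proof -
  define es where "es = (SOME es. lattice_basis v V L es)"
  have "lattice_basis v V L es" unfolding es_def by (rule someI, rule lbas_lattice_basis[OF e])
  then have es: "lbas (length es) (nth es) L" by (rule lattice_basis_lbas)
  have n: "length es = n" using lbas_rank[OF es] lbas_rank[OF e] by simp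
  obtain d where d: "d \<noteq> 0" "det (gram n (nth es)) = d\<^sup>2 * det (gram n f)"
    using gram_span_change[OF f(1) es[unfolded n] s] by blast
  have "disc_of_list V es = d\<^sup>2 * ((-1) ^ (n div 2) * det (gram n f))"
    unfolding disc_of_list_gram n d by (simp add: mult_ac)
  then show ?thesis
    unfolding lattice_chi_def es_def[symmetric] using d(1) f(2) by (simp only: quad_symbol_square_mult) (subst quad_symbol_square_mult, auto)
qed

text \<open>Norms in the maximal ideal come first and unit norms last, the order in which
  \<open>card_emb\<close> counts. The number \<open>t\<close> turns out to be the type.\<close>

definition jordan :: "nat \<Rightarrow> nat \<Rightarrow> (nat \<Rightarrow> 'b) \<Rightarrow> 'b set \<Rightarrow> bool" where
  "jordan n t g L \<longleftrightarrow> lbas n g L \<and> orth n g \<and> t \<le> n \<and> (\<forall>i<n. B (g i) (g i) \<noteq> 0) \<and>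
     (\<forall>i<t. 1 \<le> v (B (g i) (g i))) \<and> (\<forall>i. t \<le> i \<longrightarrow> i < n \<longrightarrow> v (B (g i) (g i)) = 0)"

lemma jordan_exists:
  assumes f: "lbas n f L" and L: "nondeg L" and int: "\<forall>x\<in>L. \<forall>y\<in>L. B x y \<in> \<O>"
  shows "\<exists>t g. jordan n t g L"
proof -
  obtain g0 where g0: "lbas n g0 L" "orth n g0"
    "\<forall>i j. i \<le> j \<longrightarrow> j < n \<longrightarrow> v (B (g0 i) (g0 i)) \<le> v (B (g0 j) (g0 j))"
    using sorted_orthogonal_basis[OF f] by blast
  \<comment> \<open>Reversal of the sorted order moves the nonunit norms to the front.\<close>
  define \<sigma> where "\<sigma> = (\<lambda>i. n - 1 - i)"
  have \<sigma>: "bij_betw \<sigma> {..<n} {..<n}"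
    by (rule bij_betw_byWitness[where f' = \<sigma>]) (auto simp: \<sigma>_def)
  define g where "g = g0 \<circ> \<sigma>"
  have g: "lbas n g L" "orth n g" unfolding g_def by (rule lbas_perm[OF g0(1) \<sigma>], rule orth_perm[OF g0(2) \<sigma>])
  have desc: "v (B (g j) (g j)) \<le> v (B (g i) (g i))" if "i \<le> j" "j < n" for i j
    using g0(3) that by (simp add: g_def \<sigma>_def)
  have nz: "B (g i) (g i) \<noteq> 0" if "i < n" for i by (rule orth_norm_nonzero[OF g L that])
  have nonneg: "0 \<le> v (B (g i) (g i))" if "i < n" for i
    using int lbas_base[OF g(1) that] nz[OF that] by (auto simp: PP_iff)
  define P where "P t \<longleftrightarrow> (\<forall>i. t \<le> i \<longrightarrow> i < n \<longrightarrow> v (B (g i) (g i)) = 0)" for t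
  define t where "t = (LEAST t. P t)"
  have Pn: "P n" by (simp add: P_def)
  have "P t" unfolding t_def by (rule LeastI[of P, OF Pn])
  moreover have "t \<le> n" unfolding t_def by (rule Least_le[of P, OF Pn])
  moreover have "1 \<le> v (B (g i) (g i))" if "i < t" for i
  proof (rule ccontr)
    assume *: "\<not> ?thesis"
    have "v (B (g j) (g j)) = 0" if j: "i \<le> j" "j < n" for j
      using * desc[OF j] nonneg[OF j(2)] by linarith
    then have "P i" by (simp add: P_def)
    then show False using that not_less_Least[of i P] by (simp add: t_def)
  qed
  ultimately show ?thesis unfolding jordan_def P_def using g nz by blast
qed

lemma jordan_nondeg_dual:
  assumes "jordan n t g L" "nondeg L"
  shows "dual_lattice v V L = lat n g (\<lambda>i. - v (B (g i) (g i)))"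
  using assms by (intro dual_lattice_orth) (auto simp: jordan_def)

text \<open>Pairing a whole coset of \<open>L\<close> with a basis vector again gives a coset. So
  the components of the isomorphism below are defined without choosing representatives.\<close>

lemma B_image_lattice:
  assumes g: "lbas n g L" "orth n g" and i: "i < n" "B (g i) (g i) \<noteq> 0"
  shows "(\<lambda>y. B y (g i)) ` coset L x = coset (PP (v (B (g i) (g i)))) (B x (g i))"
proof -
  have "(\<lambda>y. B y (g i)) ` L = PP (v (B (g i) (g i)))"
  proof (intro equalityI subsetI)
    fix s assume "s \<in> (\<lambda>y. B y (g i)) ` L"
    then obtain y where y: "y \<in> L" "s = B y (g i)" by blast
    obtain c where c: "y = lc n g c" "\<forall>i<n. c i \<in> \<O>" using lbas_ex[OF g(1) y(1)] by blast
    show "s \<in> PP (v (B (g i) (g i)))"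
      unfolding y c(1) B_orth_coeff[OF g(2) i(1)] using c(2) i by (intro PP_mult_O) (auto simp: PP_iff)
  next
    fix s assume s: "s \<in> PP (v (B (g i) (g i)))"
    have "s / B (g i) (g i) \<in> \<O>" using s i(2) by (simp add: PP_divide_iff)
    then have "(s / B (g i) (g i)) \<cdot> g i \<in> L"
      by (rule submod_scale[OF lbas_submod[OF g(1)] _ lbas_base[OF g(1) i(1)]])
    moreover have "B ((s / B (g i) (g i)) \<cdot> g i) (g i) = s" using i(2) by (simp add: B_simps)
    ultimately show "s \<in> (\<lambda>y. B y (g i)) ` L" by (metis image_eqI)
  qed
  then have "(\<lambda>s. B x (g i) + s) ` PP (v (B (g i) (g i))) = (\<lambda>y. B x (g i) + B y (g i)) ` L" by (metis image_image)
  then show ?thesis unfolding coset_def by (simp add: image_image B_simps)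
qed

text \<open>The type is defined through a choice, so existence is needed. The isomorphism pairs the
  dual lattice with an orthogonal basis, and the invariants are the valuations of its norms.\<close>

lemma fundamental_invariants_exist:
  assumes f: "lbas n f L" and L: "nondeg L" and int: "\<forall>x\<in>L. \<forall>y\<in>L. B x y \<in> \<O>"
  shows "\<exists>as. fundamental_invariants v V L as"
proof -
  obtain g where g: "lbas n g L" "orth n g"
    "\<forall>i j. i \<le> j \<longrightarrow> j < n \<longrightarrow> v (B (g i) (g i)) \<le> v (B (g j) (g j))"
    using sorted_orthogonal_basis[OF f] by blast
  have nz: "B (g i) (g i) \<noteq> 0" if "i < n" for i by (rule orth_norm_nonzero[OF g(1,2) L that])
  define D where "D = dual_lattice v V L"
  have D: "D = lat n g (\<lambda>i. - v (B (g i) (g i)))" unfolding D_def by (rule dual_lattice_orth[OF g(1,2) L])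
  have sL: "subgrp L" by (rule submod_subgrp[OF lbas_submod[OF g(1)]])
  have indg: "ind n g" using g(1) by (simp add: lbas_def)
  have sD: "submod D" unfolding D by (rule submod_lat)
  have DO: "B x (g i) \<in> \<O>" if "x \<in> D" "i < n" for x i
    using that(1) lbas_base[OF g(1) that(2)] by (simp add: D_def dual_lattice_def)
  define as where "as = map (\<lambda>i. nat (v (B (g i) (g i)))) [0..<n]"
  have as: "int (as ! i) = v (B (g i) (g i))" if "i < n" for i
    using int lbas_base[OF g(1) that] nz[OF that] that by (auto simp: PP_iff as_def)
  have len: "length as = n" by (simp add: as_def)
  define F where "F X = (\<lambda>i\<in>{..<n}. (\<lambda>y. B y (g i)) ` X)" for X
  have F: "F (coset L x) i = coset (PP (int (as ! i))) (B x (g i))" if "i < n" for x i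
    using B_image_lattice[OF g(1,2) that nz[OF that]] that by (simp add: F_def as)
  have Fmem: "s \<in> F (coset L x) i \<longleftrightarrow> s - B x (g i) \<in> PP (int (as ! i))" if "i < n" for s x i
    by (simp add: F[OF that] mem_coset)
  have "bij_betw F (quot D L) (\<Pi>\<^sub>E i\<in>{..<n}. quot \<O> (PP (int (as ! i))))"
    unfolding bij_betw_def
  proof
    show "inj_on F (quot D L)"
    proof (rule inj_onI)
      fix X Y assume "X \<in> quot D L" "Y \<in> quot D L" and eq: "F X = F Y"
      then obtain x y where x: "x \<in> D" "X = coset L x" and y: "y \<in> D" "Y = coset L y" by (auto simp: quot_def)
      have "x - y \<in> D" by (rule submod_diff[OF sD x(1) y(1)])
      then obtain c where c: "x - y = lc n g c" unfolding D lat_def by blast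
      have "c i \<in> \<O>" if i: "i < n" for i
      proof -
        have "coset (PP (int (as ! i))) (B x (g i)) = coset (PP (int (as ! i))) (B y (g i))"
          using eq x y F[OF i] by metis
        then have "B (x - y) (g i) \<in> PP (int (as ! i))" by (simp add: coset_eq_iff B_simps)
        then show ?thesis unfolding c B_orth_coeff[OF g(2) i] as[OF i]
          using PP_mult_cancel[OF nz[OF i], of "c i"] by (simp add: mult.commute)
      qed
      then have "x - y \<in> L" unfolding c using lbas_mem[OF g(1)] by blast
      then show "X = Y" using x y coset_eq_iff[OF sL] by blast
    qed
    show "F ` quot D L = (\<Pi>\<^sub>E i\<in>{..<n}. quot \<O> (PP (int (as ! i))))"
    proof (intro equalityI subsetI)
      fix h assume "h \<in> F ` quot D L"
      then obtain x where x: "x \<in> D" "h = F (coset L x)" by (auto simp: quot_def)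
      show "h \<in> (\<Pi>\<^sub>E i\<in>{..<n}. quot \<O> (PP (int (as ! i))))"
      proof (rule PiE_I)
        fix i assume "i \<in> {..<n}"
        then show "h i \<in> quot \<O> (PP (int (as ! i)))" using DO[OF x(1)] by (simp add: x F quot_def)
      next
        fix i assume "i \<notin> {..<n}"
        then show "h i = undefined" by (simp add: x F_def)
      qed
    next
      fix h assume h: "h \<in> (\<Pi>\<^sub>E i\<in>{..<n}. quot \<O> (PP (int (as ! i))))"
      have "\<forall>i\<in>{..<n}. \<exists>s. s \<in> \<O> \<and> h i = coset (PP (int (as ! i))) s"
        using PiE_mem[OF h] by (fastforce simp: quot_def)
      then obtain s where s: "\<forall>i\<in>{..<n}. s i \<in> \<O> \<and> h i = coset (PP (int (as ! i))) (s i)" by metis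
      define x where "x = lc n g (\<lambda>i. s i / B (g i) (g i))"
      have x: "x \<in> D" unfolding x_def D by (rule latI) (use s nz in \<open>auto simp: PP_divide_iff\<close>)
      have "F (coset L x) = h"
      proof
        fix i show "F (coset L x) i = h i"
        proof (cases "i < n")
          case True
          have "B x (g i) = s i" unfolding x_def B_orth_coeff[OF g(2) True] using nz[OF True] by simp
          then show ?thesis using True s by (simp add: F)
        next
          case False
          then show ?thesis using PiE_arb[OF h, of i] by (simp add: F_def)
        qed
      qed
      then show "h \<in> F ` quot D L" using x by (auto simp: quot_def)
    qed
  qed
  moreover have "s + t \<in> F (coset L (x + y)) i"
    if "i < n" "s \<in> F (coset L x) i" "t \<in> F (coset L y) i" for x y i s t
    using PP_add[of "s - B x (g i)" "int (as ! i)" "t - B y (g i)"] that by (simp add: Fmem B_simps algebra_simps)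
  moreover have "c * s \<in> F (coset L (c \<cdot> x)) i"
    if "c \<in> \<O>" "i < n" "s \<in> F (coset L x) i" for c x i s
    using PP_mult_O[of c "s - B x (g i)" "int (as ! i)"] that by (simp add: Fmem B_simps algebra_simps)
  moreover have "sorted as"
    unfolding sorted_iff_nth_mono as_def using g(3) by (auto intro!: nat_mono)
  ultimately show ?thesis
    unfolding fundamental_invariants_def using len lbas_rank[OF g(1)]
    by (intro exI[of _ as]) (auto simp: D_def intro!: exI[of _ F])
qed

text \<open>The type is read off from the number of elements of \<open>L\<^sup>\<or> / L\<close> killed by the uniformizer.\<close>

lemma card_torsion:
  assumes g: "jordan n t g L" and L: "nondeg L"
  shows "card (quot {x \<in> dual_lattice v V L. \<pi> \<cdot> x \<in> L} L) = q ^ t"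
proof -
  have gb: "lbas n g L" and nz: "\<And>i. i < n \<Longrightarrow> B (g i) (g i) \<noteq> 0" and t: "t \<le> n"
    and v1: "\<And>i. i < t \<Longrightarrow> 1 \<le> v (B (g i) (g i))" and v0: "\<And>i. t \<le> i \<Longrightarrow> i < n \<Longrightarrow> v (B (g i) (g i)) = 0"
    using g by (auto simp: jordan_def)
  have indg: "ind n g" using gb by (simp add: lbas_def)
  have "{x \<in> dual_lattice v V L. \<pi> \<cdot> x \<in> L} = lat n g (\<lambda>i. if i < t then -1 else 0)"
  proof (intro equalityI subsetI)
    fix x assume x: "x \<in> {x \<in> dual_lattice v V L. \<pi> \<cdot> x \<in> L}"
    then obtain c where c: "x = lc n g c" "\<forall>i<n. c i \<in> PP (- v (B (g i) (g i)))"
      unfolding jordan_nondeg_dual[OF g L] lat_def by blast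
    have "\<forall>i<n. \<pi> * c i \<in> \<O>" using x lbas_mem[OF gb] by (simp add: c lc_scale)
    then have "c i \<in> PP (if i < t then -1 else 0)" if "i < n" for i
      using that c(2) v0[of i] PP_mult_cancel[of \<pi> "c i" 0] by (cases "i < t") auto
    then show "x \<in> lat n g (\<lambda>i. if i < t then -1 else 0)" unfolding c by (rule latI)
  next
    fix x assume "x \<in> lat n g (\<lambda>i. if i < t then -1 else 0)"
    then obtain c where c: "x = lc n g c" "\<forall>i<n. c i \<in> PP (if i < t then -1 else 0)"
      unfolding lat_def by blast
    have ci: "c i \<in> PP (- v (B (g i) (g i))) \<and> \<pi> * c i \<in> \<O>" if "i < n" for i
    proof (cases "i < t")
      case True
      have "c i \<in> PP (-1)" using c(2) that True by auto
      then show ?thesis using v1[OF True] PP_mono[of "- v (B (g i) (g i))" "-1" "c i"] PP_mult_cancel[of \<pi> "c i" 0] by simp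
    next
      case False
      have "c i \<in> \<O>" using c(2) that False by auto
      then show ?thesis using False v0[of i] that PP_mult_cancel[of \<pi> "c i" 0] PP_mono[of "-1" 0 "c i"] by simp
    qed
    then show "x \<in> {x \<in> dual_lattice v V L. \<pi> \<cdot> x \<in> L}"
      unfolding jordan_nondeg_dual[OF g L] using lbas_mem[OF gb] by (auto simp: c lc_scale intro!: latI)
  qed
  moreover have "L = lat n g (\<lambda>_. 0)" using gb by (simp add: lbas_def)
  ultimately have "card (quot {x \<in> dual_lattice v V L. \<pi> \<cdot> x \<in> L} L) =
      q ^ (\<Sum>i<n. nat (0 - (if i < t then -1 else 0)))"
    using quot_lat(1)[OF indg, of "\<lambda>i. if i < t then -1 else 0" "\<lambda>_. 0"] by simp
  also have "(\<Sum>i<n. nat (0 - (if i < t then -1 else 0))) = (\<Sum>i\<in>{..<n} \<inter> {i. i < t}. 1)"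
    by (subst sum.inter_restrict) (auto intro!: sum.cong)
  also have "\<dots> = t" using t by (simp add: Int_absorb1 lessThan_def[symmetric] subset_eq)
  finally show ?thesis .
qed

text \<open>A summand O/\<varpi>^a has q elements killed by \<open>\<pi>\<close> if a is positive
  and one if a = 0. Since \<open>as\<close> is an arbitrary list of invariants, the number of
  nonzero ones does not depend on the choice.\<close>

lemma card_torsion_invariants:
  assumes f: "lbas n f L" and as: "fundamental_invariants v V L as"
  shows "card (quot {x \<in> dual_lattice v V L. \<pi> \<cdot> x \<in> L} L) = q ^ length (filter (\<lambda>a. a \<noteq> 0) as)"
proof -
  define D where "D = dual_lattice v V L"
  define n where "n = length as"
  define P where "P i = PP (int (as ! i))" for i
  have sL: "subgrp L" and mL: "submod L"
    using lbas_submod[OF f] submod_subgrp by blast+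
  obtain F where bij: "bij_betw F (quot D L) (\<Pi>\<^sub>E i\<in>{..<n}. quot \<O> (P i))"
    and scale: "\<forall>c\<in>\<O>. \<forall>x\<in>D. \<forall>i<n. \<forall>s\<in>F (coset L x) i. c * s \<in> F (coset L (c \<cdot> x)) i"
    using as unfolding fundamental_invariants_def D_def n_def P_def by blast
  have D_scale: "c \<cdot> x \<in> D" if "c \<in> \<O>" "x \<in> D" for c x
    using that unfolding D_def dual_lattice_def rational_span_def
    by (auto simp: B_simps vs.span_scale O_mult)
  have sP: "subgrp (P i)" for i by (simp add: P_def)
  have FPi: "F (coset L x) \<in> (\<Pi>\<^sub>E i\<in>{..<n}. quot \<O> (P i))" if "x \<in> D" for x
  proof -
    have "coset L x \<in> quot D L" using that by (simp add: quot_def)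
    then show ?thesis by (rule bij_betwE[OF bij, rule_format])
  qed
  have FD: "\<exists>s\<in>\<O>. F (coset L x) i = coset (P i) s" if "x \<in> D" "i < n" for x i
  proof -
    have "F (coset L x) i \<in> quot \<O> (P i)" using FPi[OF that(1)] that(2) by (simp add: PiE_iff)
    then show ?thesis by (auto simp: quot_def)
  qed
  have coset_mem: "X = coset (P i) s" if X: "\<exists>s'\<in>\<O>. X = coset (P i) s'" "s \<in> X" for X s i
  proof -
    obtain s' where s': "X = coset (P i) s'" using X(1) by blast
    then have "s - s' \<in> P i" using X(2) by (simp only: mem_coset)
    then show ?thesis unfolding s' by (simp add: coset_eq_iff[OF sP] subgrp_diff_swap[OF sP, of s'])
  qed
  have Fscale: "F (coset L (c \<cdot> x)) i = coset (P i) (c * s)"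
    if "x \<in> D" "i < n" "c \<in> \<O>" "F (coset L x) i = coset (P i) s" for x i c s
  proof (rule coset_mem)
    show "\<exists>s'\<in>\<O>. F (coset L (c \<cdot> x)) i = coset (P i) s'" by (rule FD) (use that D_scale in auto)
    have "s \<in> F (coset L x) i" using that(4) by (simp add: mem_coset subgrp_zero[OF sP])
    then show "c * s \<in> F (coset L (c \<cdot> x)) i" using scale that by blast
  qed
  have Fext: "F (coset L x) = F (coset L y)" if "x \<in> D" "y \<in> D" "\<forall>i<n. F (coset L x) i = F (coset L y) i" for x y
  proof (rule PiE_ext)
    show "F (coset L x) \<in> (\<Pi>\<^sub>E i\<in>{..<n}. quot \<O> (P i))" "F (coset L y) \<in> (\<Pi>\<^sub>E i\<in>{..<n}. quot \<O> (P i))"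
      by (rule FPi[OF that(1)], rule FPi[OF that(2)])
  qed (use that(3) in auto)
  have tors: "\<pi> \<cdot> x \<in> L \<longleftrightarrow> (\<forall>i<n. \<pi> * s i \<in> P i)"
    if x: "x \<in> D" and s: "\<forall>i<n. F (coset L x) i = coset (P i) (s i)" for x s
  proof -
    have pO: "\<pi> \<in> \<O>" by (simp add: PP_iff)
    \<comment> \<open>Zero is written as 0 times x, so that compatibility with scalars also gives
      the image of the zero class.\<close>
    have px: "\<pi> \<cdot> x \<in> D" and zx: "0 \<cdot> x \<in> D"
      by (rule D_scale[OF pO x], rule D_scale[OF PP_zero x])
    have "\<pi> \<cdot> x \<in> L \<longleftrightarrow> coset L (\<pi> \<cdot> x) = coset L (0 \<cdot> x)" by (simp add: coset_eq_iff[OF sL])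
    also have "\<dots> \<longleftrightarrow> F (coset L (\<pi> \<cdot> x)) = F (coset L (0 \<cdot> x))"
      by (rule inj_on_eq_iff[OF bij_betw_imp_inj_on[OF bij], symmetric])
        (unfold quot_def, rule imageI[OF px], rule imageI[OF zx])
    also have "\<dots> \<longleftrightarrow> (\<forall>i<n. F (coset L (\<pi> \<cdot> x)) i = F (coset L (0 \<cdot> x)) i)"
      using Fext[OF px zx] by auto
    also have "\<dots> \<longleftrightarrow> (\<forall>i<n. coset (P i) (\<pi> * s i) = coset (P i) (0 * s i))"
      using Fscale[OF x _ pO] Fscale[OF x _ PP_zero] s by (metis (no_types, lifting))
    also have "\<dots> \<longleftrightarrow> (\<forall>i<n. \<pi> * s i \<in> P i)" by (simp add: coset_eq_iff[OF sP])
    finally show ?thesis .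
  qed
  define R where "R i = {s \<in> \<O>. \<pi> * s \<in> P i}" for i
  have R: "R i = PP (if as ! i = 0 then 0 else int (as ! i) - 1)" for i
    unfolding R_def P_def using PP_mono[of 0 "int (as ! i) - 1"] PP_mono[of "-1" 0]
    by (auto simp: PP_mult_cancel)
  have "F ` quot {x \<in> D. \<pi> \<cdot> x \<in> L} L = (\<Pi>\<^sub>E i\<in>{..<n}. quot (R i) (P i))"
  proof (intro equalityI subsetI)
    fix h assume "h \<in> F ` quot {x \<in> D. \<pi> \<cdot> x \<in> L} L"
    then obtain x where x: "x \<in> D" "\<pi> \<cdot> x \<in> L" "h = F (coset L x)" by (auto simp: quot_def)
    obtain s where s: "\<forall>i<n. s i \<in> \<O> \<and> F (coset L x) i = coset (P i) (s i)"
      using FD[OF x(1)] by metis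
    have "\<forall>i<n. \<pi> * s i \<in> P i" using tors[OF x(1), of s] x(2) s by blast
    moreover have "h \<in> (\<Pi>\<^sub>E i\<in>{..<n}. quot \<O> (P i))"
      unfolding x(3) by (rule FPi[OF x(1)])
    ultimately show "h \<in> (\<Pi>\<^sub>E i\<in>{..<n}. quot (R i) (P i))"
      using s x(3) by (auto simp: PiE_iff quot_def R_def)
  next
    fix h assume h: "h \<in> (\<Pi>\<^sub>E i\<in>{..<n}. quot (R i) (P i))"
    have "h \<in> (\<Pi>\<^sub>E i\<in>{..<n}. quot \<O> (P i))"
      using h by (auto simp: PiE_iff quot_def R_def)
    then obtain x where x: "x \<in> D" "h = F (coset L x)" using bij unfolding bij_betw_def quot_def by blast
    have "\<forall>i\<in>{..<n}. \<exists>s. s \<in> R i \<and> h i = coset (P i) s" using PiE_mem[OF h] by (fastforce simp: quot_def)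
    then obtain s where s: "\<forall>i\<in>{..<n}. s i \<in> R i \<and> h i = coset (P i) (s i)" by metis
    have "\<pi> \<cdot> x \<in> L" using tors[OF x(1), of s] s x(2) by (auto simp: R_def)
    then show "h \<in> F ` quot {x \<in> D. \<pi> \<cdot> x \<in> L} L" using x by (auto simp: quot_def)
  qed
  moreover have "inj_on F (quot {x \<in> D. \<pi> \<cdot> x \<in> L} L)"
    using bij unfolding bij_betw_def by (rule inj_on_subset[OF conjunct1]) (auto simp: quot_def)
  ultimately have "card (quot {x \<in> D. \<pi> \<cdot> x \<in> L} L) = card (\<Pi>\<^sub>E i\<in>{..<n}. quot (R i) (P i))"
    using card_image[of F "quot {x \<in> D. \<pi> \<cdot> x \<in> L} L"] by simp
  also have "\<dots> = (\<Prod>i<n. card (quot (R i) (P i)))" by (simp add: card_PiE)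
  also have "\<dots> = (\<Prod>i<n. q ^ (if as ! i \<noteq> 0 then 1 else 0))"
  proof (rule prod.cong[OF refl])
    fix i
    show "card (quot (R i) (P i)) = q ^ (if as ! i \<noteq> 0 then 1 else 0)"
      unfolding R P_def using quot_PP[of "if as ! i = 0 then 0 else int (as ! i) - 1" "int (as ! i)"] by auto
  qed
  also have "\<dots> = q ^ (\<Sum>i<n. if as ! i \<noteq> 0 then 1 else 0)" by (rule power_sum[symmetric])
  also have "(\<Sum>i<n. if as ! i \<noteq> 0 then 1 else 0) = card {i. i < n \<and> as ! i \<noteq> 0}"
    by (simp add: sum.If_cases) (rule arg_cong[where f = card], auto)
  also have "\<dots> = length (filter (\<lambda>a. a \<noteq> 0) as)" by (simp add: length_filter_conv_card n_def)
  finally show ?thesis by (simp add: D_def)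
qed

lemma lattice_type_jordan:
  assumes g: "jordan n t g L" and L: "nondeg L" and int: "\<forall>x\<in>L. \<forall>y\<in>L. B x y \<in> \<O>"
  shows "lattice_type v V L = t"
proof -
  have gb: "lbas n g L" using g by (simp add: jordan_def)
  have as: "fundamental_invariants v V L (SOME as. fundamental_invariants v V L as)"
    by (rule someI_ex[OF fundamental_invariants_exist[OF gb L int]])
  have "q ^ t = q ^ lattice_type v V L"
    using card_torsion[OF g L] card_torsion_invariants[OF gb as] by (simp add: lattice_type_def)
  then show ?thesis using power_inject_exp[of q] q_gt_1 by simp
qed

end

section \<open>The residual sign\<close>

context qspace
begin

definition core :: "'b set \<Rightarrow> nat \<Rightarrow> (nat \<Rightarrow> 'b) \<Rightarrow> bool" where
  "core L r u \<longleftrightarrow> (\<forall>i<r. u i \<in> L) \<and>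
     (\<forall>x\<in>L. \<exists>c. (\<forall>i. c i \<in> \<O>) \<and> x - lc r u c \<in> residual_radical v V L) \<and>
     (\<forall>c. (\<forall>i. c i \<in> \<O>) \<and> lc r u c \<in> residual_radical v V L \<longrightarrow> (\<forall>i<r. c i \<in> PP 1))"

lemma residual_core_basis_core: "residual_core_basis v V L us \<longleftrightarrow> core L (length us) (nth us)"
proof -
  have "set us \<subseteq> L \<longleftrightarrow> (\<forall>i<length us. us ! i \<in> L)" by (auto simp: set_conv_nth)
  then show ?thesis unfolding residual_core_basis_def core_def lin_comb_def lc_def by simp
qed

lemma submod_residual_radical:
  assumes "submod L"
  shows "submod (residual_radical v V L)"
  using assms unfolding is_submodule_def residual_radical_def
  by (auto simp: B_simps intro: PP_add PP_mult_O)

text \<open>The length of a core basis is thereby independent of the choice made in the definition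
  of the residual sign.\<close>

lemma card_quot_radical:
  assumes L: "submod L" and int: "\<forall>x\<in>L. \<forall>y\<in>L. B x y \<in> \<O>" and u: "core L r u"
  shows "card (quot L (residual_radical v V L)) = q ^ r"
proof -
  let ?R = "residual_radical v V L"
  have sR: "submod ?R" by (rule submod_residual_radical[OF L])
  have uL: "\<forall>i<r. u i \<in> L" and gen: "\<forall>x\<in>L. \<exists>c. (\<forall>i. c i \<in> \<O>) \<and> x - lc r u c \<in> ?R"
    and ind: "\<forall>c. (\<forall>i. c i \<in> \<O>) \<and> lc r u c \<in> ?R \<longrightarrow> (\<forall>i<r. c i \<in> PP 1)"
    using u unfolding core_def by blast+
  have lcL: "lc r u c \<in> L" if "c \<in> Tup r \<O>" for c
    by (rule lc_in_submod[OF L]) (use that uL in \<open>auto simp: TupI_def\<close>)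
  have lcR: "lc r u c \<in> ?R \<longleftrightarrow> c \<in> Tup r (PP 1)" if c: "c \<in> Tup r \<O>" for c
  proof
    assume R: "lc r u c \<in> ?R"
    have "\<forall>i. c i \<in> \<O>"
    proof
      fix i show "c i \<in> \<O>" using c by (cases "i < r") (auto simp: TupI_def)
    qed
    then have "\<forall>i<r. c i \<in> PP 1" using ind R by blast
    then show "c \<in> Tup r (PP 1)" using c by (simp add: TupI_def)
  next
    assume "c \<in> Tup r (PP 1)"
    then have "\<forall>i<r. c i \<in> PP 1" by (simp add: TupI_def)
    then have "B (lc r u c) y \<in> PP 1" if "y \<in> L" for y
      unfolding B_lc by (intro PP_sum PP_mult_O') (use uL int that in auto)
    then show "lc r u c \<in> ?R" using lcL[OF c] by (simp add: residual_radical_def)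
  qed
  have sub: "subgrp (Tup r (PP 1))" "subgrp (Tup r \<O>)" by (intro subgrp_TupI subgrp_PP)+
  have "card (quot (Tup r \<O>) (Tup r (PP 1))) = card (quot L ?R)"
  proof (rule quot_card_cong(1)[of _ _ _ "lc r u"])
    show "subgrp (Tup r (PP 1))" by (rule sub)
    show "subgrp ?R" by (rule submod_subgrp[OF sR])
    fix x show "x \<in> Tup r \<O> \<Longrightarrow> lc r u x \<in> L" by (rule lcL)
    fix y assume x: "x \<in> Tup r \<O>" and y: "y \<in> Tup r \<O>"
    have "lc r u x - lc r u y = lc r u (x - y)" by (simp add: lc_diff fun_diff_def)
    then show "lc r u x - lc r u y \<in> ?R \<longleftrightarrow> x - y \<in> Tup r (PP 1)"
      using lcR[OF subgrp_diff[OF sub(2) x y]] by simp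
  next
    fix y assume "y \<in> L"
    then obtain c where c: "\<forall>i. c i \<in> \<O>" "y - lc r u c \<in> ?R" using gen by blast
    define d where "d = (\<lambda>i. if i < r then c i else 0)"
    have "lc r u d = lc r u c" by (rule lc_cong) (simp_all add: d_def)
    then have "lc r u d - y \<in> ?R" using c(2) by (simp add: subgrp_diff_swap[OF submod_subgrp[OF sR], of "lc r u c"])
    moreover have "d \<in> Tup r \<O>" using c(1) by (auto simp: d_def TupI_def)
    ultimately show "\<exists>x\<in>Tup r \<O>. lc r u x - y \<in> ?R" by blast
  qed
  moreover have "card (quot (Tup r \<O>) (Tup r (PP 1))) = q ^ r"
    using card_quot_TupI[of r "\<lambda>_. PP 1" "\<lambda>_. \<O>"] quot_PP[of 0 1] by simp
  ultimately show ?thesis by simp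
qed

text \<open>Express \<open>u\<close> through \<open>w\<close> modulo the radical. Radical vectors
  pair into the maximal ideal, so the Gram matrices agree modulo \<open>\<varpi>\<close> after a
  base change whose determinant must be a unit.\<close>

lemma core_disc:
  assumes L: "submod L" and int: "\<forall>x\<in>L. \<forall>y\<in>L. B x y \<in> \<O>" and w: "core L r w"
    and u: "\<forall>i<r. u i \<in> L" "det (gram r u) \<noteq> 0" "v (det (gram r u)) = 0"
  shows "\<exists>d. d \<noteq> 0 \<and> v d = 0 \<and> det (gram r w) \<noteq> 0 \<and> v (det (gram r w)) = 0 \<and>
    det (gram r u) - d\<^sup>2 * det (gram r w) \<in> PP 1"
proof -
  let ?R = "residual_radical v V L"
  have wL: "\<forall>i<r. w i \<in> L" and gen: "\<forall>x\<in>L. \<exists>c. (\<forall>i. c i \<in> \<O>) \<and> x - lc r w c \<in> ?R"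
    using w unfolding core_def by blast+
  have "\<forall>i\<in>{..<r}. \<exists>c. (\<forall>j. c j \<in> \<O>) \<and> u i - lc r w c \<in> ?R" using gen u(1) by blast
  then obtain P where P: "\<forall>i\<in>{..<r}. (\<forall>j. P i j \<in> \<O>) \<and> u i - lc r w (P i) \<in> ?R" by metis
  define u' where "u' i = lc r w (P i)" for i
  have u'L: "u' i \<in> L" if "i < r" for i
    unfolding u'_def by (rule lc_in_submod[OF L]) (use P wL that in auto)
  have cong: "B (u i) (u j) - B (u' i) (u' j) \<in> PP 1" if ij: "i < r" "j < r" for i j
  proof -
    have "B (u i) (u j) - B (u' i) (u' j) = B (u i - u' i) (u j) + B (u j - u' j) (u' i)"
      by (simp add: B_simps B_sym)
    moreover have "B (u i - u' i) (u j) \<in> PP 1"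
      using P ij u(1) by (auto simp: residual_radical_def u'_def)
    moreover have "B (u j - u' j) (u' i) \<in> PP 1"
      using P ij u'L[OF ij(1)] by (auto simp: residual_radical_def u'_def)
    ultimately show ?thesis by (simp only: PP_add)
  qed
  define d where "d = det (mat r r (\<lambda>(i, j). P i j))"
  have dO: "d \<in> \<O>" unfolding d_def by (rule det_in_O[of _ r]) (use P in auto)
  have wO: "det (gram r w) \<in> \<O>" by (rule det_in_O[of _ r]) (use wL int in \<open>auto simp: gram_def\<close>)
  have "det (gram r u) - det (gram r u') \<in> PP 1"
    by (rule det_cong_P1[of _ r]) (use u(1) int cong in \<open>auto simp: gram_def\<close>)
  moreover have "det (gram r u') = d\<^sup>2 * det (gram r w)"
    unfolding d_def by (rule gram_change) (simp add: u'_def)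
  ultimately have c: "det (gram r u) - d\<^sup>2 * det (gram r w) \<in> PP 1" by simp
  then have "d\<^sup>2 * det (gram r w) - det (gram r u) \<in> PP 1"
    by (simp add: subgrp_diff_swap[OF subgrp_PP, of "det (gram r u)"])
  then have unit: "d\<^sup>2 * det (gram r w) \<noteq> 0 \<and> v (d\<^sup>2 * det (gram r w)) = 0" by (rule cong_unit) (fact u)+
  then have "d \<noteq> 0" "det (gram r w) \<noteq> 0" by auto
  moreover from this have "2 * v d + v (det (gram r w)) = 0" using unit by (simp add: val_mult v_power)
  ultimately have "v d = 0" "v (det (gram r w)) = 0" using dO wO by (auto simp: PP_iff)
  then show ?thesis using \<open>d \<noteq> 0\<close> \<open>det (gram r w) \<noteq> 0\<close> c by blast
qed

lemma jordan_core:
  assumes g: "jordan n t g L"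
  shows "core L (n - t) (\<lambda>i. g (t + i))"
proof -
  have gb: "lbas n g L" "orth n g" and nz: "\<And>i. i < n \<Longrightarrow> B (g i) (g i) \<noteq> 0" and t: "t \<le> n"
    and v1: "\<And>i. i < t \<Longrightarrow> 1 \<le> v (B (g i) (g i))" and v0: "\<And>i. t \<le> i \<Longrightarrow> i < n \<Longrightarrow> v (B (g i) (g i)) = 0"
    using g by (auto simp: jordan_def)
  have gL: "g i \<in> L" if "i < n" for i by (rule lbas_base[OF gb(1) that])
  have L: "submod L" by (rule lbas_submod[OF gb(1)])
  have shift: "lc (n - t) (\<lambda>i. g (t + i)) c = lc n g (\<lambda>i. if t \<le> i then c (i - t) else 0)" for c
  proof -
    have "lc n g (\<lambda>i. if t \<le> i then c (i - t) else 0) = (\<Sum>i\<in>{..<n} \<inter> {i. t \<le> i}. c (i - t) \<cdot> g i)"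
      unfolding lc_def by (subst sum.inter_restrict) (auto intro!: sum.cong)
    also have "\<dots> = (\<Sum>i<n-t. c i \<cdot> g (t + i))"
      by (rule sum.reindex_bij_witness[of _ "\<lambda>i. t + i" "\<lambda>i. i - t"]) auto
    finally show ?thesis by (simp add: lc_def)
  qed
  have gen: "\<exists>c. (\<forall>i. c i \<in> \<O>) \<and> x - lc (n - t) (\<lambda>i. g (t + i)) c \<in> residual_radical v V L" if "x \<in> L" for x
  proof -
    obtain c where c: "x = lc n g c" "\<forall>i<n. c i \<in> \<O>" using lbas_ex[OF gb(1) \<open>x \<in> L\<close>] by blast
    define d where "d i = (if t + i < n then c (t + i) else 0)" for i
    define c' where "c' i = (if i < t then c i else 0)" for i
    have eq: "x - lc (n - t) (\<lambda>i. g (t + i)) d = lc n g c'"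
      unfolding shift c(1) lc_diff by (rule lc_cong) (auto simp: d_def c'_def)
    have "lc n g c' \<in> L" using lbas_mem[OF gb(1)] c(2) by (simp add: c'_def)
    moreover have "B (lc n g c') y \<in> PP 1" if "y \<in> L" for y
    proof -
      obtain b where b: "y = lc n g b" "\<forall>i<n. b i \<in> \<O>" using lbas_ex[OF gb(1) \<open>y \<in> L\<close>] by blast
      have "c' i * B (g i) y \<in> PP 1" if i: "i < n" for i
      proof (cases "i < t")
        case True
        have "B (g i) y = B (lc n g b) (g i)" unfolding b(1) by (rule B_sym)
        also have "\<dots> = b i * B (g i) (g i)" by (rule B_orth_coeff[OF gb(2) i])
        finally have "B (g i) y = b i * B (g i) (g i)" .
        moreover have "B (g i) (g i) \<in> PP 1" using v1[OF True] by (simp add: PP_iff)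
        ultimately have "B (g i) y \<in> PP 1" using b(2) i by (simp add: PP_mult_O)
        then show ?thesis using c(2) i by (intro PP_mult_O) (auto simp: c'_def)
      qed (simp add: c'_def)
      then show ?thesis unfolding B_lc by (intro PP_sum) simp
    qed
    moreover have "\<forall>i. d i \<in> \<O>" using c(2) by (simp add: d_def)
    ultimately show ?thesis using eq by (auto simp: residual_radical_def intro!: exI[of _ d])
  qed
  moreover have "c j \<in> PP 1" if R: "lc (n - t) (\<lambda>i. g (t + i)) c \<in> residual_radical v V L" and j: "j < n - t" for c j
  proof -
    have tj: "t + j < n" using j by simp
    have "B (lc (n - t) (\<lambda>i. g (t + i)) c) (g (t + j)) \<in> PP 1"
      using R gL[OF tj] by (simp add: residual_radical_def)
    then have "c j * B (g (t + j)) (g (t + j)) \<in> PP 1"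
      unfolding shift B_orth_coeff[OF gb(2) tj] by simp
    then show ?thesis using unit_mult_PP[OF nz[OF tj] v0[OF _ tj], of "c j"] by (simp add: mult.commute)
  qed
  ultimately show ?thesis unfolding core_def using gL by auto
qed

text \<open>The unit part of a Jordan basis is one core basis; \<open>card_quot_radical\<close> and
  \<open>core_disc\<close> compare it with the chosen one.\<close>

lemma residual_sgn_jordan:
  assumes g: "jordan n t g L" and int: "\<forall>x\<in>L. \<forall>y\<in>L. B x y \<in> \<O>"
  shows "residual_sgn v V N L =
    (if even (n - t) = even N then sg (n - t) (\<Prod>i\<in>{t..<n}. B (g i) (g i)) else 0)"
proof -
  define r where "r = n - t"
  define u where "u = (\<lambda>i. g (t + i))"
  have gb: "lbas n g L" "orth n g" and nz: "\<And>i. i < n \<Longrightarrow> B (g i) (g i) \<noteq> 0" and t: "t \<le> n"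
    and v0: "\<And>i. t \<le> i \<Longrightarrow> i < n \<Longrightarrow> v (B (g i) (g i)) = 0"
    using g by (auto simp: jordan_def)
  have L: "submod L" by (rule lbas_submod[OF gb(1)])
  have core: "core L r u" unfolding r_def u_def by (rule jordan_core[OF g])
  have tn: "t + i < n" if "i < r" for i using that by (simp add: r_def)
  have "orth r u" using gb(2) tn by (simp add: orth_def u_def)
  then have "det (gram r u) = (\<Prod>i<r. B (g (t + i)) (g (t + i)))" by (simp add: det_gram_orth u_def)
  also have "\<dots> = (\<Prod>i\<in>{t..<n}. B (g i) (g i))"
    by (rule prod.reindex_bij_witness[of _ "\<lambda>i. i - t" "\<lambda>i. t + i"]) (auto simp: r_def)
  finally have det: "det (gram r u) = (\<Prod>i\<in>{t..<n}. B (g i) (g i))" .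
  have unit: "det (gram r u) \<noteq> 0 \<and> v (det (gram r u)) = 0"
    unfolding det by (rule prod_unit) (use nz v0 in auto)
  define us where "us = (SOME us. residual_core_basis v V L us)"
  have "residual_core_basis v V L (map u [0..<r])"
  proof -
    have "lc r (nth (map u [0..<r])) c = lc r u c" for c by (rule lc_cong) auto
    then show ?thesis unfolding residual_core_basis_core using core by (simp add: core_def)
  qed
  then have "residual_core_basis v V L us" unfolding us_def by (rule someI)
  then have us: "core L (length us) (nth us)" by (simp add: residual_core_basis_core)
  have "q ^ length us = q ^ r"
    using card_quot_radical[OF L int us] card_quot_radical[OF L int core] by simp
  then have len: "length us = r" using power_inject_exp[of q] q_gt_1 by simp
  obtain d where d: "d \<noteq> 0" "v d = 0" "det (gram r (nth us)) \<noteq> 0" "v (det (gram r (nth us))) = 0"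
    "det (gram r u) - d\<^sup>2 * det (gram r (nth us)) \<in> PP 1"
    using core_disc[OF L int us[unfolded len], of u] core unit unfolding core_def by blast
  have "\<chi> (det (gram r u)) = \<chi> (d\<^sup>2 * det (gram r (nth us)))"
    by (rule chi_cong[OF d(5)]) (use unit unit_O in blast)
  also have "\<dots> = \<chi> (det (gram r (nth us)))" by (rule chi_square_mult) (use d unit_O in auto)
  finally have "sg r (det (gram r (nth us))) = sg r (det (gram r u))"
    using unit d unit_O by (intro sg_cong) auto
  then have "quad_symbol v (disc_of_list V us) = sg r (\<Prod>i\<in>{t..<n}. B (g i) (g i))"
    unfolding disc_of_list_gram len sg_eq_quad_symbol[OF d(3,4)] det .
  then show ?thesis unfolding residual_sgn_def us_def[symmetric] Let_def len r_def[symmetric] by simp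
qed

text \<open>In an orthogonal basis the dual lattice has the negated valuations of the norms as
  exponents, so self-duality forces them to be zero.\<close>

lemma is_H_unimod:
  assumes M: "is_H v \<epsilon> m V M"
  shows "\<exists>h. unimod m h M \<and> \<epsilon> = sg m (dprod m h)"
proof -
  have "is_lattice v V M" and nd: "nondeg M" and rank: "rank V M = m" and dual: "dual_lattice v V M = M"
    and chi: "lattice_chi v V M = \<epsilon>"
    using M by (simp_all add: is_H_def quadratic_lattice_def nondeg_def)
  then obtain k e where e: "lbas k e M" by (auto simp: is_lattice_iff)
  then have "k = m" using lbas_rank rank by blast
  then obtain h where h: "lbas m h M" "orth m h" using orthogonal_basis[of m e M] e by blast
  have ind: "ind m h" using h by (simp add: lbas_def)
  have nz: "B (h i) (h i) \<noteq> 0" if "i < m" for i by (rule orth_norm_nonzero[OF h nd that])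
  have D: "M = lat m h (\<lambda>i. - v (B (h i) (h i)))" using dual_lattice_orth[OF h nd] dual by simp
  have unit: "v (B (h i) (h i)) = 0" if i: "i < m" for i
  proof -
    define c where "c = (\<lambda>j. if j = i then 1 / B (h i) (h i) else 0)"
    have "lc m h c \<in> lat m h (\<lambda>i. - v (B (h i) (h i)))"
      by (rule latI) (use nz[OF i] in \<open>auto simp: c_def PP_divide_iff\<close>)
    then have "lc m h c \<in> M" using D by simp
    then have "c i \<in> \<O>" using lbas_mem[OF h(1)] i by simp
    then have "v (B (h i) (h i)) \<le> 0" using nz[OF i] by (simp add: c_def PP_iff v_divide)
    moreover have "h i \<in> dual_lattice v V M" using dual lbas_base[OF h(1) i] by simp
    then have "B (h i) (h i) \<in> \<O>" using lbas_base[OF h(1) i] by (simp add: dual_lattice_def)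
    then have "0 \<le> v (B (h i) (h i))" using nz[OF i] by (simp add: PP_iff)
    ultimately show ?thesis by simp
  qed
  have um: "unimod m h M" unfolding unimod_def using h nz unit by blast
  have "lattice_chi v V M = quad_symbol v ((-1) ^ (m div 2) * det (gram m h))"
    by (rule lattice_chi_span[OF h(1) h(1) _ refl]) (use unimod_dprod[OF um] det_gram_orth[OF h(2)] in simp)
  also have "\<dots> = sg m (dprod m h)"
    unfolding det_gram_orth[OF h(2)] by (rule sg_eq_quad_symbol) (use unimod_dprod[OF um] in auto)
  finally show ?thesis using um chi by auto
qed

end

section \<open>The density polynomial\<close>

context odd_local_field
begin

text \<open>For c = 1 or c = -1 the factor 1 - X^2 is (1 - cX)(1 + cX); for c = 0 the divisor is 1.
  The product form cannot be solved for the value at X = 1 when c = 1, so the quotient is also given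
  explicitly.\<close>

lemma Nor_poly_exact:
  fixes V :: "('a, 'b::ab_group_add) quad_space"
  assumes n: "rank V L = n" "n \<ge> 1" and \<epsilon>: "\<epsilon> \<in> {1, -1}"
  defines "A \<equiv> [:1, - (of_int (sgn_H \<epsilon> n) * Q powr (- real n / 2)):]"
    and "c \<equiv> real_of_int (\<epsilon> * lattice_chi v V L)"
  shows "Nor_poly v V L \<epsilon> * [:1, - c:] = A * (\<Prod>i\<in>{i. 2 * i < n}. [:1, 0, - (Q powr (- 2 * real i)):])"
    and "c \<noteq> 0 \<Longrightarrow> Nor_poly v V L \<epsilon> = A * ([:1, c:] * (\<Prod>i\<in>{i. 0 < i \<and> 2 * i < n}. [:1, 0, - (Q powr (- 2 * real i)):]))"
proof -
  define P where "P = (\<lambda>I. \<Prod>i\<in>I. [:1, 0, - (Q powr (- 2 * real i)):])"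
  have c: "c = 0 \<or> c = 1 \<or> c = - 1"
    using quad_symbol_values[of "disc_of_list V (SOME es. lattice_basis v V L es)"] \<epsilon>
    unfolding c_def lattice_chi_def by auto
  have set: "{i::nat. real i < real n / 2} = {i. 2 * i < n}" by auto
  have fin: "finite {i. 2 * i < n}" by (rule finite_subset[of _ "{..n}"]) auto
  have "{i. 2 * i < n} = insert 0 {i. 0 < i \<and> 2 * i < n}" using n(2) by auto
  then have P0: "P {i. 2 * i < n} = [:1, 0, - 1:] * P {i. 0 < i \<and> 2 * i < n}"
    unfolding P_def using fin Q_pos by (simp add: powr_zero_eq_one)
  have Nor: "Nor_poly v V L \<epsilon> = (A * P {i. 2 * i < n}) div [:1, - c:]"
    unfolding Nor_poly_def Let_def n(1) set A_def P_def c_def ..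
  have nz: "[:1, - c:] \<noteq> 0" by simp
  have sq: "Nor_poly v V L \<epsilon> = A * ([:1, c:] * P {i. 0 < i \<and> 2 * i < n})" if "c \<noteq> 0"
  proof -
    have "[:1, 0, - 1:] = [:1, c:] * [:1, - c:]" using c that by auto
    then have "A * P {i. 2 * i < n} = (A * ([:1, c:] * P {i. 0 < i \<and> 2 * i < n})) * [:1, - c:]"
      unfolding P0 by (simp only: mult_ac)
    then show ?thesis unfolding Nor using nonzero_mult_div_cancel_right[OF nz] by simp
  qed
  show "Nor_poly v V L \<epsilon> = A * ([:1, c:] * (\<Prod>i\<in>{i. 0 < i \<and> 2 * i < n}. [:1, 0, - (Q powr (- 2 * real i)):]))"
    if "c \<noteq> 0" using sq[OF that] unfolding P_def .
  have "Nor_poly v V L \<epsilon> * [:1, - c:] = A * P {i. 2 * i < n}"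
  proof (cases "c = 0")
    case True
    then have "[:1, - c:] = 1" by (simp add: one_pCons)
    then show ?thesis unfolding Nor by simp
  next
    case False
    have "[:1, 0, - 1:] = [:1, c:] * [:1, - c:]" using c False by auto
    then show ?thesis unfolding sq[OF False] P0 by (simp only: mult_ac)
  qed
  then show "Nor_poly v V L \<epsilon> * [:1, - c:] = A * (\<Prod>i\<in>{i. 2 * i < n}. [:1, 0, - (Q powr (- 2 * real i)):])"
    by (simp only: P_def)
qed

lemma Nor_poly_nonzero:
  fixes V :: "('a, 'b::ab_group_add) quad_space"
  assumes n: "rank V L = n" "n \<ge> 1" and \<epsilon>: "\<epsilon> \<in> {1, -1}"
  shows "Nor_poly v V L \<epsilon> \<noteq> 0"
proof
  assume "Nor_poly v V L \<epsilon> = 0"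
  then have "[:1, - (of_int (sgn_H \<epsilon> n) * Q powr (- real n / 2)):] *
      (\<Prod>i\<in>{i. 2 * i < n}. [:1, 0, - (Q powr (- 2 * real i)):]) = 0"
    using Nor_poly_exact(1)[OF assms] by simp
  \<comment> \<open>At 0 every factor has the value 1.\<close>
  then have "poly ([:1, - (of_int (sgn_H \<epsilon> n) * Q powr (- real n / 2)):] *
      (\<Prod>i\<in>{i. 2 * i < n}. [:1, 0, - (Q powr (- 2 * real i)):])) 0 = 0" by simp
  then show False by (simp add: poly_prod)
qed

text \<open>With X = q^(-k), the factor of index k + j is 1 - q^(-2j) X^2. Indices from k on belong
  to the normalizing polynomial and those below k to the weight polynomial.\<close>

lemma prod_hh:
  assumes X: "X = 1 / Q ^ k"
  shows "t \<ge> 1 \<Longrightarrow> (\<Prod>i\<in>{i. int (2 * k + t) - 2 * int t < 2 * i \<and> 2 * i < int (n + 2 * k)}. zeta_factor i) =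
      (\<Prod>i\<in>{i. 2 * i < n}. 1 - Q powr (- 2 * real i) * X\<^sup>2) * (\<Prod>i\<in>{i. 0 < i \<and> 2 * i < t}. 1 - Q ^ (2 * i) * X\<^sup>2)"
    and "(\<Prod>i\<in>{i. int (2 * k) < 2 * i \<and> 2 * i < int (n + 2 * k)}. zeta_factor i) =
      (\<Prod>i\<in>{i. 0 < i \<and> 2 * i < n}. 1 - Q powr (- 2 * real i) * X\<^sup>2)"
proof -
  have X2: "X\<^sup>2 = Q powi (- 2 * int k)"
    unfolding X by (simp add: power_int_minus power_int_mult power_divide field_simps flip: power_mult)
  have hX: "zeta_factor (int k + j) = 1 - Q powi (- 2 * j) * X\<^sup>2" for j
  proof -
    have "Q powi (- 2 * (int k + j)) = Q powi (- 2 * j) * Q powi (- 2 * int k)"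
      using power_int_add[of Q "- 2 * j" "- 2 * int k"] Q_pos by (simp add: algebra_simps)
    then show ?thesis unfolding zeta_factor_def X2 by simp
  qed
  have h1: "zeta_factor (int k + int i) = 1 - Q powr (- 2 * real i) * X\<^sup>2" for i
  proof -
    have "Q powr (- 2 * real i) = Q powi (- 2 * int i)"
      using powr_real_of_int'[of Q "- 2 * int i"] Q_pos by simp
    then show ?thesis unfolding hX by simp
  qed
  have h2: "zeta_factor (int k - int i) = 1 - Q ^ (2 * i) * X\<^sup>2" for i
  proof -
    have "Q powi (2 * int i) = Q ^ (2 * i)" using power_int_of_nat[of Q "2 * i"] by simp
    then show ?thesis using hX[of "- int i"] by simp
  qed
  have fin: "finite {i::nat. P i \<and> 2 * i < b}" for b P by (rule finite_subset[of _ "{..b}"]) auto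
  show "(\<Prod>i\<in>{i. int (2 * k) < 2 * i \<and> 2 * i < int (n + 2 * k)}. zeta_factor i) =
      (\<Prod>i\<in>{i. 0 < i \<and> 2 * i < n}. 1 - Q powr (- 2 * real i) * X\<^sup>2)"
    unfolding h1[symmetric]
    by (rule prod.reindex_bij_witness[of _ "\<lambda>i. int k + int i" "\<lambda>j. nat (j - int k)"]) auto
  assume t: "t \<ge> 1"
  \<comment> \<open>The index k itself, present because t is positive, becomes the factor 1 - X^2 of
    the normalizing polynomial.\<close>
  have "{i. int (2 * k + t) - 2 * int t < 2 * i \<and> 2 * i < int (n + 2 * k)} =
      {i. 2 * int k \<le> 2 * i \<and> 2 * i < int (n + 2 * k)} \<union> {i. int (2 * k + t) - 2 * int t < 2 * i \<and> i < int k}"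
    using t by auto
  moreover have "finite {i. 2 * int k \<le> 2 * i \<and> 2 * i < int (n + 2 * k)}"
    by (rule finite_subset[of _ "{0..int (n + 2 * k)}"]) auto
  moreover have "finite {i. int (2 * k + t) - 2 * int t < 2 * i \<and> i < int k}"
    by (rule finite_subset[of _ "{- int t..int k}"]) auto
  ultimately have "(\<Prod>i\<in>{i. int (2 * k + t) - 2 * int t < 2 * i \<and> 2 * i < int (n + 2 * k)}. zeta_factor i) =
      (\<Prod>i\<in>{i. 2 * int k \<le> 2 * i \<and> 2 * i < int (n + 2 * k)}. zeta_factor i) *
      (\<Prod>i\<in>{i. int (2 * k + t) - 2 * int t < 2 * i \<and> i < int k}. zeta_factor i)"
    by (simp only:) (rule prod.union_disjoint, auto)
  also have "(\<Prod>i\<in>{i. 2 * int k \<le> 2 * i \<and> 2 * i < int (n + 2 * k)}. zeta_factor i) =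
      (\<Prod>i\<in>{i. 2 * i < n}. 1 - Q powr (- 2 * real i) * X\<^sup>2)"
    unfolding h1[symmetric]
    by (rule prod.reindex_bij_witness[of _ "\<lambda>i. int k + int i" "\<lambda>j. nat (j - int k)"]) auto
  also have "(\<Prod>i\<in>{i. int (2 * k + t) - 2 * int t < 2 * i \<and> i < int k}. zeta_factor i) =
      (\<Prod>i\<in>{i. 0 < i \<and> 2 * i < t}. 1 - Q ^ (2 * i) * X\<^sup>2)"
    unfolding h2[symmetric]
    by (rule prod.reindex_bij_witness[of _ "\<lambda>i. int k - int i" "\<lambda>j. nat (int k - j)"]) auto
  finally show "(\<Prod>i\<in>{i. int (2 * k + t) - 2 * int t < 2 * i \<and> 2 * i < int (n + 2 * k)}. zeta_factor i) =
      (\<Prod>i\<in>{i. 2 * i < n}. 1 - Q powr (- 2 * real i) * X\<^sup>2) * (\<Prod>i\<in>{i. 0 < i \<and> 2 * i < t}. 1 - Q ^ (2 * i) * X\<^sup>2)" .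
qed

text \<open>The first sign factor of the density is the linear factor of the normalizing polynomial,
  the second is the factor 1 + s q^(t/2) \<epsilon> X of the weight. For positive \<open>t\<close>
  the remaining factor 1 - cX of the weight cancels the denominator of the normalizing
  polynomial.\<close>

lemma emb_density_eq_poly:
  fixes V :: "('a, 'b::ab_group_add) quad_space"
  assumes n: "rank V L = n" "n \<ge> 1" "n = r + t" and \<epsilon>: "\<epsilon> \<in> {1, -1}"
    and s: "even t \<Longrightarrow> \<zeta> = \<epsilon> * s" "odd t \<Longrightarrow> s = 0"
    and t0: "t = 0 \<Longrightarrow> s = lattice_chi v V L \<and> s \<noteq> 0"
    and X: "X = 1 / Q ^ k"
  shows "emb_density (n + 2 * k) (n + 2 * k - r) t \<epsilon> \<zeta> =
    poly (Nor_poly v V L \<epsilon>) X * poly (weight_poly Q t s (lattice_chi v V L) \<circ>\<^sub>p [:0, of_int \<epsilon>:]) X"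
proof -
  define A where "A = 1 - of_int (sgn_H \<epsilon> n) * Q powr (- real n / 2) * X"
  define S where "S = 1 + of_int s * Q powr (real t / 2) * (of_int \<epsilon> * X)"
  have Xk: "X = Q powi (- int k)" unfolding X by (simp add: power_int_minus field_simps)
  have nd: "n + 2 * k - r = 2 * k + t" using n(3) by simp
  have half: "Q powr (real j / 2) = Q powi (int (j div 2))" "Q powr (- real j / 2) = Q powi (- int (j div 2))"
    if j: "even j" for j
  proof -
    obtain i where i: "j = 2 * i" using j by blast
    show "Q powr (real j / 2) = Q powi (int (j div 2))"
      using powr_real_of_int'[of Q "int i"] Q_pos i by simp
    show "Q powr (- real j / 2) = Q powi (- int (j div 2))"
      using powr_real_of_int'[of Q "- int i"] Q_pos i by simp
  qed
  have 1: "1 - (if even (n + 2 * k) then of_int \<epsilon> * Q powi (- int ((n + 2 * k) div 2)) else 0) = A"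
  proof (cases "even n")
    case True
    have "(n + 2 * k) div 2 = n div 2 + k" by simp
    then have "Q powi (- int ((n + 2 * k) div 2)) = Q powi (- int (n div 2)) * X"
      using power_int_add[of Q "- int (n div 2)" "- int k"] Q_pos by (simp add: Xk algebra_simps)
    then show ?thesis using True half(2)[OF True] by (simp add: A_def sgn_H_def)
  qed (simp add: A_def sgn_H_def)
  have 2: "1 + (if even (2 * k + t) then of_int \<zeta> * Q powi (int t - int ((2 * k + t) div 2)) else 0) = S"
  proof (cases "even t")
    case True
    have "int t - int ((2 * k + t) div 2) = int (t div 2) + (- int k)" using True by (auto elim!: evenE)
    then have "Q powi (int t - int ((2 * k + t) div 2)) = Q powi (int (t div 2) + (- int k))" by (simp only:)
    also have "\<dots> = Q powi (int (t div 2)) * X" unfolding Xk by (rule power_int_add) (use Q_pos in simp)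
    finally have "Q powi (int t - int ((2 * k + t) div 2)) = Q powi (int (t div 2)) * X" .
    then show ?thesis using True s(1) by (simp add: S_def half del: power_int_of_nat)
  qed (simp add: S_def s(2))
  define c where "c = real_of_int (\<epsilon> * lattice_chi v V L)"
  note N = Nor_poly_exact[OF n(1,2) \<epsilon>]
  have \<epsilon>2: "(of_int \<epsilon> :: real) * of_int \<epsilon> = 1" using \<epsilon> by auto
  have pA: "poly [:1, - (of_int (sgn_H \<epsilon> n) * Q powr (- real n / 2)):] X = A" by (simp add: A_def)
  have pP: "poly (\<Prod>i\<in>I. [:1, 0, - (Q powr (- 2 * real i)):]) X = (\<Prod>i\<in>I. 1 - Q powr (- 2 * real i) * X\<^sup>2)" for I
    by (simp add: poly_prod power2_eq_square algebra_simps)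
  show ?thesis
  \<comment> \<open>For t = 0 the weight is 1; the second sign factor is then 1 + cX, what remains
    of 1 - X^2 after division by 1 - cX.\<close>
  proof (cases "t = 0")
    case True
    have c: "c = of_int \<epsilon> * of_int s" "c \<noteq> 0" using t0[OF True] \<epsilon> by (auto simp: c_def)
    have "poly (Nor_poly v V L \<epsilon>) X = A * ((1 + c * X) * (\<Prod>i\<in>{i. 0 < i \<and> 2 * i < n}. 1 - Q powr (- 2 * real i) * X\<^sup>2))"
    proof -
      have "poly [:1, real_of_int (\<epsilon> * lattice_chi v V L):] X = 1 + c * X" by (simp add: c_def)
      then show ?thesis unfolding N(2)[OF c(2)[unfolded c_def]] poly_mult pA pP by (simp only:)
    qed
    moreover have "S = 1 + c * X" using Q_pos by (simp add: S_def True c(1))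
    ultimately show ?thesis
      unfolding emb_density_def nd 1 2 using prod_hh(2)[OF X, of n] by (simp add: True weight_poly_def poly_pcompose)
  next
    case False
    have a: "poly (Nor_poly v V L \<epsilon>) X * (1 - c * X) = A * (\<Prod>i\<in>{i. 2 * i < n}. 1 - Q powr (- 2 * real i) * X\<^sup>2)"
    proof -
      have "1 - c * X = poly [:1, - c:] X" by simp
      then have "poly (Nor_poly v V L \<epsilon>) X * (1 - c * X) = poly (Nor_poly v V L \<epsilon> * [:1, - c:]) X"
        by (simp only: poly_mult)
      also have "\<dots> = A * (\<Prod>i\<in>{i. 2 * i < n}. 1 - Q powr (- 2 * real i) * X\<^sup>2)"
        unfolding c_def N(1) by (simp only: poly_mult pA pP)
      finally show ?thesis .
    qed
    have w: "poly (weight_poly Q t s (lattice_chi v V L) \<circ>\<^sub>p [:0, of_int \<epsilon>:]) X =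
        S * (1 - c * X) * (\<Prod>i\<in>{i. 0 < i \<and> 2 * i < t}. 1 - Q ^ (2 * i) * X\<^sup>2)"
    proof -
      have set: "{i::nat. 0 < i \<and> real i < real t / 2} = {i. 0 < i \<and> 2 * i < t}" by auto
      have e2: "of_int \<epsilon> * X * (of_int \<epsilon> * X) = X\<^sup>2"
        using \<epsilon>2 by (simp add: power2_eq_square mult_ac)
      have "poly (weight_poly Q t s (lattice_chi v V L) \<circ>\<^sub>p [:0, of_int \<epsilon>:]) X =
          poly (weight_poly Q t s (lattice_chi v V L)) (of_int \<epsilon> * X)" by (simp add: poly_pcompose mult.commute)
      also have "\<dots> = S * (1 - c * X) * (\<Prod>i\<in>{i. 0 < i \<and> 2 * i < t}. 1 - Q ^ (2 * i) * (of_int \<epsilon> * X * (of_int \<epsilon> * X)))"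
        unfolding weight_poly_def set using False by (simp add: S_def c_def poly_prod algebra_simps)
      finally show ?thesis unfolding e2 .
    qed
    have f: "emb_density (n + 2 * k) (n + 2 * k - r) t \<epsilon> \<zeta> = A * S *
        ((\<Prod>i\<in>{i. 2 * i < n}. 1 - Q powr (- 2 * real i) * X\<^sup>2) * (\<Prod>i\<in>{i. 0 < i \<and> 2 * i < t}. 1 - Q ^ (2 * i) * X\<^sup>2))"
      unfolding emb_density_def nd 1 2 using prod_hh(1)[OF X, of t n] False by simp
    have "poly (Nor_poly v V L \<epsilon>) X * (S * (1 - c * X) * (\<Prod>i\<in>{i. 0 < i \<and> 2 * i < t}. 1 - Q ^ (2 * i) * X\<^sup>2)) =
        (poly (Nor_poly v V L \<epsilon>) X * (1 - c * X)) * (S * (\<Prod>i\<in>{i. 0 < i \<and> 2 * i < t}. 1 - Q ^ (2 * i) * X\<^sup>2))"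
      by (simp only: mult_ac)
    then show ?thesis unfolding f w a by (simp only: mult_ac)
  qed
qed

end

context two_qspaces
begin

lemma primitive_density:
  assumes L: "V.lbas n e L" "V.nondeg L" and n: "n \<ge> 1" and L': "L' \<in> integral_overlattices v V L"
    and g: "V.jordan n t g L'" and M: "W.unimod (n + 2 * k) h M" and \<epsilon>: "\<epsilon> = V.sg (n + 2 * k) (W.dprod (n + 2 * k) h)"
    and X: "X = 1 / real (residue_card v) ^ k"
  shows "real (card (quot (W.emb n M (\<lambda>i. frm V (g i) (g i))) (Tup n (W.spow 1 M)))) * real (residue_card v) powi (- V.emb_dim (n + 2 * k) n) =
    poly (Nor_poly v V L \<epsilon>) X *
    poly (weight_poly (real (residue_card v)) (lattice_type v V L') (residual_sgn v V n L') (lattice_chi v V L) \<circ>\<^sub>p [:0, of_int \<epsilon>:]) X"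
proof -
  define T where "T i = frm V (g i) (g i)" for i
  define m where "m = n + 2 * k"
  define r where "r = n - t"
  define D where "D = W.dprod m h"
  define U where "U = (\<Prod>i\<in>{t..<n}. T i)"
  define s where "s = residual_sgn v V n L'"
  have gb: "V.lbas n g L'" "V.orth n g" and nz: "\<And>i. i < n \<Longrightarrow> T i \<noteq> 0" and t: "t \<le> n"
    and v1: "\<And>i. i < t \<Longrightarrow> 1 \<le> v (T i)" and v0: "\<And>i. t \<le> i \<Longrightarrow> i < n \<Longrightarrow> v (T i) = 0"
    using g by (auto simp: V.jordan_def T_def)
  note facts = V.overlattice_facts[OF L L']
  have nrt: "n = r + t" using t by (simp add: r_def)
  have Dunit: "D \<noteq> 0" "v D = 0" using W.unimod_dprod[OF M] by (simp_all add: D_def m_def)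
  have Uunit: "U \<noteq> 0" "v U = 0" using V.prod_unit[of "{t..<n}" T] nz v0 by (auto simp: U_def)
  have s: "s = (if even r = even n then V.sg r U else 0)"
    unfolding s_def r_def U_def T_def by (rule V.residual_sgn_jordan[OF g facts(5)])
  have type: "lattice_type v V L' = t" by (rule V.lattice_type_jordan[OF g facts(3,5)])
  have \<epsilon>D: "\<epsilon> = V.sg m D" by (simp add: \<epsilon> m_def D_def)
  have eps: "\<epsilon> \<in> {1, -1}" unfolding \<epsilon>D using V.sg_values[OF Dunit] by blast
  have "real (card (quot (W.emb (t + r) M T) (Tup (t + r) (W.spow 1 M)))) = real (residue_card v) powi V.emb_dim m (t + r) *
      V.emb_density m (m - r) t (V.sg m (W.dprod m h)) (V.sg (m - r) (W.dprod m h * (\<Prod>i\<in>{t..<t+r}. T i)))"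
  proof (rule W.card_emb)
    show "W.unimod m h M" using M by (simp add: m_def)
    show "\<forall>i<t. T i \<in> V.PP 1" using v1 by (simp add: V.PP_iff)
    show "\<forall>i. t \<le> i \<longrightarrow> i < t + r \<longrightarrow> T i \<noteq> 0 \<and> v (T i) = 0" using nz v0 nrt by simp
    show "1 \<le> t \<or> 1 \<le> r" using n nrt by linarith
    show "r \<le> m" by (simp add: m_def r_def)
  qed
  moreover have "t + r = n" using nrt by simp
  moreover have "real (residue_card v) powi V.emb_dim m n * real (residue_card v) powi (- V.emb_dim m n) = 1"
    using V.Q_pos by (simp add: power_int_minus)
  ultimately have "real (card (quot (W.emb n M T) (Tup n (W.spow 1 M)))) * real (residue_card v) powi (- V.emb_dim m n) =
      V.emb_density m (m - r) t \<epsilon> (V.sg (m - r) (D * U))"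
    unfolding \<epsilon>D D_def U_def by (simp add: mult_ac)
  also have "\<dots> = poly (Nor_poly v V L \<epsilon>) X *
    poly (weight_poly (real (residue_card v)) t s (lattice_chi v V L) \<circ>\<^sub>p [:0, of_int \<epsilon>:]) X"
    unfolding m_def
  proof (rule V.emb_density_eq_poly[OF V.lbas_rank[OF L(1)] n nrt eps _ _ _ X])
    show "V.sg (n + 2 * k - r) (D * U) = \<epsilon> * s" if t: "even t"
    proof -
      have "V.sg (2 * k + t) (D * U) = V.sg (r + t + 2 * k) D * V.sg r U"
        by (rule V.sg_mult[OF V.unit_O[OF Dunit] V.unit_O[OF Uunit] t])
      moreover have "2 * k + t = n + 2 * k - r" "r + t + 2 * k = m" "even r = even n"
        using nrt t by (simp_all add: m_def)
      ultimately show ?thesis using s \<epsilon>D by simp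
    qed
    show "s = 0" if "odd t" using s that nrt by simp
    \<comment> \<open>Type 0 makes \<open>L'\<close> unimodular with the same rational span as
      \<open>L\<close>, so its residual sign is the symbol of \<open>L\<close>.\<close>
    show "s = lattice_chi v V L \<and> s \<noteq> 0" if "t = 0"
    proof -
      have "V.gram n g \<in> carrier_mat n n" by simp
      have det: "det (V.gram n g) = U" unfolding V.det_gram_orth[OF gb(2)] U_def T_def
        using that by (simp add: lessThan_atLeast0)
      have "lattice_chi v V L = quad_symbol v ((-1) ^ (n div 2) * det (V.gram n g))"
        by (rule V.lattice_chi_span[OF L(1) gb(1) _ facts(2)]) (simp add: det Uunit)
      also have "\<dots> = V.sg n U" unfolding det by (rule V.sg_eq_quad_symbol[OF Uunit])
      finally show ?thesis using s that nrt V.sg_values[OF Uunit, of n] by auto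
    qed
  qed
  finally show ?thesis unfolding type s_def m_def T_def .
qed

theorem local_density_formula:
  assumes L: "quadratic_lattice v V L" and n: "rank V L = n" "n \<ge> 1" and H: "is_H v \<epsilon> (n + 2 * k) W M"
    and X: "X = 1 / real (residue_card v) ^ k"
  shows "local_density v W M V L = poly (Nor_poly v V L \<epsilon>) X * poly (lattice_sum_poly v V L \<epsilon>) X"
proof -
  define m where "m = n + 2 * k"
  have "is_lattice v V L" and nd: "V.nondeg L" using L by (simp_all add: quadratic_lattice_def V.nondeg_def)
  then obtain e where e: "V.lbas n e L" using V.is_lattice_iff V.lbas_rank n(1) by metis
  obtain h where h: "W.unimod m h M" "\<epsilon> = V.sg m (W.dprod m h)" using W.is_H_unimod[OF H] by (auto simp: m_def)
  have "\<forall>L'\<in>integral_overlattices v V L. \<exists>p. V.jordan n (fst p) (snd p) L'"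
  proof
    fix L' assume L': "L' \<in> integral_overlattices v V L"
    note facts = V.overlattice_facts[OF e nd L']
    obtain f where "V.lbas n f L'" using facts(1) by blast
    from V.jordan_exists[OF this facts(3,5)] show "\<exists>p. V.jordan n (fst p) (snd p) L'" by auto
  qed
  from bchoice[OF this] obtain p where p: "\<forall>L'\<in>integral_overlattices v V L. V.jordan n (fst (p L')) (snd (p L')) L'" by blast
  define G where "G L' = snd (p L')" for L'
  have G: "V.lbas n (G L') L' \<and> V.orth n (G L')" if "L' \<in> integral_overlattices v V L" for L'
    using p that by (simp add: G_def V.jordan_def)
  let ?w = "\<lambda>L'. weight_poly (real (residue_card v)) (lattice_type v V L') (residual_sgn v V n L') (lattice_chi v V L) \<circ>\<^sub>p [:0, of_int \<epsilon>:]"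
  let ?S = "\<Sum>L'\<in>integral_overlattices v V L. real (residue_card v) powi ((int n + 1 - int m) * int (quot_length v V L' L)) *
      (real (card (quot (W.emb n M (\<lambda>i. frm V (G L' i) (G L' i))) (Tup n (W.spow 1 M)))) * real (residue_card v) powi (- V.emb_dim m n))"
  have "\<exists>N0. \<forall>N\<ge>N0. real (card (rep_set v W M V L N)) / real (residue_card v) ^ (N * rep_dim m n) = ?S"
    by (rule density_stable[OF e nd h(1) _ G]) (simp add: m_def)
  then have "eventually (\<lambda>N. real (card (rep_set v W M V L N)) / real (residue_card v) ^ (N * rep_dim m n) = ?S) sequentially"
    by (simp add: eventually_sequentially)
  then have "(\<lambda>N. real (card (rep_set v W M V L N)) / real (residue_card v) ^ (N * rep_dim m n)) \<longlonglongrightarrow> ?S"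
    by (rule tendsto_eventually)
  then have "lim (\<lambda>N. real (card (rep_set v W M V L N)) / real (residue_card v) ^ (N * rep_dim m n)) = ?S" by (rule limI)
  moreover have "rank W M = m" using H by (simp add: is_H_def m_def)
  ultimately have "local_density v W M V L = ?S" unfolding local_density_def by (simp only: n(1))
  also have "\<dots> = (\<Sum>L'\<in>integral_overlattices v V L. poly (Nor_poly v V L \<epsilon>) X *
      poly ([:0, real (residue_card v) powr (1 / 2):] ^ (2 * quot_length v V L' L) * ?w L') X)"
  proof (rule sum.cong[OF refl])
    fix L' assume L': "L' \<in> integral_overlattices v V L"
    define l where "l = quot_length v V L' L"
    have "real (card (quot (W.emb n M (\<lambda>i. frm V (G L' i) (G L' i))) (Tup n (W.spow 1 M)))) * real (residue_card v) powi (- V.emb_dim m n) =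
        poly (Nor_poly v V L \<epsilon>) X * poly (?w L') X"
      unfolding m_def G_def
      by (rule primitive_density[OF e nd n(2) L' p[rule_format, OF L'] h[unfolded m_def] X])
    \<comment> \<open>Since m = n + 2k, the exponent is (1 - 2k) l, and q^(1 - 2k) = q X^2.\<close>
    moreover have "real (residue_card v) powi ((int n + 1 - int m) * int l) =
        poly ([:0, real (residue_card v) powr (1 / 2):] ^ (2 * l)) X"
    proof -
      have "(real (residue_card v) powr (1 / 2))\<^sup>2 = real (residue_card v)"
        using V.Q_pos by (simp add: powr_half_sqrt)
      then have "(X * real (residue_card v) powr (1 / 2)) ^ (2 * l) = (X\<^sup>2 * real (residue_card v)) ^ l"
        by (simp add: power_mult power_mult_distrib)
      also have "X\<^sup>2 * real (residue_card v) = real (residue_card v) powi (1 - 2 * int k)"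
      proof -
        have "real (residue_card v) powi (1 - int (2 * k)) = real (residue_card v) powi 1 / real (residue_card v) powi int (2 * k)"
          by (rule power_int_diff) (use V.Q_pos in simp)
        then have "real (residue_card v) powi (1 - 2 * int k) = real (residue_card v) / real (residue_card v) ^ (2 * k)"
          unfolding power_int_of_nat by simp
        then show ?thesis by (simp add: X power_divide power_even_eq)
      qed
      also have "(real (residue_card v) powi (1 - 2 * int k)) ^ l = real (residue_card v) powi ((1 - 2 * int k) * int l)"
        by (simp add: power_int_mult)
      finally show ?thesis by (simp add: m_def poly_power algebra_simps)
    qed
    ultimately show "real (residue_card v) powi ((int n + 1 - int m) * int (quot_length v V L' L)) *
      (real (card (quot (W.emb n M (\<lambda>i. frm V (G L' i) (G L' i))) (Tup n (W.spow 1 M)))) * real (residue_card v) powi (- V.emb_dim m n)) =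
      poly (Nor_poly v V L \<epsilon>) X * poly ([:0, real (residue_card v) powr (1 / 2):] ^ (2 * quot_length v V L' L) * ?w L') X"
      unfolding l_def[symmetric] poly_mult by (simp only: mult_ac)
  qed
  also have "\<dots> = poly (Nor_poly v V L \<epsilon>) X * poly (lattice_sum_poly v V L \<epsilon>) X"
    unfolding lattice_sum_poly_def Let_def n(1) poly_sum sum_distrib_left ..
  finally show ?thesis .
qed

end

section \<open>The Siegel series\<close>

text \<open>The form sees only the first \<open>r\<close> coordinates of the ambient type;
  nondegeneracy is demanded on the span of the lattice alone.\<close>

definition diag_space :: "(nat \<Rightarrow> 'a::field) \<Rightarrow> nat \<Rightarrow> ('a, nat \<Rightarrow> 'a) quad_space" where
  "diag_space d r = \<lparr>scl = \<lambda>c x i. c * x i, frm = \<lambda>x y. \<Sum>i<r. d i * x i * y i\<rparr>"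

lemma quadratic_space_diag: "quadratic_space (diag_space d r)"
proof -
  have vs: "vector_space (scl (diag_space d r))"
    by unfold_locales (auto simp: diag_space_def algebra_simps)
  have "vector_space ((*) :: 'a \<Rightarrow> 'a \<Rightarrow> 'a)" by unfold_locales (auto simp: algebra_simps)
  then have "Vector_Spaces.linear (scl (diag_space d r)) (*) (frm (diag_space d r) x)" for x
    unfolding Vector_Spaces.linear_iff using vs
    by (simp add: diag_space_def algebra_simps sum.distrib sum_distrib_left)
  then show ?thesis using vs unfolding quadratic_space_def by (simp add: diag_space_def mult_ac)
qed

lemma (in odd_local_field) is_H_exists:
  assumes "\<epsilon> \<in> {1, -1}" "r \<ge> 1"
  shows "\<exists>(W :: ('a, nat \<Rightarrow> 'a) quad_space) M. scl W = (\<lambda>c x i. c * x i) \<and> is_H v \<epsilon> r W M"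
proof -
  obtain w where w: "w \<noteq> 0" "v w = 0" "\<chi> w = \<epsilon>"
    using assms(1) exists_nonsquare that[of 1] chi_one by auto
  \<comment> \<open>One entry adjusts the discriminant: the power of -1 cancels the sign convention
    and w is a square or nonsquare unit according to \<epsilon>. This takes positive rank.\<close>
  define d where "d i = (if i = 0 then (-1) ^ (r div 2) * w else 1)" for i :: nat
  have d: "d i \<noteq> 0" "v (d i) = 0" for i using w by (simp_all add: d_def val_mult v_power)
  have "(\<Prod>i<r. d i) = (\<Prod>i\<in>{0}. d i)" by (rule prod.mono_neutral_right) (use assms(2) in \<open>auto simp: d_def\<close>)
  then have "(-1) ^ (r div 2) * (\<Prod>i<r. d i) = ((-1) ^ (r div 2))\<^sup>2 * w"
    by (simp add: d_def power2_eq_square)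
  moreover have "((-1) ^ (r div 2))\<^sup>2 = (1::'a)" by (simp add: power_even_eq[symmetric])
  ultimately have sgd: "sg r (\<Prod>i<r. d i) = \<epsilon>" using w by (simp add: sg_def)
  define W where "W = diag_space d r"
  interpret W: qspace v W by unfold_locales (simp add: W_def quadratic_space_diag)
  define e where "e i = (\<lambda>j. if j = i then 1 else 0 :: 'a)" for i :: nat
  define M where "M = W.osp r e"
  have lc: "W.lc n e c = (\<lambda>j. if j < n then c j else 0)" for n c
  proof (induction n)
    case 0
    then show ?case by (simp add: W.lc_def zero_fun_def)
  next
    case (Suc n)
    show ?case unfolding W.lc_Suc Suc.IH by (auto simp: W_def diag_space_def e_def fun_eq_iff less_Suc_eq)
  qed
  have "W.ind r e" unfolding W.ind_def lc by (auto simp: fun_eq_iff)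
  then have e: "W.lbas r e M" by (simp add: W.lbas_def M_def)
  have Be: "frm W x (e j) = d j * x j" if "j < r" for x j
    using that unfolding W_def diag_space_def e_def by (simp add: if_distrib[of "\<lambda>z. _ * z"] cong: if_cong)
  have orth: "W.orth r e" by (simp add: W.orth_def Be) (simp add: e_def)
  have norm: "frm W (e i) (e i) = d i" if "i < r" for i using that by (simp add: Be) (simp add: e_def)
  have nd: "W.nondeg M" unfolding W.nondeg_def
  proof (intro ballI impI)
    fix x assume x: "x \<in> rational_span W M" and z: "\<forall>y\<in>rational_span W M. frm W x y = 0"
    obtain c where c: "x = W.lc r e c" using W.lbas_obtain_span[OF e x] by blast
    have "c j = 0" if "j < r" for j
    proof -
      have "e j \<in> rational_span W M" using W.lbas_base[OF e that] W.lattice_subset_span by blast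
      then have "frm W x (e j) = 0" using z by blast
      then show ?thesis using d(1)[of j] that by (simp add: Be c lc)
    qed
    then show "x = 0" unfolding c lc by (auto simp: fun_eq_iff)
  qed
  have dual: "dual_lattice v W M = M"
  proof -
    have "dual_lattice v W M = W.lat r e (\<lambda>i. - v (frm W (e i) (e i)))" by (rule W.dual_lattice_orth[OF e orth nd])
    also have "\<dots> = W.osp r e" unfolding W.lat_def using norm d by simp
    finally show ?thesis by (simp only: M_def)
  qed
  have dp: "W.dprod r e = (\<Prod>i<r. d i)" by (rule prod.cong) (simp_all add: norm)
  have unit: "(\<Prod>i<r. d i) \<noteq> 0 \<and> v (\<Prod>i<r. d i) = 0" by (rule prod_unit) (simp add: d)
  have "lattice_chi v W M = quad_symbol v ((-1) ^ (r div 2) * det (W.gram r e))"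
    by (rule W.lattice_chi_span[OF e e _ refl]) (simp only: W.det_gram_orth[OF orth] dp unit, simp)
  also have "\<dots> = \<epsilon>" unfolding W.det_gram_orth[OF orth] dp using sg_eq_quad_symbol[of "\<Prod>i<r. d i" r] unit sgd by simp
  finally have chi: "lattice_chi v W M = \<epsilon>" .
  have "is_lattice v W M" using e W.is_lattice_iff by blast
  then have "is_H v \<epsilon> r W M"
    unfolding is_H_def quadratic_lattice_def
    using nd dual chi W.lbas_rank[OF e] W.qs by (simp add: W.nondeg_def)
  moreover have "scl W = (\<lambda>c x i. c * x i)" by (simp add: W_def diag_space_def)
  ultimately show ?thesis by blast
qed

lemma local_density_eq:
  fixes v :: "'a::field \<Rightarrow> int" and V :: "('a, 'b::ab_group_add) quad_space" and W :: "('a, 'c::ab_group_add) quad_space"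
  assumes "nonarch_local_field v" "odd (residue_char v)" "quadratic_lattice v V L" "rank V L = n" "n \<ge> 1"
    "is_H v \<epsilon> (n + 2 * k) W M"
  shows "local_density v W M V L = poly (Nor_poly v V L \<epsilon>) (1 / real (residue_card v) ^ k) *
    poly (lattice_sum_poly v V L \<epsilon>) (1 / real (residue_card v) ^ k)"
proof -
  interpret odd_local_field v using assms(1,2) by (simp add: odd_local_field_def odd_local_field_axioms_def)
  interpret two_qspaces v V W
    using assms(3,6) by unfold_locales (simp_all add: quadratic_lattice_def is_H_def)
  show ?thesis by (rule local_density_formula[OF assms(3-6) refl])
qed

lemma siegel_series_eq:
  fixes v :: "'a::field \<Rightarrow> int" and V :: "('a, 'b::ab_group_add) quad_space"
  assumes v: "nonarch_local_field v" "odd (residue_char v)" and L: "quadratic_lattice v V L" "rank V L = n" "n \<ge> 1"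
    and \<epsilon>: "\<epsilon> \<in> {1, -1}"
  shows "siegel_series v V L \<epsilon> = lattice_sum_poly v V L \<epsilon>"
proof -
  interpret odd_local_field v using v by (simp add: odd_local_field_def odd_local_field_axioms_def)
  define N where "N = Nor_poly v V L \<epsilon>"
  define S where "S = lattice_sum_poly v V L \<epsilon>"
  define R where "R P \<longleftrightarrow> (\<forall>k (W :: ('a, nat \<Rightarrow> 'a) quad_space) M.
        scl W = (\<lambda>c x i. c * x i) \<longrightarrow> is_H v \<epsilon> (rank V L + 2 * k) W M \<longrightarrow>
        (let X = 1 / real (residue_card v) ^ k in
         poly (Nor_poly v V L \<epsilon>) X \<noteq> 0 \<longrightarrow>
         poly P X = local_density v W M V L / poly (Nor_poly v V L \<epsilon>) X))" for P
  have RS: "R S" unfolding R_def Let_def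
  proof (intro allI impI)
    fix k and W :: "('a, nat \<Rightarrow> 'a) quad_space" and M
    assume H: "is_H v \<epsilon> (rank V L + 2 * k) W M" and nz: "poly (Nor_poly v V L \<epsilon>) (1 / real q ^ k) \<noteq> 0"
    show "poly S (1 / real q ^ k) = local_density v W M V L / poly (Nor_poly v V L \<epsilon>) (1 / real q ^ k)"
      using local_density_eq[OF v L H[unfolded L(2)]] nz by (simp add: S_def)
  qed
  have uniq: "P = S" if P: "R P" for P
  proof (rule ccontr)
    assume "P \<noteq> S"
    \<comment> \<open>The factor N also covers the points where the normalizing polynomial vanishes
      and nothing is prescribed, so all the q^(-k) are roots.\<close>
    then have "N * (P - S) \<noteq> 0" using Nor_poly_nonzero[OF L(2,3) \<epsilon>] by (simp add: N_def)
    then have fin: "finite {x. poly (N * (P - S)) x = 0}" by (rule poly_roots_finite)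
    have "range (\<lambda>k. 1 / real q ^ k) \<subseteq> {x. poly (N * (P - S)) x = 0}"
    proof (clarify)
      fix k
      obtain W :: "('a, nat \<Rightarrow> 'a) quad_space" and M
        where W: "scl W = (\<lambda>c x i. c * x i)" "is_H v \<epsilon> (rank V L + 2 * k) W M"
        using is_H_exists[OF \<epsilon>, of "rank V L + 2 * k"] L by auto
      have "poly P (1 / real q ^ k) = poly S (1 / real q ^ k)" if "poly N (1 / real q ^ k) \<noteq> 0"
        using P RS W that unfolding R_def Let_def N_def by metis
      then show "poly (N * (P - S)) (1 / real q ^ k) = 0" by auto
    qed
    moreover have "inj (\<lambda>k. 1 / real q ^ k)"
      by (rule injI) (use q_gt_1 in \<open>simp add: power_inject_exp\<close>)
    ultimately show False using fin finite_subset range_inj_infinite by blast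
  qed
  show ?thesis unfolding siegel_series_def R_def[symmetric]
    using the_equality[of R S, OF RS uniq] by (simp add: S_def)
qed

theorem theorem3p5p4:
  fixes v :: "'a::field \<Rightarrow> int"
    and V :: "('a, 'b::ab_group_add) quad_space"
    and L :: "'b set"
    and n :: nat
    and \<epsilon> :: int
  assumes "nonarch_local_field v"
    and "odd (residue_char v)"
    and "quadratic_lattice v V L"
    and "rank V L = n"
    and "n \<ge> 1"
    and "\<epsilon> \<in> {1, -1}"
  shows "(\<forall>(k::nat) (W :: ('a, 'c::ab_group_add) quad_space) M.
            is_H v \<epsilon> (n + 2 * k) W M \<longrightarrow>
            local_density v W M V L =
              poly (Nor_poly v V L \<epsilon>) (1 / real (residue_card v) ^ k) *
              poly (lattice_sum_poly v V L \<epsilon>) (1 / real (residue_card v) ^ k)) \<and>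
         siegel_series v V L \<epsilon> = lattice_sum_poly v V L \<epsilon>"
  using local_density_eq[OF assms(1-5)] siegel_series_eq[OF assms] by blast

end
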